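(* Let $\psi:Y\to X$ be a local homeomorphism of a second-countable, locally compact and Hausdorff space $Y$ onto a topological space $X$, and let $\sigma:R(\psi)^{(2)}\to\mathbb{T}$ be a continuous normalised $2$-cocycle. Then $C^*(R(\psi),\sigma)$ is a Fell algebra, the map $y\mapsto\operatorname{Ind}_y^{\sigma}$ induces a homeomorphism of $Y/R(\psi)$ onto the spectrum $C^*(R(\psi),\sigma)^\wedge$, and $C^*(R(\psi),\sigma)=C^*_{\mathrm r}(R(\psi),\sigma)$.
   Context: $R(\psi)=\{(y,z)\in Y\times Y:\psi(y)=\psi(z)\}$ with the subspace topology from $Y\times Y$ and operations $r(y,z)=y$, $s(y,z)=z$, $(x,y)(y,z)=(x,z)$; it is a locally compact Hausdorff étale groupoid with unit space $Y$, and it carries the Haar system of counting measures. $Y/R(\psi)$ is the set of equivalence classes (orbits) with the quotient topology. Let $G$ be a second-countable locally compact Hausdorff étale groupoid, with composable pairs $G^{(2)}$ and unit space $G^{(0)}$. A continuous normalised $2$-cocycle on $G$ is a continuous $\sigma:G^{(2)}\to\mathbb{T}$ with $\sigma(\alpha,\beta)\sigma(\alpha\beta,\gamma)=\sigma(\beta,\gamma)\sigma(\alpha,\beta\gamma)$ and $\sigma(r(\gamma),\gamma)=1=\sigma(\gamma,s(\gamma))$. $C_c(G,\sigma)$ is the vector space $C_c(G)$ with the $*$-algebra structure $$(f*g)(\alpha)=\sum_{r(\beta)=r(\alpha)}f(\beta)g(\beta^{-1}\alpha)\sigma(\beta,\beta^{-1}\alpha),\qquad f^*(\alpha)=\overline{f(\alpha^{-1})\sigma(\alpha,\alpha^{-1})}.$$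 The full algebra $C^*(G,\sigma)$ is the completion of $C_c(G,\sigma)$ in the norm $\sup\|L(f)\|$, with $L$ ranging over the nondegenerate $*$-representations on Hilbert spaces which are continuous from the inductive limit topology to the weak operator topology. For $u\in G^{(0)}$ the induced representation $\operatorname{Ind}_u^\sigma$ on $\ell^2(s^{-1}(u))$ is $$(\operatorname{Ind}_u^\sigma(f)\xi)(\alpha)=\sum_{r(\beta)=r(\alpha)}f(\beta)\xi(\beta^{-1}\alpha)\sigma(\beta,\beta^{-1}\alpha).$$ The reduced algebra $C^*_{\mathrm r}(G,\sigma)$ is the completion of $C_c(G,\sigma)$ in the norm $\|f\|_{\mathrm r}=\sup_{u\in G^{(0)}}\|\operatorname{Ind}_u^\sigma(f)\|$. The equality $C^*(G,\sigma)=C^*_{\mathrm r}(G,\sigma)$ means that the full and reduced norms on $C_c(G,\sigma)$ coincide. A $C^*$-algebra $A$ with spectrum $\hat A$ is a Fell algebra if for each $\pi\in\hat A$ there are a positive element $a\in A$ and a neighbourhood $U$ of $\pi$ in $\hat A$ such that $\rho(a)$ is a rank-one projection for all $\rho\in U$. *)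

theory Defs
  imports "HOL-Analysis.Analysis" "HOL-Algebra.Module"
begin

section \<open>Complex vector spaces and Hilbert spaces with explicit carriers\<close>

definition complex_ring :: "complex ring" where
  "complex_ring = \<lparr>carrier = UNIV, mult = (*), one = 1, zero = 0, add = (+)\<rparr>"

text \<open>Complex vector spaces are modules over \<^const>\<open>complex_ring\<close>; Hilbert spaces do not use
  the fields \<^const>\<open>mult\<close> and \<^const>\<open>one\<close>, and (non-unital) algebras do not use \<^const>\<open>one\<close>.\<close>

record 'h hilbert = "(complex, 'h) module" +
  hinner :: "'h \<Rightarrow> 'h \<Rightarrow> complex"

definition hnorm :: "('h, 'm) hilbert_scheme \<Rightarrow> 'h \<Rightarrow> real" where
  "hnorm H x = sqrt (Re (hinner H x x))"

definition cauchy_in :: "(complex, 'v, 'm) module_scheme \<Rightarrow> ('v \<Rightarrow> real) \<Rightarrow> (nat \<Rightarrow> 'v) \<Rightarrow> bool" where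
  "cauchy_in V N u \<longleftrightarrow> (\<forall>n. u n \<in> carrier V) \<and>
     (\<forall>e>0. \<exists>M. \<forall>m\<ge>M. \<forall>n\<ge>M. N (u m \<ominus>\<^bsub>V\<^esub> u n) < e)"

definition converges_in ::
  "(complex, 'v, 'm) module_scheme \<Rightarrow> ('v \<Rightarrow> real) \<Rightarrow> (nat \<Rightarrow> 'v) \<Rightarrow> 'v \<Rightarrow> bool" where
  "converges_in V N u x \<longleftrightarrow> (\<lambda>n. N (u n \<ominus>\<^bsub>V\<^esub> x)) \<longlonglongrightarrow> 0"

definition complete_in :: "(complex, 'v, 'm) module_scheme \<Rightarrow> ('v \<Rightarrow> real) \<Rightarrow> bool" where
  "complete_in V N \<longleftrightarrow> (\<forall>u. cauchy_in V N u \<longrightarrow> (\<exists>x\<in>carrier V. converges_in V N u x))"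

definition closed_subspace :: "(complex, 'v, 'm) module_scheme \<Rightarrow> ('v \<Rightarrow> real) \<Rightarrow> 'v set \<Rightarrow> bool" where
  "closed_subspace V N S \<longleftrightarrow> submodule S complex_ring V \<and>
     (\<forall>u x. (\<forall>n. u n \<in> S) \<longrightarrow> x \<in> carrier V \<longrightarrow> converges_in V N u x \<longrightarrow> x \<in> S)"

definition closed_span :: "(complex, 'v, 'm) module_scheme \<Rightarrow> ('v \<Rightarrow> real) \<Rightarrow> 'v set \<Rightarrow> 'v set" where
  "closed_span V N E = \<Inter> {S. closed_subspace V N S \<and> E \<subseteq> S}"

text \<open>Inner products are linear in the first variable.\<close>

definition hilbert_space :: "('h, 'm) hilbert_scheme \<Rightarrow> bool" where
  "hilbert_space H \<longleftrightarrow> module complex_ring H \<and>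
     (\<forall>x\<in>carrier H. \<forall>y\<in>carrier H. \<forall>z\<in>carrier H.
        hinner H (x \<oplus>\<^bsub>H\<^esub> y) z = hinner H x z + hinner H y z) \<and>
     (\<forall>c. \<forall>x\<in>carrier H. \<forall>y\<in>carrier H. hinner H (c \<odot>\<^bsub>H\<^esub> x) y = c * hinner H x y) \<and>
     (\<forall>x\<in>carrier H. \<forall>y\<in>carrier H. hinner H y x = cnj (hinner H x y)) \<and>
     (\<forall>x\<in>carrier H. 0 \<le> Re (hinner H x x) \<and> (hinner H x x = 0 \<longrightarrow> x = \<zero>\<^bsub>H\<^esub>)) \<and>
     complete_in H (hnorm H)"

definition linear_on ::
  "(complex, 'v, 'm) module_scheme \<Rightarrow> (complex, 'w, 'n) module_scheme \<Rightarrow> ('v \<Rightarrow> 'w) \<Rightarrow> bool" where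
  "linear_on V W T \<longleftrightarrow> (\<forall>x\<in>carrier V. T x \<in> carrier W) \<and>
     (\<forall>x\<in>carrier V. \<forall>y\<in>carrier V. T (x \<oplus>\<^bsub>V\<^esub> y) = T x \<oplus>\<^bsub>W\<^esub> T y) \<and>
     (\<forall>c. \<forall>x\<in>carrier V. T (c \<odot>\<^bsub>V\<^esub> x) = c \<odot>\<^bsub>W\<^esub> T x)"

text \<open>Bounded operators are extensional functions on the carrier, so that equality of operators
  is equality of functions.\<close>

definition bounded_ops :: "('h, 'm) hilbert_scheme \<Rightarrow> ('h \<Rightarrow> 'h) set" where
  "bounded_ops H = {T \<in> extensional (carrier H). linear_on H H T \<and>
     (\<exists>B. \<forall>x\<in>carrier H. hnorm H (T x) \<le> B * hnorm H x)}"

definition op_norm :: "('h, 'm) hilbert_scheme \<Rightarrow> ('h \<Rightarrow> 'h) \<Rightarrow> real" where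
  "op_norm H T = Sup {hnorm H (T x) | x. x \<in> carrier H \<and> hnorm H x \<le> 1}"

definition weak_operator_topology :: "('h, 'm) hilbert_scheme \<Rightarrow> ('h \<Rightarrow> 'h) topology" where
  "weak_operator_topology H = topology_generated_by
     {{T \<in> bounded_ops H. hinner H (T x) y \<in> U} | x y U. x \<in> carrier H \<and> y \<in> carrier H \<and> open U}"


section \<open>Star-algebras, representations and spectra\<close>

record 'a star_algebra = "(complex, 'a) module" +
  astar :: "'a \<Rightarrow> 'a"

record 'a normed_star_algebra = "'a star_algebra" +
  anorm :: "'a \<Rightarrow> real"

definition is_star_algebra :: "('a, 'm) star_algebra_scheme \<Rightarrow> bool" where
  "is_star_algebra A \<longleftrightarrow> module complex_ring A \<and>
     (\<forall>x\<in>carrier A. \<forall>y\<in>carrier A. x \<otimes>\<^bsub>A\<^esub> y \<in> carrier A) \<and>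
     (\<forall>x\<in>carrier A. \<forall>y\<in>carrier A. \<forall>z\<in>carrier A.
        (x \<otimes>\<^bsub>A\<^esub> y) \<otimes>\<^bsub>A\<^esub> z = x \<otimes>\<^bsub>A\<^esub> (y \<otimes>\<^bsub>A\<^esub> z) \<and>
        (x \<oplus>\<^bsub>A\<^esub> y) \<otimes>\<^bsub>A\<^esub> z = x \<otimes>\<^bsub>A\<^esub> z \<oplus>\<^bsub>A\<^esub> y \<otimes>\<^bsub>A\<^esub> z \<and>
        x \<otimes>\<^bsub>A\<^esub> (y \<oplus>\<^bsub>A\<^esub> z) = x \<otimes>\<^bsub>A\<^esub> y \<oplus>\<^bsub>A\<^esub> x \<otimes>\<^bsub>A\<^esub> z) \<and>
     (\<forall>c. \<forall>x\<in>carrier A. \<forall>y\<in>carrier A.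
        (c \<odot>\<^bsub>A\<^esub> x) \<otimes>\<^bsub>A\<^esub> y = c \<odot>\<^bsub>A\<^esub> (x \<otimes>\<^bsub>A\<^esub> y) \<and>
        x \<otimes>\<^bsub>A\<^esub> (c \<odot>\<^bsub>A\<^esub> y) = c \<odot>\<^bsub>A\<^esub> (x \<otimes>\<^bsub>A\<^esub> y)) \<and>
     (\<forall>x\<in>carrier A. astar A x \<in> carrier A \<and> astar A (astar A x) = x) \<and>
     (\<forall>x\<in>carrier A. \<forall>y\<in>carrier A.
        astar A (x \<oplus>\<^bsub>A\<^esub> y) = astar A x \<oplus>\<^bsub>A\<^esub> astar A y \<and>
        astar A (x \<otimes>\<^bsub>A\<^esub> y) = astar A y \<otimes>\<^bsub>A\<^esub> astar A x) \<and>
     (\<forall>c. \<forall>x\<in>carrier A. astar A (c \<odot>\<^bsub>A\<^esub> x) = cnj c \<odot>\<^bsub>A\<^esub> astar A x)"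

definition cstar_algebra :: "('a, 'm) normed_star_algebra_scheme \<Rightarrow> bool" where
  "cstar_algebra A \<longleftrightarrow> is_star_algebra A \<and>
     (\<forall>x\<in>carrier A. 0 \<le> anorm A x \<and> (anorm A x = 0 \<longleftrightarrow> x = \<zero>\<^bsub>A\<^esub>)) \<and>
     (\<forall>c. \<forall>x\<in>carrier A. anorm A (c \<odot>\<^bsub>A\<^esub> x) = cmod c * anorm A x) \<and>
     (\<forall>x\<in>carrier A. \<forall>y\<in>carrier A. anorm A (x \<oplus>\<^bsub>A\<^esub> y) \<le> anorm A x + anorm A y \<and>
        anorm A (x \<otimes>\<^bsub>A\<^esub> y) \<le> anorm A x * anorm A y) \<and>
     (\<forall>x\<in>carrier A. anorm A (astar A x \<otimes>\<^bsub>A\<^esub> x) = (anorm A x)\<^sup>2) \<and>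
     complete_in A (anorm A)"

definition star_rep ::
  "('a, 'm) star_algebra_scheme \<Rightarrow> 'h hilbert \<Rightarrow> ('a \<Rightarrow> 'h \<Rightarrow> 'h) \<Rightarrow> bool" where
  "star_rep A H L \<longleftrightarrow> hilbert_space H \<and> (\<forall>a\<in>carrier A. L a \<in> bounded_ops H) \<and>
     (\<forall>a\<in>carrier A. \<forall>b\<in>carrier A. \<forall>x\<in>carrier H.
        L (a \<oplus>\<^bsub>A\<^esub> b) x = L a x \<oplus>\<^bsub>H\<^esub> L b x \<and> L (a \<otimes>\<^bsub>A\<^esub> b) x = L a (L b x)) \<and>
     (\<forall>c. \<forall>a\<in>carrier A. \<forall>x\<in>carrier H. L (c \<odot>\<^bsub>A\<^esub> a) x = c \<odot>\<^bsub>H\<^esub> L a x) \<and>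
     (\<forall>a\<in>carrier A. \<forall>x\<in>carrier H. \<forall>y\<in>carrier H.
        hinner H (L a x) y = hinner H x (L (astar A a) y))"

definition nondegenerate ::
  "('a, 'm) star_algebra_scheme \<Rightarrow> 'h hilbert \<Rightarrow> ('a \<Rightarrow> 'h \<Rightarrow> 'h) \<Rightarrow> bool" where
  "nondegenerate A H L \<longleftrightarrow>
     closed_span H (hnorm H) {L a x | a x. a \<in> carrier A \<and> x \<in> carrier H} = carrier H"

text \<open>Irreducible means nonzero and without nontrivial closed invariant subspaces.\<close>

definition irreducible_rep ::
  "('a, 'm) star_algebra_scheme \<Rightarrow> 'h hilbert \<Rightarrow> ('a \<Rightarrow> 'h \<Rightarrow> 'h) \<Rightarrow> bool" where
  "irreducible_rep A H L \<longleftrightarrow> star_rep A H L \<and>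
     (\<exists>a\<in>carrier A. \<exists>x\<in>carrier H. L a x \<noteq> \<zero>\<^bsub>H\<^esub>) \<and>
     (\<forall>S. closed_subspace H (hnorm H) S \<longrightarrow> (\<forall>a\<in>carrier A. \<forall>x\<in>S. L a x \<in> S) \<longrightarrow>
        S = {\<zero>\<^bsub>H\<^esub>} \<or> S = carrier H)"

definition unitarily_equivalent ::
  "('a, 'm) star_algebra_scheme \<Rightarrow> 'h hilbert \<times> ('a \<Rightarrow> 'h \<Rightarrow> 'h)
     \<Rightarrow> 'k hilbert \<times> ('a \<Rightarrow> 'k \<Rightarrow> 'k) \<Rightarrow> bool" where
  "unitarily_equivalent A = (\<lambda>(H, L) (K, M). \<exists>U. linear_on H K U \<and>
     bij_betw U (carrier H) (carrier K) \<and>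
     (\<forall>x\<in>carrier H. \<forall>y\<in>carrier H. hinner K (U x) (U y) = hinner H x y) \<and>
     (\<forall>a\<in>carrier A. \<forall>x\<in>carrier H. U (L a x) = M a (U x)))"

text \<open>HOL cannot quantify over Hilbert spaces of all types at once.  The type \<open>'h\<close> plays the role
  of a universe: Hilbert spaces are those whose carrier is a set of elements of \<open>'h\<close>.
  A representation on a space of any type \<open>'k\<close> determines the class of the irreducible
  representations in the universe \<open>'h\<close> which are unitarily equivalent to it.  A universe of
  at least the cardinality of the continuum contains a copy of every separable Hilbert space, and
  so of every cyclic representation of a separable algebra; smaller universes miss some.\<close>

type_synonym ('a, 'h) rep_class = "('h hilbert \<times> ('a \<Rightarrow> 'h \<Rightarrow> 'h)) set"

definition rep_class ::
  "('a, 'm) star_algebra_scheme \<Rightarrow> 'k hilbert \<times> ('a \<Rightarrow> 'k \<Rightarrow> 'k) \<Rightarrow> ('a, 'h) rep_class" where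
  "rep_class A \<pi> = {(H, L). irreducible_rep A H L \<and> unitarily_equivalent A \<pi> (H, L)}"

definition spectrum :: "('a, 'm) star_algebra_scheme \<Rightarrow> ('a, 'h) rep_class set" where
  "spectrum A = {rep_class A (H, L) | (H :: 'h hilbert) L. irreducible_rep A H L}"

definition closed_ideal :: "('a, 'm) normed_star_algebra_scheme \<Rightarrow> 'a set \<Rightarrow> bool" where
  "closed_ideal A J \<longleftrightarrow> closed_subspace A (anorm A) J \<and>
     (\<forall>a\<in>carrier A. \<forall>b\<in>J. a \<otimes>\<^bsub>A\<^esub> b \<in> J \<and> b \<otimes>\<^bsub>A\<^esub> a \<in> J)"

text \<open>The topology pulled back from the hull-kernel topology on the primitive ideals.  For a
  \<open>C\<^sup>*\<close>-algebra the generating sets are already all the open sets.\<close>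

definition spectrum_topology ::
  "('a, 'm) normed_star_algebra_scheme \<Rightarrow> ('a, 'h) rep_class topology" where
  "spectrum_topology A = topology_generated_by
     {{c \<in> spectrum A. \<exists>(H, L)\<in>c. \<exists>a\<in>J. \<exists>x\<in>carrier H. L a x \<noteq> \<zero>\<^bsub>H\<^esub>} | J. closed_ideal A J}"

definition positive_element :: "('a, 'm) star_algebra_scheme \<Rightarrow> 'a \<Rightarrow> bool" where
  "positive_element A a \<longleftrightarrow> (\<exists>b\<in>carrier A. a = astar A b \<otimes>\<^bsub>A\<^esub> b)"

definition rank_one_projection :: "'h hilbert \<Rightarrow> ('h \<Rightarrow> 'h) \<Rightarrow> bool" where
  "rank_one_projection H P \<longleftrightarrow> P \<in> bounded_ops H \<and>
     (\<forall>x\<in>carrier H. P (P x) = P x) \<and>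
     (\<forall>x\<in>carrier H. \<forall>y\<in>carrier H. hinner H (P x) y = hinner H x (P y)) \<and>
     (\<exists>e\<in>carrier H. e \<noteq> \<zero>\<^bsub>H\<^esub> \<and> P ` carrier H = {c \<odot>\<^bsub>H\<^esub> e | c. True})"

definition fell_algebra :: "'h itself \<Rightarrow> ('a, 'm) normed_star_algebra_scheme \<Rightarrow> bool" where
  "fell_algebra _ A \<longleftrightarrow> cstar_algebra A \<and>
     (\<forall>c \<in> (spectrum A :: ('a, 'h) rep_class set). \<exists>a\<in>carrier A. positive_element A a \<and>
        (\<exists>U V. openin (spectrum_topology A) V \<and> c \<in> V \<and> V \<subseteq> U \<and> U \<subseteq> spectrum A \<and>
           (\<forall>d\<in>U. \<forall>(H, L)\<in>d. rank_one_projection H (L a))))"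


section \<open>Completion of a star-algebra in a \<open>C\<^sup>*\<close>-seminorm\<close>

text \<open>Elements of the completion are classes of Cauchy sequences modulo null sequences.\<close>

definition cauchy_class ::
  "('a, 'm) normed_star_algebra_scheme \<Rightarrow> (nat \<Rightarrow> 'a) \<Rightarrow> (nat \<Rightarrow> 'a) set" where
  "cauchy_class A u = {v. cauchy_in A (anorm A) v \<and> (\<lambda>n. anorm A (v n \<ominus>\<^bsub>A\<^esub> u n)) \<longlonglongrightarrow> 0}"

text \<open>In the operations below all the classes in the unions coincide.\<close>

definition completion ::
  "('a, 'm) normed_star_algebra_scheme \<Rightarrow> (nat \<Rightarrow> 'a) set normed_star_algebra" where
  "completion A = \<lparr>
     carrier = {cauchy_class A u | u. cauchy_in A (anorm A) u},
     mult = (\<lambda>F G. \<Union>u\<in>F. \<Union>v\<in>G. cauchy_class A (\<lambda>n. u n \<otimes>\<^bsub>A\<^esub> v n)),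
     one = undefined,
     zero = cauchy_class A (\<lambda>_. \<zero>\<^bsub>A\<^esub>),
     add = (\<lambda>F G. \<Union>u\<in>F. \<Union>v\<in>G. cauchy_class A (\<lambda>n. u n \<oplus>\<^bsub>A\<^esub> v n)),
     smult = (\<lambda>c F. \<Union>u\<in>F. cauchy_class A (\<lambda>n. c \<odot>\<^bsub>A\<^esub> u n)),
     astar = (\<lambda>F. \<Union>u\<in>F. cauchy_class A (\<lambda>n. astar A (u n))),
     anorm = (\<lambda>F. THE l. \<forall>u\<in>F. (\<lambda>n. anorm A (u n)) \<longlonglongrightarrow> l)\<rparr>"

text \<open>The continuous extension of a norm-bounded representation to the completion.\<close>

definition extend_rep :: "'h hilbert \<Rightarrow> ('a \<Rightarrow> 'h \<Rightarrow> 'h) \<Rightarrow> (nat \<Rightarrow> 'a) set \<Rightarrow> 'h \<Rightarrow> 'h" where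
  "extend_rep H L F = (THE T. T \<in> bounded_ops H \<and>
     (\<forall>u\<in>F. (\<lambda>n. op_norm H (\<lambda>x. L (u n) x \<ominus>\<^bsub>H\<^esub> T x)) \<longlonglongrightarrow> 0))"


section \<open>Twisted groupoid \<open>C\<^sup>*\<close>-algebras\<close>

text \<open>The set of arrows is the underlying set of the topology; \<open>gunit\<close> embeds the unit space
  into the arrows.\<close>

record ('g, 'u) groupoid =
  gtop :: "'g topology"
  grng :: "'g \<Rightarrow> 'u"
  gsrc :: "'g \<Rightarrow> 'u"
  gunit :: "'u \<Rightarrow> 'g"
  gmult :: "'g \<Rightarrow> 'g \<Rightarrow> 'g"
  ginv :: "'g \<Rightarrow> 'g"

definition arrows :: "('g, 'u) groupoid \<Rightarrow> 'g set" where
  "arrows G = topspace (gtop G)"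

definition units :: "('g, 'u) groupoid \<Rightarrow> 'u set" where
  "units G = gsrc G ` arrows G"

definition composable :: "('g, 'u) groupoid \<Rightarrow> ('g \<times> 'g) set" where
  "composable G = {(\<alpha>, \<beta>). \<alpha> \<in> arrows G \<and> \<beta> \<in> arrows G \<and> gsrc G \<alpha> = grng G \<beta>}"

text \<open>Only the values of a cocycle on composable pairs matter.\<close>

definition normalised_cocycle :: "('g, 'u) groupoid \<Rightarrow> ('g \<times> 'g \<Rightarrow> complex) \<Rightarrow> bool" where
  "normalised_cocycle G \<sigma> \<longleftrightarrow>
     continuous_map (subtopology (prod_topology (gtop G) (gtop G)) (composable G)) euclidean \<sigma> \<and>
     (\<forall>p\<in>composable G. cmod (\<sigma> p) = 1) \<and>
     (\<forall>\<alpha> \<beta> \<gamma>. (\<alpha>, \<beta>) \<in> composable G \<and> (\<beta>, \<gamma>) \<in> composable G \<longrightarrow>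
        \<sigma> (\<alpha>, \<beta>) * \<sigma> (gmult G \<alpha> \<beta>, \<gamma>) = \<sigma> (\<beta>, \<gamma>) * \<sigma> (\<alpha>, gmult G \<beta> \<gamma>)) \<and>
     (\<forall>\<gamma>\<in>arrows G. \<sigma> (gunit G (grng G \<gamma>), \<gamma>) = 1 \<and> \<sigma> (\<gamma>, gunit G (gsrc G \<gamma>)) = 1)"

text \<open>Functions on the groupoid are extended by zero to the whole type.\<close>

definition Cc :: "('g, 'u) groupoid \<Rightarrow> ('g \<Rightarrow> complex) set" where
  "Cc G = {f. continuous_map (gtop G) euclidean f \<and> (\<forall>\<alpha>. \<alpha> \<notin> arrows G \<longrightarrow> f \<alpha> = 0) \<and>
     compactin (gtop G) (gtop G closure_of {\<alpha> \<in> arrows G. f \<alpha> \<noteq> 0})}"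

definition twisted_algebra ::
  "('g, 'u) groupoid \<Rightarrow> ('g \<times> 'g \<Rightarrow> complex) \<Rightarrow> ('g \<Rightarrow> complex) star_algebra" where
  "twisted_algebra G \<sigma> = \<lparr>
     carrier = Cc G,
     mult = (\<lambda>f g \<alpha>. if \<alpha> \<in> arrows G
       then \<Sum>\<^sub>\<infinity>\<beta>\<in>{\<beta> \<in> arrows G. grng G \<beta> = grng G \<alpha>}.
         f \<beta> * g (gmult G (ginv G \<beta>) \<alpha>) * \<sigma> (\<beta>, gmult G (ginv G \<beta>) \<alpha>)
       else 0),
     one = undefined,
     zero = (\<lambda>_. 0),
     add = (\<lambda>f g \<alpha>. f \<alpha> + g \<alpha>),
     smult = (\<lambda>c f \<alpha>. c * f \<alpha>),
     astar = (\<lambda>f \<alpha>. if \<alpha> \<in> arrows G then cnj (f (ginv G \<alpha>) * \<sigma> (\<alpha>, ginv G \<alpha>)) else 0)\<rparr>"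

text \<open>The inductive limit topology on \<^term>\<open>Cc G\<close> is the finest locally convex topology for which
  the inclusion of the functions supported in \<open>K\<close>, with the supremum norm, is continuous
  for every compact \<open>K\<close>.  Its basic neighbourhoods of zero are the absolutely convex sets
  that meet each of these normed spaces in a neighbourhood of zero.\<close>

definition indlim_nhd :: "('g, 'u) groupoid \<Rightarrow> ('g \<Rightarrow> complex) set \<Rightarrow> bool" where
  "indlim_nhd G W \<longleftrightarrow> W \<subseteq> Cc G \<and>
     (\<forall>f\<in>W. \<forall>g\<in>W. \<forall>c d. cmod c + cmod d \<le> 1 \<longrightarrow> (\<lambda>\<alpha>. c * f \<alpha> + d * g \<alpha>) \<in> W) \<and>
     (\<forall>K. compactin (gtop G) K \<longrightarrow>
        (\<exists>e>0. \<forall>f\<in>Cc G. (\<forall>\<alpha>. f \<alpha> \<noteq> 0 \<longrightarrow> \<alpha> \<in> K) \<and> (\<forall>\<alpha>. cmod (f \<alpha>) < e) \<longrightarrow> f \<in> W))"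

definition indlim_topology :: "('g, 'u) groupoid \<Rightarrow> ('g \<Rightarrow> complex) topology" where
  "indlim_topology G = topology (\<lambda>U. U \<subseteq> Cc G \<and>
     (\<forall>f\<in>U. \<exists>W. indlim_nhd G W \<and> (\<forall>w\<in>W. (\<lambda>\<alpha>. f \<alpha> + w \<alpha>) \<in> U)))"

lemma indlim_nhd_Int:
  assumes "indlim_nhd G V" "indlim_nhd G W"
  shows "indlim_nhd G (V \<inter> W)"
proof -
  have "\<exists>e>0. \<forall>f\<in>Cc G. (\<forall>\<alpha>. f \<alpha> \<noteq> 0 \<longrightarrow> \<alpha> \<in> K) \<and> (\<forall>\<alpha>. cmod (f \<alpha>) < e) \<longrightarrow> f \<in> V \<inter> W"
    if K: "compactin (gtop G) K" for K
  proof -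
    obtain d where d: "d > 0"
      "\<forall>f\<in>Cc G. (\<forall>\<alpha>. f \<alpha> \<noteq> 0 \<longrightarrow> \<alpha> \<in> K) \<and> (\<forall>\<alpha>. cmod (f \<alpha>) < d) \<longrightarrow> f \<in> V"
      using assms(1)[unfolded indlim_nhd_def, THEN conjunct2, THEN conjunct2, THEN spec[of _ K],
          THEN mp, OF K] by (elim exE conjE)
    obtain e where e: "e > 0"
      "\<forall>f\<in>Cc G. (\<forall>\<alpha>. f \<alpha> \<noteq> 0 \<longrightarrow> \<alpha> \<in> K) \<and> (\<forall>\<alpha>. cmod (f \<alpha>) < e) \<longrightarrow> f \<in> W"
      using assms(2)[unfolded indlim_nhd_def, THEN conjunct2, THEN conjunct2, THEN spec[of _ K],
          THEN mp, OF K] by (elim exE conjE)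
    show ?thesis
      using d e by (intro exI[of _ "min d e"]) simp
  qed
  moreover have "V \<inter> W \<subseteq> Cc G"
    using assms(1) unfolding indlim_nhd_def by blast
  moreover have "(\<lambda>\<alpha>. c * f \<alpha> + d * g \<alpha>) \<in> V \<inter> W"
    if "f \<in> V \<inter> W" "g \<in> V \<inter> W" "cmod c + cmod d \<le> 1" for f g c d
    using assms that unfolding indlim_nhd_def by simp
  ultimately show ?thesis
    unfolding indlim_nhd_def[of G "V \<inter> W"] by simp
qed

lemma openin_indlim_topology:
  "openin (indlim_topology G) U \<longleftrightarrow> U \<subseteq> Cc G \<and>
     (\<forall>f\<in>U. \<exists>W. indlim_nhd G W \<and> (\<forall>w\<in>W. (\<lambda>\<alpha>. f \<alpha> + w \<alpha>) \<in> U))"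
proof -
  define P where "P U f W \<longleftrightarrow> indlim_nhd G W \<and>
    (\<forall>w\<in>W. (\<lambda>\<alpha>. f \<alpha> + w \<alpha>) \<in> U)" for U f W
  have Int: "P (S \<inter> T) f (V \<inter> W)" if "P S f V" "P T f W" for S T f V W
    using that indlim_nhd_Int[of G V W] unfolding P_def by simp
  have mono: "P T f W" if "P S f W" "S \<subseteq> T" for S T f W
    using that unfolding P_def by blast
  have "istopology (\<lambda>U. U \<subseteq> Cc G \<and> (\<forall>f\<in>U. \<exists>W. P U f W))"
    unfolding istopology_def
  proof (intro conjI allI impI)
    fix S T
    assume "S \<subseteq> Cc G \<and> (\<forall>f\<in>S. \<exists>W. P S f W)" "T \<subseteq> Cc G \<and> (\<forall>f\<in>T. \<exists>W. P T f W)"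
    then show "S \<inter> T \<subseteq> Cc G" and "\<forall>f\<in>S \<inter> T. \<exists>W. P (S \<inter> T) f W"
      by (blast, metis Int IntE)
  next
    fix \<K>
    assume *: "\<forall>K\<in>\<K>. K \<subseteq> Cc G \<and> (\<forall>f\<in>K. \<exists>W. P K f W)"
    then show "\<Union>\<K> \<subseteq> Cc G" by blast
    show "\<forall>f\<in>\<Union>\<K>. \<exists>W. P (\<Union>\<K>) f W"
      using * by (metis UnionE Union_upper mono)
  qed
  then have "openin (indlim_topology G) U \<longleftrightarrow> U \<subseteq> Cc G \<and> (\<forall>f\<in>U. \<exists>W. P U f W)"
    unfolding indlim_topology_def P_def[symmetric] by (simp add: topology_inverse')
  then show ?thesis
    unfolding P_def .
qed

definition full_norm ::
  "'h itself \<Rightarrow> ('g, 'u) groupoid \<Rightarrow> ('g \<times> 'g \<Rightarrow> complex) \<Rightarrow> ('g \<Rightarrow> complex) \<Rightarrow> real" where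
  "full_norm _ G \<sigma> f = Sup {op_norm H (L f) | (H :: 'h hilbert) L.
     star_rep (twisted_algebra G \<sigma>) H L \<and> nondegenerate (twisted_algebra G \<sigma>) H L \<and>
     continuous_map (indlim_topology G) (weak_operator_topology H) L}"

definition full_twisted_algebra ::
  "'h itself \<Rightarrow> ('g, 'u) groupoid \<Rightarrow> ('g \<times> 'g \<Rightarrow> complex)
     \<Rightarrow> (nat \<Rightarrow> 'g \<Rightarrow> complex) set normed_star_algebra" where
  "full_twisted_algebra U G \<sigma> = completion
     (star_algebra.extend (twisted_algebra G \<sigma>) (normed_star_algebra.fields (full_norm U G \<sigma>)))"

definition ell2 :: "'g set \<Rightarrow> ('g \<Rightarrow> complex) hilbert" where
  "ell2 I = \<lparr>
     carrier = {\<xi>. (\<forall>\<alpha>. \<alpha> \<notin> I \<longrightarrow> \<xi> \<alpha> = 0) \<and> (\<lambda>\<alpha>. (cmod (\<xi> \<alpha>))\<^sup>2) summable_on I},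
     mult = undefined,
     one = undefined,
     zero = (\<lambda>_. 0),
     add = (\<lambda>\<xi> \<eta> \<alpha>. \<xi> \<alpha> + \<eta> \<alpha>),
     smult = (\<lambda>c \<xi> \<alpha>. c * \<xi> \<alpha>),
     hinner = (\<lambda>\<xi> \<eta>. \<Sum>\<^sub>\<infinity>\<alpha>\<in>I. \<xi> \<alpha> * cnj (\<eta> \<alpha>))\<rparr>"

definition source_fibre :: "('g, 'u) groupoid \<Rightarrow> 'u \<Rightarrow> 'g set" where
  "source_fibre G u = {\<alpha> \<in> arrows G. gsrc G \<alpha> = u}"

definition Ind ::
  "('g, 'u) groupoid \<Rightarrow> ('g \<times> 'g \<Rightarrow> complex) \<Rightarrow> 'u
     \<Rightarrow> ('g \<Rightarrow> complex) \<Rightarrow> ('g \<Rightarrow> complex) \<Rightarrow> 'g \<Rightarrow> complex" where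
  "Ind G \<sigma> u f = restrict (\<lambda>\<xi> \<alpha>. if \<alpha> \<in> source_fibre G u
       then \<Sum>\<^sub>\<infinity>\<beta>\<in>{\<beta> \<in> arrows G. grng G \<beta> = grng G \<alpha>}.
         f \<beta> * \<xi> (gmult G (ginv G \<beta>) \<alpha>) * \<sigma> (\<beta>, gmult G (ginv G \<beta>) \<alpha>)
       else 0)
     (carrier (ell2 (source_fibre G u)))"

text \<open>Inserting 0 only matters for the empty groupoid, where the supremum is over the empty set.\<close>

definition reduced_norm ::
  "('g, 'u) groupoid \<Rightarrow> ('g \<times> 'g \<Rightarrow> complex) \<Rightarrow> ('g \<Rightarrow> complex) \<Rightarrow> real" where
  "reduced_norm G \<sigma> f =
     Sup (insert 0 {op_norm (ell2 (source_fibre G u)) (Ind G \<sigma> u f) | u. u \<in> units G})"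

text \<open>The induced representation, extended to the full algebra.\<close>

definition Ind_rep ::
  "('g, 'u) groupoid \<Rightarrow> ('g \<times> 'g \<Rightarrow> complex) \<Rightarrow> 'u
     \<Rightarrow> ('g \<Rightarrow> complex) hilbert
       \<times> ((nat \<Rightarrow> 'g \<Rightarrow> complex) set \<Rightarrow> ('g \<Rightarrow> complex) \<Rightarrow> ('g \<Rightarrow> complex))" where
  "Ind_rep G \<sigma> u =
     (ell2 (source_fibre G u), extend_rep (ell2 (source_fibre G u)) (Ind G \<sigma> u))"


section \<open>The groupoid of a local homeomorphism\<close>

definition local_homeomorphism :: "'y topology \<Rightarrow> 'x topology \<Rightarrow> ('y \<Rightarrow> 'x) \<Rightarrow> bool" where
  "local_homeomorphism Y X \<psi> \<longleftrightarrow> (\<forall>y\<in>topspace Y. \<exists>U. openin Y U \<and> y \<in> U \<and> openin X (\<psi> ` U) \<and>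
     homeomorphic_map (subtopology Y U) (subtopology X (\<psi> ` U)) \<psi>)"

definition fibre_relation :: "'y topology \<Rightarrow> ('y \<Rightarrow> 'x) \<Rightarrow> ('y \<times> 'y) set" where
  "fibre_relation Y \<psi> = {(y, z). y \<in> topspace Y \<and> z \<in> topspace Y \<and> \<psi> y = \<psi> z}"

definition fibre_groupoid :: "'y topology \<Rightarrow> ('y \<Rightarrow> 'x) \<Rightarrow> ('y \<times> 'y, 'y) groupoid" where
  "fibre_groupoid Y \<psi> = \<lparr>
     gtop = subtopology (prod_topology Y Y) (fibre_relation Y \<psi>),
     grng = fst,
     gsrc = snd,
     gunit = (\<lambda>y. (y, y)),
     gmult = (\<lambda>\<alpha> \<beta>. (fst \<alpha>, snd \<beta>)),
     ginv = (\<lambda>\<alpha>. (snd \<alpha>, fst \<alpha>))\<rparr>"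

definition quotient_topology :: "'y topology \<Rightarrow> ('y \<times> 'y) set \<Rightarrow> 'y set topology" where
  "quotient_topology Y R = topology (\<lambda>U. U \<subseteq> topspace Y // R \<and>
     openin Y {y \<in> topspace Y. R `` {y} \<in> U})"

lemma openin_quotient_topology:
  "openin (quotient_topology Y R) U \<longleftrightarrow>
     U \<subseteq> topspace Y // R \<and> openin Y {y \<in> topspace Y. R `` {y} \<in> U}"
proof -
  have "istopology (\<lambda>U. U \<subseteq> topspace Y // R \<and> openin Y {y \<in> topspace Y. R `` {y} \<in> U})"
    unfolding istopology_def
  proof (intro conjI allI impI)
    fix S T
    assume *: "S \<subseteq> topspace Y // R \<and> openin Y {y \<in> topspace Y. R `` {y} \<in> S}"
      "T \<subseteq> topspace Y // R \<and> openin Y {y \<in> topspace Y. R `` {y} \<in> T}"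
    then show "S \<inter> T \<subseteq> topspace Y // R" by blast
    have "{y \<in> topspace Y. R `` {y} \<in> S \<inter> T} =
        {y \<in> topspace Y. R `` {y} \<in> S} \<inter> {y \<in> topspace Y. R `` {y} \<in> T}"
      by auto
    then show "openin Y {y \<in> topspace Y. R `` {y} \<in> S \<inter> T}"
      using * by auto
  next
    fix \<K>
    assume *: "\<forall>K\<in>\<K>. K \<subseteq> topspace Y // R \<and> openin Y {y \<in> topspace Y. R `` {y} \<in> K}"
    then show "\<Union>\<K> \<subseteq> topspace Y // R" by blast
    have "{y \<in> topspace Y. R `` {y} \<in> \<Union>\<K>} = (\<Union>K\<in>\<K>. {y \<in> topspace Y. R `` {y} \<in> K})"
      by auto
    then show "openin Y {y \<in> topspace Y. R `` {y} \<in> \<Union>\<K>}"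
      using * by auto
  qed
  then show ?thesis
    unfolding quotient_topology_def by (simp add: topology_inverse')
qed

end

theory Submission
  imports Defs
begin

text \<open>Write \<open>R\<close> for the fibre relation, and call an open set on which \<open>\<psi>\<close> is injective a slice. Slices cover
  \<open>Y\<close>, and a compact set meets the fibres in boundedly many points. So twisted convolution on \<open>C\<^sub>c(R)\<close> is
  multiplication of finite matrices over the fibres. The functions in \<open>C\<^sub>c(Y)\<close> sit on the diagonal of \<open>R\<close>,
  and if \<open>h\<close> and \<open>k\<close> are two of them with supports in the same slice, then \<open>h f k\<close> is diagonal for every \<open>f\<close>.
  All parts of the theorem rest on this.

  Norms. A \<open>*\<close>-representation bounds diagonal functions by their supremum, and it bounds a function \<open>f\<close> whose
  second variable stays in a slice because \<open>f\<^sup>* f\<close> is diagonal. A partition of unity then gives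
  \<open>\<parallel>L f\<parallel> \<le> K sup |f|\<close>, where \<open>K\<close> depends only on a compact set carrying \<open>f\<close> (\<open>crude_bound\<close>). The values of \<open>f\<close> are
  matrix entries of induced representations, up to phases, so \<open>sup |f| \<le> \<parallel>f\<parallel>\<^sub>r\<close>. The iterated products
  \<open>f\<^sup>* f\<close>, \<open>(f\<^sup>* f)\<^sup>* (f\<^sup>* f)\<close>, \<open>\<dots>\<close> are carried by the same compact set as \<open>f\<close>, and the \<open>C\<^sup>*\<close>-identity improves
  \<open>\<parallel>L f\<parallel> \<le> K \<parallel>f\<parallel>\<^sub>r\<close> to \<open>\<parallel>L f\<parallel> \<le> \<parallel>f\<parallel>\<^sub>r\<close> (\<open>star_rep_le_reduced\<close>). Conversely the induced representations occur in the
  supremum that defines the full norm: fibres are countable, so their spaces inject into any universe of the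
  size of the continuum (\<open>full_eq_reduced\<close>).

  The points of the spectrum. Let \<open>L\<close> be irreducible. Of two functions on \<open>Y\<close> with disjoint supports in one
  slice, \<open>L\<close> kills one (\<open>prime\<close>), while a partition of unity provides a point \<open>y\<close> all of whose neighbourhoods
  support functions that \<open>L\<close> does not kill. Hence \<open>L\<close> acts near \<open>y\<close> by evaluation at \<open>y\<close>, and some vector has the vector state
  \<open>f \<mapsto> f(y, y)\<close>, up to a scalar. The basis vector at \<open>(y, y)\<close> has this state for the irreducible representation
  \<open>Ind\<^sub>y\<close>. The uniqueness part of the GNS construction makes \<open>L\<close> and \<open>Ind\<^sub>y\<close> equivalent (\<open>equivalent_to_Ind\<close>). By the
  same argument \<open>Ind\<^sub>y\<close> and \<open>Ind\<^sub>z\<close> are equivalent for \<open>(y, z) \<in> R\<close>, and bump functions separate different orbits.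

  The topology of the spectrum. The matrix entries of an element \<open>F\<close> of the completion are uniform limits of
  continuous functions on \<open>R\<close>. So the set of all \<open>y\<close> with \<open>Ind\<^sub>y F \<noteq> 0\<close> is open (\<open>openin_nonvanishing\<close>), which gives
  continuity of the map from \<open>Y/R\<close> to the spectrum. It is open because the elements that \<open>Ind\<^sub>y\<close> kills for all \<open>y\<close>
  outside a given invariant open set form an ideal (\<open>openin_ind_class_image\<close>). Finally, if a bump function over a
  slice is \<open>1\<close> near \<open>y\<close>, then it acts by a rank-one projection in \<open>Ind\<^sub>v\<close> for all \<open>v\<close> near \<open>y\<close> (\<open>rank_one_diag\<close>),
  which is the Fell property.

  The general part of the theory provides the completion as a \<open>C\<^sup>*\<close>-algebra, the passage of representations
  between an algebra and its completion, which uses that representations of \<open>C\<^sup>*\<close>-algebras are contractive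
  (\<open>star_rep_contractive\<close>), and the equivalence of irreducible representations that share a nonzero vector state
  (\<open>irreducible_same_state_equivalent\<close>).\<close>


section \<open>Complex vector spaces with a seminorm\<close>

lemma complex_ring_simps [simp]:
  "carrier complex_ring = UNIV" "mult complex_ring = (*)" "one complex_ring = 1"
  "ring.zero complex_ring = 0" "add complex_ring = (+)"
  by (simp_all add: complex_ring_def)

lemma cring_complex_ring: "cring complex_ring"
proof (rule cringI)
  show "abelian_group complex_ring"
  proof (rule abelian_groupI)
    show "\<exists>y\<in>carrier complex_ring. y \<oplus>\<^bsub>complex_ring\<^esub> x = \<zero>\<^bsub>complex_ring\<^esub>" for x
      by (rule bexI[of _ "- x"]) simp_all
  qed (simp_all add: algebra_simps)
  show "Group.comm_monoid complex_ring"
    by (rule comm_monoidI) (simp_all add: algebra_simps)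
qed (simp add: algebra_simps)

lemma complex_moduleI:
  fixes M (structure)
  assumes "\<And>x y. x \<in> carrier M \<Longrightarrow> y \<in> carrier M \<Longrightarrow> x \<oplus> y \<in> carrier M"
    and "\<zero> \<in> carrier M"
    and "\<And>x y z. x \<in> carrier M \<Longrightarrow> y \<in> carrier M \<Longrightarrow> z \<in> carrier M \<Longrightarrow> (x \<oplus> y) \<oplus> z = x \<oplus> (y \<oplus> z)"
    and "\<And>x y. x \<in> carrier M \<Longrightarrow> y \<in> carrier M \<Longrightarrow> x \<oplus> y = y \<oplus> x"
    and "\<And>x. x \<in> carrier M \<Longrightarrow> \<zero> \<oplus> x = x"
    and smult: "\<And>c x. x \<in> carrier M \<Longrightarrow> c \<odot> x \<in> carrier M"
    and null: "\<And>x. x \<in> carrier M \<Longrightarrow> (0::complex) \<odot> x = \<zero>"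
    and l_distr: "\<And>c d x. x \<in> carrier M \<Longrightarrow> (c + d) \<odot> x = c \<odot> x \<oplus> d \<odot> x"
    and "\<And>c x y. x \<in> carrier M \<Longrightarrow> y \<in> carrier M \<Longrightarrow> c \<odot> (x \<oplus> y) = c \<odot> x \<oplus> c \<odot> y"
    and "\<And>c d x. x \<in> carrier M \<Longrightarrow> (c * d) \<odot> x = c \<odot> (d \<odot> x)"
    and one: "\<And>x. x \<in> carrier M \<Longrightarrow> 1 \<odot> x = x"
  shows "module complex_ring M"
proof (rule moduleI)
  show "abelian_group M"
  proof (rule abelian_groupI)
    fix x assume x: "x \<in> carrier M"
    then have "(-1) \<odot> x \<oplus> x = ((-1) + 1) \<odot> x"
      using l_distr[of x "-1" 1] one[of x] by simp
    then show "\<exists>y\<in>carrier M. y \<oplus> x = \<zero>"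
      using x smult null by (intro bexI[of _ "(-1) \<odot> x"]) simp_all
  qed (use assms in auto)
qed (use assms cring_complex_ring in auto)

locale complex_module = module complex_ring V for V :: "(complex, 'v, 'm) module_scheme" (structure)
begin

lemma smult_simps:
  "x \<in> carrier V \<Longrightarrow> y \<in> carrier V \<Longrightarrow> c \<odot> (x \<oplus> y) = c \<odot> x \<oplus> c \<odot> y"
  "x \<in> carrier V \<Longrightarrow> c \<odot> (d \<odot> x) = (c * d) \<odot> x"
  by (simp_all add: smult_r_distr smult_assoc1[symmetric])

lemma smult_add_left: "x \<in> carrier V \<Longrightarrow> (c + d) \<odot> x = c \<odot> x \<oplus> d \<odot> x"
  using smult_l_distr[of c d x] by simp

lemma smult_closed' [simp, intro]: "x \<in> carrier V \<Longrightarrow> c \<odot> x \<in> carrier V"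
  by simp

lemma smult_null [simp]: "x \<in> carrier V \<Longrightarrow> 0 \<odot> x = \<zero>"
  using smult_l_null by simp

lemma smult_1 [simp]: "x \<in> carrier V \<Longrightarrow> 1 \<odot> x = x"
  using smult_one by simp

lemma minus_eq_smult: "x \<in> carrier V \<Longrightarrow> \<ominus> x = (-1) \<odot> x"
  using smult_add_left[of x "-1" 1] by (intro M.minus_equality) simp_all

lemma a_minus_eq: "x \<in> carrier V \<Longrightarrow> y \<in> carrier V \<Longrightarrow> x \<ominus> y = x \<oplus> (-1) \<odot> y"
  by (simp add: a_minus_def minus_eq_smult)

lemma a_minus_self [simp]: "x \<in> carrier V \<Longrightarrow> x \<ominus> x = \<zero>"
  by (simp add: a_minus_def M.r_neg)

lemma a_minus_zero [simp]: "x \<in> carrier V \<Longrightarrow> x \<ominus> \<zero> = x"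
  by (simp add: a_minus_def)

lemma minus_add_minus:
  "x \<in> carrier V \<Longrightarrow> y \<in> carrier V \<Longrightarrow> x' \<in> carrier V \<Longrightarrow> y' \<in> carrier V \<Longrightarrow>
    (x \<oplus> y) \<ominus> (x' \<oplus> y') = (x \<ominus> x') \<oplus> (y \<ominus> y')"
  by (simp add: a_minus_eq smult_simps M.a_ac)

lemma smult_minus:
  "x \<in> carrier V \<Longrightarrow> y \<in> carrier V \<Longrightarrow> c \<odot> (x \<ominus> y) = c \<odot> x \<ominus> c \<odot> y"
  by (simp add: a_minus_eq smult_simps)

lemma minus_chain:
  assumes "x \<in> carrier V" "y \<in> carrier V" "z \<in> carrier V"
  shows "x \<ominus> z = (x \<ominus> y) \<oplus> (y \<ominus> z)"
proof -
  have "(-1) \<odot> y \<oplus> y = \<zero>"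
    using smult_add_left[of y "-1" 1] assms by simp
  then show ?thesis
    using assms by (simp add: a_minus_eq M.a_assoc flip: M.a_assoc[of "(-1) \<odot> y" y])
qed

lemma minus_eq_zero_iff: "x \<in> carrier V \<Longrightarrow> y \<in> carrier V \<Longrightarrow> x \<ominus> y = \<zero> \<longleftrightarrow> x = y"
  using minus_chain[of x y \<zero>] by auto

lemma submodule_iff:
  "submodule S complex_ring V \<longleftrightarrow> S \<subseteq> carrier V \<and> \<zero> \<in> S \<and> (\<forall>x\<in>S. \<forall>y\<in>S. x \<oplus> y \<in> S) \<and>
    (\<forall>c. \<forall>x\<in>S. c \<odot> x \<in> S)" (is "?L \<longleftrightarrow> ?R")
proof
  assume L: ?L
  note E = submoduleE[OF L]
  obtain x where "x \<in> S" using E(2) by blast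
  then have "\<zero> \<in> S" using E(1) E(4)[of 0 x] by auto
  then show ?R using E by auto
next
  assume R: ?R
  then show ?L by (intro submoduleI) (auto simp: minus_eq_smult subset_iff)
qed

end

locale seminormed_module = complex_module V for V :: "(complex, 'v, 'm) module_scheme" (structure) +
  fixes N :: "'v \<Rightarrow> real"
  assumes N_ge0: "x \<in> carrier V \<Longrightarrow> 0 \<le> N x"
    and N_add: "x \<in> carrier V \<Longrightarrow> y \<in> carrier V \<Longrightarrow> N (x \<oplus> y) \<le> N x + N y"
    and N_smult: "x \<in> carrier V \<Longrightarrow> N (c \<odot> x) = cmod c * N x"
begin

lemma N_zero [simp]: "N \<zero> = 0"
  using N_smult[of \<zero> 0] by simp

lemma N_minus_commute: "x \<in> carrier V \<Longrightarrow> y \<in> carrier V \<Longrightarrow> N (x \<ominus> y) = N (y \<ominus> x)"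
  using N_smult[of "x \<ominus> y" "-1"] by (simp add: a_minus_eq smult_simps M.a_comm)

lemma N_minus_triangle:
  "x \<in> carrier V \<Longrightarrow> y \<in> carrier V \<Longrightarrow> z \<in> carrier V \<Longrightarrow> N (x \<ominus> z) \<le> N (x \<ominus> y) + N (y \<ominus> z)"
  using N_add[of "x \<ominus> y" "y \<ominus> z"] minus_chain[of x y z] by simp

lemma N_minus_le: "x \<in> carrier V \<Longrightarrow> y \<in> carrier V \<Longrightarrow> N (x \<ominus> y) \<le> N x + N y"
  using N_minus_triangle[of x \<zero> y] N_minus_commute[of \<zero> y] by simp

lemma N_diff: "x \<in> carrier V \<Longrightarrow> y \<in> carrier V \<Longrightarrow> \<bar>N x - N y\<bar> \<le> N (x \<ominus> y)"
  using N_minus_triangle[of x y \<zero>] N_minus_triangle[of y x \<zero>] N_minus_commute[of x y] by simp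

lemma N_minus_add:
  "x \<in> carrier V \<Longrightarrow> y \<in> carrier V \<Longrightarrow> x' \<in> carrier V \<Longrightarrow> y' \<in> carrier V \<Longrightarrow>
    N ((x \<oplus> y) \<ominus> (x' \<oplus> y')) \<le> N (x \<ominus> x') + N (y \<ominus> y')"
  using N_add[of "x \<ominus> x'" "y \<ominus> y'"] by (simp add: minus_add_minus)

lemma N_minus_smult:
  "x \<in> carrier V \<Longrightarrow> y \<in> carrier V \<Longrightarrow> N (c \<odot> x \<ominus> c \<odot> y) = cmod c * N (x \<ominus> y)"
  using N_smult[of "x \<ominus> y" c] by (simp add: smult_minus)

lemma converges_inI:
  assumes "\<And>n. u n \<in> carrier V" "x \<in> carrier V" "\<And>n. N (u n \<ominus> x) \<le> d n" "d \<longlonglongrightarrow> 0"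
  shows "converges_in V N u x"
  unfolding converges_in_def
  by (rule tendsto_sandwich[of "\<lambda>_. 0" _ _ d]) (use assms N_ge0 in auto)

lemma converges_in_N:
  assumes "\<And>n. u n \<in> carrier V" "x \<in> carrier V" "converges_in V N u x"
  shows "(\<lambda>n. N (u n)) \<longlonglongrightarrow> N x"
proof -
  have "(\<lambda>n. N (u n) - N x) \<longlonglongrightarrow> 0"
    by (rule Lim_null_comparison[of _ "\<lambda>n. N (u n \<ominus> x)"])
      (use assms N_diff in \<open>auto simp: converges_in_def\<close>)
  then show ?thesis by (simp add: LIM_zero_iff)
qed

lemma converges_in_const: "x \<in> carrier V \<Longrightarrow> converges_in V N (\<lambda>_. x) x"
  by (simp add: converges_in_def)

lemma converges_in_add:
  assumes "\<And>n. u n \<in> carrier V" "x \<in> carrier V" "converges_in V N u x"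
    "\<And>n. v n \<in> carrier V" "y \<in> carrier V" "converges_in V N v y"
  shows "converges_in V N (\<lambda>n. u n \<oplus> v n) (x \<oplus> y)"
proof (rule converges_inI)
  show "(\<lambda>n. N (u n \<ominus> x) + N (v n \<ominus> y)) \<longlonglongrightarrow> 0"
    using tendsto_add[of "\<lambda>n. N (u n \<ominus> x)" 0 sequentially "\<lambda>n. N (v n \<ominus> y)" 0] assms(3,6)
    by (simp add: converges_in_def)
qed (use assms N_minus_add in auto)

lemma converges_in_smult:
  assumes "\<And>n. u n \<in> carrier V" "x \<in> carrier V" "converges_in V N u x"
  shows "converges_in V N (\<lambda>n. c \<odot> u n) (c \<odot> x)"
  using tendsto_mult_right_zero[of "\<lambda>n. N (u n \<ominus> x)" sequentially "cmod c"] assms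
  by (simp add: converges_in_def N_minus_smult)

lemma converges_in_unique_seminorm:
  assumes "\<And>n. u n \<in> carrier V" "x \<in> carrier V" "y \<in> carrier V"
    "converges_in V N u x" "converges_in V N u y"
  shows "N (x \<ominus> y) = 0"
proof -
  have "(\<lambda>n. N (u n \<ominus> x) + N (u n \<ominus> y)) \<longlonglongrightarrow> 0 + 0"
    using assms(4,5) by (intro tendsto_add) (simp_all add: converges_in_def)
  moreover have "N (x \<ominus> y) \<le> N (u n \<ominus> x) + N (u n \<ominus> y)" for n
    using assms N_minus_triangle[of x "u n" y] N_minus_commute[of x "u n"] by simp
  ultimately have "N (x \<ominus> y) \<le> 0 + 0"
    by (intro LIMSEQ_le_const) auto
  then show ?thesis using N_ge0[of "x \<ominus> y"] assms by simp
qed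

lemma converges_in_cauchy:
  assumes "\<And>n. u n \<in> carrier V" "x \<in> carrier V" "converges_in V N u x"
  shows "cauchy_in V N u"
  unfolding cauchy_in_def
proof (intro conjI allI impI)
  fix e :: real assume "e > 0"
  then obtain M where M: "\<And>n. n \<ge> M \<Longrightarrow> N (u n \<ominus> x) < e / 2"
    using LIMSEQ_D[of "\<lambda>n. N (u n \<ominus> x)" 0 "e / 2"] assms(3) unfolding converges_in_def by fastforce
  show "\<exists>M. \<forall>m\<ge>M. \<forall>n\<ge>M. N (u m \<ominus> u n) < e"
  proof (intro exI allI impI)
    fix m n assume "m \<ge> M" "n \<ge> M"
    then show "N (u m \<ominus> u n) < e"
      using M[of m] M[of n] N_minus_triangle[of "u m" x "u n"] N_minus_commute[of x "u n"] assms(1,2)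
      by simp
  qed
qed (use assms in auto)

lemma closed_subspaceI:
  assumes "S \<subseteq> carrier V" "\<zero> \<in> S" "\<And>x y. x \<in> S \<Longrightarrow> y \<in> S \<Longrightarrow> x \<oplus> y \<in> S"
    "\<And>c x. x \<in> S \<Longrightarrow> c \<odot> x \<in> S"
    "\<And>u x. (\<And>n. u n \<in> S) \<Longrightarrow> x \<in> carrier V \<Longrightarrow> converges_in V N u x \<Longrightarrow> x \<in> S"
  shows "closed_subspace V N S"
  unfolding closed_subspace_def submodule_iff
proof (intro conjI ballI allI impI)
  show "x \<in> S" if "\<forall>n. u n \<in> S" "x \<in> carrier V" "converges_in V N u x" for u x
    using assms(5)[of u x] that by simp
qed (use assms(1-4) in simp_all)

lemma closed_subspaceD:
  assumes "closed_subspace V N S"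
  shows "S \<subseteq> carrier V" "\<zero> \<in> S" "x \<in> S \<Longrightarrow> y \<in> S \<Longrightarrow> x \<oplus> y \<in> S" "x \<in> S \<Longrightarrow> c \<odot> x \<in> S"
    "(\<And>n. u n \<in> S) \<Longrightarrow> x \<in> carrier V \<Longrightarrow> converges_in V N u x \<Longrightarrow> x \<in> S"
  using assms[unfolded closed_subspace_def submodule_iff]
    assms[unfolded closed_subspace_def, THEN conjunct2, rule_format, of u x] by simp_all

definition limit_points :: "'v set \<Rightarrow> 'v set" where
  "limit_points S = {x \<in> carrier V. \<exists>u. (\<forall>n. u n \<in> S) \<and> converges_in V N u x}"

lemma limit_points_seqI:
  "(\<And>n. u n \<in> S) \<Longrightarrow> x \<in> carrier V \<Longrightarrow> converges_in V N u x \<Longrightarrow> x \<in> limit_points S"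
  unfolding limit_points_def by auto

lemma limit_pointsE:
  assumes "x \<in> limit_points S"
  obtains u where "\<forall>n. u n \<in> S" "x \<in> carrier V" "converges_in V N u x"
  using assms unfolding limit_points_def by auto

lemma limit_pointsI:
  assumes x: "x \<in> carrier V" and S: "S \<subseteq> carrier V" and "\<And>e. e > 0 \<Longrightarrow> \<exists>y\<in>S. N (y \<ominus> x) < e"
  shows "x \<in> limit_points S"
proof -
  obtain u where u: "u n \<in> S" "N (u n \<ominus> x) < inverse (of_nat (Suc n))" for n
    using assms(3)[of "inverse (of_nat (Suc n))" for n] that[of "\<lambda>n. SOME y. y \<in> S \<and> N (y \<ominus> x) < inverse (of_nat (Suc n))"]
      someI_ex[of "\<lambda>y. y \<in> S \<and> N (y \<ominus> x) < inverse (of_nat (Suc n))" for n] by (auto simp: Bex_def)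
  have "converges_in V N u x"
    by (rule converges_inI[where d = "\<lambda>n. inverse (of_nat (Suc n))"])
      (use u S x LIMSEQ_inverse_real_of_nat in \<open>auto intro: less_imp_le\<close>)
  then show ?thesis using x u by (auto simp: limit_points_def)
qed

lemma limit_points_approx:
  assumes "x \<in> limit_points S" "e > 0" "S \<subseteq> carrier V"
  shows "\<exists>y\<in>S. N (y \<ominus> x) < e"
proof -
  obtain u where u: "\<And>n. u n \<in> S" "(\<lambda>n. N (u n \<ominus> x)) \<longlonglongrightarrow> 0"
    using assms(1) by (auto simp: limit_points_def converges_in_def)
  then obtain n where "norm (N (u n \<ominus> x) - 0) < e"
    using LIMSEQ_D[OF u(2) assms(2)] by blast
  then show ?thesis using u(1)[of n] by (intro bexI[of _ "u n"]) auto
qed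

lemma subset_limit_points: "S \<subseteq> carrier V \<Longrightarrow> S \<subseteq> limit_points S"
  using converges_in_const limit_points_seqI[of "\<lambda>_. x" S x for x] by blast

lemma closed_subspace_limit_points:
  assumes "submodule S complex_ring V"
  shows "closed_subspace V N (limit_points S)"
proof (rule closed_subspaceI)
  note S = assms[unfolded submodule_iff]
  show "limit_points S \<subseteq> carrier V" by (auto simp: limit_points_def)
  show "\<zero> \<in> limit_points S" using S subset_limit_points[of S] by (elim conjE) (rule subsetD)
  show "x \<oplus> y \<in> limit_points S" if x: "x \<in> limit_points S" and y: "y \<in> limit_points S" for x y
  proof -
    from x obtain u where u: "\<forall>n. u n \<in> S" "x \<in> carrier V" "converges_in V N u x"
      by (rule limit_pointsE)
    from y obtain v where v: "\<forall>n. v n \<in> S" "y \<in> carrier V" "converges_in V N v y"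
      by (rule limit_pointsE)
    have uv: "u n \<in> carrier V" "v n \<in> carrier V" for n using u(1) v(1) S by auto
    have "converges_in V N (\<lambda>n. u n \<oplus> v n) (x \<oplus> y)"
      by (rule converges_in_add[OF uv(1) u(2,3) uv(2) v(2,3)])
    then show ?thesis using u v S by (intro limit_points_seqI[of "\<lambda>n. u n \<oplus> v n"]) simp_all
  qed
  show "c \<odot> x \<in> limit_points S" if x: "x \<in> limit_points S" for x c
  proof -
    from x obtain u where u: "\<forall>n. u n \<in> S" "x \<in> carrier V" "converges_in V N u x"
      by (rule limit_pointsE)
    have uc: "u n \<in> carrier V" for n using u(1) S by auto
    have "converges_in V N (\<lambda>n. c \<odot> u n) (c \<odot> x)"
      by (rule converges_in_smult[OF uc u(2,3)])
    then show ?thesis using u S by (intro limit_points_seqI[of "\<lambda>n. c \<odot> u n"]) simp_all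
  qed
  fix u x assume u: "\<And>n. u n \<in> limit_points S" and x: "x \<in> carrier V" "converges_in V N u x"
  show "x \<in> limit_points S"
  proof (rule limit_pointsI)
    fix e :: real assume e: "e > 0"
    obtain n where n: "norm (N (u n \<ominus> x) - 0) < e / 2"
      using LIMSEQ_D[of "\<lambda>n. N (u n \<ominus> x)" 0 "e / 2"] x(2) e by (auto simp: converges_in_def)
    obtain y where y: "y \<in> S" "N (y \<ominus> u n) < e / 2"
      using limit_points_approx[OF u, of "e / 2" n] e S by auto
    have "N (y \<ominus> x) \<le> N (y \<ominus> u n) + N (u n \<ominus> x)"
      using N_minus_triangle[of y "u n" x] y(1) S u[of n] x(1) by (auto simp: limit_points_def)
    then show "\<exists>y\<in>S. N (y \<ominus> x) < e" using y n by force
  qed (use x S in auto)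
qed

lemma limit_points_subset: "closed_subspace V N T \<Longrightarrow> S \<subseteq> T \<Longrightarrow> limit_points S \<subseteq> T"
  by (rule subsetI, erule limit_pointsE) (auto intro: closed_subspaceD(5)[of T])

lemma closed_subspace_carrier: "closed_subspace V N (carrier V)"
  by (rule closed_subspaceI) auto

lemma closed_subspace_zero:
  assumes "\<And>x. x \<in> carrier V \<Longrightarrow> N x = 0 \<Longrightarrow> x = \<zero>"
  shows "closed_subspace V N {\<zero>}"
proof (rule closed_subspaceI)
  fix u x assume "\<And>n. u n \<in> {\<zero>}" and x: "x \<in> carrier V" "converges_in V N u x"
  then have "u = (\<lambda>_. \<zero>)" by auto
  with x have "N (\<zero> \<ominus> x) = 0" by (simp add: converges_in_def LIMSEQ_const_iff)
  then show "x \<in> {\<zero>}" using assms[of x] x N_minus_commute[of \<zero> x] by simp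
qed auto

end

section \<open>Hilbert spaces and bounded operators\<close>

locale hilbert = fixes H :: "('h, 'm) hilbert_scheme" (structure)
  assumes hilbert_space: "hilbert_space H"
begin

sublocale complex_module H
  using hilbert_space by (simp add: hilbert_space_def complex_module_def)

abbreviation inner_H :: "'h \<Rightarrow> 'h \<Rightarrow> complex" (\<open>\<langle>_, _\<rangle>\<close>) where
  "\<langle>x, y\<rangle> \<equiv> hinner H x y"

lemma inner_add_left:
  "x \<in> carrier H \<Longrightarrow> y \<in> carrier H \<Longrightarrow> z \<in> carrier H \<Longrightarrow> \<langle>x \<oplus> y, z\<rangle> = \<langle>x, z\<rangle> + \<langle>y, z\<rangle>"
  and inner_smult_left: "x \<in> carrier H \<Longrightarrow> y \<in> carrier H \<Longrightarrow> \<langle>c \<odot> x, y\<rangle> = c * \<langle>x, y\<rangle>"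
  and inner_commute: "x \<in> carrier H \<Longrightarrow> y \<in> carrier H \<Longrightarrow> \<langle>y, x\<rangle> = cnj \<langle>x, y\<rangle>"
  and inner_Re_ge0: "x \<in> carrier H \<Longrightarrow> 0 \<le> Re \<langle>x, x\<rangle>"
  and inner_zero_imp: "x \<in> carrier H \<Longrightarrow> \<langle>x, x\<rangle> = 0 \<Longrightarrow> x = \<zero>"
  and complete: "complete_in H (hnorm H)"
  using hilbert_space unfolding hilbert_space_def by blast+

lemma inner_add_right:
  "x \<in> carrier H \<Longrightarrow> y \<in> carrier H \<Longrightarrow> z \<in> carrier H \<Longrightarrow> \<langle>z, x \<oplus> y\<rangle> = \<langle>z, x\<rangle> + \<langle>z, y\<rangle>"
  using inner_commute[of "x \<oplus> y" z] inner_commute[of x z] inner_commute[of y z]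
  by (simp add: inner_add_left)

lemma inner_smult_right: "x \<in> carrier H \<Longrightarrow> y \<in> carrier H \<Longrightarrow> \<langle>x, c \<odot> y\<rangle> = cnj c * \<langle>x, y\<rangle>"
  using inner_commute[of "c \<odot> y" x] inner_commute[of y x] by (simp add: inner_smult_left)

lemma inner_zero_left [simp]: "x \<in> carrier H \<Longrightarrow> \<langle>\<zero>, x\<rangle> = 0"
  using inner_smult_left[of \<zero> x 0] by simp

lemma inner_zero_right [simp]: "x \<in> carrier H \<Longrightarrow> \<langle>x, \<zero>\<rangle> = 0"
  using inner_smult_right[of x \<zero> 0] by simp

lemma inner_minus_left:
  "x \<in> carrier H \<Longrightarrow> y \<in> carrier H \<Longrightarrow> z \<in> carrier H \<Longrightarrow> \<langle>x \<ominus> y, z\<rangle> = \<langle>x, z\<rangle> - \<langle>y, z\<rangle>"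
  by (simp add: a_minus_eq inner_add_left inner_smult_left)

lemma inner_minus_right:
  "x \<in> carrier H \<Longrightarrow> y \<in> carrier H \<Longrightarrow> z \<in> carrier H \<Longrightarrow> \<langle>z, x \<ominus> y\<rangle> = \<langle>z, x\<rangle> - \<langle>z, y\<rangle>"
  by (simp add: a_minus_eq inner_add_right inner_smult_right)

lemma inner_self: "x \<in> carrier H \<Longrightarrow> \<langle>x, x\<rangle> = of_real ((hnorm H x)\<^sup>2)"
  using inner_commute[of x x] inner_Re_ge0[of x] by (simp add: hnorm_def complex_eq_iff)

lemma hnorm_ge0 [simp]: "x \<in> carrier H \<Longrightarrow> 0 \<le> hnorm H x"
  by (simp add: hnorm_def inner_Re_ge0)

lemma hnorm_zero_imp: "x \<in> carrier H \<Longrightarrow> hnorm H x = 0 \<Longrightarrow> x = \<zero>"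
  using inner_self inner_zero_imp by simp

lemma hnorm_power2: "x \<in> carrier H \<Longrightarrow> (hnorm H x)\<^sup>2 = Re \<langle>x, x\<rangle>"
  by (simp add: inner_self)

lemma hnorm_add_power2:
  assumes "x \<in> carrier H" "y \<in> carrier H"
  shows "(hnorm H (x \<oplus> y))\<^sup>2 = (hnorm H x)\<^sup>2 + 2 * Re \<langle>x, y\<rangle> + (hnorm H y)\<^sup>2"
  using assms inner_commute[of x y]
  by (simp add: hnorm_power2 inner_add_left inner_add_right)

lemma hnorm_minus_power2:
  assumes "x \<in> carrier H" "y \<in> carrier H"
  shows "(hnorm H (x \<ominus> y))\<^sup>2 = (hnorm H x)\<^sup>2 - 2 * Re \<langle>x, y\<rangle> + (hnorm H y)\<^sup>2"
  using assms inner_commute[of x y]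
  by (simp add: hnorm_power2 inner_minus_left inner_minus_right)

lemma hnorm_smult: "x \<in> carrier H \<Longrightarrow> hnorm H (c \<odot> x) = cmod c * hnorm H x"
proof -
  assume x: "x \<in> carrier H"
  have "\<langle>c \<odot> x, c \<odot> x\<rangle> = of_real ((cmod c)\<^sup>2 * (hnorm H x)\<^sup>2)"
    using x inner_self[of x] complex_norm_square[of c]
    by (simp add: inner_smult_left inner_smult_right mult_ac)
  then show ?thesis
    using x by (simp add: hnorm_def[of H "c \<odot> x"] real_sqrt_mult del: of_real_mult of_real_power)
qed

lemma cauchy_schwarz: 
  assumes x: "x \<in> carrier H" and y: "y \<in> carrier H"
  shows "cmod \<langle>x, y\<rangle> \<le> hnorm H x * hnorm H y"
proof (cases "hnorm H y = 0")
  case True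
  then have "y = \<zero>" using y hnorm_zero_imp by blast
  then show ?thesis using x y by simp
next
  case False
  define c where "c = \<langle>x, y\<rangle> / of_real ((hnorm H y)\<^sup>2)"
  have pos: "hnorm H y > 0" using False y by (simp add: less_le)
  have "Re (cnj c * \<langle>x, y\<rangle>) = (cmod \<langle>x, y\<rangle>)\<^sup>2 / (hnorm H y)\<^sup>2"
    unfolding c_def by (simp add: mult.commute[of "cnj _"] complex_norm_square[symmetric] Re_divide_of_real
        flip: of_real_power)
  moreover have "(cmod c * hnorm H y)\<^sup>2 = (cmod \<langle>x, y\<rangle>)\<^sup>2 / (hnorm H y)\<^sup>2"
    unfolding c_def norm_divide norm_of_real using pos
    by (simp add: power_divide power_mult_distrib power2_eq_square)
  moreover have "0 \<le> (hnorm H (x \<ominus> c \<odot> y))\<^sup>2" by simp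
  ultimately have "(cmod \<langle>x, y\<rangle>)\<^sup>2 / (hnorm H y)\<^sup>2 \<le> (hnorm H x)\<^sup>2"
    using x y by (simp add: hnorm_minus_power2 inner_smult_right hnorm_smult)
  then have "(cmod \<langle>x, y\<rangle>)\<^sup>2 \<le> (hnorm H x * hnorm H y)\<^sup>2"
    using pos by (simp add: pos_divide_le_eq power_mult_distrib)
  then show ?thesis using x y by (auto intro: power2_le_imp_le[OF _ mult_nonneg_nonneg])
qed

lemma hnorm_add:
  assumes "x \<in> carrier H" "y \<in> carrier H"
  shows "hnorm H (x \<oplus> y) \<le> hnorm H x + hnorm H y"
proof (rule power2_le_imp_le)
  have "Re \<langle>x, y\<rangle> \<le> hnorm H x * hnorm H y"
    using cauchy_schwarz[OF assms] complex_Re_le_cmod[of "\<langle>x, y\<rangle>"] by linarith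
  then show "(hnorm H (x \<oplus> y))\<^sup>2 \<le> (hnorm H x + hnorm H y)\<^sup>2"
    using assms by (simp add: hnorm_add_power2 power2_sum)
qed (use assms in simp)

sublocale seminormed_module H "hnorm H"
  by unfold_locales (use hnorm_add hnorm_smult in auto)

lemma converges_in_unique:
  assumes "\<And>n. u n \<in> carrier H" "x \<in> carrier H" "y \<in> carrier H"
    "converges_in H (hnorm H) u x" "converges_in H (hnorm H) u y"
  shows "x = y"
  using converges_in_unique_seminorm[OF assms] assms(2,3) hnorm_zero_imp[of "x \<ominus> y"]
  by (simp add: minus_eq_zero_iff)

lemma converges_in_inner:
  assumes "\<And>n. u n \<in> carrier H" "x \<in> carrier H" "converges_in H (hnorm H) u x" "y \<in> carrier H"
  shows "(\<lambda>n. \<langle>u n, y\<rangle>) \<longlonglongrightarrow> \<langle>x, y\<rangle>"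
proof -
  have "(\<lambda>n. \<langle>u n, y\<rangle> - \<langle>x, y\<rangle>) \<longlonglongrightarrow> 0"
  proof (rule Lim_null_comparison)
    show "\<forall>\<^sub>F n in sequentially. norm (\<langle>u n, y\<rangle> - \<langle>x, y\<rangle>) \<le> hnorm H (u n \<ominus> x) * hnorm H y"
      using assms cauchy_schwarz[of "u n \<ominus> x" y for n] by (simp add: inner_minus_left)
    show "(\<lambda>n. hnorm H (u n \<ominus> x) * hnorm H y) \<longlonglongrightarrow> 0"
      using assms(3) by (intro tendsto_mult_left_zero) (simp add: converges_in_def)
  qed
  then show ?thesis by (simp add: LIM_zero_iff)
qed

lemma converges_in_inner_right:
  assumes "\<And>n. u n \<in> carrier H" "x \<in> carrier H" "converges_in H (hnorm H) u x" "y \<in> carrier H"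
  shows "(\<lambda>n. \<langle>y, u n\<rangle>) \<longlonglongrightarrow> \<langle>y, x\<rangle>"
  using tendsto_cnj[OF converges_in_inner[OF assms]] assms inner_commute[of _ y] by simp

lemma eqI_inner_dense:
  assumes "x \<in> carrier H" "y \<in> carrier H" "S \<subseteq> carrier H" "limit_points S = carrier H"
    and eq: "\<And>s. s \<in> S \<Longrightarrow> \<langle>x, s\<rangle> = \<langle>y, s\<rangle>"
  shows "x = y"
proof -
  have "x \<ominus> y \<in> limit_points S" using assms by simp
  then obtain u where u: "\<And>n. u n \<in> S" "converges_in H (hnorm H) u (x \<ominus> y)"
    by (auto simp: limit_points_def)
  have "(\<lambda>n. \<langle>x \<ominus> y, u n\<rangle>) \<longlonglongrightarrow> \<langle>x \<ominus> y, x \<ominus> y\<rangle>"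
    using u assms by (intro converges_in_inner_right) auto
  moreover have "\<langle>x \<ominus> y, u n\<rangle> = 0" for n
    using u(1)[of n] assms by (auto simp: inner_minus_left subset_iff)
  ultimately have "\<langle>x \<ominus> y, x \<ominus> y\<rangle> = 0"
    by (simp add: LIMSEQ_const_iff)
  then show ?thesis using assms inner_zero_imp[of "x \<ominus> y"] by (simp add: minus_eq_zero_iff)
qed

subsection \<open>Bounded operators\<close>

lemma bounded_opsD:
  assumes "T \<in> bounded_ops H"
  shows "x \<in> carrier H \<Longrightarrow> T x \<in> carrier H"
    "x \<in> carrier H \<Longrightarrow> y \<in> carrier H \<Longrightarrow> T (x \<oplus> y) = T x \<oplus> T y"
    "x \<in> carrier H \<Longrightarrow> T (c \<odot> x) = c \<odot> T x"
    "T \<in> extensional (carrier H)"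
  using assms by (auto simp: bounded_ops_def linear_on_def)

lemma bounded_ops_minus:
  "T \<in> bounded_ops H \<Longrightarrow> x \<in> carrier H \<Longrightarrow> y \<in> carrier H \<Longrightarrow> T (x \<ominus> y) = T x \<ominus> T y"
  using bounded_opsD[of T] by (simp add: a_minus_eq)

lemma bounded_ops_zero: "T \<in> bounded_ops H \<Longrightarrow> T \<zero> = \<zero>"
  using bounded_opsD(1)[of T \<zero>] bounded_opsD(3)[of T \<zero> 0] by simp

text \<open>Unlike \<^const>\<open>bounded_ops\<close> this does not ask for an extensional function, so that it covers pointwise
  differences of operators, which need not be \<open>undefined\<close> off the carrier.\<close>

definition lin_bounded :: "('h \<Rightarrow> 'h) \<Rightarrow> bool" where
  "lin_bounded T \<longleftrightarrow> linear_on H H T \<and> (\<exists>B. \<forall>x\<in>carrier H. hnorm H (T x) \<le> B * hnorm H x)"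

lemma bounded_ops_lin_bounded: "T \<in> bounded_ops H \<Longrightarrow> lin_bounded T"
  by (simp add: bounded_ops_def lin_bounded_def)

lemma op_norm_bdd:
  assumes "lin_bounded T"
  shows "bdd_above {hnorm H (T x) | x. x \<in> carrier H \<and> hnorm H x \<le> 1}"
proof -
  obtain B where B: "\<And>x. x \<in> carrier H \<Longrightarrow> hnorm H (T x) \<le> B * hnorm H x"
    using assms(1) by (auto simp: lin_bounded_def)
  have "hnorm H (T x) \<le> \<bar>B\<bar>" if "x \<in> carrier H" "hnorm H x \<le> 1" for x
  proof -
    have "B * hnorm H x \<le> \<bar>B\<bar> * 1"
      using that by (intro mult_mono) auto
    then show ?thesis using B[OF that(1)] by simp
  qed
  then show ?thesis by (intro bdd_aboveI[of _ "\<bar>B\<bar>"]) auto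
qed

lemma hnorm_le_op_norm:
  assumes "lin_bounded T" "x \<in> carrier H"
  shows "hnorm H (T x) \<le> op_norm H T * hnorm H x"
proof -
  obtain B where B: "\<And>x. x \<in> carrier H \<Longrightarrow> hnorm H (T x) \<le> B * hnorm H x"
    using assms(1) by (auto simp: lin_bounded_def)
  have T: "\<And>x. x \<in> carrier H \<Longrightarrow> T x \<in> carrier H" "\<And>c x. x \<in> carrier H \<Longrightarrow> T (c \<odot> x) = c \<odot> T x"
    using assms(1) by (auto simp: lin_bounded_def linear_on_def)
  note bdd = op_norm_bdd[OF assms(1)]
  show ?thesis
  proof (cases "hnorm H x = 0")
    case True
    then show ?thesis using B[OF assms(2)] T(1)[OF assms(2)] by simp
  next
    case False
    then have pos: "hnorm H x > 0" using assms(2) by (simp add: less_le)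
    let ?c = "of_real (inverse (hnorm H x)) :: complex"
    have c: "cmod ?c = inverse (hnorm H x)"
      using pos by (simp only: norm_of_real) simp
    have "hnorm H (?c \<odot> x) = 1"
      using pos assms(2) c by (simp only: hnorm_smult) simp
    then have "hnorm H (T (?c \<odot> x)) \<le> op_norm H T"
      unfolding op_norm_def using assms(2) by (intro cSup_upper bdd) auto
    moreover have "hnorm H (T (?c \<odot> x)) = inverse (hnorm H x) * hnorm H (T x)"
      using assms(2) T c by (simp only: hnorm_smult)
    ultimately have "inverse (hnorm H x) * hnorm H (T x) \<le> op_norm H T" by linarith
    then show ?thesis
      using pos by (simp add: field_simps)
  qed
qed

lemma op_norm_le:
  assumes "0 \<le> B" "\<And>x. x \<in> carrier H \<Longrightarrow> hnorm H (T x) \<le> B * hnorm H x"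
  shows "op_norm H T \<le> B"
  unfolding op_norm_def
proof (rule cSup_least)
  show "{hnorm H (T x) |x. x \<in> carrier H \<and> hnorm H x \<le> 1} \<noteq> {}"
    using M.zero_closed by force
  fix r assume "r \<in> {hnorm H (T x) |x. x \<in> carrier H \<and> hnorm H x \<le> 1}"
  then obtain x where x: "x \<in> carrier H" "hnorm H x \<le> 1" "r = hnorm H (T x)" by auto
  then show "r \<le> B"
    using assms(2)[OF x(1)] mult_left_mono[OF x(2) assms(1)] by simp
qed

lemma op_norm_ge0:
  assumes "lin_bounded T"
  shows "0 \<le> op_norm H T"
proof -
  have T: "T \<zero> \<in> carrier H" using assms(1) by (auto simp: lin_bounded_def linear_on_def)
  have "hnorm H (T \<zero>) \<le> op_norm H T"
    unfolding op_norm_def by (rule cSup_upper[OF _ op_norm_bdd[OF assms]]) force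
  then show ?thesis using hnorm_ge0[OF T] by linarith
qed

lemma bounded_opsI:
  assumes "T \<in> extensional (carrier H)" "\<And>x. x \<in> carrier H \<Longrightarrow> T x \<in> carrier H"
    "\<And>x y. x \<in> carrier H \<Longrightarrow> y \<in> carrier H \<Longrightarrow> T (x \<oplus> y) = T x \<oplus> T y"
    "\<And>c x. x \<in> carrier H \<Longrightarrow> T (c \<odot> x) = c \<odot> T x"
    "\<And>x. x \<in> carrier H \<Longrightarrow> hnorm H (T x) \<le> B * hnorm H x"
  shows "T \<in> bounded_ops H"
proof -
  have "\<exists>B. \<forall>x\<in>carrier H. hnorm H (T x) \<le> B * hnorm H x"
    using assms(5) by (intro exI[of _ B]) simp
  then show ?thesis using assms(1-4) by (simp add: bounded_ops_def linear_on_def)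
qed

lemma lin_bounded_minus:
  assumes "lin_bounded S" "lin_bounded T"
  shows "lin_bounded (\<lambda>x. S x \<ominus> T x)"
proof -
  obtain B C where B: "\<And>x. x \<in> carrier H \<Longrightarrow> hnorm H (S x) \<le> B * hnorm H x"
    and C: "\<And>x. x \<in> carrier H \<Longrightarrow> hnorm H (T x) \<le> C * hnorm H x"
    using assms by (auto simp: lin_bounded_def)
  have S: "linear_on H H S" and T: "linear_on H H T" using assms by (auto simp: lin_bounded_def)
  then have cl: "\<And>x. x \<in> carrier H \<Longrightarrow> S x \<in> carrier H" "\<And>x. x \<in> carrier H \<Longrightarrow> T x \<in> carrier H"
    by (auto simp: linear_on_def)
  have "linear_on H H (\<lambda>x. S x \<ominus> T x)"
    unfolding linear_on_def
  proof (intro conjI ballI allI)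
    fix x y assume "x \<in> carrier H" "y \<in> carrier H"
    then show "S (x \<oplus> y) \<ominus> T (x \<oplus> y) = (S x \<ominus> T x) \<oplus> (S y \<ominus> T y)"
      using S T cl by (simp add: linear_on_def minus_add_minus)
  next
    fix c x assume "x \<in> carrier H"
    then show "S (c \<odot> x) \<ominus> T (c \<odot> x) = c \<odot> (S x \<ominus> T x)"
      using S T cl by (simp add: linear_on_def smult_minus)
  qed (use cl in simp)
  moreover have "hnorm H (S x \<ominus> T x) \<le> (B + C) * hnorm H x" if "x \<in> carrier H" for x
    using N_minus_le[of "S x" "T x"] B[OF that] C[OF that] cl that by (simp add: distrib_right)
  ultimately show ?thesis unfolding lin_bounded_def by blast
qed

lemma converges_in_bounded_op:
  assumes "T \<in> bounded_ops H" "\<And>n. u n \<in> carrier H" "x \<in> carrier H" "converges_in H (hnorm H) u x"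
  shows "converges_in H (hnorm H) (\<lambda>n. T (u n)) (T x)"
proof (rule converges_inI)
  note T = bounded_opsD[OF assms(1)]
  show "(\<lambda>n. op_norm H T * hnorm H (u n \<ominus> x)) \<longlonglongrightarrow> 0"
    using assms(4) by (intro tendsto_mult_right_zero) (simp add: converges_in_def)
  show "hnorm H (T (u n) \<ominus> T x) \<le> op_norm H T * hnorm H (u n \<ominus> x)" for n
    using hnorm_le_op_norm[OF bounded_ops_lin_bounded[OF assms(1)], of "u n \<ominus> x"] assms
    by (simp add: bounded_ops_minus)
  show "T (u n) \<in> carrier H" "T x \<in> carrier H" for n
    using T assms by auto
qed

lemma kernel_closed_subspace:
  assumes T: "T \<in> bounded_ops H" and S: "closed_subspace H (hnorm H) S"
  shows "closed_subspace H (hnorm H) {x \<in> carrier H. T x \<in> S}"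
proof (rule closed_subspaceI)
  note T' = bounded_opsD[OF T]
  note S' = closed_subspaceD[OF S]
  show "\<zero> \<in> {x \<in> carrier H. T x \<in> S}" using S'(2) bounded_ops_zero[OF T] by simp
  show "x \<oplus> y \<in> {x \<in> carrier H. T x \<in> S}"
    if "x \<in> {x \<in> carrier H. T x \<in> S}" "y \<in> {x \<in> carrier H. T x \<in> S}" for x y
    using that S'(3)[of "T x" "T y"] T' by simp
  show "c \<odot> x \<in> {x \<in> carrier H. T x \<in> S}" if "x \<in> {x \<in> carrier H. T x \<in> S}" for c x
    using that S'(4)[of "T x" c] T' by simp
  fix u x assume u: "\<And>n. u n \<in> {x \<in> carrier H. T x \<in> S}" and x: "x \<in> carrier H" "converges_in H (hnorm H) u x"
  have "converges_in H (hnorm H) (\<lambda>n. T (u n)) (T x)"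
    using u x by (intro converges_in_bounded_op[OF T]) auto
  then have "T x \<in> S" using u x T' by (auto intro!: S'(5)[of "\<lambda>n. T (u n)" "T x"])
  then show "x \<in> {x \<in> carrier H. T x \<in> S}" using x by simp
qed auto

lemma closed_subspace_zero_H: "closed_subspace H (hnorm H) {\<zero>}"
  by (intro closed_subspace_zero hnorm_zero_imp)

end

section \<open>Star-algebras and their completions\<close>

lemma null_sequence_le:
  fixes a b :: "nat \<Rightarrow> real"
  assumes "\<And>n. 0 \<le> a n" "\<And>n. a n \<le> b n" "b \<longlonglongrightarrow> 0"
  shows "a \<longlonglongrightarrow> 0"
  using assms by (intro tendsto_sandwich[of "\<lambda>_. 0" a sequentially b 0]) auto

locale star_alg = fixes A :: "('a, 'm) star_algebra_scheme" (structure)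
  assumes is_star_algebra: "is_star_algebra A"
begin

sublocale complex_module A
  using is_star_algebra by (simp add: is_star_algebra_def complex_module_def)

lemma mult_closed [simp, intro]: "x \<in> carrier A \<Longrightarrow> y \<in> carrier A \<Longrightarrow> x \<otimes> y \<in> carrier A"
  and mult_assoc: "x \<in> carrier A \<Longrightarrow> y \<in> carrier A \<Longrightarrow> z \<in> carrier A \<Longrightarrow> (x \<otimes> y) \<otimes> z = x \<otimes> (y \<otimes> z)"
  and distrib_right': "x \<in> carrier A \<Longrightarrow> y \<in> carrier A \<Longrightarrow> z \<in> carrier A \<Longrightarrow> (x \<oplus> y) \<otimes> z = x \<otimes> z \<oplus> y \<otimes> z"
  and distrib_left': "x \<in> carrier A \<Longrightarrow> y \<in> carrier A \<Longrightarrow> z \<in> carrier A \<Longrightarrow> x \<otimes> (y \<oplus> z) = x \<otimes> y \<oplus> x \<otimes> z"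
  and smult_mult_left: "x \<in> carrier A \<Longrightarrow> y \<in> carrier A \<Longrightarrow> (c \<odot> x) \<otimes> y = c \<odot> (x \<otimes> y)"
  and smult_mult_right: "x \<in> carrier A \<Longrightarrow> y \<in> carrier A \<Longrightarrow> x \<otimes> (c \<odot> y) = c \<odot> (x \<otimes> y)"
  and star_closed [simp, intro]: "x \<in> carrier A \<Longrightarrow> astar A x \<in> carrier A"
  and star_star [simp]: "x \<in> carrier A \<Longrightarrow> astar A (astar A x) = x"
  and star_add: "x \<in> carrier A \<Longrightarrow> y \<in> carrier A \<Longrightarrow> astar A (x \<oplus> y) = astar A x \<oplus> astar A y"
  and star_mult: "x \<in> carrier A \<Longrightarrow> y \<in> carrier A \<Longrightarrow> astar A (x \<otimes> y) = astar A y \<otimes> astar A x"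
  and star_smult: "x \<in> carrier A \<Longrightarrow> astar A (c \<odot> x) = cnj c \<odot> astar A x"
  using is_star_algebra unfolding is_star_algebra_def by simp_all

lemma mult_minus_mult:
  assumes "x \<in> carrier A" "y \<in> carrier A" "x' \<in> carrier A" "y' \<in> carrier A"
  shows "(x \<otimes> y) \<ominus> (x' \<otimes> y') = (x \<ominus> x') \<otimes> y \<oplus> x' \<otimes> (y \<ominus> y')"
proof -
  have "(x \<otimes> y) \<ominus> (x' \<otimes> y') = ((x \<otimes> y) \<ominus> (x' \<otimes> y)) \<oplus> ((x' \<otimes> y) \<ominus> (x' \<otimes> y'))"
    using assms by (intro minus_chain) auto
  also have "(x \<otimes> y) \<ominus> (x' \<otimes> y) = (x \<ominus> x') \<otimes> y"
    using assms by (simp add: a_minus_eq distrib_right' smult_mult_left)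
  also have "(x' \<otimes> y) \<ominus> (x' \<otimes> y') = x' \<otimes> (y \<ominus> y')"
    using assms by (simp add: a_minus_eq distrib_left' smult_mult_right)
  finally show ?thesis .
qed

lemma star_minus: "x \<in> carrier A \<Longrightarrow> y \<in> carrier A \<Longrightarrow> astar A (x \<ominus> y) = astar A x \<ominus> astar A y"
  by (simp add: a_minus_eq star_add star_smult)

end

locale cstar_seminormed_alg = star_alg A for A :: "('a, 'm) normed_star_algebra_scheme" (structure) +
  assumes anorm_ge0: "x \<in> carrier A \<Longrightarrow> 0 \<le> anorm A x"
    and anorm_smult: "x \<in> carrier A \<Longrightarrow> anorm A (c \<odot> x) = cmod c * anorm A x"
    and anorm_add: "x \<in> carrier A \<Longrightarrow> y \<in> carrier A \<Longrightarrow> anorm A (x \<oplus> y) \<le> anorm A x + anorm A y"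
    and anorm_mult: "x \<in> carrier A \<Longrightarrow> y \<in> carrier A \<Longrightarrow> anorm A (x \<otimes> y) \<le> anorm A x * anorm A y"
    and anorm_star_mult: "x \<in> carrier A \<Longrightarrow> anorm A (astar A x \<otimes> x) = (anorm A x)\<^sup>2"
begin

sublocale seminormed_module A "anorm A"
  by unfold_locales (use anorm_ge0 anorm_smult anorm_add in auto)

text \<open>The \<open>C\<^sup>*\<close>-identity gives \<open>\<parallel>x\<parallel>\<^sup>2 \<le> \<parallel>x\<^sup>*\<parallel> \<parallel>x\<parallel>\<close>.\<close>

lemma anorm_star [simp]:
  assumes "x \<in> carrier A"
  shows "anorm A (astar A x) = anorm A x"
proof -
  have le: "anorm A x \<le> anorm A (astar A x)" if x: "x \<in> carrier A" for x
  proof (cases "anorm A x = 0")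
    case False
    have "anorm A x * anorm A x \<le> anorm A (astar A x) * anorm A x"
      using anorm_star_mult[OF x] anorm_mult[of "astar A x" x] x by (simp add: power2_eq_square)
    then show ?thesis using False anorm_ge0[OF x] by simp
  qed (use x anorm_ge0 in auto)
  show ?thesis using le[OF assms] le[of "astar A x"] assms by simp
qed

lemma anorm_mult_minus:
  assumes "x \<in> carrier A" "y \<in> carrier A" "x' \<in> carrier A" "y' \<in> carrier A"
  shows "anorm A ((x \<otimes> y) \<ominus> (x' \<otimes> y')) \<le> anorm A (x \<ominus> x') * anorm A y + anorm A x' * anorm A (y \<ominus> y')"
  using assms anorm_add[of "(x \<ominus> x') \<otimes> y" "x' \<otimes> (y \<ominus> y')"]
    anorm_mult[of "x \<ominus> x'" y] anorm_mult[of x' "y \<ominus> y'"]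
  by (simp add: mult_minus_mult)

abbreviation "cauchy \<equiv> cauchy_in A (anorm A)"
abbreviation "cls \<equiv> cauchy_class A"

lemma cauchy_carrier: "cauchy u \<Longrightarrow> u n \<in> carrier A"
  by (simp add: cauchy_in_def)

lemma cauchy_const [simp]: "a \<in> carrier A \<Longrightarrow> cauchy (\<lambda>_. a)"
  by (simp add: cauchy_in_def)

lemma cauchy_anorm_convergent:
  assumes "cauchy u"
  shows "convergent (\<lambda>n. anorm A (u n))"
proof -
  have "Cauchy (\<lambda>n. anorm A (u n))"
  proof (rule metric_CauchyI)
    fix e :: real assume "e > 0"
    then obtain M where M: "\<forall>m\<ge>M. \<forall>n\<ge>M. anorm A (u m \<ominus> u n) < e"
      using assms by (auto simp: cauchy_in_def)
    show "\<exists>M. \<forall>m\<ge>M. \<forall>n\<ge>M. dist (anorm A (u m)) (anorm A (u n)) < e"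
    proof (intro exI allI impI)
      fix m n assume "m \<ge> M" "n \<ge> M"
      then have "anorm A (u m \<ominus> u n) < e" using M by blast
      then show "dist (anorm A (u m)) (anorm A (u n)) < e"
        using N_diff[of "u m" "u n"] cauchy_carrier[OF assms] by (simp add: dist_real_def)
    qed
  qed
  then show ?thesis by (simp add: Cauchy_convergent_iff)
qed

lemma cauchy_bounded:
  assumes "cauchy u"
  obtains B where "B > 0" "\<And>n. anorm A (u n) \<le> B"
proof -
  obtain B where B: "B > 0" "\<And>n. norm (anorm A (u n)) \<le> B"
    using convergent_imp_Bseq[OF cauchy_anorm_convergent[OF assms]] unfolding Bseq_def by blast
  show thesis
    by (rule that[of B]) (use B abs_le_D1 in auto)
qed

text \<open>The form that the estimates for all the algebra operations share.\<close>

lemma cauchy_combine: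
  assumes u: "cauchy u" and v: "cauchy v" and w: "\<And>n. w n \<in> carrier A" and B: "B > 0"
    and le: "\<And>m n. anorm A (w m \<ominus> w n) \<le> B * (anorm A (u m \<ominus> u n) + anorm A (v m \<ominus> v n))"
  shows "cauchy w"
  unfolding cauchy_in_def
proof (intro conjI allI impI)
  fix e :: real assume "e > 0"
  then have e: "e / (2 * B) > 0" using B by simp
  obtain M where M: "\<forall>m\<ge>M. \<forall>n\<ge>M. anorm A (u m \<ominus> u n) < e / (2 * B)"
    using u e unfolding cauchy_in_def by blast
  obtain M' where M': "\<forall>m\<ge>M'. \<forall>n\<ge>M'. anorm A (v m \<ominus> v n) < e / (2 * B)"
    using v e unfolding cauchy_in_def by blast
  show "\<exists>M. \<forall>m\<ge>M. \<forall>n\<ge>M. anorm A (w m \<ominus> w n) < e"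
  proof (intro exI allI impI)
    fix m n assume mn: "max M M' \<le> m" "max M M' \<le> n"
    then have "anorm A (u m \<ominus> u n) + anorm A (v m \<ominus> v n) < e / (2 * B) + e / (2 * B)"
      using M M' by (intro add_strict_mono) simp_all
    then have "B * (anorm A (u m \<ominus> u n) + anorm A (v m \<ominus> v n)) < B * (e / (2 * B) + e / (2 * B))"
      using B by (rule mult_strict_left_mono)
    then show "anorm A (w m \<ominus> w n) < e"
      using le[of m n] B by simp
  qed
qed (rule w)

lemma cauchy_add:
  assumes "cauchy u" "cauchy v" shows "cauchy (\<lambda>n. u n \<oplus> v n)"
  by (rule cauchy_combine[OF assms, of _ 1]) (use assms cauchy_carrier N_minus_add in auto)

lemma cauchy_smult:
  assumes "cauchy u" shows "cauchy (\<lambda>n. c \<odot> u n)"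
proof (rule cauchy_combine[OF assms assms, of _ "cmod c + 1"])
  fix m n
  have "cmod c * anorm A (u m \<ominus> u n) \<le> (cmod c + 1) * (2 * anorm A (u m \<ominus> u n))"
    using anorm_ge0[of "u m \<ominus> u n"] cauchy_carrier[OF assms] by (intro mult_mono) auto
  then show "anorm A (c \<odot> u m \<ominus> c \<odot> u n) \<le> (cmod c + 1) * (anorm A (u m \<ominus> u n) + anorm A (u m \<ominus> u n))"
    using cauchy_carrier[OF assms] by (simp add: N_minus_smult)
  show "0 < cmod c + 1" using norm_ge_zero[of c] by linarith
qed (simp add: cauchy_carrier[OF assms])

lemma cauchy_star:
  assumes "cauchy u" shows "cauchy (\<lambda>n. astar A (u n))"
proof (rule cauchy_combine[OF assms assms, of _ 1])
  note carr [simp] = cauchy_carrier[OF assms]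
  show "anorm A (astar A (u m) \<ominus> astar A (u n)) \<le> 1 * (anorm A (u m \<ominus> u n) + anorm A (u m \<ominus> u n))" for m n
    using star_minus[of "u m" "u n", symmetric] anorm_ge0[of "u m \<ominus> u n"] by simp
qed (simp_all add: cauchy_carrier[OF assms])

lemma cauchy_mult:
  assumes u: "cauchy u" and v: "cauchy v" shows "cauchy (\<lambda>n. u n \<otimes> v n)"
proof -
  note carr [simp] = cauchy_carrier[OF u] cauchy_carrier[OF v]
  obtain B where B: "B > 0" "\<And>n. anorm A (u n) \<le> B" using cauchy_bounded[OF u] by blast
  obtain C where C: "C > 0" "\<And>n. anorm A (v n) \<le> C" using cauchy_bounded[OF v] by blast
  show ?thesis
  proof (rule cauchy_combine[OF u v, of _ "B + C"])
    fix m n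
    have "anorm A ((u m \<otimes> v m) \<ominus> (u n \<otimes> v n))
        \<le> anorm A (u m \<ominus> u n) * anorm A (v m) + anorm A (u n) * anorm A (v m \<ominus> v n)"
      by (intro anorm_mult_minus) auto
    also have "\<dots> \<le> anorm A (u m \<ominus> u n) * (B + C) + (B + C) * anorm A (v m \<ominus> v n)"
      using B(1) C(1) B(2)[of n] C(2)[of m] anorm_ge0 by (intro add_mono mult_left_mono mult_right_mono) auto
    finally show "anorm A ((u m \<otimes> v m) \<ominus> (u n \<otimes> v n)) \<le> (B + C) * (anorm A (u m \<ominus> u n) + anorm A (v m \<ominus> v n))"
      by (simp add: algebra_simps)
  qed (use B C in auto)
qed

lemma mem_cls: "v \<in> cls u \<longleftrightarrow> cauchy v \<and> (\<lambda>n. anorm A (v n \<ominus> u n)) \<longlonglongrightarrow> 0"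
  by (simp add: cauchy_class_def)

lemma self_mem_cls: "cauchy u \<Longrightarrow> u \<in> cls u"
  using cauchy_carrier[of u] by (simp add: mem_cls)

lemma cls_subset:
  assumes "cauchy u" "v \<in> cls u"
  shows "cls v \<subseteq> cls u"
proof
  fix w assume w: "w \<in> cls v"
  have c: "cauchy v" "cauchy w" using assms w by (auto simp: mem_cls)
  note carr [simp] = cauchy_carrier[OF c(1)] cauchy_carrier[OF c(2)] cauchy_carrier[OF assms(1)]
  have "(\<lambda>n. anorm A (w n \<ominus> v n) + anorm A (v n \<ominus> u n)) \<longlonglongrightarrow> 0 + 0"
    using assms w by (intro tendsto_add) (auto simp: mem_cls)
  then have "(\<lambda>n. anorm A (w n \<ominus> u n)) \<longlonglongrightarrow> 0"
    by - (rule null_sequence_le[where b = "\<lambda>n. anorm A (w n \<ominus> v n) + anorm A (v n \<ominus> u n)"],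
      simp_all add: anorm_ge0 N_minus_triangle)
  then show "w \<in> cls u" using w by (simp add: mem_cls)
qed

lemma cls_eqI:
  assumes "cauchy u" "cauchy v" "(\<lambda>n. anorm A (v n \<ominus> u n)) \<longlonglongrightarrow> 0"
  shows "cls u = cls v"
proof
  have "v \<in> cls u" using assms by (simp add: mem_cls)
  then show "cls v \<subseteq> cls u" using assms cls_subset by blast
  have "u \<in> cls v"
    using assms cauchy_carrier N_minus_commute[of "v n" "u n" for n] by (simp add: mem_cls)
  then show "cls u \<subseteq> cls v" using assms cls_subset by blast
qed

lemma cls_cong: "(\<And>n. u n = v n) \<Longrightarrow> cls u = cls v"
  by (metis ext)

abbreviation "C \<equiv> completion A"
definition embed :: "'a \<Rightarrow> (nat \<Rightarrow> 'a) set" where "embed a = cls (\<lambda>_. a)"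

lemma carrier_completion: "carrier C = {cls u | u. cauchy u}"
  by (simp add: completion_def)

lemma cls_closed [simp, intro]: "cauchy u \<Longrightarrow> cls u \<in> carrier C"
  by (auto simp: carrier_completion)

lemma completion_cases:
  assumes "x \<in> carrier C" obtains u where "cauchy u" "x = cls u"
  using assms by (auto simp: carrier_completion)

lemma embed_closed [simp, intro]: "a \<in> carrier A \<Longrightarrow> embed a \<in> carrier C"
  by (auto simp: embed_def)

lemma add_cls:
  assumes u: "cauchy u" and v: "cauchy v"
  shows "cls u \<oplus>\<^bsub>C\<^esub> cls v = cls (\<lambda>n. u n \<oplus> v n)"
proof -
  have eq: "cls (\<lambda>n. u' n \<oplus> v' n) = cls (\<lambda>n. u n \<oplus> v n)" if "u' \<in> cls u" "v' \<in> cls v" for u' v'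
  proof (rule cls_eqI[symmetric])
    have c: "cauchy u'" "cauchy v'" using that by (auto simp: mem_cls)
    show "cauchy (\<lambda>n. u n \<oplus> v n)" "cauchy (\<lambda>n. u' n \<oplus> v' n)" using u v c cauchy_add by auto
    note carr [simp] = cauchy_carrier[OF u] cauchy_carrier[OF v] cauchy_carrier[OF c(1)] cauchy_carrier[OF c(2)]
    have "(\<lambda>n. anorm A (u' n \<ominus> u n) + anorm A (v' n \<ominus> v n)) \<longlonglongrightarrow> 0 + 0"
      using that by (intro tendsto_add) (auto simp: mem_cls)
    then show "(\<lambda>n. anorm A ((u' n \<oplus> v' n) \<ominus> (u n \<oplus> v n))) \<longlonglongrightarrow> 0"
      by - (rule null_sequence_le[where b = "\<lambda>n. anorm A (u' n \<ominus> u n) + anorm A (v' n \<ominus> v n)"],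
        simp_all add: anorm_ge0 N_minus_add)
  qed
  have "cls u \<oplus>\<^bsub>C\<^esub> cls v = (\<Union>u'\<in>cls u. \<Union>v'\<in>cls v. cls (\<lambda>n. u' n \<oplus> v' n))"
    by (simp add: completion_def)
  also have "\<dots> = (\<Union>u'\<in>cls u. \<Union>v'\<in>cls v. cls (\<lambda>n. u n \<oplus> v n))"
    using eq by simp
  also have "\<dots> = cls (\<lambda>n. u n \<oplus> v n)" using self_mem_cls u v by auto
  finally show ?thesis .
qed

lemma mult_cls:
  assumes u: "cauchy u" and v: "cauchy v"
  shows "cls u \<otimes>\<^bsub>C\<^esub> cls v = cls (\<lambda>n. u n \<otimes> v n)"
proof -
  have eq: "cls (\<lambda>n. u' n \<otimes> v' n) = cls (\<lambda>n. u n \<otimes> v n)" if "u' \<in> cls u" "v' \<in> cls v" for u' v'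
  proof (rule cls_eqI[symmetric])
    have c: "cauchy u'" "cauchy v'" using that by (auto simp: mem_cls)
    show "cauchy (\<lambda>n. u n \<otimes> v n)" "cauchy (\<lambda>n. u' n \<otimes> v' n)" using u v c cauchy_mult by auto
    obtain B where B: "B > 0" "\<And>n. anorm A (u n) \<le> B" using cauchy_bounded[OF u] by blast
    obtain D where D: "D > 0" "\<And>n. anorm A (v' n) \<le> D" using cauchy_bounded[OF c(2)] by blast
    note carr [simp] = cauchy_carrier[OF u] cauchy_carrier[OF v] cauchy_carrier[OF c(1)] cauchy_carrier[OF c(2)]
    have lim: "(\<lambda>n. anorm A (u' n \<ominus> u n) * D + B * anorm A (v' n \<ominus> v n)) \<longlonglongrightarrow> 0 * D + B * 0"
      using that by (intro tendsto_intros) (auto simp: mem_cls)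
    have "anorm A ((u' n \<otimes> v' n) \<ominus> (u n \<otimes> v n)) \<le> anorm A (u' n \<ominus> u n) * D + B * anorm A (v' n \<ominus> v n)" for n
    proof -
      have "anorm A ((u' n \<otimes> v' n) \<ominus> (u n \<otimes> v n))
          \<le> anorm A (u' n \<ominus> u n) * anorm A (v' n) + anorm A (u n) * anorm A (v' n \<ominus> v n)"
        by (intro anorm_mult_minus) auto
      also have "\<dots> \<le> anorm A (u' n \<ominus> u n) * D + B * anorm A (v' n \<ominus> v n)"
        using B(2)[of n] D(2)[of n] anorm_ge0 by (intro add_mono mult_left_mono mult_right_mono) auto
      finally show ?thesis .
    qed
    then show "(\<lambda>n. anorm A ((u' n \<otimes> v' n) \<ominus> (u n \<otimes> v n))) \<longlonglongrightarrow> 0"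
      using lim by - (rule null_sequence_le[where b = "\<lambda>n. anorm A (u' n \<ominus> u n) * D + B * anorm A (v' n \<ominus> v n)"],
        simp_all add: anorm_ge0)
  qed
  have "cls u \<otimes>\<^bsub>C\<^esub> cls v = (\<Union>u'\<in>cls u. \<Union>v'\<in>cls v. cls (\<lambda>n. u' n \<otimes> v' n))"
    by (simp add: completion_def)
  also have "\<dots> = (\<Union>u'\<in>cls u. \<Union>v'\<in>cls v. cls (\<lambda>n. u n \<otimes> v n))"
    using eq by simp
  also have "\<dots> = cls (\<lambda>n. u n \<otimes> v n)" using self_mem_cls u v by auto
  finally show ?thesis .
qed

lemma smult_cls:
  assumes u: "cauchy u"
  shows "c \<odot>\<^bsub>C\<^esub> cls u = cls (\<lambda>n. c \<odot> u n)"
proof -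
  have eq: "cls (\<lambda>n. c \<odot> u' n) = cls (\<lambda>n. c \<odot> u n)" if "u' \<in> cls u" for u'
  proof (rule cls_eqI[symmetric])
    have u': "cauchy u'" using that by (auto simp: mem_cls)
    show "cauchy (\<lambda>n. c \<odot> u n)" "cauchy (\<lambda>n. c \<odot> u' n)" using u u' cauchy_smult by auto
    show "(\<lambda>n. anorm A (c \<odot> u' n \<ominus> c \<odot> u n)) \<longlonglongrightarrow> 0"
      using that tendsto_mult_right_zero[of "\<lambda>n. anorm A (u' n \<ominus> u n)" sequentially "cmod c"]
        cauchy_carrier[OF u] cauchy_carrier[OF u'] by (simp add: mem_cls N_minus_smult)
  qed
  have "c \<odot>\<^bsub>C\<^esub> cls u = (\<Union>u'\<in>cls u. cls (\<lambda>n. c \<odot> u' n))"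
    by (simp add: completion_def)
  also have "\<dots> = (\<Union>u'\<in>cls u. cls (\<lambda>n. c \<odot> u n))" using eq by simp
  also have "\<dots> = cls (\<lambda>n. c \<odot> u n)" using self_mem_cls u by auto
  finally show ?thesis .
qed

lemma star_cls:
  assumes u: "cauchy u"
  shows "astar C (cls u) = cls (\<lambda>n. astar A (u n))"
proof -
  have eq: "cls (\<lambda>n. astar A (u' n)) = cls (\<lambda>n. astar A (u n))" if "u' \<in> cls u" for u'
  proof (rule cls_eqI[symmetric])
    have u': "cauchy u'" using that by (auto simp: mem_cls)
    show "cauchy (\<lambda>n. astar A (u n))" "cauchy (\<lambda>n. astar A (u' n))" using u u' cauchy_star by auto
    show "(\<lambda>n. anorm A (astar A (u' n) \<ominus> astar A (u n))) \<longlonglongrightarrow> 0"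
      using that cauchy_carrier[OF u] cauchy_carrier[OF u'] star_minus[of "u' n" "u n" for n, symmetric]
      by (simp add: mem_cls)
  qed
  have "astar C (cls u) = (\<Union>u'\<in>cls u. cls (\<lambda>n. astar A (u' n)))"
    by (simp add: completion_def)
  also have "\<dots> = (\<Union>u'\<in>cls u. cls (\<lambda>n. astar A (u n)))" using eq by simp
  also have "\<dots> = cls (\<lambda>n. astar A (u n))" using self_mem_cls u by auto
  finally show ?thesis .
qed

lemma zero_cls: "\<zero>\<^bsub>C\<^esub> = cls (\<lambda>_. \<zero>)"
  by (simp add: completion_def)

lemma anorm_cls:
  assumes u: "cauchy u"
  shows "(\<lambda>n. anorm A (u n)) \<longlonglongrightarrow> anorm C (cls u)"
proof -
  obtain l where l: "(\<lambda>n. anorm A (u n)) \<longlonglongrightarrow> l"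
    using cauchy_anorm_convergent[OF u] by (auto simp: convergent_def)
  have all: "\<forall>v\<in>cls u. (\<lambda>n. anorm A (v n)) \<longlonglongrightarrow> l"
  proof
    fix v assume v: "v \<in> cls u"
    then have c: "cauchy v" by (simp add: mem_cls)
    have "(\<lambda>n. anorm A (v n) - anorm A (u n)) \<longlonglongrightarrow> 0"
      by (rule Lim_null_comparison[of _ "\<lambda>n. anorm A (v n \<ominus> u n)"])
        (use v N_diff cauchy_carrier[OF u] cauchy_carrier[OF c] in \<open>auto simp: mem_cls\<close>)
    then have "(\<lambda>n. (anorm A (v n) - anorm A (u n)) + anorm A (u n)) \<longlonglongrightarrow> 0 + l"
      by (intro tendsto_add l)
    then show "(\<lambda>n. anorm A (v n)) \<longlonglongrightarrow> l" by simp
  qed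
  have "anorm C (cls u) = (THE l. \<forall>v\<in>cls u. (\<lambda>n. anorm A (v n)) \<longlonglongrightarrow> l)"
    by (simp add: completion_def)
  also have "\<dots> = l"
    using all self_mem_cls[OF u] LIMSEQ_unique by (intro the_equality) blast+
  finally show ?thesis using l by simp
qed

lemmas cauchy_intros = cauchy_add cauchy_smult cauchy_star cauchy_mult cauchy_const
lemmas cls_ops = add_cls mult_cls smult_cls star_cls zero_cls

lemma star_alg_completion: "is_star_algebra C"
  unfolding is_star_algebra_def
proof (intro conjI ballI allI)
  show "module complex_ring C"
    by (rule complex_moduleI; (elim completion_cases)?)
      (auto simp: cls_ops cauchy_intros cauchy_carrier M.a_ac smult_simps smult_add_left
        intro!: cls_cong)
next
  fix x y z assume "x \<in> carrier C" "y \<in> carrier C" "z \<in> carrier C"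
  then obtain u v w where e: "cauchy u" "x = cls u" "cauchy v" "y = cls v" "cauchy w" "z = cls w"
    by (metis completion_cases)
  show "x \<otimes>\<^bsub>C\<^esub> y \<otimes>\<^bsub>C\<^esub> z = x \<otimes>\<^bsub>C\<^esub> (y \<otimes>\<^bsub>C\<^esub> z)"
    "(x \<oplus>\<^bsub>C\<^esub> y) \<otimes>\<^bsub>C\<^esub> z = x \<otimes>\<^bsub>C\<^esub> z \<oplus>\<^bsub>C\<^esub> y \<otimes>\<^bsub>C\<^esub> z"
    "x \<otimes>\<^bsub>C\<^esub> (y \<oplus>\<^bsub>C\<^esub> z) = x \<otimes>\<^bsub>C\<^esub> y \<oplus>\<^bsub>C\<^esub> x \<otimes>\<^bsub>C\<^esub> z"
    using e by (auto simp: cls_ops cauchy_intros cauchy_carrier mult_assoc distrib_left' distrib_right'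
        intro!: cls_cong)
next
  fix c x y assume "x \<in> carrier C" "y \<in> carrier C"
  then obtain u v where e: "cauchy u" "x = cls u" "cauchy v" "y = cls v"
    by (metis completion_cases)
  show "x \<otimes>\<^bsub>C\<^esub> y \<in> carrier C" "(c \<odot>\<^bsub>C\<^esub> x) \<otimes>\<^bsub>C\<^esub> y = c \<odot>\<^bsub>C\<^esub> (x \<otimes>\<^bsub>C\<^esub> y)"
    "x \<otimes>\<^bsub>C\<^esub> (c \<odot>\<^bsub>C\<^esub> y) = c \<odot>\<^bsub>C\<^esub> (x \<otimes>\<^bsub>C\<^esub> y)"
    "astar C (x \<oplus>\<^bsub>C\<^esub> y) = astar C x \<oplus>\<^bsub>C\<^esub> astar C y"
    "astar C (x \<otimes>\<^bsub>C\<^esub> y) = astar C y \<otimes>\<^bsub>C\<^esub> astar C x"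
    using e by (auto simp: cls_ops cauchy_intros cauchy_carrier smult_mult_left smult_mult_right star_add star_mult
        intro!: cls_cong)
next
  fix c x assume "x \<in> carrier C"
  then obtain u where e: "cauchy u" "x = cls u"
    by (metis completion_cases)
  show "astar C x \<in> carrier C" "astar C (astar C x) = x" "astar C (c \<odot>\<^bsub>C\<^esub> x) = cnj c \<odot>\<^bsub>C\<^esub> astar C x"
    using e by (auto simp: cls_ops cauchy_intros cauchy_carrier star_smult intro!: cls_cong)
qed

lemma cstar_seminormed_completion: "cstar_seminormed_alg C"
proof
  show "is_star_algebra C" by (rule star_alg_completion)
next
  fix x assume "x \<in> carrier C"
  then obtain u where u: "cauchy u" "x = cls u" by (rule completion_cases)
  note lim = anorm_cls[OF u(1)]
  show "0 \<le> anorm C x"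
    unfolding u(2) by (rule LIMSEQ_le_const[OF lim]) (use anorm_ge0 cauchy_carrier[OF u(1)] in auto)
  show "anorm C (c \<odot>\<^bsub>C\<^esub> x) = cmod c * anorm C x" for c
    unfolding u(2) smult_cls[OF u(1)]
    by (rule LIMSEQ_unique[OF anorm_cls[OF cauchy_smult[OF u(1)]]])
      (use tendsto_mult_left[OF lim, of "cmod c"] anorm_smult cauchy_carrier[OF u(1)] in simp)
  show "anorm C (astar C x \<otimes>\<^bsub>C\<^esub> x) = (anorm C x)\<^sup>2"
    unfolding u(2) star_cls[OF u(1)] mult_cls[OF cauchy_star[OF u(1)] u(1)]
    by (rule LIMSEQ_unique[OF anorm_cls[OF cauchy_mult[OF cauchy_star[OF u(1)] u(1)]]])
      (use tendsto_power[OF lim, of 2] anorm_star_mult cauchy_carrier[OF u(1)] in simp)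
  fix y assume "y \<in> carrier C"
  then obtain v where v: "cauchy v" "y = cls v" by (rule completion_cases)
  note lim' = anorm_cls[OF v(1)]
  show "anorm C (x \<oplus>\<^bsub>C\<^esub> y) \<le> anorm C x + anorm C y"
    unfolding u(2) v(2) add_cls[OF u(1) v(1)]
    by (rule LIMSEQ_le[OF anorm_cls[OF cauchy_add[OF u(1) v(1)]] tendsto_add[OF lim lim']])
      (use anorm_add cauchy_carrier[OF u(1)] cauchy_carrier[OF v(1)] in auto)
  show "anorm C (x \<otimes>\<^bsub>C\<^esub> y) \<le> anorm C x * anorm C y"
    unfolding u(2) v(2) mult_cls[OF u(1) v(1)]
    by (rule LIMSEQ_le[OF anorm_cls[OF cauchy_mult[OF u(1) v(1)]] tendsto_mult[OF lim lim']])
      (use anorm_mult cauchy_carrier[OF u(1)] cauchy_carrier[OF v(1)] in auto)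
qed

interpretation Cp: cstar_seminormed_alg C
  by (rule cstar_seminormed_completion)

lemma cls_minus:
  assumes "cauchy u" "cauchy v"
  shows "cls u \<ominus>\<^bsub>C\<^esub> cls v = cls (\<lambda>n. u n \<ominus> v n)" "cauchy (\<lambda>n. u n \<ominus> v n)"
proof -
  have "cauchy (\<lambda>n. u n \<oplus> (-1) \<odot> v n)" using assms by (intro cauchy_intros)
  then show "cauchy (\<lambda>n. u n \<ominus> v n)" using assms cauchy_carrier by (simp add: a_minus_eq)
  show "cls u \<ominus>\<^bsub>C\<^esub> cls v = cls (\<lambda>n. u n \<ominus> v n)"
    using assms cauchy_carrier by (simp add: Cp.a_minus_eq a_minus_eq cls_ops cauchy_intros)
qed

lemma embed_ops:
  assumes "a \<in> carrier A" "b \<in> carrier A"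
  shows "embed (a \<oplus> b) = embed a \<oplus>\<^bsub>C\<^esub> embed b" "embed (a \<otimes> b) = embed a \<otimes>\<^bsub>C\<^esub> embed b"
    "embed (c \<odot> a) = c \<odot>\<^bsub>C\<^esub> embed a" "embed (astar A a) = astar C (embed a)"
    "embed (a \<ominus> b) = embed a \<ominus>\<^bsub>C\<^esub> embed b"
  using assms by (simp_all add: embed_def cls_ops cls_minus)

lemma anorm_embed: "a \<in> carrier A \<Longrightarrow> anorm C (embed a) = anorm A a"
  using LIMSEQ_unique[OF anorm_cls[of "\<lambda>_. a"] tendsto_const] by (simp add: embed_def)

lemma converges_embed:
  assumes u: "cauchy u"
  shows "converges_in C (anorm C) (\<lambda>n. embed (u n)) (cls u)"
  unfolding converges_in_def
proof (rule LIMSEQ_I)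
  fix e :: real assume e: "e > 0"
  note carr [simp] = cauchy_carrier[OF u]
  obtain M where M: "\<forall>m\<ge>M. \<forall>n\<ge>M. anorm A (u m \<ominus> u n) < e / 2"
    using u e unfolding cauchy_in_def by (metis half_gt_zero)
  have "norm (anorm C (embed (u n) \<ominus>\<^bsub>C\<^esub> cls u) - 0) < e" if n: "n \<ge> M" for n
  proof -
    have "(\<lambda>m. anorm A (u n \<ominus> u m)) \<longlonglongrightarrow> anorm C (embed (u n) \<ominus>\<^bsub>C\<^esub> cls u)"
      using anorm_cls[OF cls_minus(2)[of "\<lambda>_. u n" u]] u by (simp add: embed_def cls_minus(1))
    moreover have "\<exists>N. \<forall>m\<ge>N. anorm A (u n \<ominus> u m) \<le> e / 2"
      using M n by (meson less_imp_le)
    ultimately have "anorm C (embed (u n) \<ominus>\<^bsub>C\<^esub> cls u) \<le> e / 2"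
      by (rule LIMSEQ_le_const2)
    moreover have "0 \<le> anorm C (embed (u n) \<ominus>\<^bsub>C\<^esub> cls u)" using u by (intro Cp.anorm_ge0) auto
    ultimately show ?thesis using e by simp
  qed
  then show "\<exists>no. \<forall>n\<ge>no. norm (anorm C (embed (u n) \<ominus>\<^bsub>C\<^esub> cls u) - 0) < e" by blast
qed

lemma embed_dense:
  assumes "x \<in> carrier C" "e > 0"
  shows "\<exists>a\<in>carrier A. anorm C (x \<ominus>\<^bsub>C\<^esub> embed a) < e"
proof -
  obtain u where u: "cauchy u" "x = cls u" using assms(1) by (rule completion_cases)
  note carr [simp] = cauchy_carrier[OF u(1)]
  obtain n where "norm (anorm C (embed (u n) \<ominus>\<^bsub>C\<^esub> x) - 0) < e"
    using LIMSEQ_D[OF converges_embed[OF u(1), unfolded converges_in_def] assms(2)] u(2) by blast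
  then show ?thesis
    using Cp.N_minus_commute[of x "embed (u n)"] assms(1) by (intro bexI[of _ "u n"]) auto
qed

text \<open>Approximating the terms of a Cauchy sequence of classes by single elements gives a Cauchy
  sequence of elements, whose class is the limit.\<close>

lemma complete_completion: "complete_in C (anorm C)"
  unfolding complete_in_def
proof (intro allI impI)
  fix F assume F: "cauchy_in C (anorm C) F"
  then have Fc [simp]: "F k \<in> carrier C" for k by (simp add: cauchy_in_def)
  have "\<exists>a\<in>carrier A. anorm C (F k \<ominus>\<^bsub>C\<^esub> embed a) < inverse (of_nat (Suc k))" for k
    by (rule embed_dense) auto
  then obtain w where w: "\<And>k. w k \<in> carrier A" "\<And>k. anorm C (F k \<ominus>\<^bsub>C\<^esub> embed (w k)) < inverse (of_nat (Suc k))"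
    by metis
  note [simp] = w(1)
  have lim: "(\<lambda>k. anorm C (F k \<ominus>\<^bsub>C\<^esub> embed (w k))) \<longlonglongrightarrow> 0"
    by (rule null_sequence_le[OF _ less_imp_le[OF w(2)] LIMSEQ_inverse_real_of_nat])
      (simp add: Cp.anorm_ge0)
  have "cauchy w"
    unfolding cauchy_in_def
  proof (intro conjI allI impI)
    fix e :: real assume "e > 0"
    then have e: "e / 3 > 0" by simp
    obtain M where M: "\<forall>m\<ge>M. \<forall>n\<ge>M. anorm C (F m \<ominus>\<^bsub>C\<^esub> F n) < e / 3"
      using F e unfolding cauchy_in_def by blast
    obtain M' where M': "\<forall>n\<ge>M'. norm (anorm C (F n \<ominus>\<^bsub>C\<^esub> embed (w n)) - 0) < e / 3"
      using LIMSEQ_D[OF lim e] by blast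
    show "\<exists>M. \<forall>m\<ge>M. \<forall>n\<ge>M. anorm A (w m \<ominus> w n) < e"
    proof (intro exI allI impI)
      fix m n assume mn: "max M M' \<le> m" "max M M' \<le> n"
      have "anorm A (w m \<ominus> w n) = anorm C (embed (w m) \<ominus>\<^bsub>C\<^esub> embed (w n))"
        using anorm_embed[of "w m \<ominus> w n"] by (simp add: embed_ops)
      also have "\<dots> \<le> anorm C (embed (w m) \<ominus>\<^bsub>C\<^esub> F m) + (anorm C (F m \<ominus>\<^bsub>C\<^esub> F n) + anorm C (F n \<ominus>\<^bsub>C\<^esub> embed (w n)))"
        using Cp.N_minus_triangle[of "embed (w m)" "F m" "embed (w n)"]
          Cp.N_minus_triangle[of "F m" "F n" "embed (w n)"] by simp
      also have "\<dots> < e / 3 + (e / 3 + e / 3)"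
        using M M' mn Cp.N_minus_commute[of "embed (w m)" "F m"]
        by (intro add_strict_mono) (auto simp: abs_less_iff)
      finally show "anorm A (w m \<ominus> w n) < e" by simp
    qed
  qed simp
  moreover have "converges_in C (anorm C) F (cls w)"
  proof (rule Cp.converges_inI)
    have "(\<lambda>k. anorm C (F k \<ominus>\<^bsub>C\<^esub> embed (w k)) + anorm C (embed (w k) \<ominus>\<^bsub>C\<^esub> cls w)) \<longlonglongrightarrow> 0 + 0"
      using converges_embed[OF \<open>cauchy w\<close>] by (intro tendsto_add lim) (simp add: converges_in_def)
    then show "(\<lambda>k. anorm C (F k \<ominus>\<^bsub>C\<^esub> embed (w k)) + anorm C (embed (w k) \<ominus>\<^bsub>C\<^esub> cls w)) \<longlonglongrightarrow> 0"
      by simp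
  qed (use \<open>cauchy w\<close> Cp.N_minus_triangle in auto)
  ultimately show "\<exists>x\<in>carrier C. converges_in C (anorm C) F x" by blast
qed

lemma cstar_algebra_completion: "cstar_algebra C"
  unfolding cstar_algebra_def
proof (intro conjI ballI allI)
  fix x assume x: "x \<in> carrier C"
  then obtain u where u: "cauchy u" "x = cls u" by (rule completion_cases)
  show "anorm C x = 0 \<longleftrightarrow> x = \<zero>\<^bsub>C\<^esub>"
  proof
    assume "anorm C x = 0"
    then have "(\<lambda>n. anorm A (u n)) \<longlonglongrightarrow> 0" using anorm_cls[OF u(1)] u(2) by simp
    then show "x = \<zero>\<^bsub>C\<^esub>"
      unfolding u(2) zero_cls using cls_eqI[of "\<lambda>_. \<zero>" u] u(1) cauchy_carrier[OF u(1)] by simp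
  qed simp
qed (use star_alg_completion complete_completion Cp.anorm_ge0 Cp.anorm_smult Cp.anorm_add Cp.anorm_mult
    Cp.anorm_star_mult in auto)

end

section \<open>Representations\<close>

lemma (in seminormed_module) converges_in_close:
  assumes "\<And>n. u n \<in> carrier V" "\<And>n. v n \<in> carrier V" "x \<in> carrier V" "converges_in V N u x"
    and "(\<lambda>n. N (v n \<ominus> u n)) \<longlonglongrightarrow> 0"
  shows "converges_in V N v x"
proof (rule converges_inI)
  have "(\<lambda>n. N (v n \<ominus> u n) + N (u n \<ominus> x)) \<longlonglongrightarrow> 0 + 0"
    using assms(4,5) by (intro tendsto_add) (simp_all add: converges_in_def)
  then show "(\<lambda>n. N (v n \<ominus> u n) + N (u n \<ominus> x)) \<longlonglongrightarrow> 0" by simp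
qed (use assms N_minus_triangle in auto)

lemma (in seminormed_module) closed_subspace_INT:
  assumes "I \<noteq> {}" "\<And>i. i \<in> I \<Longrightarrow> closed_subspace V N (S i)"
  shows "closed_subspace V N (\<Inter>i\<in>I. S i)"
proof (rule closed_subspaceI)
  note D = closed_subspaceD[OF assms(2)]
  show "(\<Inter>i\<in>I. S i) \<subseteq> carrier V" using assms(1) D(1) by blast
  show "\<zero> \<in> (\<Inter>i\<in>I. S i)" using D(2) by blast
  show "x \<oplus> y \<in> (\<Inter>i\<in>I. S i)" if "x \<in> (\<Inter>i\<in>I. S i)" "y \<in> (\<Inter>i\<in>I. S i)" for x y
    using that D(3) by blast
  show "c \<odot> x \<in> (\<Inter>i\<in>I. S i)" if "x \<in> (\<Inter>i\<in>I. S i)" for c x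
    using that D(4) by blast
  fix u x assume u: "\<And>n. u n \<in> (\<Inter>i\<in>I. S i)" and x: "x \<in> carrier V" "converges_in V N u x"
  show "x \<in> (\<Inter>i\<in>I. S i)"
  proof
    fix i assume "i \<in> I"
    then show "x \<in> S i" using D(5)[of i u x] u x by auto
  qed
qed

locale rep = star_alg A + H: hilbert H
  for A :: "('a, 'm) star_algebra_scheme" (structure) and H :: "'h hilbert" and L +
  assumes star_rep: "star_rep A H L"
begin

lemma L_bounded: "a \<in> carrier A \<Longrightarrow> L a \<in> bounded_ops H"
  and L_add: "a \<in> carrier A \<Longrightarrow> b \<in> carrier A \<Longrightarrow> x \<in> carrier H \<Longrightarrow> L (a \<oplus> b) x = L a x \<oplus>\<^bsub>H\<^esub> L b x"
  and L_mult: "a \<in> carrier A \<Longrightarrow> b \<in> carrier A \<Longrightarrow> x \<in> carrier H \<Longrightarrow> L (a \<otimes> b) x = L a (L b x)"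
  and L_smult: "a \<in> carrier A \<Longrightarrow> x \<in> carrier H \<Longrightarrow> L (c \<odot> a) x = c \<odot>\<^bsub>H\<^esub> L a x"
  and L_adj: "a \<in> carrier A \<Longrightarrow> x \<in> carrier H \<Longrightarrow> y \<in> carrier H \<Longrightarrow>
    hinner H (L a x) y = hinner H x (L (astar A a) y)"
  using star_rep unfolding star_rep_def by blast+

lemmas L_lin = H.bounded_opsD(2,3)[OF L_bounded] H.bounded_ops_zero[OF L_bounded] H.bounded_ops_minus[OF L_bounded]

lemma L_closed [simp, intro]: "a \<in> carrier A \<Longrightarrow> x \<in> carrier H \<Longrightarrow> L a x \<in> carrier H"
  using H.bounded_opsD(1)[OF L_bounded] .

lemma L_minus: "a \<in> carrier A \<Longrightarrow> b \<in> carrier A \<Longrightarrow> x \<in> carrier H \<Longrightarrow> L (a \<ominus> b) x = L a x \<ominus>\<^bsub>H\<^esub> L b x"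
  by (simp add: a_minus_eq H.a_minus_eq L_add L_smult)

lemma L_zero: "x \<in> carrier H \<Longrightarrow> L \<zero> x = \<zero>\<^bsub>H\<^esub>"
  using L_smult[of \<zero> x 0] by simp

lemma L_adj': "a \<in> carrier A \<Longrightarrow> x \<in> carrier H \<Longrightarrow> y \<in> carrier H \<Longrightarrow>
    hinner H x (L a y) = hinner H (L (astar A a) x) y"
  using L_adj[of "astar A a" x y] by simp

abbreviation "p a \<equiv> op_norm H (L a)"

lemma hnorm_L: "a \<in> carrier A \<Longrightarrow> x \<in> carrier H \<Longrightarrow> hnorm H (L a x) \<le> p a * hnorm H x"
  by (intro H.hnorm_le_op_norm H.bounded_ops_lin_bounded L_bounded)

lemma p_ge0: "a \<in> carrier A \<Longrightarrow> 0 \<le> p a"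
  by (intro H.op_norm_ge0 H.bounded_ops_lin_bounded L_bounded)

lemma hnorm_L_power2: "a \<in> carrier A \<Longrightarrow> x \<in> carrier H \<Longrightarrow>
    (hnorm H (L a x))\<^sup>2 = Re (hinner H (L (astar A a \<otimes> a) x) x)"
  using L_adj[of "astar A a" "L a x" x] by (simp add: H.hnorm_power2 L_mult)

lemma p_add: "a \<in> carrier A \<Longrightarrow> b \<in> carrier A \<Longrightarrow> p (a \<oplus> b) \<le> p a + p b"
proof (rule H.op_norm_le)
  fix x assume ab: "a \<in> carrier A" "b \<in> carrier A" and x: "x \<in> carrier H"
  show "hnorm H (L (a \<oplus> b) x) \<le> (p a + p b) * hnorm H x"
    using H.hnorm_add[of "L a x" "L b x"] hnorm_L[OF ab(1) x] hnorm_L[OF ab(2) x] ab x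
    by (simp add: L_add distrib_right)
qed (simp add: p_ge0)

lemma p_smult: "a \<in> carrier A \<Longrightarrow> p (c \<odot> a) = cmod c * p a"
proof -
  have le: "p (c \<odot> a) \<le> cmod c * p a" if "a \<in> carrier A" for a c
  proof (rule H.op_norm_le)
    fix x assume x: "x \<in> carrier H"
    show "hnorm H (L (c \<odot> a) x) \<le> cmod c * p a * hnorm H x"
      using mult_left_mono[OF hnorm_L[OF that x], of "cmod c"] that x
      by (simp add: L_smult H.hnorm_smult mult.assoc)
  qed (simp add: p_ge0 that)
  assume a: "a \<in> carrier A"
  show ?thesis
  proof (cases "c = 0")
    case True
    then show ?thesis using le[OF a, of c] p_ge0[of "c \<odot> a"] a by simp
  next
    case False
    have "p a = p (inverse c \<odot> (c \<odot> a))" using a False by (simp add: smult_simps)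
    also have "\<dots> \<le> cmod (inverse c) * p (c \<odot> a)" using a by (intro le) simp
    finally have "p a \<le> inverse (cmod c) * p (c \<odot> a)" by (simp only: norm_inverse)
    then have "cmod c * p a \<le> p (c \<odot> a)" using False by (simp add: field_simps)
    then show ?thesis using le[OF a, of c] by simp
  qed
qed

lemma p_mult: "a \<in> carrier A \<Longrightarrow> b \<in> carrier A \<Longrightarrow> p (a \<otimes> b) \<le> p a * p b"
proof (rule H.op_norm_le)
  fix x assume ab: "a \<in> carrier A" "b \<in> carrier A" and x: "x \<in> carrier H"
  have "hnorm H (L a (L b x)) \<le> p a * hnorm H (L b x)" using ab x by (intro hnorm_L) auto
  also have "\<dots> \<le> p a * (p b * hnorm H x)"
    using ab x by (intro mult_left_mono hnorm_L p_ge0) auto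
  finally show "hnorm H (L (a \<otimes> b) x) \<le> p a * p b * hnorm H x"
    using ab x by (simp add: L_mult mult.assoc)
qed (simp add: p_ge0)

lemma p_star_mult: assumes a: "a \<in> carrier A" shows "p (astar A a \<otimes> a) = (p a)\<^sup>2"
proof -
  have star_le: "p (astar A b) \<le> p b" if b: "b \<in> carrier A" for b
  proof (rule H.op_norm_le)
    fix x assume x: "x \<in> carrier H"
    let ?y = "L (astar A b) x"
    have "(hnorm H ?y)\<^sup>2 = Re (hinner H x (L b ?y))"
      using L_adj[of "astar A b" x ?y] b x by (simp add: H.hnorm_power2)
    also have "\<dots> \<le> hnorm H x * hnorm H (L b ?y)"
      using H.cauchy_schwarz[of x "L b ?y"] complex_Re_le_cmod[of "hinner H x (L b ?y)"] b x
      by (meson L_closed order_trans star_closed)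
    also have "\<dots> \<le> hnorm H x * (p b * hnorm H ?y)"
      using b x by (intro mult_left_mono hnorm_L) auto
    finally have "hnorm H ?y * hnorm H ?y \<le> (p b * hnorm H x) * hnorm H ?y"
      by (simp add: power2_eq_square mult_ac)
    moreover have "0 \<le> hnorm H ?y" "0 \<le> p b * hnorm H x" using b x p_ge0 by auto
    ultimately show "hnorm H ?y \<le> p b * hnorm H x"
      by (cases "hnorm H ?y = 0") simp_all
  qed (simp add: p_ge0 b)
  have "p (astar A a \<otimes> a) \<le> p (astar A a) * p a" using a by (intro p_mult) auto
  also have "\<dots> \<le> p a * p a" using a by (intro mult_right_mono star_le p_ge0) auto
  finally have "p (astar A a \<otimes> a) \<le> (p a)\<^sup>2" by (simp add: power2_eq_square)
  moreover have "p a \<le> sqrt (p (astar A a \<otimes> a))"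
  proof (rule H.op_norm_le)
    fix x assume x: "x \<in> carrier H"
    have "(hnorm H (L a x))\<^sup>2 \<le> hnorm H (L (astar A a \<otimes> a) x) * hnorm H x"
      using hnorm_L_power2[OF a x] complex_Re_le_cmod[of "hinner H (L (astar A a \<otimes> a) x) x"]
        H.cauchy_schwarz[of "L (astar A a \<otimes> a) x" x] a x by simp
    also have "\<dots> \<le> (p (astar A a \<otimes> a) * hnorm H x) * hnorm H x"
      using a x by (intro mult_right_mono hnorm_L) auto
    finally have "sqrt ((hnorm H (L a x))\<^sup>2) \<le> sqrt (p (astar A a \<otimes> a) * (hnorm H x)\<^sup>2)"
      by (intro real_sqrt_le_mono) (simp add: power2_eq_square)
    then show "hnorm H (L a x) \<le> sqrt (p (astar A a \<otimes> a)) * hnorm H x"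
      using a x by (simp add: real_sqrt_mult)
  qed (use a p_ge0 in auto)
  then have "(p a)\<^sup>2 \<le> p (astar A a \<otimes> a)"
    using p_ge0[of a] p_ge0[of "astar A a \<otimes> a"] a by (simp add: real_le_rsqrt sqrt_le_D real_le_lsqrt sqrt_ge_absD)
  ultimately show ?thesis by simp
qed

lemma p_star: "a \<in> carrier A \<Longrightarrow> p (astar A a) = p a"
proof -
  have "p b \<le> p (astar A b)" if b: "b \<in> carrier A" for b
  proof (cases "p b = 0")
    case False
    have "p b * p b \<le> p (astar A b) * p b"
      using p_star_mult[OF b] p_mult[of "astar A b" b] b by (simp add: power2_eq_square)
    then show ?thesis using False p_ge0[OF b] by simp
  qed (use b p_ge0 in auto)
  then show "a \<in> carrier A \<Longrightarrow> p (astar A a) = p a" by (metis antisym star_closed star_star)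
qed

end

subsection \<open>Representations of complete algebras are contractive\<close>

lemma cstar_algebra_imp_seminormed: "cstar_algebra A \<Longrightarrow> cstar_seminormed_alg A"
  unfolding cstar_algebra_def cstar_seminormed_alg_def cstar_seminormed_alg_axioms_def star_alg_def by simp

text \<open>An element of norm less than one has a quasi-inverse, the sum of its powers.\<close>

lemma (in cstar_seminormed_alg) quasi_inverse:
  assumes complete: "complete_in A (anorm A)" and definite: "\<And>x. x \<in> carrier A \<Longrightarrow> anorm A x = 0 \<Longrightarrow> x = \<zero>"
    and d [simp]: "d \<in> carrier A" and r: "anorm A d < 1"
  shows "\<exists>g\<in>carrier A. g = d \<oplus> g \<otimes> d"
proof -
  define r where "r = anorm A d"
  have r01: "0 \<le> r" "r < 1" using anorm_ge0[OF d] r by (auto simp: r_def)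
  define s where "s = rec_nat \<zero> (\<lambda>_ y. d \<oplus> y \<otimes> d)"
  have s_simps: "s 0 = \<zero>" "s (Suc n) = d \<oplus> s n \<otimes> d" for n by (simp_all add: s_def)
  have [simp]: "s n \<in> carrier A" for n by (induction n) (simp_all add: s_simps)
  have step: "anorm A ((d \<oplus> y \<otimes> d) \<ominus> (d \<oplus> z \<otimes> d)) \<le> anorm A (y \<ominus> z) * r"
    if "y \<in> carrier A" "z \<in> carrier A" for y z
    using anorm_mult_minus[of y d z d] N_minus_add[of d "y \<otimes> d" d "z \<otimes> d"] that
    by (simp add: r_def)
  have bound: "anorm A (s k) \<le> r / (1 - r)" for k
  proof (induction k)
    case 0
    then show ?case using r01 by (simp add: s_simps)
  next
    case (Suc k)
    have "anorm A (s (Suc k)) \<le> r + anorm A (s k) * r"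
      using anorm_add[of d "s k \<otimes> d"] anorm_mult[of "s k" d] by (simp add: s_simps r_def)
    also have "\<dots> \<le> r + r / (1 - r) * r" using Suc r01 by (intro add_left_mono mult_right_mono) auto
    also have "\<dots> = r / (1 - r)" using r01 by (simp add: field_simps)
    finally show ?case .
  qed
  have diff: "anorm A (s (n + k) \<ominus> s n) \<le> r ^ n * (r / (1 - r))" for n k
  proof (induction n)
    case 0
    then show ?case using bound by (simp add: s_simps)
  next
    case (Suc n)
    have "anorm A (s (Suc n + k) \<ominus> s (Suc n)) \<le> anorm A (s (n + k) \<ominus> s n) * r"
      using step[of "s (n + k)" "s n"] by (simp add: s_simps)
    also have "\<dots> \<le> r ^ n * (r / (1 - r)) * r" using Suc r01 by (intro mult_right_mono) auto
    finally show ?case by (simp add: mult_ac)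
  qed
  have "cauchy s"
    unfolding cauchy_in_def
  proof (intro conjI allI impI)
    fix e :: real assume e: "e > 0"
    have "(\<lambda>n. r ^ n * (r / (1 - r))) \<longlonglongrightarrow> 0 * (r / (1 - r))"
      using r01 by (intro tendsto_intros LIMSEQ_realpow_zero) auto
    from LIMSEQ_D[OF this[unfolded mult_zero_left] e]
    obtain M where M: "\<forall>n\<ge>M. norm (r ^ n * (r / (1 - r)) - 0) < e"
      by blast
    have less: "anorm A (s m \<ominus> s n) < e" if mn: "n \<ge> M" "m \<ge> n" for m n
    proof -
      have "r ^ n * (r / (1 - r)) < e"
        using M[rule_format, OF mn(1)] by (simp only: diff_zero real_norm_def abs_less_iff)
      then show ?thesis using diff[of n "m - n"] mn by simp
    qed
    show "\<exists>M. \<forall>m\<ge>M. \<forall>n\<ge>M. anorm A (s m \<ominus> s n) < e"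
    proof (intro exI allI impI)
      fix m n assume "M \<le> m" "M \<le> n"
      then show "anorm A (s m \<ominus> s n) < e"
        using less[of m n] less[of n m] N_minus_commute[of "s m" "s n"] by (cases "m \<le> n") simp_all
    qed
  qed simp
  then obtain g where g: "g \<in> carrier A" "converges_in A (anorm A) s g"
    using complete unfolding complete_in_def by blast
  note [simp] = g(1)
  have lim: "(\<lambda>n. anorm A (s n \<ominus> g)) \<longlonglongrightarrow> 0" using g(2) by (simp add: converges_in_def)
  have "converges_in A (anorm A) (\<lambda>n. s (Suc n)) (d \<oplus> g \<otimes> d)"
    by (rule converges_inI[OF _ _ _ tendsto_mult_left_zero[OF lim, of r]])
      (use step in \<open>simp_all add: s_simps\<close>)
  moreover have "converges_in A (anorm A) (\<lambda>n. s (Suc n)) g"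
    using lim LIMSEQ_Suc unfolding converges_in_def by blast
  ultimately have "anorm A (g \<ominus> (d \<oplus> g \<otimes> d)) = 0"
    by (intro converges_in_unique_seminorm[of "\<lambda>n. s (Suc n)"]) auto
  then have "g \<ominus> (d \<oplus> g \<otimes> d) = \<zero>" by (intro definite) auto
  then show ?thesis by (intro bexI[of _ g]) (simp_all add: minus_eq_zero_iff)
qed

text \<open>If \<open>\<lambda> = \<parallel>L a\<parallel>\<^sup>2\<close> exceeded \<open>\<parallel>a\<^sup>* a\<parallel>\<close>, then \<open>1 - a\<^sup>* a / \<lambda>\<close> would be invertible up to adjoining a
  unit, hence bounded below under \<open>L\<close>; but \<open>\<lambda>\<close> lies in the spectrum of \<open>L (a\<^sup>* a)\<close>.\<close>

theorem star_rep_contractive: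
  fixes A (structure)
  assumes A: "cstar_algebra A" and L: "star_rep A H L" and a: "a \<in> carrier A"
  shows "op_norm H (L a) \<le> anorm A a"
proof -
  interpret cstar_seminormed_alg A using cstar_algebra_imp_seminormed[OF A] .
  interpret rep A H L
    using L by unfold_locales (simp_all add: star_rep_def)
  show ?thesis
  proof (rule ccontr)
    assume "\<not> p a \<le> anorm A a"
    then have lt: "anorm A a < p a" by simp
    define l where "l = (p a)\<^sup>2"
    have pa: "p a > 0" using lt anorm_ge0[OF a] by simp
    then have l: "l > 0" by (simp add: l_def)
    define d where "d = of_real (1 / l) \<odot> (astar A a \<otimes> a)"
    have d [simp]: "d \<in> carrier A" using a by (simp add: d_def)
    have "anorm A d = (anorm A a)\<^sup>2 / l"
      using l a by (simp add: d_def anorm_smult anorm_star_mult norm_divide)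
    moreover have "(anorm A a)\<^sup>2 < l" unfolding l_def using lt anorm_ge0[OF a] by (intro power_strict_mono) auto
    ultimately have "anorm A d < 1" using l by simp
    then obtain g where g: "g \<in> carrier A" "g = d \<oplus> g \<otimes> d"
      using quasi_inverse[of d] A by (auto simp: cstar_algebra_def)
    define K where "K = (1 + p g)\<^sup>2"
    have K: "K \<ge> 1" using p_ge0[OF g(1)] by (simp add: K_def power2_eq_square algebra_simps)
    have main: "(hnorm H (L a x))\<^sup>2 \<le> l * (1 - 1 / K) * (hnorm H x)\<^sup>2" if x: "x \<in> carrier H" for x
    proof -
      \<comment> \<open>the quasi-inverse recovers \<open>x = z + L g z\<close>, so \<open>z\<close> is at least as long as \<open>x / (1 + \<parallel>L g\<parallel>)\<close>\<close>
      let ?z = "x \<ominus>\<^bsub>H\<^esub> L d x"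
      have z: "?z \<in> carrier H" using x by simp
      have "L g x = L d x \<oplus>\<^bsub>H\<^esub> L g (L d x)"
        using arg_cong[OF g(2), of "\<lambda>b. L b x"] g(1) x by (simp add: L_add L_mult)
      then have "L g ?z = L d x"
        using g(1) x H.minus_add_minus[of "L d x" "L g (L d x)" "\<zero>\<^bsub>H\<^esub>" "L g (L d x)"]
        by (simp add: L_lin)
      then have "x = ?z \<oplus>\<^bsub>H\<^esub> L g ?z"
        using x H.minus_chain[of x "L d x" "\<zero>\<^bsub>H\<^esub>"] by simp
      then have "hnorm H x \<le> hnorm H ?z + p g * hnorm H ?z"
        using H.hnorm_add[of ?z "L g ?z"] hnorm_L[OF g(1) z] g(1) z by simp
      then have "(hnorm H x)\<^sup>2 \<le> ((1 + p g) * hnorm H ?z)\<^sup>2"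
        using x by (intro power_mono) (simp_all add: algebra_simps)
      then have 1: "(hnorm H x)\<^sup>2 \<le> K * (hnorm H ?z)\<^sup>2" by (simp add: K_def power_mult_distrib)
      have "Re (hinner H x (L d x)) = (hnorm H (L a x))\<^sup>2 / l"
        using hnorm_L_power2[OF a x] H.inner_commute[of x "L (astar A a \<otimes> a) x"] a x
        by (simp add: d_def L_smult H.inner_smult_right)
      moreover have "hnorm H (L d x) \<le> p a * hnorm H (L a x) / l"
        using hnorm_L[of "astar A a" "L a x"] a x l
        by (simp add: d_def L_smult L_mult H.hnorm_smult p_star norm_divide divide_right_mono)
      then have "(hnorm H (L d x))\<^sup>2 \<le> (p a * hnorm H (L a x) / l)\<^sup>2"
        using x by (intro power_mono) auto
      then have "(hnorm H (L d x))\<^sup>2 \<le> (hnorm H (L a x))\<^sup>2 / l"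
        using l pa by (simp add: l_def power_mult_distrib power_divide power2_eq_square)
      ultimately have 2: "(hnorm H ?z)\<^sup>2 \<le> (hnorm H x)\<^sup>2 - (hnorm H (L a x))\<^sup>2 / l"
        using x by (simp add: H.hnorm_minus_power2)
      have "(hnorm H x)\<^sup>2 \<le> K * ((hnorm H x)\<^sup>2 - (hnorm H (L a x))\<^sup>2 / l)"
        using 1 mult_left_mono[OF 2, of K] K by linarith
      then show ?thesis using K l by (simp add: field_simps)
    qed
    have "p a \<le> sqrt (l * (1 - 1 / K))"
    proof (rule H.op_norm_le)
      fix x assume x: "x \<in> carrier H"
      show "hnorm H (L a x) \<le> sqrt (l * (1 - 1 / K)) * hnorm H x"
        using real_sqrt_le_mono[OF main[OF x]] a x by (simp add: real_sqrt_mult)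
    qed (use l K in simp)
    then have "l \<le> l * (1 - 1 / K)"
      using pa l K real_sqrt_ge_zero by (simp add: l_def real_le_rsqrt sqrt_ge_absD)
    moreover have "l / K > 0" using l K by (intro divide_pos_pos) auto
    ultimately show False by (simp add: algebra_simps)
  qed
qed

subsection \<open>Unitary equivalence\<close>

locale unitary = H: hilbert H + K: hilbert K for H :: "'h hilbert" and K :: "'k hilbert" +
  fixes U :: "'h \<Rightarrow> 'k"
  assumes linear: "linear_on H K U" and bij: "bij_betw U (carrier H) (carrier K)"
    and inner: "x \<in> carrier H \<Longrightarrow> y \<in> carrier H \<Longrightarrow> hinner K (U x) (U y) = hinner H x y"
begin

lemma U_closed [simp, intro]: "x \<in> carrier H \<Longrightarrow> U x \<in> carrier K"
  and U_add: "x \<in> carrier H \<Longrightarrow> y \<in> carrier H \<Longrightarrow> U (x \<oplus>\<^bsub>H\<^esub> y) = U x \<oplus>\<^bsub>K\<^esub> U y"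
  and U_smult: "x \<in> carrier H \<Longrightarrow> U (c \<odot>\<^bsub>H\<^esub> x) = c \<odot>\<^bsub>K\<^esub> U x"
  using linear by (simp_all add: linear_on_def)

lemma U_minus: "x \<in> carrier H \<Longrightarrow> y \<in> carrier H \<Longrightarrow> U (x \<ominus>\<^bsub>H\<^esub> y) = U x \<ominus>\<^bsub>K\<^esub> U y"
  by (simp add: H.a_minus_eq K.a_minus_eq U_add U_smult)

lemma U_zero: "U \<zero>\<^bsub>H\<^esub> = \<zero>\<^bsub>K\<^esub>"
  using U_smult[of "\<zero>\<^bsub>H\<^esub>" 0] by simp

lemma U_norm: "x \<in> carrier H \<Longrightarrow> hnorm K (U x) = hnorm H x"
  by (simp add: hnorm_def inner)

lemma U_inj: "x \<in> carrier H \<Longrightarrow> y \<in> carrier H \<Longrightarrow> U x = U y \<Longrightarrow> x = y"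
  using bij by (auto simp: bij_betw_def inj_on_def)

lemma U_surj:
  assumes "y \<in> carrier K" obtains x where "x \<in> carrier H" "y = U x"
  using bij assms by (auto simp: bij_betw_def)

lemma U_converges:
  "(\<And>n. u n \<in> carrier H) \<Longrightarrow> x \<in> carrier H \<Longrightarrow>
    converges_in K (hnorm K) (\<lambda>n. U (u n)) (U x) \<longleftrightarrow> converges_in H (hnorm H) u x"
  by (simp add: converges_in_def U_norm flip: U_minus)

lemma op_norm_unitary:
  assumes "\<And>x. x \<in> carrier H \<Longrightarrow> T x \<in> carrier H" "\<And>x. x \<in> carrier H \<Longrightarrow> U (T x) = S (U x)"
  shows "op_norm K S = op_norm H T"
proof -
  have "{hnorm K (S y) |y. y \<in> carrier K \<and> hnorm K y \<le> 1} = {hnorm H (T x) |x. x \<in> carrier H \<and> hnorm H x \<le> 1}"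
    (is "?A = ?B")
  proof
    show "?A \<subseteq> ?B"
    proof
      fix r assume "r \<in> ?A"
      then obtain y where y: "y \<in> carrier K" "hnorm K y \<le> 1" "r = hnorm K (S y)" by blast
      then obtain x where "x \<in> carrier H" "y = U x" by (elim U_surj)
      then show "r \<in> ?B" using y assms U_norm[of "T x"] U_norm[of x] by auto
    qed
    show "?B \<subseteq> ?A"
    proof
      fix r assume "r \<in> ?B"
      then obtain x where x: "x \<in> carrier H" "hnorm H x \<le> 1" "r = hnorm H (T x)" by blast
      then have "r = hnorm K (S (U x)) \<and> U x \<in> carrier K \<and> hnorm K (U x) \<le> 1"
        using assms U_norm[of "T x"] U_norm[of x] by simp
      then show "r \<in> ?A" by blast
    qed
  qed
  then show ?thesis by (simp add: op_norm_def)
qed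

lemma inverse_unitary: "unitary K H (inv_into (carrier H) U)"
proof -
  let ?V = "inv_into (carrier H) U"
  have V: "?V y \<in> carrier H" "U (?V y) = y" if "y \<in> carrier K" for y
    using that bij by (auto simp: bij_betw_def inv_into_into f_inv_into_f)
  show ?thesis
  proof
    show "linear_on K H ?V"
      unfolding linear_on_def
    proof (intro conjI ballI allI)
      fix x y assume xy: "x \<in> carrier K" "y \<in> carrier K"
      show "?V (x \<oplus>\<^bsub>K\<^esub> y) = ?V x \<oplus>\<^bsub>H\<^esub> ?V y"
        by (rule U_inj) (use xy V in \<open>simp_all add: U_add\<close>)
    next
      fix c x assume x: "x \<in> carrier K"
      show "?V (c \<odot>\<^bsub>K\<^esub> x) = c \<odot>\<^bsub>H\<^esub> ?V x"
        by (rule U_inj) (use x V in \<open>simp_all add: U_smult\<close>)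
    qed (use V in simp)
    show "bij_betw ?V (carrier K) (carrier H)" by (rule bij_betw_inv_into[OF bij])
    show "hinner H (?V x) (?V y) = hinner K x y" if "x \<in> carrier K" "y \<in> carrier K" for x y
      using that V inner[of "?V x" "?V y"] by simp
  qed
qed

end

lemma unitarily_equivalent_iff:
  assumes "hilbert_space H" "hilbert_space K"
  shows "unitarily_equivalent A (H, L) (K, M) \<longleftrightarrow>
    (\<exists>U. unitary H K U \<and> (\<forall>a\<in>carrier A. \<forall>x\<in>carrier H. U (L a x) = M a (U x)))"
  using assms unfolding unitarily_equivalent_def unitary_def unitary_axioms_def hilbert_def by auto

lemma unitarily_equivalent_sym:
  assumes L: "star_rep A H L" and M: "star_rep A K M" and e: "unitarily_equivalent A (H, L) (K, M)"
  shows "unitarily_equivalent A (K, M) (H, L)"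
proof -
  have HK: "hilbert_space H" "hilbert_space K" using L M by (auto simp: star_rep_def)
  obtain U where U: "unitary H K U" "\<And>a x. a \<in> carrier A \<Longrightarrow> x \<in> carrier H \<Longrightarrow> U (L a x) = M a (U x)"
    using e[unfolded unitarily_equivalent_iff[OF HK]] by blast
  interpret unitary H K U by (rule U(1))
  let ?V = "inv_into (carrier H) U"
  have V: "?V y \<in> carrier H" "U (?V y) = y" if "y \<in> carrier K" for y
    using that bij by (auto simp: bij_betw_def inv_into_into f_inv_into_f)
  have Lc: "L a x \<in> carrier H" if "a \<in> carrier A" "x \<in> carrier H" for a x
    using L that H.bounded_opsD(1) by (auto simp: star_rep_def)
  have Mc: "M a x \<in> carrier K" if "a \<in> carrier A" "x \<in> carrier K" for a x
    using M that K.bounded_opsD(1) by (auto simp: star_rep_def)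
  have "?V (M a x) = L a (?V x)" if "a \<in> carrier A" "x \<in> carrier K" for a x
    by (rule U_inj) (use that V U(2) Lc Mc in auto)
  then show ?thesis using inverse_unitary unitarily_equivalent_iff[OF HK(2,1)] by blast
qed

lemma unitarily_equivalent_trans:
  assumes "hilbert_space H" "hilbert_space K" "hilbert_space J"
    and "unitarily_equivalent A (H, L) (K, M)" "unitarily_equivalent A (K, M) (J, N)"
  shows "unitarily_equivalent A (H, L) (J, N)"
proof -
  obtain U where U: "unitary H K U" "\<And>a x. a \<in> carrier A \<Longrightarrow> x \<in> carrier H \<Longrightarrow> U (L a x) = M a (U x)"
    using assms(4)[unfolded unitarily_equivalent_iff[OF assms(1,2)]] by blast
  obtain V where V: "unitary K J V" "\<And>a x. a \<in> carrier A \<Longrightarrow> x \<in> carrier K \<Longrightarrow> V (M a x) = N a (V x)"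
    using assms(5)[unfolded unitarily_equivalent_iff[OF assms(2,3)]] by blast
  interpret U: unitary H K U by (rule U(1))
  interpret V: unitary K J V by (rule V(1))
  have "unitary H J (V \<circ> U)"
  proof
    show "linear_on H J (V \<circ> U)"
      by (simp add: linear_on_def U.U_add U.U_smult V.U_add V.U_smult)
    show "bij_betw (V \<circ> U) (carrier H) (carrier J)" by (rule bij_betw_trans[OF U.bij V.bij])
  qed (simp add: U.inner V.inner)
  moreover have "(V \<circ> U) (L a x) = N a ((V \<circ> U) x)" if "a \<in> carrier A" "x \<in> carrier H" for a x
    using that U(2) V(2) by simp
  ultimately show ?thesis using unitarily_equivalent_iff[OF assms(1,3)] by blast
qed

lemma irreducible_rep_unitarily_equivalent:
  assumes L: "irreducible_rep A H L" and M: "star_rep A K M" and e: "unitarily_equivalent A (H, L) (K, M)"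
  shows "irreducible_rep A K M"
proof -
  have L': "star_rep A H L" using L by (simp add: irreducible_rep_def)
  then have HK: "hilbert_space H" "hilbert_space K" using M by (auto simp: star_rep_def)
  obtain U where U: "unitary H K U" "\<And>a x. a \<in> carrier A \<Longrightarrow> x \<in> carrier H \<Longrightarrow> U (L a x) = M a (U x)"
    using e[unfolded unitarily_equivalent_iff[OF HK]] by blast
  interpret unitary H K U by (rule U(1))
  have Lc: "L a x \<in> carrier H" if "a \<in> carrier A" "x \<in> carrier H" for a x
    using L' that H.bounded_opsD(1) by (auto simp: star_rep_def)
  show ?thesis
    unfolding irreducible_rep_def
  proof (intro conjI allI impI M)
    obtain a x where ax: "a \<in> carrier A" "x \<in> carrier H" "L a x \<noteq> \<zero>\<^bsub>H\<^esub>"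
      using L by (auto simp: irreducible_rep_def)
    then have "M a (U x) \<noteq> \<zero>\<^bsub>K\<^esub>"
      using U(2)[of a x] U_zero U_inj[of "L a x" "\<zero>\<^bsub>H\<^esub>"] Lc by auto
    then show "\<exists>a\<in>carrier A. \<exists>x\<in>carrier K. M a x \<noteq> \<zero>\<^bsub>K\<^esub>" using ax by blast
  next
    fix S assume S: "closed_subspace K (hnorm K) S" and inv: "\<forall>a\<in>carrier A. \<forall>x\<in>S. M a x \<in> S"
    note S' = K.closed_subspaceD[OF S]
    let ?T = "{x \<in> carrier H. U x \<in> S}"
    have "closed_subspace H (hnorm H) ?T"
    proof (rule H.closed_subspaceI)
      fix u x assume u: "\<And>n. u n \<in> ?T" and x: "x \<in> carrier H" "converges_in H (hnorm H) u x"
      have "converges_in K (hnorm K) (\<lambda>n. U (u n)) (U x)" using u x by (subst U_converges) auto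
      then have "U x \<in> S" using u x by (auto intro!: S'(5)[of "\<lambda>n. U (u n)" "U x"])
      then show "x \<in> ?T" using x by simp
    qed (use S' in \<open>auto simp: U_zero U_add U_smult\<close>)
    moreover have "\<forall>a\<in>carrier A. \<forall>x\<in>?T. L a x \<in> ?T" using inv U(2) Lc by auto
    ultimately consider "?T = {\<zero>\<^bsub>H\<^esub>}" | "?T = carrier H"
      using L unfolding irreducible_rep_def by blast
    then show "S = {\<zero>\<^bsub>K\<^esub>} \<or> S = carrier K"
    proof cases
      case 1
      have "y = \<zero>\<^bsub>K\<^esub>" if y: "y \<in> S" for y
      proof -
        obtain x where x: "x \<in> carrier H" "y = U x" using y S'(1) by (meson U_surj subsetD)
        then have "x \<in> ?T" using y by simp
        then show ?thesis using 1 x U_zero by auto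
      qed
      then show ?thesis using S'(2) by blast
    next
      case 2
      have "y \<in> S" if y: "y \<in> carrier K" for y
      proof -
        obtain x where x: "x \<in> carrier H" "y = U x" using y by (rule U_surj)
        then have "x \<in> ?T" using 2 by blast
        then show ?thesis using x by simp
      qed
      then show ?thesis using S'(1) by blast
    qed
  qed
qed

lemma irreducible_rep_star_rep: "irreducible_rep A H L \<Longrightarrow> star_rep A H L"
  by (simp add: irreducible_rep_def)

lemma star_rep_hilbert: "star_rep A H L \<Longrightarrow> hilbert_space H"
  by (simp add: star_rep_def)

lemma rep_class_eqI:
  assumes L: "star_rep A H L" and M: "star_rep A K M" and e: "unitarily_equivalent A (H, L) (K, M)"
  shows "rep_class A (H, L) = rep_class A (K, M)"
proof -
  have e': "unitarily_equivalent A (K, M) (H, L)" by (rule unitarily_equivalent_sym[OF L M e])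
  have "unitarily_equivalent A (H, L) (J, N) \<longleftrightarrow> unitarily_equivalent A (K, M) (J, N)"
    if "irreducible_rep A J N" for J :: "'j hilbert" and N
    using unitarily_equivalent_trans[OF star_rep_hilbert[OF L] star_rep_hilbert[OF M] _ e]
      unitarily_equivalent_trans[OF star_rep_hilbert[OF M] star_rep_hilbert[OF L] _ e']
      star_rep_hilbert[OF irreducible_rep_star_rep[OF that]] by blast
  then show ?thesis unfolding rep_class_def by auto
qed

subsection \<open>Transporting a representation along an injection\<close>

text \<open>The structure that makes \<open>j\<close> a unitary onto its image.\<close>

definition transport_hilbert :: "('h \<Rightarrow> 'k) \<Rightarrow> 'h hilbert \<Rightarrow> 'k hilbert" where
  "transport_hilbert j H = (let i = inv_into (carrier H) j in \<lparr>carrier = j ` carrier H, mult = undefined,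
     one = undefined, zero = j \<zero>\<^bsub>H\<^esub>, add = (\<lambda>x y. j (i x \<oplus>\<^bsub>H\<^esub> i y)), smult = (\<lambda>c x. j (c \<odot>\<^bsub>H\<^esub> i x)),
     hinner = (\<lambda>x y. hinner H (i x) (i y))\<rparr>)"

definition transport_rep :: "('h \<Rightarrow> 'k) \<Rightarrow> 'h hilbert \<Rightarrow> ('a \<Rightarrow> 'h \<Rightarrow> 'h) \<Rightarrow> 'a \<Rightarrow> 'k \<Rightarrow> 'k" where
  "transport_rep j H L a = restrict (\<lambda>x. j (L a (inv_into (carrier H) j x))) (j ` carrier H)"



lemma unitary_transport:
  assumes H': "hilbert_space H0" and j: "inj_on j (carrier H0)"
  shows "unitary H0 (transport_hilbert j H0) j"
proof -
  interpret H: hilbert H0 using H' by (simp add: hilbert_def)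
  let ?K = "transport_hilbert j H0"
  let ?i = "inv_into (carrier H0) j"
  have i [simp]: "?i (j x) = x" if "x \<in> carrier H0" for x using that j by simp
  have K [simp]: "carrier ?K = j ` carrier H0" "add ?K x y = j (?i x \<oplus>\<^bsub>H0\<^esub> ?i y)"
    "smult ?K c x = j (c \<odot>\<^bsub>H0\<^esub> ?i x)" "hinner ?K x y = hinner H0 (?i x) (?i y)" "\<zero>\<^bsub>?K\<^esub> = j \<zero>\<^bsub>H0\<^esub>" for x y c
    by (simp_all add: transport_hilbert_def Let_def)
  have mod: "module complex_ring ?K"
    by (rule complex_moduleI) (auto simp: H.M.a_ac H.smult_simps H.smult_add_left)
  then interpret K: complex_module ?K by (simp add: complex_module_def)
  have minus: "j x \<ominus>\<^bsub>?K\<^esub> j y = j (x \<ominus>\<^bsub>H0\<^esub> y)" if "x \<in> carrier H0" "y \<in> carrier H0" for x y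
    using that by (simp add: K.a_minus_eq H.a_minus_eq)
  have norm: "hnorm ?K (j x) = hnorm H0 x" if "x \<in> carrier H0" for x using that by (simp add: hnorm_def)
  have "complete_in ?K (hnorm ?K)"
    unfolding complete_in_def
  proof (intro allI impI)
    fix u assume u: "cauchy_in ?K (hnorm ?K) u"
    define v where "v n = ?i (u n)" for n
    have v: "v n \<in> carrier H0" "u n = j (v n)" for n
      using u j by (auto simp: cauchy_in_def v_def inv_into_into f_inv_into_f)
    then have u_eq: "u = (\<lambda>n. j (v n))" by auto
    have "cauchy_in H0 (hnorm H0) v"
      using u v(1) unfolding u_eq cauchy_in_def by (simp add: minus norm)
    then obtain x where x: "x \<in> carrier H0" "converges_in H0 (hnorm H0) v x"
      using H.complete unfolding complete_in_def by blast
    then have "converges_in ?K (hnorm ?K) u (j x)"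
      using v(1) unfolding u_eq converges_in_def by (simp add: minus norm)
    then show "\<exists>x\<in>carrier ?K. converges_in ?K (hnorm ?K) u x" using x by auto
  qed
  then have "hilbert_space ?K"
    unfolding hilbert_space_def
  proof (intro conjI mod)
    show "\<forall>x\<in>carrier ?K. \<forall>y\<in>carrier ?K. hinner ?K y x = cnj (hinner ?K x y)"
      by simp (blast intro: H.inner_commute)
    show "\<forall>x\<in>carrier ?K. 0 \<le> Re (hinner ?K x x) \<and> (hinner ?K x x = 0 \<longrightarrow> x = \<zero>\<^bsub>?K\<^esub>)"
      using H.inner_Re_ge0 H.inner_zero_imp by auto
  qed (simp_all add: H.inner_add_left H.inner_smult_left)
  then interpret K: hilbert ?K by (simp add: hilbert_def)
  show ?thesis
    by unfold_locales (use j in \<open>auto simp: linear_on_def bij_betw_def\<close>)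
qed

lemma star_rep_transport:
  assumes A: "is_star_algebra A" and L: "star_rep A H L" and j: "inj_on j (carrier H)"
  shows "star_rep A (transport_hilbert j H) (transport_rep j H L)"
    "unitarily_equivalent A (H, L) (transport_hilbert j H, transport_rep j H L)"
    "a \<in> carrier A \<Longrightarrow> op_norm (transport_hilbert j H) (transport_rep j H L a) = op_norm H (L a)"
proof -
  have H: "hilbert_space H" using L by (rule star_rep_hilbert)
  interpret H: hilbert H using H by (simp add: hilbert_def)
  let ?K = "transport_hilbert j H" and ?M = "transport_rep j H L"
  interpret unitary H ?K j by (rule unitary_transport[OF H j])
  have i [simp]: "inv_into (carrier H) j (j x) = x" if "x \<in> carrier H" for x using that j by simp
  have K: "carrier ?K = j ` carrier H" by (simp add: transport_hilbert_def Let_def)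
  have M: "?M a (j x) = j (L a x)" if "x \<in> carrier H" for a x using that by (simp add: transport_rep_def)
  have B: "L a \<in> bounded_ops H" if "a \<in> carrier A" for a using L that by (simp add: star_rep_def)
  note Lc = H.bounded_opsD(1)[OF B]
  have MB: "?M a \<in> bounded_ops ?K" if a: "a \<in> carrier A" for a
  proof (rule K.bounded_opsI)
    show "?M a \<in> extensional (carrier ?K)" by (simp add: transport_rep_def K)
    fix x assume x: "x \<in> carrier ?K"
    then obtain x' where x': "x' \<in> carrier H" "x = j x'" by (rule U_surj)
    show "?M a x \<in> carrier ?K" using x' a M Lc by simp
    show "?M a (c \<odot>\<^bsub>?K\<^esub> x) = c \<odot>\<^bsub>?K\<^esub> ?M a x" for c
      using x' a M Lc by (simp add: H.bounded_opsD[OF B] flip: U_smult)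
    show "hnorm ?K (?M a x) \<le> op_norm H (L a) * hnorm ?K x"
      using x' a M Lc U_norm H.hnorm_le_op_norm[OF H.bounded_ops_lin_bounded[OF B]] by simp
    fix y assume y: "y \<in> carrier ?K"
    then obtain y' where y': "y' \<in> carrier H" "y = j y'" by (rule U_surj)
    show "?M a (x \<oplus>\<^bsub>?K\<^esub> y) = ?M a x \<oplus>\<^bsub>?K\<^esub> ?M a y"
      using x' y' a M Lc by (simp add: H.bounded_opsD[OF B] flip: U_add)
  qed
  show "star_rep A ?K ?M"
    unfolding star_rep_def
  proof (intro conjI ballI allI)
    show "hilbert_space ?K" by (rule K.hilbert_space)
    fix a b x assume ab: "a \<in> carrier A" "b \<in> carrier A" and x: "x \<in> carrier ?K"
    obtain x' where x': "x' \<in> carrier H" "x = j x'" using x by (rule U_surj)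
    show "?M (a \<oplus>\<^bsub>A\<^esub> b) x = ?M a x \<oplus>\<^bsub>?K\<^esub> ?M b x"
      using L ab x' M Lc by (simp add: star_rep_def flip: U_add)
    show "?M (a \<otimes>\<^bsub>A\<^esub> b) x = ?M a (?M b x)"
      using L ab x' M Lc by (simp add: star_rep_def)
  next
    fix c a x assume a: "a \<in> carrier A" and x: "x \<in> carrier ?K"
    obtain x' where x': "x' \<in> carrier H" "x = j x'" using x by (rule U_surj)
    show "?M (c \<odot>\<^bsub>A\<^esub> a) x = c \<odot>\<^bsub>?K\<^esub> ?M a x"
      using L a x' M Lc by (simp add: star_rep_def flip: U_smult)
  next
    fix a x y assume a: "a \<in> carrier A" and x: "x \<in> carrier ?K" and y: "y \<in> carrier ?K"
    obtain x' where x': "x' \<in> carrier H" "x = j x'" using x by (rule U_surj)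
    obtain y' where y': "y' \<in> carrier H" "y = j y'" using y by (rule U_surj)
    show "hinner ?K (?M a x) y = hinner ?K x (?M (astar A a) y)"
      using L a x' y' M Lc star_alg.star_closed[OF star_alg.intro[OF A] a] by (simp add: star_rep_def inner)
  qed (rule MB)
  show "unitarily_equivalent A (H, L) (?K, ?M)"
    using unitarily_equivalent_iff[OF H K.hilbert_space] unitary_transport[OF H j] M by metis
  show "op_norm ?K (?M a) = op_norm H (L a)" if "a \<in> carrier A"
    by (rule op_norm_unitary) (use that Lc M in auto)
qed

subsection \<open>Irreducible representations are determined by one vector state\<close>

lemma rep_intro: "is_star_algebra A \<Longrightarrow> star_rep A H L \<Longrightarrow> rep A H L"
  by (simp add: rep_def rep_axioms_def star_alg_def hilbert_def star_rep_hilbert)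

context rep begin

abbreviation "orbit_space x \<equiv> {L a x | a. a \<in> carrier A}"

lemma orbit_space_submodule:
  assumes "x \<in> carrier H" shows "submodule (orbit_space x) complex_ring H"
  unfolding H.submodule_iff
proof (intro conjI ballI allI)
  show "\<zero>\<^bsub>H\<^esub> \<in> orbit_space x" using L_zero[OF assms] by (auto intro!: exI[of _ \<zero>])
  fix y z assume "y \<in> orbit_space x" "z \<in> orbit_space x"
  then obtain a b where "a \<in> carrier A" "b \<in> carrier A" "y = L a x" "z = L b x" by blast
  then show "y \<oplus>\<^bsub>H\<^esub> z \<in> orbit_space x" using assms by (auto intro!: exI[of _ "a \<oplus> b"] simp: L_add)
next
  fix c y assume "y \<in> orbit_space x"
  then obtain a where "a \<in> carrier A" "y = L a x" by blast
  then show "c \<odot>\<^bsub>H\<^esub> y \<in> orbit_space x" using assms by (auto intro!: exI[of _ "c \<odot> a"] simp: L_smult)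
qed (use assms in auto)

text \<open>The closure of the orbit of \<open>x\<close> is invariant. If it were zero, then \<open>x\<close> would lie in the invariant subspace
  of the vectors that all operators annihilate, and the representation would be zero.\<close>

lemma irreducible_cyclic:
  assumes irr: "irreducible_rep A H L" and x: "x \<in> carrier H" "x \<noteq> \<zero>\<^bsub>H\<^esub>"
  shows "H.limit_points (orbit_space x) = carrier H"
proof -
  let ?S = "H.limit_points (orbit_space x)"
  have dichotomy: "S = {\<zero>\<^bsub>H\<^esub>} \<or> S = carrier H"
    if "closed_subspace H (hnorm H) S" "\<forall>a\<in>carrier A. \<forall>y\<in>S. L a y \<in> S" for S
    using irr that unfolding irreducible_rep_def by blast
  have sub: "orbit_space x \<subseteq> carrier H" using x by auto
  have S: "closed_subspace H (hnorm H) ?S"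
    by (rule H.closed_subspace_limit_points[OF orbit_space_submodule[OF x(1)]])
  have "L b y \<in> ?S" if b: "b \<in> carrier A" and y: "y \<in> ?S" for b y
  proof -
    have "orbit_space x \<subseteq> {y \<in> carrier H. L b y \<in> ?S}"
    proof
      fix z assume "z \<in> orbit_space x"
      then obtain a where a: "a \<in> carrier A" "z = L a x" by blast
      then have "L b z \<in> orbit_space x" using b x by (auto intro!: exI[of _ "b \<otimes> a"] simp: L_mult)
      then show "z \<in> {y \<in> carrier H. L b y \<in> ?S}" using a x H.subset_limit_points[OF sub] by auto
    qed
    from H.limit_points_subset[OF H.kernel_closed_subspace[OF L_bounded[OF b] S] this] y
    show ?thesis by blast
  qed
  then have "?S = {\<zero>\<^bsub>H\<^esub>} \<or> ?S = carrier H" using dichotomy[OF S] by blast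
  moreover have "?S \<noteq> {\<zero>\<^bsub>H\<^esub>}"
  proof
    assume S0: "?S = {\<zero>\<^bsub>H\<^esub>}"
    let ?K = "\<Inter>a\<in>carrier A. {y \<in> carrier H. L a y \<in> {\<zero>\<^bsub>H\<^esub>}}"
    have "closed_subspace H (hnorm H) ?K"
      by (intro H.closed_subspace_INT H.kernel_closed_subspace[OF L_bounded H.closed_subspace_zero_H])
        (use M.zero_closed in blast)+
    moreover have "\<forall>a\<in>carrier A. \<forall>y\<in>?K. L a y \<in> ?K"
      by (auto simp: L_lin)
    moreover have "x \<in> ?K"
      using S0 H.subset_limit_points[OF sub] x by blast
    ultimately have "?K = carrier H" using dichotomy[of ?K] x(2) by blast
    then have "\<forall>a\<in>carrier A. \<forall>y\<in>carrier H. L a y = \<zero>\<^bsub>H\<^esub>" by blast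
    then show False using irr unfolding irreducible_rep_def by blast
  qed
  ultimately show ?thesis by blast
qed

text \<open>A closed subspace that contains all \<open>L a x\<close> is invariant.\<close>

lemma irreducible_nondegenerate:
  assumes irr: "irreducible_rep A H L"
  shows "nondegenerate A H L"
proof -
  let ?E = "{L a x | a x. a \<in> carrier A \<and> x \<in> carrier H}"
  have "S = carrier H" if S: "closed_subspace H (hnorm H) S" "?E \<subseteq> S" for S
  proof -
    have "\<forall>a\<in>carrier A. \<forall>x\<in>S. L a x \<in> S" using S H.closed_subspaceD(1)[OF S(1)] by blast
    then have "S = {\<zero>\<^bsub>H\<^esub>} \<or> S = carrier H" using irr S(1) unfolding irreducible_rep_def by blast
    moreover obtain a x where "a \<in> carrier A" "x \<in> carrier H" "L a x \<noteq> \<zero>\<^bsub>H\<^esub>"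
      using irr unfolding irreducible_rep_def by blast
    then have "S \<noteq> {\<zero>\<^bsub>H\<^esub>}" using S(2) by blast
    ultimately show ?thesis by blast
  qed
  then have "{S. closed_subspace H (hnorm H) S \<and> ?E \<subseteq> S} = {carrier H}"
    using H.closed_subspace_carrier by auto
  then show ?thesis by (simp add: nondegenerate_def closed_span_def)
qed

end

text \<open>The setting of the uniqueness part of the GNS construction: two cyclic vectors with the same vector state.\<close>

locale same_state = H: rep A H L + K: rep A K M
  for A :: "('a, 'm) star_algebra_scheme" (structure) and H :: "'h hilbert" and L
    and K :: "'k hilbert" and M +
  fixes x y
  assumes x: "x \<in> carrier H" and y: "y \<in> carrier K"
    and cyclic_x: "H.H.limit_points {L a x | a. a \<in> carrier A} = carrier H"
    and cyclic_y: "K.H.limit_points {M a y | a. a \<in> carrier A} = carrier K"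
    and state: "a \<in> carrier A \<Longrightarrow> hinner H (L a x) x = hinner K (M a y) y"
begin

lemma state2:
  assumes a: "a \<in> carrier A" and b: "b \<in> carrier A"
  shows "hinner H (L a x) (L b x) = hinner K (M a y) (M b y)"
  using state[of "astar A b \<otimes> a"] a b x y
  by (simp add: H.L_adj' K.L_adj' H.L_mult K.L_mult)

text \<open>Vectors of the two spaces correspond if they have the same inner products with the cyclic
  families. The correspondence is the graph of the unitary.\<close>

definition corr :: "'h \<Rightarrow> 'k \<Rightarrow> bool" where
  "corr u v \<longleftrightarrow> u \<in> carrier H \<and> v \<in> carrier K \<and>
    (\<forall>b\<in>carrier A. hinner K v (M b y) = hinner H u (L b x))"

lemma corr_unique: assumes "corr u v" "corr u v'" shows "v = v'"
proof (rule K.H.eqI_inner_dense)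
  show "{M a y | a. a \<in> carrier A} \<subseteq> carrier K" using y by auto
qed (use assms cyclic_y in \<open>auto simp: corr_def\<close>)

lemma corr_limit:
  assumes u: "u \<in> carrier H"
  obtains a v where "\<forall>n. a n \<in> carrier A" "converges_in H (hnorm H) (\<lambda>n. L (a n) x) u"
    "converges_in K (hnorm K) (\<lambda>n. M (a n) y) v" "corr u v"
proof -
  have "u \<in> H.H.limit_points {L a x | a. a \<in> carrier A}" using u cyclic_x by simp
  then obtain w where w: "\<forall>n. w n \<in> {L a x | a. a \<in> carrier A}" "converges_in H (hnorm H) w u"
    by (rule H.H.limit_pointsE)
  then have "\<forall>n. \<exists>a. a \<in> carrier A \<and> w n = L a x" by blast
  then obtain a where a: "\<And>n. a n \<in> carrier A" "\<And>n. w n = L (a n) x" by metis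
  then have conv: "converges_in H (hnorm H) (\<lambda>n. L (a n) x) u"
    using w(2) ext[of w "\<lambda>n. L (a n) x", OF a(2)] by simp
  note [simp] = a(1) x y
  have norm: "hnorm K (M (a m) y \<ominus>\<^bsub>K\<^esub> M (a n) y) = hnorm H (L (a m) x \<ominus>\<^bsub>H\<^esub> L (a n) x)" for m n
    using state2[of "a m \<ominus> a n" "a m \<ominus> a n"]
    by (simp add: hnorm_def H.L_minus K.L_minus)
  have "cauchy_in H (hnorm H) (\<lambda>n. L (a n) x)"
    using conv u by (intro H.H.converges_in_cauchy) auto
  then have "cauchy_in K (hnorm K) (\<lambda>n. M (a n) y)"
    by (simp add: cauchy_in_def norm)
  then obtain v where v: "v \<in> carrier K" "converges_in K (hnorm K) (\<lambda>n. M (a n) y) v"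
    using K.H.complete unfolding complete_in_def by blast
  have "hinner K v (M b y) = hinner H u (L b x)" if b: "b \<in> carrier A" for b
  proof -
    have "(\<lambda>n. hinner K (M (a n) y) (M b y)) \<longlonglongrightarrow> hinner K v (M b y)"
      using v b by (intro K.H.converges_in_inner) auto
    moreover have "(\<lambda>n. hinner H (L (a n) x) (L b x)) \<longlonglongrightarrow> hinner H u (L b x)"
      using u conv b by (intro H.H.converges_in_inner) auto
    ultimately show ?thesis using state2[OF a(1) b] LIMSEQ_unique by auto
  qed
  then have "corr u v" using u v by (simp add: corr_def)
  then show thesis using that[OF _ conv v(2)] a(1) by blast
qed

lemma corr_inner: assumes c: "corr u v" "corr u' v'" shows "hinner K v v' = hinner H u u'"
proof -
  have u': "u' \<in> carrier H" using c by (simp add: corr_def)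
  then obtain a w where a: "\<forall>n. a n \<in> carrier A" "converges_in H (hnorm H) (\<lambda>n. L (a n) x) u'"
    "converges_in K (hnorm K) (\<lambda>n. M (a n) y) w" "corr u' w" by (rule corr_limit)
  have w: "w = v'" using corr_unique[OF a(4) c(2)] .
  have "(\<lambda>n. hinner K v (M (a n) y)) \<longlonglongrightarrow> hinner K v v'"
    using a(1,3) c y w by (intro K.H.converges_in_inner_right) (auto simp: corr_def)
  moreover have "(\<lambda>n. hinner H u (L (a n) x)) \<longlonglongrightarrow> hinner H u u'"
    using a(1,2) c x by (intro H.H.converges_in_inner_right) (auto simp: corr_def)
  moreover have "(\<lambda>n. hinner K v (M (a n) y)) = (\<lambda>n. hinner H u (L (a n) x))"
    using c(1) a(1) by (simp add: corr_def)
  ultimately show ?thesis using LIMSEQ_unique by metis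
qed

end

text \<open>The correspondence is defined symmetrically in the two representations. What makes it a function
  therefore also makes it injective, and what makes it total also makes it surjective.\<close>

lemma (in same_state) unitarily_equivalent: "unitarily_equivalent A (H, L) (K, M)"
proof -
  interpret swap: same_state A K M H L y x
    by unfold_locales (use x y cyclic_x cyclic_y state in auto)
  have swap: "swap.corr v u \<longleftrightarrow> corr u v" for u v by (auto simp: corr_def swap.corr_def)
  define U where "U u = (THE v. corr u v)" for u
  have U: "corr u (U u)" if u: "u \<in> carrier H" for u
  proof -
    obtain v where "corr u v" using corr_limit[OF u] by metis
    then have "\<exists>!v. corr u v" using corr_unique by blast
    then show ?thesis unfolding U_def by (rule theI')
  qed
  have U_eq: "U u = v" if "corr u v" for u v
    using corr_unique[OF U that] that by (auto simp: corr_def)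
  have Uc: "U u \<in> carrier K" if "u \<in> carrier H" for u using U[OF that] by (simp add: corr_def)
  note [simp] = x y
  have "unitary H K U"
  proof
    show "linear_on H K U"
      unfolding linear_on_def
    proof (intro conjI ballI allI)
      fix u u' assume u: "u \<in> carrier H" "u' \<in> carrier H"
      have "corr (u \<oplus>\<^bsub>H\<^esub> u') (U u \<oplus>\<^bsub>K\<^esub> U u')"
        using U[OF u(1)] U[OF u(2)] by (simp add: corr_def H.H.inner_add_left K.H.inner_add_left)
      then show "U (u \<oplus>\<^bsub>H\<^esub> u') = U u \<oplus>\<^bsub>K\<^esub> U u'" by (rule U_eq)
    next
      fix c u assume u: "u \<in> carrier H"
      have "corr (c \<odot>\<^bsub>H\<^esub> u) (c \<odot>\<^bsub>K\<^esub> U u)"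
        using U[OF u] by (simp add: corr_def H.H.inner_smult_left K.H.inner_smult_left)
      then show "U (c \<odot>\<^bsub>H\<^esub> u) = c \<odot>\<^bsub>K\<^esub> U u" by (rule U_eq)
    qed (rule Uc)
    show "bij_betw U (carrier H) (carrier K)"
    proof (rule bij_betwI')
      fix u u' assume u: "u \<in> carrier H" "u' \<in> carrier H"
      show "U u = U u' \<longleftrightarrow> u = u'"
        using swap.corr_unique[of "U u" u u'] U[OF u(1)] U[OF u(2)] by (auto simp: swap)
    next
      fix v assume v: "v \<in> carrier K"
      obtain u where "swap.corr v u" using swap.corr_limit[OF v] by metis
      then have "corr u v" by (simp add: swap)
      then show "\<exists>u\<in>carrier H. v = U u" using U_eq by (auto simp: corr_def intro!: bexI[of _ u])
    qed (rule Uc)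
    show "hinner K (U u) (U u') = hinner H u u'" if "u \<in> carrier H" "u' \<in> carrier H" for u u'
      by (rule corr_inner[OF U U]) (use that in auto)
  qed
  moreover have "U (L a u) = M a (U u)" if a: "a \<in> carrier A" and u: "u \<in> carrier H" for a u
  proof (rule U_eq)
    have "hinner K (M a (U u)) (M b y) = hinner H (L a u) (L b x)" if b: "b \<in> carrier A" for b
      using U[OF u] a b u Uc[OF u]
      by (simp add: corr_def H.L_adj K.L_adj flip: H.L_mult K.L_mult)
    then show "corr (L a u) (M a (U u))" using a u Uc by (simp add: corr_def)
  qed
  ultimately show ?thesis
    using unitarily_equivalent_iff[OF H.H.hilbert_space K.H.hilbert_space] by blast
qed

text \<open>In an irreducible representation every nonzero vector is cyclic.\<close>

theorem irreducible_same_state_equivalent: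
  assumes A: "is_star_algebra A" and L: "irreducible_rep A H L" and M: "irreducible_rep A K M"
    and x: "x \<in> carrier H" "x \<noteq> \<zero>\<^bsub>H\<^esub>" and y: "y \<in> carrier K" "y \<noteq> \<zero>\<^bsub>K\<^esub>"
    and state: "\<And>a. a \<in> carrier A \<Longrightarrow> hinner H (L a x) x = hinner K (M a y) y"
  shows "unitarily_equivalent A (H, L) (K, M)"
proof -
  interpret H: rep A H L using A L by (intro rep_intro irreducible_rep_star_rep)
  interpret K: rep A K M using A M by (intro rep_intro irreducible_rep_star_rep)
  interpret same_state A H L K M x y
    by unfold_locales (use x y state H.irreducible_cyclic[OF L x] K.irreducible_cyclic[OF M y] in auto)
  show ?thesis by (rule unitarily_equivalent)
qed

subsection \<open>Extending representations to the completion\<close>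

locale contractive_rep = cstar_seminormed_alg A + rep A H L
  for A :: "('a, 'm) normed_star_algebra_scheme" (structure) and H :: "'h hilbert" and L +
  assumes contractive: "a \<in> carrier A \<Longrightarrow> op_norm H (L a) \<le> anorm A a"
begin

lemma hnorm_L_le: "a \<in> carrier A \<Longrightarrow> x \<in> carrier H \<Longrightarrow> hnorm H (L a x) \<le> anorm A a * hnorm H x"
  using hnorm_L[of a x] mult_right_mono[OF contractive, of a "hnorm H x"] by simp

lemma cauchy_L:
  assumes u: "cauchy u" and x: "x \<in> carrier H"
  shows "cauchy_in H (hnorm H) (\<lambda>n. L (u n) x)"
  unfolding cauchy_in_def
proof (intro conjI allI impI)
  note [simp] = cauchy_carrier[OF u] x
  fix e :: real assume e: "e > 0"
  have pos: "hnorm H x + 1 > 0" using H.hnorm_ge0[OF x] by linarith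
  then obtain M where M: "\<forall>m\<ge>M. \<forall>n\<ge>M. anorm A (u m \<ominus> u n) < e / (hnorm H x + 1)"
    using u e unfolding cauchy_in_def by (metis divide_pos_pos)
  show "\<exists>M. \<forall>m\<ge>M. \<forall>n\<ge>M. hnorm H (L (u m) x \<ominus>\<^bsub>H\<^esub> L (u n) x) < e"
  proof (intro exI allI impI)
    fix m n assume "M \<le> m" "M \<le> n"
    then have "anorm A (u m \<ominus> u n) * (hnorm H x + 1) < e" using M pos by (simp add: pos_less_divide_eq)
    moreover have "anorm A (u m \<ominus> u n) * hnorm H x \<le> anorm A (u m \<ominus> u n) * (hnorm H x + 1)"
      using anorm_ge0 by (intro mult_left_mono) auto
    ultimately show "hnorm H (L (u m) x \<ominus>\<^bsub>H\<^esub> L (u n) x) < e"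
      using hnorm_L_le[of "u m \<ominus> u n" x] by (simp add: L_minus)
  qed
qed (use cauchy_carrier[OF u] x in auto)

text \<open>The pointwise limit exists because contractivity turns Cauchy sequences of the algebra into Cauchy
  sequences of vectors.\<close>

definition lim_op :: "(nat \<Rightarrow> 'a) \<Rightarrow> 'h \<Rightarrow> 'h" where
  "lim_op u = restrict (\<lambda>x. SOME y. y \<in> carrier H \<and> converges_in H (hnorm H) (\<lambda>n. L (u n) x) y) (carrier H)"

lemma lim_op:
  assumes "cauchy u" "x \<in> carrier H"
  shows "lim_op u x \<in> carrier H" "converges_in H (hnorm H) (\<lambda>n. L (u n) x) (lim_op u x)"
proof -
  have "\<exists>y. y \<in> carrier H \<and> converges_in H (hnorm H) (\<lambda>n. L (u n) x) y"
    using H.complete cauchy_L[OF assms] unfolding complete_in_def by blast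
  from someI_ex[OF this] show "lim_op u x \<in> carrier H" "converges_in H (hnorm H) (\<lambda>n. L (u n) x) (lim_op u x)"
    using assms by (simp_all add: lim_op_def)
qed

lemma lim_opI:
  assumes "cauchy u" "x \<in> carrier H" "y \<in> carrier H" "converges_in H (hnorm H) (\<lambda>n. L (u n) x) y"
  shows "lim_op u x = y"
  by (rule H.converges_in_unique[of "\<lambda>n. L (u n) x"]) (use assms lim_op cauchy_carrier in auto)

lemma lim_op_bounded_ops:
  assumes u: "cauchy u"
  shows "lim_op u \<in> bounded_ops H"
proof -
  note [simp] = cauchy_carrier[OF u] lim_op(1)[OF u]
  obtain B where B: "B > 0" "\<And>n. anorm A (u n) \<le> B" using cauchy_bounded[OF u] by blast
  show ?thesis
  proof (rule H.bounded_opsI)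
    show "lim_op u \<in> extensional (carrier H)" by (simp add: lim_op_def)
    fix x assume x [simp]: "x \<in> carrier H"
    show "lim_op u x \<in> carrier H" by simp
    show "lim_op u (c \<odot>\<^bsub>H\<^esub> x) = c \<odot>\<^bsub>H\<^esub> lim_op u x" for c
      using H.converges_in_smult[OF _ _ lim_op(2)[OF u x], of c] by (intro lim_opI[OF u]) (simp_all add: L_lin)
    show "hnorm H (lim_op u x) \<le> B * hnorm H x"
    proof (rule LIMSEQ_le_const2)
      show "(\<lambda>n. hnorm H (L (u n) x)) \<longlonglongrightarrow> hnorm H (lim_op u x)"
        by (rule H.converges_in_N[OF _ _ lim_op(2)[OF u x]]) simp_all
      have "hnorm H (L (u n) x) \<le> B * hnorm H x" for n
        using hnorm_L_le[of "u n" x] mult_right_mono[OF B(2)[of n], of "hnorm H x"] by simp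
      then show "\<exists>N. \<forall>n\<ge>N. hnorm H (L (u n) x) \<le> B * hnorm H x" by blast
    qed
    fix y assume y [simp]: "y \<in> carrier H"
    show "lim_op u (x \<oplus>\<^bsub>H\<^esub> y) = lim_op u x \<oplus>\<^bsub>H\<^esub> lim_op u y"
      using H.converges_in_add[OF _ _ lim_op(2)[OF u x] _ _ lim_op(2)[OF u y]]
      by (intro lim_opI[OF u]) (simp_all add: L_lin)
  qed
qed

lemma lim_op_norm:
  assumes u: "cauchy u"
  shows "(\<lambda>n. op_norm H (\<lambda>x. L (u n) x \<ominus>\<^bsub>H\<^esub> lim_op u x)) \<longlonglongrightarrow> 0"
proof (rule LIMSEQ_I)
  note [simp] = cauchy_carrier[OF u] lim_op(1)[OF u]
  fix e :: real assume e: "e > 0"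
  obtain M where M: "\<forall>m\<ge>M. \<forall>n\<ge>M. anorm A (u m \<ominus> u n) < e / 2"
    using u e unfolding cauchy_in_def by (metis half_gt_zero)
  have lb: "H.lin_bounded (\<lambda>x. L (u n) x \<ominus>\<^bsub>H\<^esub> lim_op u x)" for n
    using u by (intro H.lin_bounded_minus H.bounded_ops_lin_bounded L_bounded lim_op_bounded_ops) auto
  have "op_norm H (\<lambda>x. L (u n) x \<ominus>\<^bsub>H\<^esub> lim_op u x) \<le> e / 2" if n: "n \<ge> M" for n
  proof (rule H.op_norm_le)
    fix x assume x [simp]: "x \<in> carrier H"
    have conv: "converges_in H (hnorm H) (\<lambda>m. L (u n) x \<oplus>\<^bsub>H\<^esub> (-1) \<odot>\<^bsub>H\<^esub> L (u m) x) (L (u n) x \<oplus>\<^bsub>H\<^esub> (-1) \<odot>\<^bsub>H\<^esub> lim_op u x)"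
      by (rule H.converges_in_add[OF _ _ H.converges_in_const _ _ H.converges_in_smult[OF _ _ lim_op(2)[OF u x]]]) simp_all
    show "hnorm H (L (u n) x \<ominus>\<^bsub>H\<^esub> lim_op u x) \<le> e / 2 * hnorm H x"
    proof (rule LIMSEQ_le_const2)
      show "(\<lambda>m. hnorm H (L (u n) x \<ominus>\<^bsub>H\<^esub> L (u m) x)) \<longlonglongrightarrow> hnorm H (L (u n) x \<ominus>\<^bsub>H\<^esub> lim_op u x)"
        using H.converges_in_N[OF _ _ conv] by (simp add: H.a_minus_eq)
      have "hnorm H (L (u n) x \<ominus>\<^bsub>H\<^esub> L (u m) x) \<le> e / 2 * hnorm H x" if "m \<ge> M" for m
        using hnorm_L_le[of "u n \<ominus> u m" x] mult_right_mono[of "anorm A (u n \<ominus> u m)" "e / 2" "hnorm H x"] M n that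
        by (force simp: L_minus)
      then show "\<exists>N. \<forall>m\<ge>N. hnorm H (L (u n) x \<ominus>\<^bsub>H\<^esub> L (u m) x) \<le> e / 2 * hnorm H x" by blast
    qed
  qed (use e in simp)
  then have "norm (op_norm H (\<lambda>x. L (u n) x \<ominus>\<^bsub>H\<^esub> lim_op u x) - 0) < e" if "n \<ge> M" for n
    using that H.op_norm_ge0[OF lb, of n] e by force
  then show "\<exists>no. \<forall>n\<ge>no. norm (op_norm H (\<lambda>x. L (u n) x \<ominus>\<^bsub>H\<^esub> lim_op u x) - 0) < e" by blast
qed

lemma lim_op_cong:
  assumes u: "cauchy u" and v: "v \<in> cls u"
  shows "lim_op v = lim_op u"
proof
  have c: "cauchy v" using v by (simp add: mem_cls)
  note [simp] = cauchy_carrier[OF u] cauchy_carrier[OF c] lim_op(1)[OF u]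
  fix x
  show "lim_op v x = lim_op u x"
  proof (cases "x \<in> carrier H")
    case x [simp]: True
    have "(\<lambda>n. anorm A (v n \<ominus> u n) * hnorm H x) \<longlonglongrightarrow> 0"
      using v by (intro tendsto_mult_left_zero) (simp add: mem_cls)
    moreover have "hnorm H (L (v n) x \<ominus>\<^bsub>H\<^esub> L (u n) x) \<le> anorm A (v n \<ominus> u n) * hnorm H x" for n
      using hnorm_L_le[of "v n \<ominus> u n" x] by (simp add: L_minus)
    ultimately have "(\<lambda>n. hnorm H (L (v n) x \<ominus>\<^bsub>H\<^esub> L (u n) x)) \<longlonglongrightarrow> 0"
      by - (rule null_sequence_le[where b = "\<lambda>n. anorm A (v n \<ominus> u n) * hnorm H x"], simp_all)
    then have "converges_in H (hnorm H) (\<lambda>n. L (v n) x) (lim_op u x)"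
      by - (rule H.converges_in_close[OF _ _ _ lim_op(2)[OF u x]], simp_all)
    then show ?thesis by (intro lim_opI[OF c]) simp_all
  qed (simp add: lim_op_def)
qed

abbreviation "E \<equiv> extend_rep H L"

text \<open>A limit in operator norm is a pointwise limit, so only one operator fits the description of
  \<^const>\<open>extend_rep\<close>.\<close>

lemma extend_rep_cls:
  assumes u: "cauchy u"
  shows "E (cls u) = lim_op u"
  unfolding extend_rep_def
proof (rule the_equality)
  show "lim_op u \<in> bounded_ops H \<and>
    (\<forall>v\<in>cls u. (\<lambda>n. op_norm H (\<lambda>x. L (v n) x \<ominus>\<^bsub>H\<^esub> lim_op u x)) \<longlonglongrightarrow> 0)"
  proof (intro conjI ballI lim_op_bounded_ops[OF u])
    fix v assume v: "v \<in> cls u"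
    then show "(\<lambda>n. op_norm H (\<lambda>x. L (v n) x \<ominus>\<^bsub>H\<^esub> lim_op u x)) \<longlonglongrightarrow> 0"
      using lim_op_norm[of v] lim_op_cong[OF u v] by (simp add: mem_cls)
  qed
  fix T assume T: "T \<in> bounded_ops H \<and>
    (\<forall>v\<in>cls u. (\<lambda>n. op_norm H (\<lambda>x. L (v n) x \<ominus>\<^bsub>H\<^esub> T x)) \<longlonglongrightarrow> 0)"
  note [simp] = cauchy_carrier[OF u] H.bounded_opsD(1)[OF conjunct1[OF T]]
  have lim: "(\<lambda>n. op_norm H (\<lambda>x. L (u n) x \<ominus>\<^bsub>H\<^esub> T x)) \<longlonglongrightarrow> 0" using T self_mem_cls[OF u] by blast
  have lb: "H.lin_bounded (\<lambda>x. L (u n) x \<ominus>\<^bsub>H\<^esub> T x)" for n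
    using T by (intro H.lin_bounded_minus H.bounded_ops_lin_bounded L_bounded) auto
  have "lim_op u x = T x" if x [simp]: "x \<in> carrier H" for x
  proof (rule lim_opI[OF u x])
    show "converges_in H (hnorm H) (\<lambda>n. L (u n) x) (T x)"
      by (rule H.converges_inI[OF _ _ H.hnorm_le_op_norm[OF lb] tendsto_mult_left_zero[OF lim]]) simp_all
  qed simp
  then show "T = lim_op u"
    using H.bounded_opsD(4)[OF conjunct1[OF T]] H.bounded_opsD(4)[OF lim_op_bounded_ops[OF u]]
    by (intro extensionalityI[of T "carrier H"]) auto
qed

lemma extend_rep_embed: "a \<in> carrier A \<Longrightarrow> x \<in> carrier H \<Longrightarrow> E (embed a) x = L a x"
  unfolding embed_def using H.converges_in_const[of "L a x"]
  by (simp add: extend_rep_cls lim_opI)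

lemma star_rep_extend: "star_rep C H E"
  unfolding star_rep_def
proof (intro conjI ballI allI)
  show "hilbert_space H" by (rule H.hilbert_space)
  fix F x y assume "F \<in> carrier C" and x [simp]: "x \<in> carrier H"
  then obtain u where u: "cauchy u" "F = cls u" by (elim completion_cases)
  note [simp] = cauchy_carrier[OF u(1)] lim_op(1)[OF u(1)]
  show "E (c \<odot>\<^bsub>C\<^esub> F) x = c \<odot>\<^bsub>H\<^esub> E F x" for c
    unfolding u(2) smult_cls[OF u(1)] extend_rep_cls[OF u(1)] extend_rep_cls[OF cauchy_smult[OF u(1)]]
    using H.converges_in_smult[OF _ _ lim_op(2)[OF u(1) x], of c]
    by (intro lim_opI[OF cauchy_smult[OF u(1)]]) (simp_all add: L_smult)
  show "hinner H (E F x) y = hinner H x (E (astar C F) y)" if y [simp]: "y \<in> carrier H"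
  proof -
    note s = cauchy_star[OF u(1)]
    have "(\<lambda>n. hinner H (L (u n) x) y) \<longlonglongrightarrow> hinner H (lim_op u x) y"
      by (rule H.converges_in_inner[OF _ _ lim_op(2)[OF u(1) x]]) simp_all
    moreover have "(\<lambda>n. hinner H x (L (astar A (u n)) y)) \<longlonglongrightarrow> hinner H x (lim_op (\<lambda>n. astar A (u n)) y)"
      by (rule H.converges_in_inner_right[OF _ _ lim_op(2)[OF s y]]) (simp_all add: lim_op(1)[OF s])
    moreover have "(\<lambda>n. hinner H (L (u n) x) y) = (\<lambda>n. hinner H x (L (astar A (u n)) y))"
      by (simp add: L_adj)
    ultimately show ?thesis
      unfolding u(2) star_cls[OF u(1)] extend_rep_cls[OF u(1)] extend_rep_cls[OF s] using LIMSEQ_unique by metis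
  qed
  fix G assume "G \<in> carrier C"
  then obtain v where v: "cauchy v" "G = cls v" by (elim completion_cases)
  note [simp] = cauchy_carrier[OF v(1)] lim_op(1)[OF v(1)]
  show "E (F \<oplus>\<^bsub>C\<^esub> G) x = E F x \<oplus>\<^bsub>H\<^esub> E G x"
    unfolding u(2) v(2) add_cls[OF u(1) v(1)] extend_rep_cls[OF u(1)] extend_rep_cls[OF v(1)]
      extend_rep_cls[OF cauchy_add[OF u(1) v(1)]]
    using H.converges_in_add[OF _ _ lim_op(2)[OF u(1) x] _ _ lim_op(2)[OF v(1) x]]
    by (intro lim_opI[OF cauchy_add[OF u(1) v(1)]]) (simp_all add: L_add)
  show "E (F \<otimes>\<^bsub>C\<^esub> G) x = E F (E G x)"
    unfolding u(2) v(2) mult_cls[OF u(1) v(1)] extend_rep_cls[OF u(1)] extend_rep_cls[OF v(1)]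
      extend_rep_cls[OF cauchy_mult[OF u(1) v(1)]]
  proof (rule lim_opI[OF cauchy_mult[OF u(1) v(1)]])
    obtain B where B: "B > 0" "\<And>n. anorm A (u n) \<le> B" using cauchy_bounded[OF u(1)] by blast
    let ?y = "lim_op v x"
    have "converges_in H (hnorm H) (\<lambda>n. L (u n) (L (v n) x)) (lim_op u ?y)"
    proof (rule H.converges_in_close[OF _ _ _ lim_op(2)[OF u(1), of ?y]])
      have "(\<lambda>n. B * hnorm H (L (v n) x \<ominus>\<^bsub>H\<^esub> ?y)) \<longlonglongrightarrow> 0"
        using lim_op(2)[OF v(1) x] by (intro tendsto_mult_right_zero) (simp add: converges_in_def)
      moreover have "hnorm H (L (u n) (L (v n) x) \<ominus>\<^bsub>H\<^esub> L (u n) ?y) \<le> B * hnorm H (L (v n) x \<ominus>\<^bsub>H\<^esub> ?y)" for n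
        using hnorm_L_le[of "u n" "L (v n) x \<ominus>\<^bsub>H\<^esub> ?y"]
          mult_right_mono[OF B(2)[of n], of "hnorm H (L (v n) x \<ominus>\<^bsub>H\<^esub> ?y)"]
        by (simp add: L_lin)
      ultimately show "(\<lambda>n. hnorm H (L (u n) (L (v n) x) \<ominus>\<^bsub>H\<^esub> L (u n) ?y)) \<longlonglongrightarrow> 0"
        by - (rule null_sequence_le[where b = "\<lambda>n. B * hnorm H (L (v n) x \<ominus>\<^bsub>H\<^esub> ?y)"], simp_all)
    qed simp_all
    then show "converges_in H (hnorm H) (\<lambda>n. L (u n \<otimes> v n) x) (lim_op u ?y)" by (simp add: L_mult)
  qed simp_all
next
  fix F assume "F \<in> carrier C"
  then obtain u where u: "cauchy u" "F = cls u" by (elim completion_cases)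
  then show "E F \<in> bounded_ops H" using lim_op_bounded_ops by (simp add: extend_rep_cls)
qed

lemma irreducible_extend:
  assumes irr: "irreducible_rep A H L"
  shows "irreducible_rep C H E"
  unfolding irreducible_rep_def
proof (intro conjI allI impI star_rep_extend)
  obtain a x where "a \<in> carrier A" "x \<in> carrier H" "L a x \<noteq> \<zero>\<^bsub>H\<^esub>"
    using irr unfolding irreducible_rep_def by blast
  then show "\<exists>F\<in>carrier C. \<exists>x\<in>carrier H. E F x \<noteq> \<zero>\<^bsub>H\<^esub>"
    using extend_rep_embed by (intro bexI[of _ "embed a"] bexI[of _ x]) auto
  fix S assume S: "closed_subspace H (hnorm H) S" and inv: "\<forall>F\<in>carrier C. \<forall>x\<in>S. E F x \<in> S"
  have "L a x \<in> S" if "a \<in> carrier A" "x \<in> S" for a x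
    using inv extend_rep_embed[of a x] that H.closed_subspaceD(1)[OF S] by (metis embed_closed subsetD)
  then show "S = {\<zero>\<^bsub>H\<^esub>} \<or> S = carrier H"
    using irr S unfolding irreducible_rep_def by blast
qed

end

subsection \<open>Restricting representations of the completion\<close>

context cstar_seminormed_alg begin

interpretation Cp: cstar_seminormed_alg C
  by (rule cstar_seminormed_completion)

lemma rep_completion: "star_rep C H M \<Longrightarrow> rep C H M"
  by (rule rep_intro[OF star_alg_completion])

lemma star_rep_restrict:
  assumes M: "star_rep C H M"
  shows "star_rep A H (\<lambda>a. M (embed a))"
proof -
  interpret M: rep C H M by (rule rep_completion[OF M])
  show ?thesis
    unfolding star_rep_def
    by (simp add: M.H.hilbert_space embed_ops M.L_bounded M.L_add M.L_mult M.L_smult M.L_adj)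
qed

lemma star_rep_completion_contractive:
  "star_rep C H M \<Longrightarrow> F \<in> carrier C \<Longrightarrow> op_norm H (M F) \<le> anorm C F"
  by (rule star_rep_contractive[OF cstar_algebra_completion])

lemma star_rep_completion_converges:
  assumes M: "star_rep C H M" and u: "\<And>n. u n \<in> carrier C" and F: "F \<in> carrier C"
    and lim: "converges_in C (anorm C) u F" and x: "x \<in> carrier H"
  shows "converges_in H (hnorm H) (\<lambda>n. M (u n) x) (M F x)"
proof -
  interpret M: rep C H M by (rule rep_completion[OF M])
  note [simp] = u F x
  have "(\<lambda>n. anorm C (u n \<ominus>\<^bsub>C\<^esub> F) * hnorm H x) \<longlonglongrightarrow> 0"
    using lim by (intro tendsto_mult_left_zero) (simp add: converges_in_def)
  moreover have "hnorm H (M (u n) x \<ominus>\<^bsub>H\<^esub> M F x) \<le> anorm C (u n \<ominus>\<^bsub>C\<^esub> F) * hnorm H x" for n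
    using M.hnorm_L[of "u n \<ominus>\<^bsub>C\<^esub> F" x]
      mult_right_mono[OF star_rep_completion_contractive[OF M, of "u n \<ominus>\<^bsub>C\<^esub> F"], of "hnorm H x"]
    by (simp add: M.L_minus)
  ultimately show ?thesis by (intro M.H.converges_inI) simp_all
qed

lemma star_rep_completion_limit:
  assumes M: "star_rep C H M" and u: "cauchy u" and x: "x \<in> carrier H"
  shows "converges_in H (hnorm H) (\<lambda>n. M (embed (u n)) x) (M (cls u) x)"
  by (rule star_rep_completion_converges[OF M _ _ converges_embed[OF u] x])
    (simp_all add: cauchy_carrier[OF u] u)

text \<open>Closed subspaces that the dense subalgebra leaves invariant are invariant under the completion.\<close>

lemma irreducible_restrict:
  assumes irr: "irreducible_rep C H M"
  shows "irreducible_rep A H (\<lambda>a. M (embed a))"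
proof -
  have M: "star_rep C H M" using irr by (rule irreducible_rep_star_rep)
  interpret M: rep C H M by (rule rep_completion[OF M])
  have closed: "M F x \<in> S" if S: "closed_subspace H (hnorm H) S" and inv: "\<And>a. a \<in> carrier A \<Longrightarrow> M (embed a) x \<in> S"
    and F: "F \<in> carrier C" and x: "x \<in> carrier H" for F x S
  proof -
    obtain u where u: "cauchy u" "F = cls u" using F by (rule completion_cases)
    have "M (embed (u n)) x \<in> S" for n by (rule inv[OF cauchy_carrier[OF u(1)]])
    moreover have "M F x \<in> carrier H" using F x by simp
    moreover have "converges_in H (hnorm H) (\<lambda>n. M (embed (u n)) x) (M F x)"
      using star_rep_completion_limit[OF M u(1) x] u(2) by simp
    ultimately show ?thesis by (rule M.H.closed_subspaceD(5)[OF S])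
  qed
  show ?thesis
    unfolding irreducible_rep_def
  proof (intro conjI allI impI star_rep_restrict[OF M])
    show "\<exists>a\<in>carrier A. \<exists>x\<in>carrier H. M (embed a) x \<noteq> \<zero>\<^bsub>H\<^esub>"
    proof (rule ccontr)
      assume none: "\<not> ?thesis"
      have "M F x \<in> {\<zero>\<^bsub>H\<^esub>}" if "F \<in> carrier C" "x \<in> carrier H" for F x
        by (rule closed[OF M.H.closed_subspace_zero_H]) (use that none in auto)
      then show False using irr unfolding irreducible_rep_def by blast
    qed
    fix S assume S: "closed_subspace H (hnorm H) S" and inv: "\<forall>a\<in>carrier A. \<forall>x\<in>S. M (embed a) x \<in> S"
    have "\<forall>F\<in>carrier C. \<forall>x\<in>S. M F x \<in> S"
    proof (intro ballI)
      fix F x assume F: "F \<in> carrier C" and x: "x \<in> S"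
      show "M F x \<in> S"
        by (rule closed[OF S]) (use inv F x M.H.closed_subspaceD(1)[OF S] in auto)
    qed
    then show "S = {\<zero>\<^bsub>H\<^esub>} \<or> S = carrier H"
      using irr S unfolding irreducible_rep_def by blast
  qed
qed

lemma unitarily_equivalent_completion:
  assumes M: "star_rep C H M" and N: "star_rep C K N"
    and e: "unitarily_equivalent A (H, \<lambda>a. M (embed a)) (K, \<lambda>a. N (embed a))"
  shows "unitarily_equivalent C (H, M) (K, N)"
proof -
  interpret M: rep C H M by (rule rep_completion[OF M])
  interpret N: rep C K N by (rule rep_completion[OF N])
  note iff = unitarily_equivalent_iff[OF M.H.hilbert_space N.H.hilbert_space]
  obtain U where U: "unitary H K U" "\<And>a x. a \<in> carrier A \<Longrightarrow> x \<in> carrier H \<Longrightarrow> U (M (embed a) x) = N (embed a) (U x)"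
    using e[unfolded iff] by blast
  interpret U: unitary H K U by (rule U(1))
  have "U (M F x) = N F (U x)" if F: "F \<in> carrier C" and x: "x \<in> carrier H" for F x
  proof -
    obtain u where u: "cauchy u" "F = cls u" using F by (rule completion_cases)
    note [simp] = cauchy_carrier[OF u(1)] x F
    have "converges_in K (hnorm K) (\<lambda>n. U (M (embed (u n)) x)) (U (M F x))"
      using star_rep_completion_limit[OF M u(1) x] by (subst U.U_converges) (simp_all add: u(2)[symmetric])
    moreover have "converges_in K (hnorm K) (\<lambda>n. U (M (embed (u n)) x)) (N F (U x))"
      using star_rep_completion_limit[OF N u(1), of "U x"] by (simp add: U(2) u(2)[symmetric])
    ultimately show ?thesis
      by - (rule N.H.converges_in_unique[of "\<lambda>n. U (M (embed (u n)) x)"], simp_all)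
  qed
  then show ?thesis using iff U(1) by blast
qed

end

lemma unitarily_equivalent_nonzero:
  assumes L: "star_rep A H L" and M: "star_rep A K M" and e: "unitarily_equivalent A (H, L) (K, M)"
    and a: "a \<in> carrier A"
  shows "(\<exists>x\<in>carrier H. L a x \<noteq> \<zero>\<^bsub>H\<^esub>) \<longleftrightarrow> (\<exists>x\<in>carrier K. M a x \<noteq> \<zero>\<^bsub>K\<^esub>)"
proof -
  have HK: "hilbert_space H" "hilbert_space K" using L M by (auto simp: star_rep_def)
  obtain U where U: "unitary H K U" "\<And>a x. a \<in> carrier A \<Longrightarrow> x \<in> carrier H \<Longrightarrow> U (L a x) = M a (U x)"
    using e[unfolded unitarily_equivalent_iff[OF HK]] by blast
  interpret unitary H K U by (rule U(1))
  have Lc: "L a x \<in> carrier H" if "x \<in> carrier H" for x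
    using L that a H.bounded_opsD(1) by (auto simp: star_rep_def)
  have "L a x = \<zero>\<^bsub>H\<^esub> \<longleftrightarrow> M a (U x) = \<zero>\<^bsub>K\<^esub>" if "x \<in> carrier H" for x
    using U(2)[OF a that] U_zero U_inj[OF Lc[OF that], of "\<zero>\<^bsub>H\<^esub>"] by auto
  then show ?thesis by (metis U_closed U_surj)
qed

lemma unitarily_equivalent_rank_one_projection:
  assumes L: "star_rep A H L" and M: "star_rep A K M" and e: "unitarily_equivalent A (H, L) (K, M)"
    and a: "a \<in> carrier A" and P: "rank_one_projection H (L a)"
  shows "rank_one_projection K (M a)"
proof -
  have HK: "hilbert_space H" "hilbert_space K" using L M by (auto simp: star_rep_def)
  obtain U where U: "unitary H K U" "\<And>a x. a \<in> carrier A \<Longrightarrow> x \<in> carrier H \<Longrightarrow> U (L a x) = M a (U x)"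
    using e[unfolded unitarily_equivalent_iff[OF HK]] by blast
  interpret unitary H K U by (rule U(1))
  have Lc [simp]: "L a x \<in> carrier H" if "x \<in> carrier H" for x
    using L that a H.bounded_opsD(1) by (auto simp: star_rep_def)
  note Ma = U(2)[OF a, symmetric]
  have idem: "L a (L a x) = L a x" and self: "y \<in> carrier H \<Longrightarrow> hinner H (L a x) y = hinner H x (L a y)"
    if "x \<in> carrier H" for x y
    using P that unfolding rank_one_projection_def by blast+
  obtain e where e: "e \<in> carrier H" "e \<noteq> \<zero>\<^bsub>H\<^esub>" "L a ` carrier H = {c \<odot>\<^bsub>H\<^esub> e | c. True}"
    using P unfolding rank_one_projection_def by blast
  show ?thesis
    unfolding rank_one_projection_def
  proof (intro conjI ballI)
    show "M a \<in> bounded_ops K" using M a by (simp add: star_rep_def)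
    fix x assume x: "x \<in> carrier K"
    obtain x' where x': "x' \<in> carrier H" "x = U x'" using x by (rule U_surj)
    show "M a (M a x) = M a x" using x' idem by (simp add: Ma)
    fix y assume y: "y \<in> carrier K"
    obtain y' where y': "y' \<in> carrier H" "y = U y'" using y by (rule U_surj)
    show "hinner K (M a x) y = hinner K x (M a y)" using x' y' self[of x' y'] by (simp add: Ma inner)
  next
    have "M a ` carrier K = M a ` U ` carrier H" using bij by (simp add: bij_betw_def)
    also have "\<dots> = U ` L a ` carrier H" by (auto simp: image_image Ma)
    also have "\<dots> = {c \<odot>\<^bsub>K\<^esub> U e | c. True}" unfolding e(3) using e(1) by (auto simp: U_smult[symmetric])
    finally have "M a ` carrier K = {c \<odot>\<^bsub>K\<^esub> U e | c. True}" .
    moreover have "U e \<noteq> \<zero>\<^bsub>K\<^esub>" using e U_inj[of e "\<zero>\<^bsub>H\<^esub>"] U_zero by auto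
    ultimately show "\<exists>e\<in>carrier K. e \<noteq> \<zero>\<^bsub>K\<^esub> \<and> M a ` carrier K = {c \<odot>\<^bsub>K\<^esub> e | c. True}"
      using e(1) by (intro bexI[of _ "U e"]) auto
  qed
qed

section \<open>The fibre relation of a local homeomorphism\<close>

lemma continuous_map_complex_mult:
  fixes f g :: "'a \<Rightarrow> complex"
  assumes "continuous_map X euclidean f" "continuous_map X euclidean g"
  shows "continuous_map X euclidean (\<lambda>x. f x * g x)"
  using assms by (simp add: continuous_map_atin tendsto_mult)

lemma continuous_map_lift:
  assumes "continuous_map X euclidean f" "continuous_on UNIV F"
  shows "continuous_map X euclidean (\<lambda>x. F (f x))"
  using continuous_map_compose[OF assms(1), of euclidean F] assms(2)
  by (simp add: continuous_map_iff_continuous2 o_def)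

locale local_homeo =
  fixes Y :: "'y topology" and X :: "'x topology" and \<psi> :: "'y \<Rightarrow> 'x"
  assumes second_countable: "second_countable Y" and locally_compact: "locally_compact_space Y"
    and Hausdorff: "Hausdorff_space Y" and local_homeomorphism: "local_homeomorphism Y X \<psi>"
begin

abbreviation "T \<equiv> topspace Y"
abbreviation "R \<equiv> fibre_relation Y \<psi>"
abbreviation "G \<equiv> fibre_groupoid Y \<psi>"
abbreviation "TR \<equiv> subtopology (prod_topology Y Y) R"

lemma R_iff: "(y, z) \<in> R \<longleftrightarrow> y \<in> T \<and> z \<in> T \<and> \<psi> y = \<psi> z"
  by (simp add: fibre_relation_def)

lemma R_refl: "y \<in> T \<Longrightarrow> (y, y) \<in> R" and R_sym: "(y, z) \<in> R \<Longrightarrow> (z, y) \<in> R"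
  and R_trans: "(x, y) \<in> R \<Longrightarrow> (y, z) \<in> R \<Longrightarrow> (x, z) \<in> R"
  by (auto simp: R_iff)

lemma topspace_TR [simp]: "topspace TR = R"
  by (auto simp: fibre_relation_def)

lemma G_simps [simp]: "gtop G = TR" "grng G = fst" "gsrc G = snd" "gunit G = (\<lambda>y. (y, y))"
  "gmult G \<alpha> \<beta> = (fst \<alpha>, snd \<beta>)" "ginv G \<alpha> = (snd \<alpha>, fst \<alpha>)" "arrows G = R"
  by (simp_all add: fibre_groupoid_def arrows_def fibre_relation_def) auto

lemma composable_G: "composable G = {((x, y), (y', z)). (x, y) \<in> R \<and> (y', z) \<in> R \<and> y = y'}"
  by (auto simp: composable_def)

lemma Hausdorff_TR: "Hausdorff_space TR"
  using Hausdorff by (intro Hausdorff_space_subtopology) (simp add: Hausdorff_space_prod_topology)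

lemma continuous_fst: "continuous_map TR Y fst" and continuous_snd: "continuous_map TR Y snd"
  by (auto intro: continuous_map_from_subtopology continuous_map_fst continuous_map_snd)

lemma continuous_map_into_TR:
  assumes "continuous_map Z Y f" "continuous_map Z Y g" "\<And>z. z \<in> topspace Z \<Longrightarrow> (f z, g z) \<in> R"
  shows "continuous_map Z TR (\<lambda>z. (f z, g z))"
  using assms by (intro continuous_map_into_subtopology continuous_map_pairedI) auto

text \<open>On a slice the relation is the diagonal, and two slices \<open>U\<close> and \<open>V\<close> give the open bisection
  \<open>R \<inter> (U \<times> V)\<close>.\<close>

definition slice :: "'y set \<Rightarrow> bool" where
  "slice U \<longleftrightarrow> openin Y U \<and> inj_on \<psi> U"

lemma slice_openin: "slice U \<Longrightarrow> openin Y U" by (simp add: slice_def)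

lemma slice_subset_T: "slice U \<Longrightarrow> y \<in> U \<Longrightarrow> y \<in> T"
  using openin_subset by (auto simp: slice_def)

lemma slice_eq: "slice U \<Longrightarrow> y \<in> U \<Longrightarrow> z \<in> U \<Longrightarrow> (y, z) \<in> R \<Longrightarrow> y = z"
  by (auto simp: slice_def R_iff inj_on_def)

lemma slice_Int: "slice U \<Longrightarrow> openin Y V \<Longrightarrow> slice (V \<inter> U)"
  by (auto simp: slice_def inj_on_def)

lemma slice_exists: assumes "y \<in> T" shows "\<exists>U. slice U \<and> y \<in> U"
proof -
  obtain U where U: "openin Y U" "y \<in> U" "homeomorphic_map (subtopology Y U) (subtopology X (\<psi> ` U)) \<psi>"
    using local_homeomorphism assms unfolding local_homeomorphism_def by blast
  have "inj_on \<psi> (topspace (subtopology Y U))" by (rule homeomorphic_imp_injective_map[OF U(3)])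
  then show ?thesis using U openin_subset by (auto simp: slice_def inf.absorb2)
qed

definition saturation :: "'y set \<Rightarrow> 'y set" where
  "saturation V = {y. \<exists>v\<in>V. (y, v) \<in> R}"

text \<open>The saturation of \<open>V\<close> is \<open>\<psi>\<^sup>-\<^sup>1 (\<psi> (V))\<close>, and a local homeomorphism is open and continuous.\<close>

lemma openin_saturation: assumes V: "openin Y V" shows "openin Y (saturation V)"
  unfolding openin_subopen[of Y "saturation V"]
proof
  fix y assume "y \<in> saturation V"
  then obtain v where v: "v \<in> V" "(y, v) \<in> R" by (auto simp: saturation_def)
  have vy: "v \<in> T" "y \<in> T" "\<psi> y = \<psi> v" using v by (auto simp: R_iff)
  obtain U where U: "openin Y U" "v \<in> U" "openin X (\<psi> ` U)"
    "homeomorphic_map (subtopology Y U) (subtopology X (\<psi> ` U)) \<psi>"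
    using local_homeomorphism vy(1) unfolding local_homeomorphism_def by blast
  obtain U' where U': "openin Y U'" "y \<in> U'" "openin X (\<psi> ` U')"
    "homeomorphic_map (subtopology Y U') (subtopology X (\<psi> ` U')) \<psi>"
    using local_homeomorphism vy(2) unfolding local_homeomorphism_def by blast
  have "open_map (subtopology Y U) (subtopology X (\<psi> ` U)) \<psi>"
    using U(4) homeomorphic_imp_open_map by blast
  moreover have "openin (subtopology Y U) (V \<inter> U)" using V by (auto simp: openin_subtopology)
  ultimately have "openin (subtopology X (\<psi> ` U)) (\<psi> ` (V \<inter> U))" unfolding open_map_def by blast
  then have W: "openin X (\<psi> ` (V \<inter> U))" using U(3) openin_trans_full by blast
  have cont: "continuous_map (subtopology Y U') X \<psi>"
    using U'(4) homeomorphic_imp_continuous_map continuous_map_into_fulltopology by blast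
  have opn: "openin Y {x \<in> topspace (subtopology Y U'). \<psi> x \<in> \<psi> ` (V \<inter> U)}"
    by (rule openin_trans_full[OF openin_continuous_map_preimage[OF cont W] U'(1)])
  show "\<exists>T. openin Y T \<and> y \<in> T \<and> T \<subseteq> saturation V"
  proof (rule exI, intro conjI)
    show "openin Y {x \<in> topspace (subtopology Y U'). \<psi> x \<in> \<psi> ` (V \<inter> U)}" by (rule opn)
    show "y \<in> {x \<in> topspace (subtopology Y U'). \<psi> x \<in> \<psi> ` (V \<inter> U)}"
      using v U U' vy by auto
    show "{x \<in> topspace (subtopology Y U'). \<psi> x \<in> \<psi> ` (V \<inter> U)} \<subseteq> saturation V"
    proof
      fix x assume "x \<in> {x \<in> topspace (subtopology Y U'). \<psi> x \<in> \<psi> ` (V \<inter> U)}"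
      then obtain w where "x \<in> T" "w \<in> V" "\<psi> x = \<psi> w" by auto
      moreover have "w \<in> T" using \<open>w \<in> V\<close> openin_subset[OF V] by auto
      ultimately show "x \<in> saturation V" by (auto simp: saturation_def R_iff)
    qed
  qed
qed

text \<open>The point of a slice in the fibre of a given point. Off the saturation of the slice the value is
  arbitrary.\<close>

definition section_map :: "'y set \<Rightarrow> 'y \<Rightarrow> 'y" where
  "section_map U y = (THE u. u \<in> U \<and> (y, u) \<in> R)"

lemma section_map_eq: "slice U \<Longrightarrow> u \<in> U \<Longrightarrow> (y, u) \<in> R \<Longrightarrow> section_map U y = u"
  unfolding section_map_def by (rule the_equality) (auto simp: slice_def R_iff inj_on_def)

lemma section_map: "slice U \<Longrightarrow> y \<in> saturation U \<Longrightarrow> section_map U y \<in> U \<and> (y, section_map U y) \<in> R"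
  using section_map_eq by (auto simp: saturation_def)

lemma continuous_section_map:
  assumes U: "slice U" shows "continuous_map (subtopology Y (saturation U)) Y (section_map U)"
  unfolding continuous_map_def
proof (intro conjI allI impI)
  have top: "topspace (subtopology Y (saturation U)) = saturation U"
    using openin_subset[OF openin_saturation[OF slice_openin[OF U]]] by auto
  show "section_map U \<in> topspace (subtopology Y (saturation U)) \<rightarrow> T"
    unfolding top using section_map[OF U] slice_subset_T[OF U] by blast
  fix W assume W: "openin Y W"
  have "{y \<in> topspace (subtopology Y (saturation U)). section_map U y \<in> W} = saturation (W \<inter> U)"
    unfolding top
  proof (intro equalityI subsetI)
    fix y assume "y \<in> {y \<in> saturation U. section_map U y \<in> W}"
    then show "y \<in> saturation (W \<inter> U)" using section_map[OF U, of y] unfolding saturation_def by blast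
  next
    fix y assume "y \<in> saturation (W \<inter> U)"
    then obtain w where "w \<in> W" "w \<in> U" "(y, w) \<in> R" by (auto simp: saturation_def)
    then show "y \<in> {y \<in> saturation U. section_map U y \<in> W}"
      using section_map_eq[OF U] by (auto simp: saturation_def)
  qed
  moreover have "openin Y (saturation (W \<inter> U))"
    using W slice_openin[OF U] by (intro openin_saturation openin_Int)
  moreover have "saturation (W \<inter> U) \<subseteq> saturation U" by (auto simp: saturation_def)
  ultimately show "openin (subtopology Y (saturation U)) {y \<in> topspace (subtopology Y (saturation U)). section_map U y \<in> W}"
    by (auto simp: openin_subtopology intro!: exI[of _ "saturation (W \<inter> U)"])
qed

subsection \<open>Compactly supported functions on the base\<close>

text \<open>Functions are extended by zero, and the support is bounded by a compact subset of \<open>U\<close>.\<close>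

definition bump_functions :: "'y set \<Rightarrow> ('y \<Rightarrow> complex) set" where
  "bump_functions U = {h. continuous_map Y euclidean h \<and>
    (\<exists>C. compactin Y C \<and> C \<subseteq> U \<and> (\<forall>y. h y \<noteq> 0 \<longrightarrow> y \<in> C))}"

lemma bump_functionsD:
  assumes "h \<in> bump_functions U"
  shows "continuous_map Y euclidean h" "h y \<noteq> 0 \<Longrightarrow> y \<in> U" "h y \<noteq> 0 \<Longrightarrow> y \<in> T"
  using assms by (auto simp: bump_functions_def dest: compactin_subset_topspace)

lemma bump_functions_T: "h \<in> bump_functions U \<Longrightarrow> h \<in> bump_functions T"
  using compactin_subset_topspace by (auto simp: bump_functions_def)

lemma bump_functions_supported:
  assumes "h \<in> bump_functions U" "continuous_map Y euclidean k" "\<And>y. k y \<noteq> 0 \<Longrightarrow> h y \<noteq> 0"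
  shows "k \<in> bump_functions U"
  using assms unfolding bump_functions_def by blast

lemma bump_functions_mult:
  "h \<in> bump_functions U \<Longrightarrow> continuous_map Y euclidean k \<Longrightarrow> (\<lambda>y. h y * k y) \<in> bump_functions U"
  by (rule bump_functions_supported) (auto intro: continuous_map_complex_mult dest: bump_functionsD)

lemma bump_functions_lift:
  "h \<in> bump_functions U \<Longrightarrow> continuous_on UNIV F \<Longrightarrow> F 0 = 0 \<Longrightarrow> (\<lambda>y. F (h y)) \<in> bump_functions U"
  by (rule bump_functions_supported[of h]) (auto intro: continuous_map_lift dest: bump_functionsD)

lemma bump_functions_add:
  assumes "h \<in> bump_functions U" "k \<in> bump_functions U"
  shows "(\<lambda>y. h y + k y) \<in> bump_functions U"
proof -
  obtain C D where CD: "compactin Y C" "C \<subseteq> U" "\<forall>y. h y \<noteq> 0 \<longrightarrow> y \<in> C" "compactin Y D" "D \<subseteq> U"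
    "\<forall>y. k y \<noteq> 0 \<longrightarrow> y \<in> D"
    using assms by (auto simp: bump_functions_def)
  have "compactin Y (C \<union> D)" "C \<union> D \<subseteq> U" using CD compactin_Un by auto
  moreover have "\<forall>y. h y + k y \<noteq> 0 \<longrightarrow> y \<in> C \<union> D" using CD by (metis Un_iff add_0)
  moreover have "continuous_map Y euclidean (\<lambda>y. h y + k y)"
    using assms by (intro continuous_map_add bump_functionsD(1))
  ultimately show ?thesis unfolding bump_functions_def by blast
qed

text \<open>Complete regularity separates \<open>y\<close> from the complement of a relatively compact neighbourhood. Scaling the
  separating function up and truncating it at \<open>1\<close> makes it constant near \<open>y\<close>.\<close>

lemma bump_at_point:
  assumes U: "openin Y U" "y \<in> U"
  obtains h V where "openin Y V" "y \<in> V" "V \<subseteq> U" "\<forall>v\<in>V. h v = 1" "\<forall>z. 0 \<le> h z \<and> h z \<le> (1::real)"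
    "(\<lambda>z. of_real (h z)) \<in> bump_functions U" "continuous_map Y euclideanreal h"
proof -
  have T: "y \<in> T" using U openin_subset by blast
  have "neighbourhood_base_of (\<lambda>C. compactin Y C \<and> closedin Y C) Y"
    using locally_compact_space_neighbourhood_base_closedin locally_compact Hausdorff by blast
  then obtain W C where W: "openin Y W" "compactin Y C" "y \<in> W" "W \<subseteq> C" "C \<subseteq> U"
    using U unfolding neighbourhood_base_of by (metis (no_types, lifting))
  have "completely_regular_space Y"
    using locally_compact Hausdorff locally_compact_Hausdorff_imp_regular_space
      locally_compact_regular_imp_completely_regular_space by blast
  moreover have "closedin Y (T - W)" "y \<in> T - (T - W)" using W T by auto
  ultimately obtain g where g: "continuous_map Y (top_of_set {0..1::real}) g" "g y = 0" "g ` (T - W) \<subseteq> {1}"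
    unfolding completely_regular_space_def by blast
  have gc: "continuous_map Y euclideanreal g" using g(1) continuous_map_into_fulltopology by blast
  have g01: "0 \<le> g z" "g z \<le> 1" if "z \<in> T" for z
    using g(1) that by (auto simp: continuous_map_in_subtopology Pi_iff)
  define k where "k z = min 1 (2 * (1 - g z))" for z
  define h where "h z = (if z \<in> T then k z else 0)" for z
  define V where "V = {z \<in> T. g z \<in> {..<1/2}} \<inter> W"
  have "continuous_map Y euclideanreal k"
    unfolding k_def by (intro continuous_intros gc) auto
  then have hc: "continuous_map Y euclideanreal h"
    by (rule continuous_map_eq) (simp add: h_def)
  have supp: "z \<in> W" if "h z \<noteq> 0" for z
    using that g(3) by (auto simp: h_def k_def split: if_splits)
  show thesis
  proof (rule that[of V h])
    have "openin Y {z \<in> T. g z \<in> {..<1/2}}" by (rule openin_continuous_map_preimage[OF gc]) auto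
    then show "openin Y V" unfolding V_def using W by blast
    show "y \<in> V" using T W g(2) by (simp add: V_def)
    show "V \<subseteq> U" using W by (auto simp: V_def)
    show "\<forall>v\<in>V. h v = 1" by (auto simp: V_def h_def k_def)
    show "\<forall>z. 0 \<le> h z \<and> h z \<le> 1" using g01 by (auto simp: h_def k_def)
    have "continuous_map Y euclidean (\<lambda>z. complex_of_real (h z))"
      by (intro continuous_map_lift[OF hc] continuous_intros)
    then show "(\<lambda>z. of_real (h z)) \<in> bump_functions U"
      unfolding bump_functions_def using W supp by (auto intro!: exI[of _ C])
    show "continuous_map Y euclideanreal h" by (rule hc)
  qed
qed

text \<open>The index of a function is a point of \<open>C\<close> whose chosen neighbourhood supports it.\<close>

lemma partition_of_unity:
  assumes C: "compactin Y C" and cover: "\<And>c. c \<in> C \<Longrightarrow> \<exists>U. openin Y U \<and> c \<in> U \<and> P U"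
  obtains F :: "'y set" and h :: "'y \<Rightarrow> 'y \<Rightarrow> complex"
  where "finite F" "\<forall>i\<in>F. \<exists>U. P U \<and> openin Y U \<and> h i \<in> bump_functions U"
    "\<forall>i y. cmod (h i y) \<le> 1" "\<forall>c\<in>C. (\<Sum>i\<in>F. h i c) = 1" "F \<subseteq> C"
proof -
  have "\<exists>g V U. openin Y V \<and> c \<in> V \<and> (\<forall>v\<in>V. g v = 1) \<and> (\<forall>z. 0 \<le> g z \<and> g z \<le> (1::real)) \<and>
      (\<lambda>z. of_real (g z)) \<in> bump_functions U \<and> continuous_map Y euclideanreal g \<and> openin Y U \<and> P U"
    if c: "c \<in> C" for c
  proof -
    obtain U where U: "openin Y U" "c \<in> U" "P U" using cover[OF c] by blast
    obtain g V where "openin Y V" "c \<in> V" "V \<subseteq> U" "\<forall>v\<in>V. g v = 1" "\<forall>z. 0 \<le> g z \<and> g z \<le> (1::real)"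
      "(\<lambda>z. of_real (g z)) \<in> bump_functions U" "continuous_map Y euclideanreal g"
      by (rule bump_at_point[OF U(1,2)])
    then show ?thesis using U by (intro exI[of _ g] exI[of _ V] exI[of _ U]) simp
  qed
  then obtain g V U where gVU: "\<And>c. c \<in> C \<Longrightarrow> openin Y (V c) \<and> c \<in> V c \<and> (\<forall>v\<in>V c. g c v = 1) \<and>
      (\<forall>z. 0 \<le> g c z \<and> g c z \<le> (1::real)) \<and> (\<lambda>z. of_real (g c z)) \<in> bump_functions (U c) \<and>
      continuous_map Y euclideanreal (g c) \<and> openin Y (U c) \<and> P (U c)"
    by metis
  have "\<exists>\<F>. finite \<F> \<and> \<F> \<subseteq> V ` C \<and> C \<subseteq> \<Union>\<F>"
    using gVU by (intro compactinD[OF C]) auto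
  then obtain F where F: "finite F" "F \<subseteq> C" "C \<subseteq> \<Union>(V ` F)"
    by (metis finite_subset_image)
  \<comment> \<open>bounded below by one, so that dividing by it preserves continuity away from \<open>C\<close> too\<close>
  define s where "s y = max 1 (\<Sum>i\<in>F. g i y)" for y
  define h where "h i y = complex_of_real (if i \<in> F then g i y / s y else 0)" for i y
  have s1: "s y \<ge> 1" for y by (simp add: s_def)
  have sc: "continuous_map Y euclideanreal s"
    unfolding s_def using F gVU by (intro continuous_intros) auto
  show thesis
  proof (rule that[of F h], safe)
    fix i assume i: "i \<in> F"
    then have iC: "i \<in> C" using F by blast
    have "continuous_map Y euclideanreal (\<lambda>y. g i y / s y)"
      using gVU[OF iC] sc s1 by (intro continuous_intros) (auto simp: order_less_le_trans[OF zero_less_one] less_imp_neq[symmetric])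
    moreover have "h i = (\<lambda>y. complex_of_real (g i y / s y))" using i by (auto simp: h_def)
    ultimately have "continuous_map Y euclidean (h i)"
      using continuous_map_lift[of Y "\<lambda>y. g i y / s y" complex_of_real] continuous_on_of_real_id by simp
    then have "h i \<in> bump_functions (U i)"
      using gVU[OF iC] by - (rule bump_functions_supported[of "\<lambda>z. of_real (g i z)"], auto simp: h_def split: if_splits)
    then show "\<exists>U. P U \<and> openin Y U \<and> h i \<in> bump_functions U" using gVU[OF iC] by blast
  next
    fix i y
    show "cmod (h i y) \<le> 1"
    proof (cases "i \<in> F")
      case True
      then have "0 \<le> g i y" "g i y \<le> 1" using gVU F by blast+
      then have "\<bar>g i y\<bar> \<le> s y" using s1[of y] by linarith
      then show ?thesis using True s1[of y] by (simp add: h_def norm_divide divide_le_eq)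
    qed (simp add: h_def)
  next
    fix c assume c: "c \<in> C"
    then obtain i where i: "i \<in> F" "c \<in> V i" using F by blast
    have "1 = g i c" using gVU i F by (metis subsetD)
    also have "\<dots> \<le> (\<Sum>i\<in>F. g i c)"
      using F gVU i by (intro member_le_sum) auto
    finally have s: "s c = (\<Sum>i\<in>F. g i c)" by (simp add: s_def)
    have "(\<Sum>i\<in>F. h i c) = of_real (\<Sum>i\<in>F. g i c / s c)" by (simp add: h_def)
    also have "(\<Sum>i\<in>F. g i c / s c) = 1"
      using s s1[of c] by (simp flip: sum_divide_distrib)
    finally show "(\<Sum>i\<in>F. h i c) = 1" by simp
  qed (use F in auto)
qed

definition fibre_in :: "'y set \<Rightarrow> 'y \<Rightarrow> 'y set" where
  "fibre_in C y = {z \<in> C. (y, z) \<in> R}"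

text \<open>A compact set is covered by finitely many slices, and meets each fibre in at most one point of
  each of them.\<close>

lemma fibre_in_bounded:
  assumes C: "compactin Y C"
  shows "\<exists>N. \<forall>y. finite (fibre_in C y) \<and> card (fibre_in C y) \<le> N"
proof -
  have "\<exists>U. openin Y U \<and> c \<in> U \<and> slice U" if "c \<in> C" for c
    using slice_exists[of c] slice_openin compactin_subset_topspace[OF C] that by blast
  then obtain F and h :: "'y \<Rightarrow> 'y \<Rightarrow> complex" where F: "finite F"
    "\<forall>i\<in>F. \<exists>U. slice U \<and> openin Y U \<and> h i \<in> bump_functions U"
    "\<forall>i y. cmod (h i y) \<le> 1" "\<forall>c\<in>C. (\<Sum>i\<in>F. h i c) = 1" "F \<subseteq> C"
    by (rule partition_of_unity[OF C])
  have "finite (fibre_in C y) \<and> card (fibre_in C y) \<le> card F" for y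
  proof -
    have "\<exists>i\<in>F. h i z \<noteq> 0" if "z \<in> fibre_in C y" for z
    proof (rule ccontr)
      assume "\<not> ?thesis"
      then have "(\<Sum>i\<in>F. h i z) = 0" by simp
      then show False using F(4) that by (simp add: fibre_in_def)
    qed
    then obtain i where i: "\<And>z. z \<in> fibre_in C y \<Longrightarrow> i z \<in> F \<and> h (i z) z \<noteq> 0" by metis
    have "inj_on i (fibre_in C y)"
    proof (rule inj_onI)
      fix z w assume z: "z \<in> fibre_in C y" and w: "w \<in> fibre_in C y" and eq: "i z = i w"
      obtain U where "slice U" "h (i z) \<in> bump_functions U" using F(2) i[OF z] by blast
      then have "slice U" "z \<in> U" "w \<in> U" using i[OF z] i[OF w] eq bump_functionsD(2) by auto
      moreover have "(z, w) \<in> R" using z w by (auto simp: fibre_in_def intro: R_trans R_sym)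
      ultimately show "z = w" by (rule slice_eq)
    qed
    moreover have "i ` fibre_in C y \<subseteq> F" using i by blast
    ultimately show ?thesis using F(1) by (metis card_inj_on_le finite_imageD finite_subset)
  qed
  then show ?thesis by blast
qed

lemma finite_fibre_in: "compactin Y C \<Longrightarrow> finite (fibre_in C y)"
  using fibre_in_bounded by blast

end

section \<open>The twisted convolution algebra\<close>

locale fibre_cocycle = local_homeo Y X \<psi> for Y :: "'y topology" and X :: "'x topology" and \<psi> +
  fixes \<sigma> :: "('y \<times> 'y) \<times> ('y \<times> 'y) \<Rightarrow> complex"
  assumes cocycle: "normalised_cocycle (fibre_groupoid Y \<psi>) \<sigma>"
begin

abbreviation "\<omega> x y z \<equiv> \<sigma> ((x, y), (y, z))"

lemma om_cocycle:
  assumes "(x, y) \<in> R" "(y, z) \<in> R" "(z, w) \<in> R"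
  shows "\<omega> x y z * \<omega> x z w = \<omega> y z w * \<omega> x y w"
proof -
  have "((x, y), (y, z)) \<in> composable G" "((y, z), (z, w)) \<in> composable G"
    using assms by (simp_all add: composable_G)
  then have "\<sigma> ((x, y), (y, z)) * \<sigma> (gmult G (x, y) (y, z), (z, w)) =
      \<sigma> ((y, z), (z, w)) * \<sigma> ((x, y), gmult G (y, z) (z, w))"
    using cocycle unfolding normalised_cocycle_def by blast
  then show ?thesis by simp
qed

lemma om_norm: "(x, y) \<in> R \<Longrightarrow> (y, z) \<in> R \<Longrightarrow> cmod (\<omega> x y z) = 1"
  using cocycle by (simp add: normalised_cocycle_def composable_G)

lemma om_cnj: "(x, y) \<in> R \<Longrightarrow> (y, z) \<in> R \<Longrightarrow> \<omega> x y z * cnj (\<omega> x y z) = 1"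
  using om_norm[of x y z] by (simp flip: complex_norm_square)

lemma om_cnj': "(x, y) \<in> R \<Longrightarrow> (y, z) \<in> R \<Longrightarrow> cnj (\<omega> x y z) * \<omega> x y z = 1"
  using om_cnj[of x y z] by (simp add: mult.commute)

lemma om_unit [simp]: "(x, y) \<in> R \<Longrightarrow> \<omega> x x y = 1" "(x, y) \<in> R \<Longrightarrow> \<omega> x y y = 1"
  using cocycle by (auto simp: normalised_cocycle_def)

lemma om_inverse: "(x, y) \<in> R \<Longrightarrow> \<omega> x y x = \<omega> y x y"
  using om_cocycle[of x y x y] R_sym[of x y] by simp

lemma om_adjoint: assumes "(z, v) \<in> R" "(v, y) \<in> R"
  shows "\<omega> z v z * cnj (\<omega> z v y) = \<omega> v z y"
proof -
  have "\<omega> z v z * \<omega> z z y = \<omega> v z y * \<omega> z v y"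
    using assms by (intro om_cocycle) (auto intro: R_sym R_trans)
  then have "\<omega> z v z = \<omega> v z y * \<omega> z v y" using om_unit(1)[OF R_trans[OF assms]] by simp
  then show ?thesis using om_cnj[OF assms] by (simp add: mult.assoc)
qed

lemma continuous_om:
  assumes c: "continuous_map Z Y a" "continuous_map Z Y b" "continuous_map Z Y c"
    and R: "\<And>z. z \<in> topspace Z \<Longrightarrow> (a z, b z) \<in> R" "\<And>z. z \<in> topspace Z \<Longrightarrow> (b z, c z) \<in> R"
  shows "continuous_map Z euclidean (\<lambda>z. \<omega> (a z) (b z) (c z))"
proof -
  have "continuous_map (subtopology (prod_topology TR TR) (composable G)) euclidean \<sigma>"
    using cocycle by (simp add: normalised_cocycle_def)
  moreover have "continuous_map Z (subtopology (prod_topology TR TR) (composable G)) (\<lambda>z. ((a z, b z), (b z, c z)))"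
    using R by (intro continuous_map_into_subtopology continuous_map_pairedI continuous_map_into_TR c)
      (auto simp: composable_G)
  ultimately have "continuous_map Z euclidean (\<sigma> \<circ> (\<lambda>z. ((a z, b z), (b z, c z))))"
    using continuous_map_compose by blast
  then show ?thesis by (simp add: o_def)
qed

subsection \<open>Compactly supported functions on the relation\<close>

lemma Cc_iff: "f \<in> Cc G \<longleftrightarrow> continuous_map TR euclidean f \<and> (\<exists>K. compactin TR K \<and> (\<forall>\<alpha>. f \<alpha> \<noteq> 0 \<longrightarrow> \<alpha> \<in> K))"
proof
  assume f: "f \<in> Cc G"
  have "f \<alpha> = 0 \<or> \<alpha> \<in> TR closure_of {\<alpha> \<in> R. f \<alpha> \<noteq> 0}" for \<alpha>
  proof (cases "\<alpha> \<in> R")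
    case True
    have "{\<alpha> \<in> R. f \<alpha> \<noteq> 0} \<subseteq> TR closure_of {\<alpha> \<in> R. f \<alpha> \<noteq> 0}"
      by (rule closure_of_subset) (auto simp: R_iff)
    then show ?thesis using True by blast
  next
    case False
    then show ?thesis using f by (cases \<alpha>) (simp add: Cc_def)
  qed
  then show "continuous_map TR euclidean f \<and> (\<exists>K. compactin TR K \<and> (\<forall>\<alpha>. f \<alpha> \<noteq> 0 \<longrightarrow> \<alpha> \<in> K))"
    using f unfolding Cc_def by (intro conjI exI[of _ "TR closure_of {\<alpha> \<in> R. f \<alpha> \<noteq> 0}"]) auto
next
  assume f: "continuous_map TR euclidean f \<and> (\<exists>K. compactin TR K \<and> (\<forall>\<alpha>. f \<alpha> \<noteq> 0 \<longrightarrow> \<alpha> \<in> K))"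
  then obtain K where K: "compactin TR K" "\<forall>\<alpha>. f \<alpha> \<noteq> 0 \<longrightarrow> \<alpha> \<in> K" by metis
  have "K \<subseteq> R" using compactin_subset_topspace[OF K(1)] by simp
  have "closedin TR K" by (rule compactin_imp_closedin[OF Hausdorff_TR K(1)])
  then have "TR closure_of {\<alpha> \<in> R. f \<alpha> \<noteq> 0} \<subseteq> K" using K(2) by (intro closure_of_minimal) auto
  then have "compactin TR (TR closure_of {\<alpha> \<in> R. f \<alpha> \<noteq> 0})"
    using closed_compactin[OF K(1)] by auto
  then show "f \<in> Cc G" using f K \<open>K \<subseteq> R\<close> by (auto simp: Cc_def)
qed

lemma Cc_R: "f \<in> Cc G \<Longrightarrow> f (y, z) \<noteq> 0 \<Longrightarrow> (y, z) \<in> R"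
  by (auto simp: Cc_def)

lemma Cc_continuous: "f \<in> Cc G \<Longrightarrow> continuous_map TR euclidean f"
  by (simp add: Cc_iff)

lemma Cc_continuous_map:
  assumes "f \<in> Cc G" "continuous_map Z Y a" "continuous_map Z Y b" "\<And>z. z \<in> topspace Z \<Longrightarrow> (a z, b z) \<in> R"
  shows "continuous_map Z euclidean (\<lambda>z. f (a z, b z))"
  using continuous_map_compose[OF continuous_map_into_TR[OF assms(2-4)] Cc_continuous[OF assms(1)]]
  by (simp add: o_def)

lemma Cc_supported:
  assumes "f \<in> Cc G" "continuous_map TR euclidean g" "\<And>\<alpha>. g \<alpha> \<noteq> 0 \<Longrightarrow> f \<alpha> \<noteq> 0"
  shows "g \<in> Cc G"
  using assms unfolding Cc_iff by blast

definition carried :: "'y set \<Rightarrow> ('y \<times> 'y \<Rightarrow> complex) \<Rightarrow> bool" where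
  "carried C f \<longleftrightarrow> (\<forall>y z. f (y, z) \<noteq> 0 \<longrightarrow> y \<in> C \<and> z \<in> C)"

lemma carried_mono: "carried C f \<Longrightarrow> C \<subseteq> D \<Longrightarrow> carried D f"
  by (auto simp: carried_def)

lemma Cc_carried:
  assumes "f \<in> Cc G" obtains C where "compactin Y C" "carried C f"
proof -
  obtain K where K: "compactin TR K" "\<forall>\<alpha>. f \<alpha> \<noteq> 0 \<longrightarrow> \<alpha> \<in> K" using assms by (auto simp: Cc_iff)
  have "compactin Y (fst ` K \<union> snd ` K)"
    using K(1) by (intro compactin_Un image_compactin[OF _ continuous_fst] image_compactin[OF _ continuous_snd])
  moreover have "carried (fst ` K \<union> snd ` K) f" using K(2) by (force simp: carried_def)
  ultimately show thesis by (rule that)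
qed

lemma Cc_carried2:
  assumes "f \<in> Cc G" "g \<in> Cc G" obtains C where "compactin Y C" "carried C f" "carried C g"
proof -
  obtain C where C: "compactin Y C" "carried C f" using Cc_carried[OF assms(1)] .
  obtain D where D: "compactin Y D" "carried D g" using Cc_carried[OF assms(2)] .
  show thesis by (rule that[of "C \<union> D"]) (use C D in \<open>auto intro: carried_mono compactin_Un\<close>)
qed

lemma Cc_carried3:
  assumes "f \<in> Cc G" "g \<in> Cc G" "h \<in> Cc G"
  obtains C where "compactin Y C" "carried C f" "carried C g" "carried C h"
proof -
  obtain C where C: "compactin Y C" "carried C f" "carried C g" using Cc_carried2[OF assms(1,2)] .
  obtain D where D: "compactin Y D" "carried D h" using Cc_carried[OF assms(3)] .
  show thesis by (rule that[of "C \<union> D"]) (use C D in \<open>auto intro: carried_mono compactin_Un\<close>)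
qed

abbreviation "A \<equiv> twisted_algebra G \<sigma>"

lemma A_simps [simp]:
  "carrier A = Cc G" "\<zero>\<^bsub>A\<^esub> = (\<lambda>_. 0)" "f \<oplus>\<^bsub>A\<^esub> g = (\<lambda>\<alpha>. f \<alpha> + g \<alpha>)" "c \<odot>\<^bsub>A\<^esub> f = (\<lambda>\<alpha>. c * f \<alpha>)"
  by (simp_all add: twisted_algebra_def)

lemma star_A: "astar A f (y, z) = (if (y, z) \<in> R then cnj (f (z, y) * \<omega> y z y) else 0)"
  by (simp add: twisted_algebra_def)

lemma fibre_in_eq: "(y, z) \<in> R \<Longrightarrow> fibre_in C y = fibre_in C z"
  by (auto simp: fibre_in_def intro: R_trans R_sym)

lemma fibre_in_R: "z \<in> fibre_in C y \<Longrightarrow> (y, z) \<in> R" "z \<in> fibre_in C y \<Longrightarrow> (z, y) \<in> R"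
  by (auto simp: fibre_in_def intro: R_sym)

lemma sum_over_fibre:
  assumes C: "compactin Y C" and zero: "\<And>z. z \<notin> C \<Longrightarrow> F (y, z) = (0::complex)"
  shows "(\<Sum>\<^sub>\<infinity>\<beta>\<in>{\<beta> \<in> R. fst \<beta> = y}. F \<beta>) = (\<Sum>z\<in>fibre_in C y. F (y, z))"
proof -
  have "(\<Sum>\<^sub>\<infinity>\<beta>\<in>{\<beta> \<in> R. fst \<beta> = y}. F \<beta>) = (\<Sum>\<^sub>\<infinity>\<beta>\<in>Pair y ` fibre_in C y. F \<beta>)"
    by (rule infsum_cong_neutral) (use zero in \<open>auto simp: fibre_in_def image_iff\<close>)
  also have "\<dots> = (\<Sum>\<beta>\<in>Pair y ` fibre_in C y. F \<beta>)"
    using finite_fibre_in[OF C] by (intro infsum_finite) simp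
  also have "\<dots> = (\<Sum>z\<in>fibre_in C y. F (y, z))"
    by (subst sum.reindex) (auto simp: inj_on_def)
  finally show ?thesis .
qed

text \<open>On functions carried by a compact set, convolution is a twisted product of finite matrices over
  each fibre.\<close>

lemma mult_A:
  assumes C: "compactin Y C" "carried C f" and R: "(y, w) \<in> R"
  shows "(f \<otimes>\<^bsub>A\<^esub> g) (y, w) = (\<Sum>z\<in>fibre_in C y. f (y, z) * g (z, w) * \<omega> y z w)"
proof -
  have "(f \<otimes>\<^bsub>A\<^esub> g) (y, w) = (\<Sum>\<^sub>\<infinity>\<beta>\<in>{\<beta> \<in> R. fst \<beta> = y}. f \<beta> * g (snd \<beta>, w) * \<sigma> (\<beta>, (snd \<beta>, w)))"
    using R by (simp add: twisted_algebra_def)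
  also have "\<dots> = (\<Sum>z\<in>fibre_in C y. f (y, z) * g (z, w) * \<omega> y z w)"
    using C(2) by (subst sum_over_fibre[OF C(1)]) (auto simp: carried_def)
  finally show ?thesis .
qed

lemma mult_A_outside: "(y, w) \<notin> R \<Longrightarrow> (f \<otimes>\<^bsub>A\<^esub> g) (y, w) = 0"
  by (simp add: twisted_algebra_def)

lemma mult_A_carried:
  assumes C: "compactin Y C" "carried C f" "carried C g"
  shows "carried C (f \<otimes>\<^bsub>A\<^esub> g)"
  unfolding carried_def
proof (intro allI impI)
  fix y w assume nz: "(f \<otimes>\<^bsub>A\<^esub> g) (y, w) \<noteq> 0"
  then have R: "(y, w) \<in> R" using mult_A_outside by blast
  have "\<exists>z\<in>fibre_in C y. f (y, z) * g (z, w) * \<omega> y z w \<noteq> 0"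
    using nz unfolding mult_A[OF C(1,2) R] by (meson sum.neutral)
  then show "y \<in> C \<and> w \<in> C" using C(2,3) by (auto simp: carried_def)
qed

lemma star_A_carried: "carried C f \<Longrightarrow> carried C (astar A f)"
  by (auto simp: carried_def star_A split: if_splits)

lemma Cc_add: assumes "f \<in> Cc G" "g \<in> Cc G" shows "(\<lambda>\<alpha>. f \<alpha> + g \<alpha>) \<in> Cc G"
proof -
  obtain K L where K: "compactin TR K" "\<forall>\<alpha>. f \<alpha> \<noteq> 0 \<longrightarrow> \<alpha> \<in> K" and L: "compactin TR L" "\<forall>\<alpha>. g \<alpha> \<noteq> 0 \<longrightarrow> \<alpha> \<in> L"
    using assms unfolding Cc_iff by blast
  have "compactin TR (K \<union> L)" using K L compactin_Un by blast
  moreover have "\<forall>\<alpha>. f \<alpha> + g \<alpha> \<noteq> 0 \<longrightarrow> \<alpha> \<in> K \<union> L" using K L by (metis Un_iff add_0)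
  moreover have "continuous_map TR euclidean (\<lambda>\<alpha>. f \<alpha> + g \<alpha>)"
    using assms by (intro continuous_map_add Cc_continuous)
  ultimately show ?thesis unfolding Cc_iff by blast
qed

lemma Cc_smult: "f \<in> Cc G \<Longrightarrow> (\<lambda>\<alpha>. c * f \<alpha>) \<in> Cc G"
  by (rule Cc_supported[of f]) (auto intro: continuous_map_complex_mult Cc_continuous)

lemma Cc_zero: "(\<lambda>_. 0) \<in> Cc G"
  by (auto simp: Cc_iff intro: exI[of _ "{}"])

lemma Cc_sum: "(\<And>i. i \<in> I \<Longrightarrow> f i \<in> Cc G) \<Longrightarrow> (\<lambda>\<alpha>. \<Sum>i\<in>I. f i \<alpha>) \<in> Cc G"
  by (induction I rule: infinite_finite_induct) (simp_all add: Cc_zero Cc_add)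

lemma Cc_star: assumes f: "f \<in> Cc G" shows "astar A f \<in> Cc G"
proof -
  obtain K where K: "compactin TR K" "\<forall>\<alpha>. f \<alpha> \<noteq> 0 \<longrightarrow> \<alpha> \<in> K" using f unfolding Cc_iff by blast
  have sw: "continuous_map TR TR (\<lambda>\<alpha>. (snd \<alpha>, fst \<alpha>))"
    by (intro continuous_map_into_TR continuous_fst continuous_snd) (auto intro: R_sym)
  have "compactin TR ((\<lambda>\<alpha>. (snd \<alpha>, fst \<alpha>)) ` K)" by (rule image_compactin[OF K(1) sw])
  moreover have "\<alpha> \<in> (\<lambda>\<alpha>. (snd \<alpha>, fst \<alpha>)) ` K" if "astar A f \<alpha> \<noteq> 0" for \<alpha>
  proof -
    have "f (snd \<alpha>, fst \<alpha>) \<noteq> 0" using that star_A[of f "fst \<alpha>" "snd \<alpha>"] by (auto split: if_splits)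
    then show ?thesis using K(2) by (intro image_eqI[of _ _ "(snd \<alpha>, fst \<alpha>)"]) auto
  qed
  moreover have "continuous_map TR euclidean (\<lambda>\<alpha>. cnj (f (snd \<alpha>, fst \<alpha>) * \<omega> (fst \<alpha>) (snd \<alpha>) (fst \<alpha>)))"
    by (intro continuous_map_lift[where F = cnj] continuous_map_complex_mult Cc_continuous_map[OF f] continuous_om
        continuous_fst continuous_snd continuous_intros) (auto intro: R_sym)
  then have "continuous_map TR euclidean (astar A f)"
    by (rule continuous_map_eq) (auto simp: star_A)
  ultimately show ?thesis unfolding Cc_iff by blast
qed

text \<open>Right multiplication by a function on the base localises a function of the relation to a slice
  in the second variable. Its convolution from the left is then a single term, evaluated along the
  section of the slice.\<close>

lemma continuous_mult_slice:
  assumes f: "f \<in> Cc G" and g: "g \<in> Cc G" and U: "slice U" and h: "h \<in> bump_functions U"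
  shows "continuous_map TR euclidean (\<lambda>\<alpha>. if fst \<alpha> \<in> saturation U then
    f (fst \<alpha>, section_map U (fst \<alpha>)) * h (section_map U (fst \<alpha>)) * g (section_map U (fst \<alpha>), snd \<alpha>) *
      \<omega> (fst \<alpha>) (section_map U (fst \<alpha>)) (snd \<alpha>) else 0)" (is "continuous_map TR euclidean ?F")
proof -
  let ?t = "section_map U"
  obtain C where C: "compactin Y C" "C \<subseteq> U" "\<forall>y. h y \<noteq> 0 \<longrightarrow> y \<in> C" using h by (auto simp: bump_functions_def)
  obtain K where K: "compactin TR K" "\<forall>\<alpha>. f \<alpha> \<noteq> 0 \<longrightarrow> \<alpha> \<in> K" using f unfolding Cc_iff by blast
  have KR: "K \<subseteq> R" using compactin_subset_topspace[OF K(1)] by simp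
  \<comment> \<open>a closed subset of \<open>Y\<close> off which the term vanishes, so that it extends continuously by zero\<close>
  define D where "D = fst ` ({\<alpha> \<in> R. snd \<alpha> \<in> C} \<inter> K)"
  have "closedin TR {\<alpha> \<in> R. snd \<alpha> \<in> C}"
    using closedin_continuous_map_preimage[OF continuous_snd compactin_imp_closedin[OF Hausdorff C(1)]]
    unfolding topspace_TR .
  then have "compactin Y D"
    unfolding D_def using K(1) by (intro image_compactin[OF _ continuous_fst] closed_Int_compactin)
  then have D: "closedin Y D" by (rule compactin_imp_closedin[OF Hausdorff])
  have DU: "D \<subseteq> saturation U"
  proof
    fix a assume "a \<in> D"
    then obtain b where "(a, b) \<in> R" "b \<in> C" by (auto simp: D_def)
    then show "a \<in> saturation U" using C(2) unfolding saturation_def by blast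
  qed
  have zero: "?F \<alpha> = 0" if "\<alpha> \<in> R" "fst \<alpha> \<notin> D" for \<alpha>
  proof (rule ccontr)
    assume nz: "?F \<alpha> \<noteq> 0"
    then have "fst \<alpha> \<in> saturation U" "f (fst \<alpha>, ?t (fst \<alpha>)) \<noteq> 0" "h (?t (fst \<alpha>)) \<noteq> 0" by (auto split: if_splits)
    then have "(fst \<alpha>, ?t (fst \<alpha>)) \<in> K" "?t (fst \<alpha>) \<in> C" using K C by auto
    then have "fst \<alpha> \<in> D" unfolding D_def using KR by (intro image_eqI[of _ _ "(fst \<alpha>, ?t (fst \<alpha>))"]) auto
    then show False using that by simp
  qed
  define N where "N b = {\<alpha> \<in> R. fst \<alpha> \<in> (if b then saturation U else T - D)}" for b
  show ?thesis
  proof (rule pasting_lemma[where I = UNIV and T = N and f = "\<lambda>b. if b then ?F else (\<lambda>_. 0)"])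
    show "openin TR (N b)" for b
      using openin_continuous_map_preimage[OF continuous_fst, of "if b then saturation U else T - D"]
        openin_saturation[OF slice_openin[OF U]] openin_diff[OF openin_topspace D]
      unfolding N_def topspace_TR by simp
    show "continuous_map (subtopology TR (N b)) euclidean (if b then ?F else (\<lambda>_. 0))" for b
    proof (cases b)
      case True
      let ?Z = "subtopology TR (N True)"
      have fZ: "continuous_map ?Z Y fst" and sZ: "continuous_map ?Z Y snd"
        by (auto intro: continuous_map_from_subtopology continuous_fst continuous_snd)
      have top: "topspace ?Z = N True"
        unfolding topspace_subtopology[of TR] topspace_TR by (auto simp: N_def)
      have "continuous_map ?Z (subtopology Y (saturation U)) fst"
        by (rule continuous_map_into_subtopology[OF fZ]) (unfold top, simp add: N_def)
      from continuous_map_compose[OF this continuous_section_map[OF U]]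
      have tZ: "continuous_map ?Z Y (\<lambda>\<alpha>. ?t (fst \<alpha>))" by (simp add: o_def)
      have t1: "(fst \<alpha>, ?t (fst \<alpha>)) \<in> R" "(?t (fst \<alpha>), snd \<alpha>) \<in> R" if "\<alpha> \<in> topspace ?Z" for \<alpha>
      proof -
        have a: "\<alpha> \<in> R" "fst \<alpha> \<in> saturation U" using that unfolding top by (auto simp: N_def)
        show t: "(fst \<alpha>, ?t (fst \<alpha>)) \<in> R" using section_map[OF U a(2)] by simp
        show "(?t (fst \<alpha>), snd \<alpha>) \<in> R" using R_trans[OF R_sym[OF t], of "snd \<alpha>"] a(1) by simp
      qed
      have hZ: "continuous_map ?Z euclidean (\<lambda>\<alpha>. h (?t (fst \<alpha>)))"
        using continuous_map_compose[OF tZ bump_functionsD(1)[OF h]] by (simp add: o_def)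
      have "continuous_map ?Z euclidean (\<lambda>\<alpha>. f (fst \<alpha>, ?t (fst \<alpha>)) * h (?t (fst \<alpha>)) * g (?t (fst \<alpha>), snd \<alpha>) *
          \<omega> (fst \<alpha>) (?t (fst \<alpha>)) (snd \<alpha>))"
        by (intro continuous_map_complex_mult hZ Cc_continuous_map[OF f fZ tZ] Cc_continuous_map[OF g tZ sZ]
            continuous_om[OF fZ tZ sZ] t1)
      then have "continuous_map ?Z euclidean ?F"
        by (rule continuous_map_eq) (unfold top, simp add: N_def)
      then show ?thesis using True by simp
    qed simp
    show "(if b then ?F else (\<lambda>_. 0)) \<alpha> = (if c then ?F else (\<lambda>_. 0)) \<alpha>" if "\<alpha> \<in> topspace TR \<inter> N b \<inter> N c" for b c \<alpha>
      using that zero[of \<alpha>] unfolding topspace_TR by (cases b; cases c) (auto simp: N_def)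
    show "\<exists>b. b \<in> UNIV \<and> \<alpha> \<in> N b \<and> ?F \<alpha> = (if b then ?F else (\<lambda>_. 0)) \<alpha>" if \<alpha>: "\<alpha> \<in> topspace TR" for \<alpha>
    proof (cases "fst \<alpha> \<in> saturation U")
      case True
      then show ?thesis using \<alpha> unfolding topspace_TR by (intro exI[of _ True]) (simp add: N_def)
    next
      case False
      have "fst \<alpha> \<in> T" using \<alpha> unfolding topspace_TR by (cases \<alpha>) (simp add: R_iff)
      then show ?thesis using \<alpha> False DU unfolding topspace_TR by (intro exI[of _ False]) (auto simp: N_def)
    qed
  qed
qed

text \<open>A partition of unity subordinate to slices writes the product as a finite sum of terms as above. Its
  support lies in the image of the compact set of composable pairs in the product of the two supports.\<close>

lemma Cc_mult: assumes f: "f \<in> Cc G" and g: "g \<in> Cc G" shows "f \<otimes>\<^bsub>A\<^esub> g \<in> Cc G"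
proof -
  obtain C where C: "compactin Y C" "carried C f" "carried C g" using Cc_carried2[OF f g] .
  have "\<exists>U. openin Y U \<and> c \<in> U \<and> slice U" if "c \<in> C" for c
    using slice_exists[of c] slice_openin compactin_subset_topspace[OF C(1)] that by blast
  then obtain F and h :: "'y \<Rightarrow> 'y \<Rightarrow> complex" where F: "finite F"
    "\<forall>i\<in>F. \<exists>U. slice U \<and> openin Y U \<and> h i \<in> bump_functions U"
    "\<forall>i y. cmod (h i y) \<le> 1" "\<forall>c\<in>C. (\<Sum>i\<in>F. h i c) = 1" "F \<subseteq> C"
    by (rule partition_of_unity[OF C(1)])
  obtain U where U: "\<And>i. i \<in> F \<Longrightarrow> slice (U i)" "\<And>i. i \<in> F \<Longrightarrow> h i \<in> bump_functions (U i)" using F(2) by metis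
  define H where "H i \<alpha> = (if fst \<alpha> \<in> saturation (U i) then
    f (fst \<alpha>, section_map (U i) (fst \<alpha>)) * h i (section_map (U i) (fst \<alpha>)) * g (section_map (U i) (fst \<alpha>), snd \<alpha>) *
      \<omega> (fst \<alpha>) (section_map (U i) (fst \<alpha>)) (snd \<alpha>) else 0)" for i \<alpha>
  have H: "(\<Sum>z\<in>fibre_in C y. f (y, z) * h i z * g (z, w) * \<omega> y z w) = H i (y, w)"
    if i: "i \<in> F" and R: "(y, w) \<in> R" for i y w
  proof (cases "y \<in> saturation (U i)")
    case True
    let ?t = "section_map (U i) y"
    have t: "?t \<in> U i" "(y, ?t) \<in> R" using section_map[OF U(1)[OF i] True] by auto
    have "(\<Sum>z\<in>fibre_in C y. f (y, z) * h i z * g (z, w) * \<omega> y z w) =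
        (\<Sum>z\<in>fibre_in C y. if z = ?t then f (y, z) * h i z * g (z, w) * \<omega> y z w else 0)"
    proof (rule sum.cong[OF refl])
      fix z assume z: "z \<in> fibre_in C y"
      show "f (y, z) * h i z * g (z, w) * \<omega> y z w = (if z = ?t then f (y, z) * h i z * g (z, w) * \<omega> y z w else 0)"
      proof (cases "h i z = 0")
        case False
        then have "z \<in> U i" using bump_functionsD(2)[OF U(2)[OF i]] by blast
        then have "?t = z" using z by (intro section_map_eq[OF U(1)[OF i]]) (auto simp: fibre_in_def)
        then show ?thesis by simp
      next
        case True
        show ?thesis unfolding True by simp
      qed
    qed
    also have "\<dots> = (if ?t \<in> fibre_in C y then f (y, ?t) * h i ?t * g (?t, w) * \<omega> y ?t w else 0)"
      using finite_fibre_in[OF C(1)] by simp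
    also have "\<dots> = H i (y, w)"
      using True t C(2) by (auto simp: H_def fibre_in_def carried_def)
    finally show ?thesis .
  next
    case False
    have "h i z = 0" if "z \<in> fibre_in C y" for z
      using that False bump_functionsD(2)[OF U(2)[OF i], of z] by (auto simp: saturation_def fibre_in_def)
    then show ?thesis using False by (simp add: H_def)
  qed
  have "(\<Sum>i\<in>F. H i \<alpha>) = (f \<otimes>\<^bsub>A\<^esub> g) \<alpha>" if \<alpha>R: "\<alpha> \<in> topspace TR" for \<alpha>
  proof -
    obtain y w where \<alpha>: "\<alpha> = (y, w)" "(y, w) \<in> R" using \<alpha>R unfolding topspace_TR by (metis surj_pair)
    have "(f \<otimes>\<^bsub>A\<^esub> g) \<alpha> = (\<Sum>z\<in>fibre_in C y. (\<Sum>i\<in>F. h i z) * (f (y, z) * g (z, w) * \<omega> y z w))"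
      unfolding \<alpha>(1) mult_A[OF C(1,2) \<alpha>(2)] using F(4) by (intro sum.cong) (auto simp: fibre_in_def)
    also have "\<dots> = (\<Sum>z\<in>fibre_in C y. \<Sum>i\<in>F. f (y, z) * h i z * g (z, w) * \<omega> y z w)"
      unfolding sum_distrib_right by (simp add: mult_ac)
    also have "\<dots> = (\<Sum>i\<in>F. \<Sum>z\<in>fibre_in C y. f (y, z) * h i z * g (z, w) * \<omega> y z w)"
      by (rule sum.swap)
    also have "\<dots> = (\<Sum>i\<in>F. H i \<alpha>)" using H \<alpha> by simp
    finally show ?thesis by simp
  qed
  moreover have "continuous_map TR euclidean (\<lambda>\<alpha>. \<Sum>i\<in>F. H i \<alpha>)"
    unfolding H_def by (intro continuous_map_sum F(1) continuous_mult_slice[OF f g U])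
  ultimately have cont: "continuous_map TR euclidean (f \<otimes>\<^bsub>A\<^esub> g)"
    using continuous_map_eq by blast
  obtain K where K: "compactin TR K" "\<forall>\<alpha>. f \<alpha> \<noteq> 0 \<longrightarrow> \<alpha> \<in> K" using f unfolding Cc_iff by blast
  obtain L where L: "compactin TR L" "\<forall>\<alpha>. g \<alpha> \<noteq> 0 \<longrightarrow> \<alpha> \<in> L" using g unfolding Cc_iff by blast
  let ?P = "prod_topology TR TR"
  have c1: "continuous_map ?P Y (\<lambda>p. snd (fst p))" "continuous_map ?P Y (\<lambda>p. fst (snd p))"
    "continuous_map ?P Y (\<lambda>p. fst (fst p))" "continuous_map ?P Y (\<lambda>p. snd (snd p))"
    using continuous_map_compose[OF continuous_map_fst continuous_snd] continuous_map_compose[OF continuous_map_snd continuous_fst]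
      continuous_map_compose[OF continuous_map_fst continuous_fst] continuous_map_compose[OF continuous_map_snd continuous_snd]
    by (simp_all add: o_def)
  have topP: "topspace ?P = R \<times> R" by (simp only: topspace_prod_topology[of TR TR] topspace_TR)
  let ?E = "{p \<in> R \<times> R. snd (fst p) = fst (snd p)} \<inter> (K \<times> L)"
  have "closedin ?P {p \<in> R \<times> R. snd (fst p) = fst (snd p)}"
    using closedin_continuous_maps_eq[OF Hausdorff c1(1,2)] unfolding topP .
  then have "compactin ?P ?E"
    using K(1) L(1) by (intro closed_Int_compactin) (auto simp: compactin_Times)
  then have E: "compactin (subtopology ?P {p \<in> R \<times> R. snd (fst p) = fst (snd p)}) ?E"
    by (auto simp: compactin_subtopology)
  have "continuous_map (subtopology ?P {p \<in> R \<times> R. snd (fst p) = fst (snd p)}) TR (\<lambda>p. (fst (fst p), snd (snd p)))"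
    by (intro continuous_map_into_TR continuous_map_from_subtopology c1(3,4))
      (unfold topspace_subtopology[of ?P] topP, auto intro: R_trans)
  from image_compactin[OF E this]
  have "compactin TR ((\<lambda>p. (fst (fst p), snd (snd p))) ` ?E)" .
  moreover have "\<forall>\<alpha>. (f \<otimes>\<^bsub>A\<^esub> g) \<alpha> \<noteq> 0 \<longrightarrow> \<alpha> \<in> (\<lambda>p. (fst (fst p), snd (snd p))) ` ?E"
  proof (intro allI impI)
    fix \<alpha> assume nz: "(f \<otimes>\<^bsub>A\<^esub> g) \<alpha> \<noteq> 0"
    obtain y w where \<alpha>: "\<alpha> = (y, w)" by (cases \<alpha>)
    then have R: "(y, w) \<in> R" using nz mult_A_outside by blast
    have "\<exists>z\<in>fibre_in C y. f (y, z) * g (z, w) * \<omega> y z w \<noteq> 0"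
      using nz unfolding \<alpha> mult_A[OF C(1,2) R] by (meson sum.neutral)
    then obtain z where "f (y, z) \<noteq> 0" "g (z, w) \<noteq> 0" by auto
    then have "((y, z), (z, w)) \<in> ?E" using K L Cc_R[OF f] Cc_R[OF g] by auto
    then show "\<alpha> \<in> (\<lambda>p. (fst (fst p), snd (snd p))) ` ?E"
      unfolding \<alpha> by (intro image_eqI[of _ _ "((y, z), (z, w))"]) auto
  qed
  ultimately show ?thesis using cont unfolding Cc_iff by blast
qed

text \<open>The cocycle identity makes twisted matrix multiplication associative. The last factor may be any
  function, for example a vector of an induced representation.\<close>

lemma mult_A_assoc:
  assumes C: "compactin Y C" "carried C f" "carried C g"
  shows "(f \<otimes>\<^bsub>A\<^esub> g) \<otimes>\<^bsub>A\<^esub> h = f \<otimes>\<^bsub>A\<^esub> (g \<otimes>\<^bsub>A\<^esub> h)"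
proof (rule ext, clarify)
  fix y w
  show "(f \<otimes>\<^bsub>A\<^esub> g \<otimes>\<^bsub>A\<^esub> h) (y, w) = (f \<otimes>\<^bsub>A\<^esub> (g \<otimes>\<^bsub>A\<^esub> h)) (y, w)"
  proof (cases "(y, w) \<in> R")
    case R: True
    let ?F = "fibre_in C y"
    have "(f \<otimes>\<^bsub>A\<^esub> g \<otimes>\<^bsub>A\<^esub> h) (y, w) = (\<Sum>v\<in>?F. (\<Sum>z\<in>?F. f (y, z) * g (z, v) * \<omega> y z v) * h (v, w) * \<omega> y v w)"
      unfolding mult_A[OF C(1) mult_A_carried[OF C(1,2,3)] R]
      by (intro sum.cong refl) (simp add: mult_A[OF C(1,2)] fibre_in_R)
    also have "\<dots> = (\<Sum>v\<in>?F. \<Sum>z\<in>?F. f (y, z) * g (z, v) * h (v, w) * (\<omega> y z v * \<omega> y v w))"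
      by (simp add: sum_distrib_right sum_distrib_left mult_ac)
    also have "\<dots> = (\<Sum>v\<in>?F. \<Sum>z\<in>?F. f (y, z) * g (z, v) * h (v, w) * (\<omega> z v w * \<omega> y z w))"
    proof (intro sum.cong refl)
      fix v z assume vz: "v \<in> ?F" "z \<in> ?F"
      have "\<omega> y z v * \<omega> y v w = \<omega> z v w * \<omega> y z w"
        using vz R by (intro om_cocycle) (auto dest: fibre_in_R intro: R_trans R_sym)
      then show "f (y, z) * g (z, v) * h (v, w) * (\<omega> y z v * \<omega> y v w) = f (y, z) * g (z, v) * h (v, w) * (\<omega> z v w * \<omega> y z w)"
        by simp
    qed
    also have "\<dots> = (\<Sum>z\<in>?F. \<Sum>v\<in>?F. f (y, z) * g (z, v) * h (v, w) * (\<omega> z v w * \<omega> y z w))"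
      by (rule sum.swap)
    also have "\<dots> = (\<Sum>z\<in>?F. f (y, z) * (\<Sum>v\<in>?F. g (z, v) * h (v, w) * \<omega> z v w) * \<omega> y z w)"
      by (simp add: sum_distrib_right sum_distrib_left mult_ac)
    also have "\<dots> = (\<Sum>z\<in>?F. f (y, z) * (g \<otimes>\<^bsub>A\<^esub> h) (z, w) * \<omega> y z w)"
    proof (intro sum.cong refl)
      fix z assume z: "z \<in> ?F"
      have "fibre_in C z = ?F" using fibre_in_eq[OF fibre_in_R(2)[OF z]] .
      then show "f (y, z) * (\<Sum>v\<in>?F. g (z, v) * h (v, w) * \<omega> z v w) * \<omega> y z w = f (y, z) * (g \<otimes>\<^bsub>A\<^esub> h) (z, w) * \<omega> y z w"
        using mult_A[OF C(1,3), of z w h] R_trans[OF fibre_in_R(2)[OF z] R] by simp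
    qed
    also have "\<dots> = (f \<otimes>\<^bsub>A\<^esub> (g \<otimes>\<^bsub>A\<^esub> h)) (y, w)" by (rule mult_A[OF C(1,2) R, symmetric])
    finally show ?thesis .
  qed (simp add: mult_A_outside)
qed

lemma star_algebra_A: "is_star_algebra A"
  unfolding is_star_algebra_def
proof (intro conjI ballI allI)
  show "module complex_ring A"
    by (rule complex_moduleI) (auto simp: Cc_add Cc_smult Cc_zero algebra_simps)
next
  fix f g h assume "f \<in> carrier A" "g \<in> carrier A" "h \<in> carrier A"
  then have f: "f \<in> Cc G" and g: "g \<in> Cc G" and h: "h \<in> Cc G" by auto
  obtain C where C: "compactin Y C" "carried C f" "carried C g" "carried C h" using Cc_carried3[OF f g h] .
  note out = mult_A_outside
  show "f \<otimes>\<^bsub>A\<^esub> g \<otimes>\<^bsub>A\<^esub> h = f \<otimes>\<^bsub>A\<^esub> (g \<otimes>\<^bsub>A\<^esub> h)" by (rule mult_A_assoc[OF C(1,2,3)])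
  have add: "carried C (\<lambda>\<alpha>. f \<alpha> + g \<alpha>)" using C(2,3) by (auto simp: carried_def) (metis add_0)+
  show "(f \<oplus>\<^bsub>A\<^esub> g) \<otimes>\<^bsub>A\<^esub> h = f \<otimes>\<^bsub>A\<^esub> h \<oplus>\<^bsub>A\<^esub> g \<otimes>\<^bsub>A\<^esub> h"
  proof (rule ext, clarify)
    fix y w
    show "((f \<oplus>\<^bsub>A\<^esub> g) \<otimes>\<^bsub>A\<^esub> h) (y, w) = (f \<otimes>\<^bsub>A\<^esub> h \<oplus>\<^bsub>A\<^esub> g \<otimes>\<^bsub>A\<^esub> h) (y, w)"
      by (cases "(y, w) \<in> R")
        (simp_all add: out mult_A[OF C(1) add] mult_A[OF C(1,2)] mult_A[OF C(1,3)] sum.distrib distrib_right distrib_left)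
  qed
  show "f \<otimes>\<^bsub>A\<^esub> (g \<oplus>\<^bsub>A\<^esub> h) = f \<otimes>\<^bsub>A\<^esub> g \<oplus>\<^bsub>A\<^esub> f \<otimes>\<^bsub>A\<^esub> h"
  proof (rule ext, clarify)
    fix y w
    show "(f \<otimes>\<^bsub>A\<^esub> (g \<oplus>\<^bsub>A\<^esub> h)) (y, w) = (f \<otimes>\<^bsub>A\<^esub> g \<oplus>\<^bsub>A\<^esub> f \<otimes>\<^bsub>A\<^esub> h) (y, w)"
      by (cases "(y, w) \<in> R") (simp_all add: out mult_A[OF C(1,2)] sum.distrib distrib_right distrib_left)
  qed
next
  fix c f g assume "f \<in> carrier A" "g \<in> carrier A"
  then have f: "f \<in> Cc G" and g: "g \<in> Cc G" by auto
  obtain C where C: "compactin Y C" "carried C f" "carried C g" using Cc_carried2[OF f g] .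
  note out = mult_A_outside
  show "f \<otimes>\<^bsub>A\<^esub> g \<in> carrier A" using Cc_mult[OF f g] by simp
  have smult: "carried C (\<lambda>\<alpha>. c * f \<alpha>)" using C(2) by (auto simp: carried_def)
  show "(c \<odot>\<^bsub>A\<^esub> f) \<otimes>\<^bsub>A\<^esub> g = c \<odot>\<^bsub>A\<^esub> (f \<otimes>\<^bsub>A\<^esub> g)"
  proof (rule ext, clarify)
    fix y w
    show "((c \<odot>\<^bsub>A\<^esub> f) \<otimes>\<^bsub>A\<^esub> g) (y, w) = (c \<odot>\<^bsub>A\<^esub> (f \<otimes>\<^bsub>A\<^esub> g)) (y, w)"
      by (cases "(y, w) \<in> R") (simp_all add: out mult_A[OF C(1,2)] mult_A[OF C(1) smult] sum_distrib_left mult_ac)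
  qed
  show "f \<otimes>\<^bsub>A\<^esub> (c \<odot>\<^bsub>A\<^esub> g) = c \<odot>\<^bsub>A\<^esub> (f \<otimes>\<^bsub>A\<^esub> g)"
  proof (rule ext, clarify)
    fix y w
    show "(f \<otimes>\<^bsub>A\<^esub> (c \<odot>\<^bsub>A\<^esub> g)) (y, w) = (c \<odot>\<^bsub>A\<^esub> (f \<otimes>\<^bsub>A\<^esub> g)) (y, w)"
      by (cases "(y, w) \<in> R") (simp_all add: out mult_A[OF C(1,2)] sum_distrib_left mult_ac)
  qed
  show "astar A (f \<oplus>\<^bsub>A\<^esub> g) = astar A f \<oplus>\<^bsub>A\<^esub> astar A g"
    by (rule ext, clarify) (simp add: star_A distrib_right)
  show "astar A (f \<otimes>\<^bsub>A\<^esub> g) = astar A g \<otimes>\<^bsub>A\<^esub> astar A f"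
  proof (rule ext, clarify)
    fix y w
    show "astar A (f \<otimes>\<^bsub>A\<^esub> g) (y, w) = (astar A g \<otimes>\<^bsub>A\<^esub> astar A f) (y, w)"
    proof (cases "(y, w) \<in> R")
      case R: True
      let ?F = "fibre_in C y"
      have F: "fibre_in C w = ?F" using fibre_in_eq[OF R] by simp
      have "astar A (f \<otimes>\<^bsub>A\<^esub> g) (y, w) = (\<Sum>z\<in>?F. cnj (f (w, z)) * cnj (g (z, y)) * cnj (\<omega> w z y * \<omega> y w y))"
        using R by (simp add: star_A mult_A[OF C(1,2) R_sym[OF R]] F sum_distrib_left mult_ac)
      also have "\<dots> = (\<Sum>z\<in>?F. astar A g (y, z) * astar A f (z, w) * \<omega> y z w)"
      proof (intro sum.cong refl)
        fix z assume z: "z \<in> ?F"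
        note yz = fibre_in_R[OF z]
        have zw: "(z, w) \<in> R" "(w, z) \<in> R" using yz R by (auto intro: R_trans R_sym)
        have 1: "\<omega> y z w * \<omega> y w z = \<omega> z w z" using om_cocycle[of y z w z] yz zw by simp
        have 2: "\<omega> y w z * \<omega> y z y = \<omega> w z y * \<omega> y w y" using om_cocycle[of y w z y] R yz zw by simp
        have "cnj (\<omega> w z y * \<omega> y w y) = cnj (\<omega> y w z * \<omega> y z y) * (\<omega> y z w * cnj (\<omega> y z w))"
          using om_cnj[OF yz(1) zw(1)] 2 by simp
        also have "\<dots> = cnj (\<omega> y z y) * cnj (\<omega> y z w * \<omega> y w z) * \<omega> y z w" by (simp add: mult_ac)
        also have "\<dots> = cnj (\<omega> y z y) * cnj (\<omega> z w z) * \<omega> y z w" by (simp only: 1)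
        finally show "cnj (f (w, z)) * cnj (g (z, y)) * cnj (\<omega> w z y * \<omega> y w y) = astar A g (y, z) * astar A f (z, w) * \<omega> y z w"
          using yz zw by (simp add: star_A mult_ac)
      qed
      also have "\<dots> = (astar A g \<otimes>\<^bsub>A\<^esub> astar A f) (y, w)"
        by (rule mult_A[OF C(1) star_A_carried[OF C(3)] R, symmetric])
      finally show ?thesis .
    qed (simp add: out star_A)
  qed
next
  fix f assume "f \<in> carrier A"
  then have f: "f \<in> Cc G" by simp
  show "astar A f \<in> carrier A" using Cc_star[OF f] by simp
  show "astar A (astar A f) = f"
  proof (rule ext, clarify)
    fix y z
    show "astar A (astar A f) (y, z) = f (y, z)"
    proof (cases "(y, z) \<in> R")
      case True
      then have "astar A (astar A f) (y, z) = f (y, z) * (\<omega> z y z * cnj (\<omega> y z y))"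
        using R_sym[OF True] by (simp add: star_A)
      then show ?thesis unfolding om_inverse[OF True, symmetric] om_cnj[OF True R_sym[OF True]] by simp
    qed (use Cc_R[OF f] in \<open>auto simp: star_A\<close>)
  qed
  show "astar A (c \<odot>\<^bsub>A\<^esub> f) = cnj c \<odot>\<^bsub>A\<^esub> astar A f" for c
    by (rule ext, clarify) (simp add: star_A mult_ac)
qed

end

section \<open>Square-summable functions\<close>

lemma ell2_simps [simp]:
  "\<zero>\<^bsub>ell2 I\<^esub> = (\<lambda>_. 0)" "\<xi> \<oplus>\<^bsub>ell2 I\<^esub> \<eta> = (\<lambda>\<alpha>. \<xi> \<alpha> + \<eta> \<alpha>)" "c \<odot>\<^bsub>ell2 I\<^esub> \<xi> = (\<lambda>\<alpha>. c * \<xi> \<alpha>)"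
  "hinner (ell2 I) \<xi> \<eta> = (\<Sum>\<^sub>\<infinity>\<alpha>\<in>I. \<xi> \<alpha> * cnj (\<eta> \<alpha>))"
  by (simp_all add: ell2_def)

lemma carrier_ell2: "\<xi> \<in> carrier (ell2 I) \<longleftrightarrow> (\<forall>\<alpha>. \<alpha> \<notin> I \<longrightarrow> \<xi> \<alpha> = 0) \<and> (\<lambda>\<alpha>. (cmod (\<xi> \<alpha>))\<^sup>2) summable_on I"
  by (simp add: ell2_def)

lemma ell2_outside: "\<xi> \<in> carrier (ell2 I) \<Longrightarrow> \<alpha> \<notin> I \<Longrightarrow> \<xi> \<alpha> = 0"
  by (simp add: carrier_ell2)

lemma ell2_inner_summable:
  assumes "\<xi> \<in> carrier (ell2 I)" "\<eta> \<in> carrier (ell2 I)"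
  shows "(\<lambda>\<alpha>. \<xi> \<alpha> * cnj (\<eta> \<alpha>)) summable_on I"
proof (rule abs_summable_summable)
  have "(\<lambda>\<alpha>. (cmod (\<xi> \<alpha>))\<^sup>2 + (cmod (\<eta> \<alpha>))\<^sup>2) summable_on I"
    using assms by (intro summable_on_add) (auto simp: carrier_ell2)
  then show "(\<lambda>\<alpha>. norm (\<xi> \<alpha> * cnj (\<eta> \<alpha>))) summable_on I"
  proof (rule summable_on_comparison_test)
    fix \<alpha>
    have "0 \<le> (cmod (\<xi> \<alpha>) - cmod (\<eta> \<alpha>))\<^sup>2" by simp
    then have "2 * (cmod (\<xi> \<alpha>) * cmod (\<eta> \<alpha>)) \<le> (cmod (\<xi> \<alpha>))\<^sup>2 + (cmod (\<eta> \<alpha>))\<^sup>2"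
      unfolding power2_diff by linarith
    moreover have "0 \<le> cmod (\<xi> \<alpha>) * cmod (\<eta> \<alpha>)" by simp
    ultimately show "norm (\<xi> \<alpha> * cnj (\<eta> \<alpha>)) \<le> (cmod (\<xi> \<alpha>))\<^sup>2 + (cmod (\<eta> \<alpha>))\<^sup>2"
      unfolding norm_mult complex_mod_cnj by linarith
  qed simp
qed

lemma ell2_add: assumes "\<xi> \<in> carrier (ell2 I)" "\<eta> \<in> carrier (ell2 I)" shows "(\<lambda>\<alpha>. \<xi> \<alpha> + \<eta> \<alpha>) \<in> carrier (ell2 I)"
proof -
  have "(\<lambda>\<alpha>. 2 * (cmod (\<xi> \<alpha>))\<^sup>2 + 2 * (cmod (\<eta> \<alpha>))\<^sup>2) summable_on I"
    using assms by (intro summable_on_add summable_on_cmult_right) (auto simp: carrier_ell2)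
  then have "(\<lambda>\<alpha>. (cmod (\<xi> \<alpha> + \<eta> \<alpha>))\<^sup>2) summable_on I"
  proof (rule summable_on_comparison_test)
    fix \<alpha>
    have "(cmod (\<xi> \<alpha> + \<eta> \<alpha>))\<^sup>2 \<le> (cmod (\<xi> \<alpha>) + cmod (\<eta> \<alpha>))\<^sup>2"
      by (intro power_mono norm_triangle_ineq) simp
    moreover have "0 \<le> (cmod (\<xi> \<alpha>) - cmod (\<eta> \<alpha>))\<^sup>2" by simp
    ultimately show "(cmod (\<xi> \<alpha> + \<eta> \<alpha>))\<^sup>2 \<le> 2 * (cmod (\<xi> \<alpha>))\<^sup>2 + 2 * (cmod (\<eta> \<alpha>))\<^sup>2"
      by (simp add: power2_sum power2_diff)
  qed simp
  then show ?thesis using assms by (auto simp: carrier_ell2)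
qed

lemma ell2_smult: "\<xi> \<in> carrier (ell2 I) \<Longrightarrow> (\<lambda>\<alpha>. c * \<xi> \<alpha>) \<in> carrier (ell2 I)"
  by (auto simp: carrier_ell2 norm_mult power_mult_distrib intro: summable_on_cmult_right)

lemma module_ell2: "module complex_ring (ell2 I)"
  by (rule complex_moduleI) (auto simp: ell2_add ell2_smult algebra_simps, simp add: carrier_ell2)

lemma ell2_minus:
  assumes "\<xi> \<in> carrier (ell2 I)" "\<eta> \<in> carrier (ell2 I)"
  shows "\<xi> \<ominus>\<^bsub>ell2 I\<^esub> \<eta> = (\<lambda>\<alpha>. \<xi> \<alpha> - \<eta> \<alpha>)"
  using complex_module.a_minus_eq[OF complex_module.intro[OF module_ell2] assms] by simp

lemma infsum_complex_of_real:
  fixes f :: "'a \<Rightarrow> real"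
  shows "(\<Sum>\<^sub>\<infinity>x\<in>I. complex_of_real (f x)) = of_real (\<Sum>\<^sub>\<infinity>x\<in>I. f x)"
proof (cases "f summable_on I")
  case True
  then show ?thesis by (intro infsumI has_sum_of_real) simp
next
  case False
  then have "\<not> (\<lambda>x. complex_of_real (f x)) summable_on I"
    using summable_on_bounded_linear[OF bounded_linear_Re, of "\<lambda>x. complex_of_real (f x)" I] by auto
  then show ?thesis using False by (simp add: infsum_not_exists)
qed

lemma ell2_inner_self: "hinner (ell2 I) \<xi> \<xi> = of_real (\<Sum>\<^sub>\<infinity>\<alpha>\<in>I. (cmod (\<xi> \<alpha>))\<^sup>2)"
proof -
  have "hinner (ell2 I) \<xi> \<xi> = (\<Sum>\<^sub>\<infinity>\<alpha>\<in>I. complex_of_real ((cmod (\<xi> \<alpha>))\<^sup>2))"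
    by (simp only: ell2_simps complex_norm_square)
  then show ?thesis by (simp only: infsum_complex_of_real)
qed

lemma ell2_hnorm: "hnorm (ell2 I) \<xi> = sqrt (\<Sum>\<^sub>\<infinity>\<alpha>\<in>I. (cmod (\<xi> \<alpha>))\<^sup>2)"
  unfolding hnorm_def ell2_inner_self by simp

lemma ell2_hnorm_power2: "(hnorm (ell2 I) \<xi>)\<^sup>2 = (\<Sum>\<^sub>\<infinity>\<alpha>\<in>I. (cmod (\<xi> \<alpha>))\<^sup>2)"
  by (simp add: ell2_hnorm infsum_nonneg)

lemma ell2_finite_sum_le:
  assumes "\<xi> \<in> carrier (ell2 I)" "finite F" "F \<subseteq> I"
  shows "(\<Sum>\<alpha>\<in>F. (cmod (\<xi> \<alpha>))\<^sup>2) \<le> (hnorm (ell2 I) \<xi>)\<^sup>2"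
  unfolding ell2_hnorm_power2 using assms by (intro finite_sum_le_infsum) (auto simp: carrier_ell2)

lemma ell2_coordinate_le:
  assumes "\<xi> \<in> carrier (ell2 I)" shows "cmod (\<xi> \<alpha>) \<le> hnorm (ell2 I) \<xi>"
proof (cases "\<alpha> \<in> I")
  case True
  then show ?thesis using ell2_finite_sum_le[OF assms, of "{\<alpha>}"]
    by (intro power2_le_imp_le[of "cmod (\<xi> \<alpha>)"]) (auto simp: ell2_hnorm infsum_nonneg)
qed (use assms in \<open>simp add: ell2_outside ell2_hnorm infsum_nonneg\<close>)

lemma ell2_bounded_sums:
  assumes "\<And>\<alpha>. \<alpha> \<notin> I \<Longrightarrow> \<xi> \<alpha> = 0" "0 \<le> B"
    and "\<And>F. finite F \<Longrightarrow> F \<subseteq> I \<Longrightarrow> (\<Sum>\<alpha>\<in>F. (cmod (\<xi> \<alpha>))\<^sup>2) \<le> B\<^sup>2"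
  shows "\<xi> \<in> carrier (ell2 I)" "hnorm (ell2 I) \<xi> \<le> B"
proof -
  have s: "(\<lambda>\<alpha>. (cmod (\<xi> \<alpha>))\<^sup>2) summable_on I"
    using assms(3) by (intro nonneg_bdd_above_summable_on bdd_aboveI[of _ "B\<^sup>2"]) auto
  then show "\<xi> \<in> carrier (ell2 I)" using assms(1) by (simp add: carrier_ell2)
  have "(\<Sum>\<^sub>\<infinity>\<alpha>\<in>I. (cmod (\<xi> \<alpha>))\<^sup>2) \<le> B\<^sup>2"
    by (rule infsum_le_finite_sums[OF s]) (use assms(3) in auto)
  then show "hnorm (ell2 I) \<xi> \<le> B"
    unfolding ell2_hnorm using assms(2) by (intro real_le_lsqrt)
qed

lemma hilbert_ell2: "hilbert_space (ell2 I)"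
  unfolding hilbert_space_def
proof (intro conjI ballI allI module_ell2)
  fix \<xi> \<eta> \<zeta> assume x: "\<xi> \<in> carrier (ell2 I)" "\<eta> \<in> carrier (ell2 I)" "\<zeta> \<in> carrier (ell2 I)"
  show "hinner (ell2 I) (\<xi> \<oplus>\<^bsub>ell2 I\<^esub> \<eta>) \<zeta> = hinner (ell2 I) \<xi> \<zeta> + hinner (ell2 I) \<eta> \<zeta>"
    using infsum_add[OF ell2_inner_summable[OF x(1,3)] ell2_inner_summable[OF x(2,3)]]
    by (simp add: distrib_right)
next
  fix c \<xi> \<eta> assume x: "\<xi> \<in> carrier (ell2 I)" "\<eta> \<in> carrier (ell2 I)"
  show "hinner (ell2 I) (c \<odot>\<^bsub>ell2 I\<^esub> \<xi>) \<eta> = c * hinner (ell2 I) \<xi> \<eta>"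
    by (simp add: mult.assoc infsum_cmult_right')
next
  fix \<xi> \<eta> assume x: "\<xi> \<in> carrier (ell2 I)" "\<eta> \<in> carrier (ell2 I)"
  show "hinner (ell2 I) \<eta> \<xi> = cnj (hinner (ell2 I) \<xi> \<eta>)"
    by (simp add: mult.commute flip: infsum_cnj)
next
  fix \<xi> assume x: "\<xi> \<in> carrier (ell2 I)"
  show "0 \<le> Re (hinner (ell2 I) \<xi> \<xi>)" unfolding ell2_inner_self by (simp add: infsum_nonneg)
  show "hinner (ell2 I) \<xi> \<xi> = 0 \<longrightarrow> \<xi> = \<zero>\<^bsub>ell2 I\<^esub>"
  proof
    assume "hinner (ell2 I) \<xi> \<xi> = 0"
    then have "hnorm (ell2 I) \<xi> = 0" by (simp add: hnorm_def)
    then have "\<xi> \<alpha> = 0" for \<alpha> using ell2_coordinate_le[OF x, of \<alpha>] by simp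
    then show "\<xi> = \<zero>\<^bsub>ell2 I\<^esub>" by auto
  qed
next
  show "complete_in (ell2 I) (hnorm (ell2 I))"
    unfolding complete_in_def
  proof (intro allI impI)
    fix u assume u: "cauchy_in (ell2 I) (hnorm (ell2 I)) u"
    then have uc: "u n \<in> carrier (ell2 I)" for n by (simp add: cauchy_in_def)
    have diff: "(\<lambda>\<alpha>. u m \<alpha> - u n \<alpha>) \<in> carrier (ell2 I)" for m n
      using ell2_add[OF uc[of m] ell2_smult[OF uc[of n], of "-1"]] by simp
    have cauchy: "\<exists>M. \<forall>m\<ge>M. \<forall>n\<ge>M. hnorm (ell2 I) (\<lambda>\<alpha>. u m \<alpha> - u n \<alpha>) < e" if "e > 0" for e
      using u that uc by (simp add: cauchy_in_def ell2_minus)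
    have "Cauchy (\<lambda>n. u n \<alpha>)" for \<alpha>
    proof (rule metric_CauchyI)
      fix e :: real assume "e > 0"
      then obtain M where M: "\<forall>m\<ge>M. \<forall>n\<ge>M. hnorm (ell2 I) (\<lambda>\<alpha>. u m \<alpha> - u n \<alpha>) < e" using cauchy by blast
      show "\<exists>M. \<forall>m\<ge>M. \<forall>n\<ge>M. dist (u m \<alpha>) (u n \<alpha>) < e"
      proof (intro exI allI impI)
        fix m n assume "M \<le> m" "M \<le> n"
        then have "hnorm (ell2 I) (\<lambda>\<alpha>. u m \<alpha> - u n \<alpha>) < e" using M by blast
        then show "dist (u m \<alpha>) (u n \<alpha>) < e"
          using ell2_coordinate_le[OF diff[of m n], of \<alpha>] by (simp add: dist_norm)
      qed
    qed
    then have "\<exists>l. (\<lambda>n. u n \<alpha>) \<longlonglongrightarrow> l" for \<alpha> by (simp add: Cauchy_convergent_iff convergent_def)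
    then obtain x where x: "\<And>\<alpha>. (\<lambda>n. u n \<alpha>) \<longlonglongrightarrow> x \<alpha>" by metis
    have x0: "x \<alpha> = 0" if "\<alpha> \<notin> I" for \<alpha>
      using x[of \<alpha>] ell2_outside[OF uc that] by (simp add: LIMSEQ_const_iff)
    have close: "(\<lambda>\<alpha>. u n \<alpha> - x \<alpha>) \<in> carrier (ell2 I) \<and> hnorm (ell2 I) (\<lambda>\<alpha>. u n \<alpha> - x \<alpha>) \<le> e"
      if e: "e > 0" and M: "\<forall>m\<ge>M. \<forall>n\<ge>M. hnorm (ell2 I) (\<lambda>\<alpha>. u m \<alpha> - u n \<alpha>) < e" and n: "n \<ge> M" for e n M
    proof -
      have "(\<Sum>\<alpha>\<in>F. (cmod (u n \<alpha> - x \<alpha>))\<^sup>2) \<le> e\<^sup>2" if F: "finite F" "F \<subseteq> I" for F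
      proof (rule LIMSEQ_le_const2)
        show "(\<lambda>m. \<Sum>\<alpha>\<in>F. (cmod (u n \<alpha> - u m \<alpha>))\<^sup>2) \<longlonglongrightarrow> (\<Sum>\<alpha>\<in>F. (cmod (u n \<alpha> - x \<alpha>))\<^sup>2)"
          by (intro tendsto_intros x)
        have "(\<Sum>\<alpha>\<in>F. (cmod (u n \<alpha> - u m \<alpha>))\<^sup>2) \<le> e\<^sup>2" if m: "m \<ge> M" for m
        proof -
          have "(\<Sum>\<alpha>\<in>F. (cmod (u n \<alpha> - u m \<alpha>))\<^sup>2) \<le> (hnorm (ell2 I) (\<lambda>\<alpha>. u n \<alpha> - u m \<alpha>))\<^sup>2"
            by (rule ell2_finite_sum_le[OF diff F])
          also have "\<dots> \<le> e\<^sup>2"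
            using M n m by (intro power_mono) (auto simp: less_imp_le ell2_hnorm infsum_nonneg)
          finally show ?thesis .
        qed
        then show "\<exists>N. \<forall>m\<ge>N. (\<Sum>\<alpha>\<in>F. (cmod (u n \<alpha> - u m \<alpha>))\<^sup>2) \<le> e\<^sup>2" by blast
      qed
      then show ?thesis
        using ell2_bounded_sums[of I "\<lambda>\<alpha>. u n \<alpha> - x \<alpha>" e] x0 ell2_outside[OF uc] e by simp
    qed
    obtain M1 where M1: "\<forall>m\<ge>M1. \<forall>n\<ge>M1. hnorm (ell2 I) (\<lambda>\<alpha>. u m \<alpha> - u n \<alpha>) < 1" using cauchy[of 1] by auto
    have "(\<lambda>\<alpha>. u M1 \<alpha> + (-1) * (u M1 \<alpha> - x \<alpha>)) \<in> carrier (ell2 I)"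
      using close[OF _ M1, of M1] by (intro ell2_add ell2_smult uc) auto
    then have xc: "x \<in> carrier (ell2 I)" by simp
    have "(\<lambda>n. hnorm (ell2 I) (u n \<ominus>\<^bsub>ell2 I\<^esub> x)) \<longlonglongrightarrow> 0"
    proof (rule LIMSEQ_I)
      fix e :: real assume e: "e > 0"
      then obtain M where M: "\<forall>m\<ge>M. \<forall>n\<ge>M. hnorm (ell2 I) (\<lambda>\<alpha>. u m \<alpha> - u n \<alpha>) < e / 2" using cauchy[of "e / 2"] by auto
      have "norm (hnorm (ell2 I) (u n \<ominus>\<^bsub>ell2 I\<^esub> x) - 0) < e" if "n \<ge> M" for n
        using close[OF _ M that] e uc xc by (simp add: ell2_minus ell2_hnorm infsum_nonneg)
      then show "\<exists>no. \<forall>n\<ge>no. norm (hnorm (ell2 I) (u n \<ominus>\<^bsub>ell2 I\<^esub> x) - 0) < e" by blast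
    qed
    then show "\<exists>x\<in>carrier (ell2 I). converges_in (ell2 I) (hnorm (ell2 I)) u x"
      using xc by (auto simp: converges_in_def)
  qed
qed

definition unit_vector :: "'g \<Rightarrow> 'g \<Rightarrow> complex" where
  "unit_vector \<alpha> \<beta> = (if \<beta> = \<alpha> then 1 else 0)"

lemma ell2_finite_support:
  assumes "finite F" "F \<subseteq> I" "\<And>\<alpha>. \<alpha> \<notin> F \<Longrightarrow> \<xi> \<alpha> = 0"
  shows "\<xi> \<in> carrier (ell2 I)" "hinner (ell2 I) \<xi> \<eta> = (\<Sum>\<alpha>\<in>F. \<xi> \<alpha> * cnj (\<eta> \<alpha>))"
    "hinner (ell2 I) \<eta> \<xi> = (\<Sum>\<alpha>\<in>F. \<eta> \<alpha> * cnj (\<xi> \<alpha>))"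
proof -
  have red: "(\<Sum>\<^sub>\<infinity>\<alpha>\<in>I. \<theta> \<alpha>) = (\<Sum>\<alpha>\<in>F. \<theta> \<alpha>)" if "\<And>\<alpha>. \<alpha> \<notin> F \<Longrightarrow> \<theta> \<alpha> = 0" for \<theta> :: "'a \<Rightarrow> complex"
  proof -
    have "(\<Sum>\<^sub>\<infinity>\<alpha>\<in>I. \<theta> \<alpha>) = (\<Sum>\<^sub>\<infinity>\<alpha>\<in>F. \<theta> \<alpha>)" by (rule infsum_cong_neutral) (use that assms(2) in auto)
    then show ?thesis using assms(1) by simp
  qed
  have "(\<lambda>\<alpha>. (cmod (\<xi> \<alpha>))\<^sup>2) summable_on I \<longleftrightarrow> (\<lambda>\<alpha>. (cmod (\<xi> \<alpha>))\<^sup>2) summable_on F"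
    by (rule summable_on_cong_neutral) (use assms in auto)
  then show "\<xi> \<in> carrier (ell2 I)" using assms by (auto simp: carrier_ell2)
  show "hinner (ell2 I) \<xi> \<eta> = (\<Sum>\<alpha>\<in>F. \<xi> \<alpha> * cnj (\<eta> \<alpha>))" "hinner (ell2 I) \<eta> \<xi> = (\<Sum>\<alpha>\<in>F. \<eta> \<alpha> * cnj (\<xi> \<alpha>))"
    using assms(3) by (simp_all add: red)
qed

lemma unit_vector_ell2:
  assumes "\<alpha> \<in> I"
  shows "unit_vector \<alpha> \<in> carrier (ell2 I)" "hinner (ell2 I) \<xi> (unit_vector \<alpha>) = \<xi> \<alpha>" "hnorm (ell2 I) (unit_vector \<alpha>) = 1"
proof -
  have z: "\<And>\<beta>. \<beta> \<notin> {\<alpha>} \<Longrightarrow> unit_vector \<alpha> \<beta> = 0" by (simp add: unit_vector_def)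
  note F = ell2_finite_support[of "{\<alpha>}" I "unit_vector \<alpha>", OF _ _ z]
  show "unit_vector \<alpha> \<in> carrier (ell2 I)" using F(1) assms by simp
  show i: "hinner (ell2 I) \<xi> (unit_vector \<alpha>) = \<xi> \<alpha>" for \<xi>
    using F(3)[of \<xi>] assms by (simp add: unit_vector_def)
  show "hnorm (ell2 I) (unit_vector \<alpha>) = 1"
    unfolding hnorm_def i by (simp add: unit_vector_def)
qed

text \<open>Every vector is the limit of its finitely supported truncations, which are combinations of unit vectors.\<close>

lemma ell2_closed_subspace_unit_vectors:
  assumes S: "closed_subspace (ell2 I) (hnorm (ell2 I)) S" and e: "\<And>\<alpha>. \<alpha> \<in> I \<Longrightarrow> unit_vector \<alpha> \<in> S"
  shows "S = carrier (ell2 I)"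
proof
  interpret hilbert "ell2 I" using hilbert_ell2 by (simp add: hilbert_def)
  note S' = closed_subspaceD[OF S]
  show "S \<subseteq> carrier (ell2 I)" by (rule S'(1))
  show "carrier (ell2 I) \<subseteq> S"
  proof
    fix \<xi> assume \<xi>: "\<xi> \<in> carrier (ell2 I)"
    have fin: "(\<lambda>\<alpha>. if \<alpha> \<in> F then \<xi> \<alpha> else 0) \<in> S" if "finite F" "F \<subseteq> I" for F
      using that
    proof (induction F)
      case empty
      then show ?case using S'(2) by simp
    next
      case (insert \<beta> F)
      have "(\<lambda>\<alpha>. if \<alpha> \<in> insert \<beta> F then \<xi> \<alpha> else 0) =
          (\<lambda>\<alpha>. if \<alpha> \<in> F then \<xi> \<alpha> else 0) \<oplus>\<^bsub>ell2 I\<^esub> (\<xi> \<beta> \<odot>\<^bsub>ell2 I\<^esub> unit_vector \<beta>)"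
        using insert by (auto simp: unit_vector_def)
      moreover have "(\<lambda>\<alpha>. if \<alpha> \<in> F then \<xi> \<alpha> else 0) \<in> S" "unit_vector \<beta> \<in> S" using insert e by auto
      ultimately show ?case using S'(3,4) by metis
    qed
    have "\<xi> \<in> limit_points S"
    proof (rule limit_pointsI[OF \<xi> S'(1)])
      fix d :: real assume d: "d > 0"
      have "((\<lambda>\<alpha>. (cmod (\<xi> \<alpha>))\<^sup>2) has_sum (\<Sum>\<^sub>\<infinity>\<alpha>\<in>I. (cmod (\<xi> \<alpha>))\<^sup>2)) I"
        using \<xi> by (auto simp: carrier_ell2)
      then have "\<forall>\<^sub>F F in finite_subsets_at_top I. dist (\<Sum>\<alpha>\<in>F. (cmod (\<xi> \<alpha>))\<^sup>2) (\<Sum>\<^sub>\<infinity>\<alpha>\<in>I. (cmod (\<xi> \<alpha>))\<^sup>2) < d\<^sup>2"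
        unfolding has_sum_def using d by (intro tendstoD) auto
      then obtain F where F: "finite F" "F \<subseteq> I" "dist (\<Sum>\<alpha>\<in>F. (cmod (\<xi> \<alpha>))\<^sup>2) (\<Sum>\<^sub>\<infinity>\<alpha>\<in>I. (cmod (\<xi> \<alpha>))\<^sup>2) < d\<^sup>2"
        unfolding eventually_finite_subsets_at_top by blast
      let ?y = "\<lambda>\<alpha>. if \<alpha> \<in> F then \<xi> \<alpha> else 0"
      have y: "?y \<in> S" by (rule fin[OF F(1,2)])
      have "?y \<ominus>\<^bsub>ell2 I\<^esub> \<xi> = (\<lambda>\<alpha>. ?y \<alpha> - \<xi> \<alpha>)" using y S'(1) \<xi> by (intro ell2_minus) auto
      then have "(hnorm (ell2 I) (?y \<ominus>\<^bsub>ell2 I\<^esub> \<xi>))\<^sup>2 = (\<Sum>\<^sub>\<infinity>\<alpha>\<in>I. (cmod (?y \<alpha> - \<xi> \<alpha>))\<^sup>2)"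
        by (simp only: ell2_hnorm_power2)
      also have "\<dots> = (\<Sum>\<^sub>\<infinity>\<alpha>\<in>I - F. (cmod (\<xi> \<alpha>))\<^sup>2)"
        by (rule infsum_cong_neutral) auto
      also have "\<dots> = (\<Sum>\<^sub>\<infinity>\<alpha>\<in>I. (cmod (\<xi> \<alpha>))\<^sup>2) - (\<Sum>\<alpha>\<in>F. (cmod (\<xi> \<alpha>))\<^sup>2)"
        using infsum_Diff[of "\<lambda>\<alpha>. (cmod (\<xi> \<alpha>))\<^sup>2" I F] \<xi> F by (simp add: carrier_ell2)
      also have "\<dots> < d\<^sup>2" using F(3) by (simp add: dist_real_def abs_less_iff)
      finally have "hnorm (ell2 I) (?y \<ominus>\<^bsub>ell2 I\<^esub> \<xi>) < d" using d by (intro power2_less_imp_less[of _ d]) auto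
      then show "\<exists>y\<in>S. hnorm (ell2 I) (y \<ominus>\<^bsub>ell2 I\<^esub> \<xi>) < d" using y by blast
    qed
    then show "\<xi> \<in> S" using limit_points_subset[OF S] by blast
  qed
qed

section \<open>Norm bounds for representations of the convolution algebra\<close>

context fibre_cocycle begin

subsection \<open>Functions on the diagonal\<close>

definition diag :: "('y \<Rightarrow> complex) \<Rightarrow> 'y \<times> 'y \<Rightarrow> complex" where
  "diag h = (\<lambda>(y, z). if y = z then h y else 0)"

lemma diag_simps [simp]: "diag h (y, y) = h y" "y \<noteq> z \<Longrightarrow> diag h (y, z) = 0"
  by (simp_all add: diag_def)

text \<open>The diagonal is open in the relation because slices exist, and closed because \<open>Y\<close> is Hausdorff.\<close>

lemma diag_Cc: assumes h: "h \<in> bump_functions T" shows "diag h \<in> Cc G"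
proof -
  let ?D = "{\<alpha> \<in> R. fst \<alpha> = snd \<alpha>}"
  have cl: "closedin TR ?D"
    using closedin_continuous_maps_eq[OF Hausdorff continuous_fst continuous_snd] unfolding topspace_TR .
  have op: "openin TR ?D"
    unfolding openin_subopen[of TR ?D]
  proof
    fix \<alpha> assume "\<alpha> \<in> ?D"
    then obtain y where y: "\<alpha> = (y, y)" "(y, y) \<in> R" by (cases \<alpha>) auto
    then obtain U where U: "slice U" "y \<in> U" using slice_exists[of y] by (auto simp: R_iff)
    let ?W = "{\<alpha> \<in> R. fst \<alpha> \<in> U} \<inter> {\<alpha> \<in> R. snd \<alpha> \<in> U}"
    have "openin TR ?W"
      using openin_continuous_map_preimage[OF continuous_fst slice_openin[OF U(1)]]
        openin_continuous_map_preimage[OF continuous_snd slice_openin[OF U(1)]]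
      unfolding topspace_TR by blast
    moreover have "?W \<subseteq> ?D"
    proof
      fix \<beta> assume \<beta>: "\<beta> \<in> ?W"
      then show "\<beta> \<in> ?D" using slice_eq[OF U(1), of "fst \<beta>" "snd \<beta>"] by simp
    qed
    ultimately show "\<exists>W. openin TR W \<and> \<alpha> \<in> W \<and> W \<subseteq> ?D" using y U by (intro exI[of _ ?W]) auto
  qed
  have cont: "continuous_map TR euclidean (diag h)"
  proof (rule pasting_lemma[where I = UNIV and T = "\<lambda>b. if b then ?D else R - ?D" and f = "\<lambda>b. if b then h \<circ> fst else (\<lambda>_. 0)"])
    have "openin TR (R - ?D)" using cl unfolding closedin_def topspace_TR by blast
    then show "openin TR (if b then ?D else R - ?D)" for b using op by simp
    have "continuous_map TR euclidean (h \<circ> fst)"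
      by (rule continuous_map_compose[OF continuous_fst bump_functionsD(1)[OF h]])
    then show "continuous_map (subtopology TR (if b then ?D else R - ?D)) euclidean (if b then h \<circ> fst else (\<lambda>_. 0))" for b
      by (cases b) (auto intro: continuous_map_from_subtopology)
    show "\<exists>b. b \<in> UNIV \<and> \<alpha> \<in> (if b then ?D else R - ?D) \<and> diag h \<alpha> = (if b then h \<circ> fst else (\<lambda>_. 0)) \<alpha>"
      if "\<alpha> \<in> topspace TR" for \<alpha>
      using that unfolding topspace_TR by (intro exI[of _ "fst \<alpha> = snd \<alpha>"]) (auto simp: diag_def split: prod.splits)
  qed (auto split: if_splits)
  obtain C where C: "compactin Y C" "\<forall>y. h y \<noteq> 0 \<longrightarrow> y \<in> C" using h by (auto simp: bump_functions_def)
  have "continuous_map Y TR (\<lambda>y. (y, y))"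
    by (intro continuous_map_into_TR) (auto simp: R_iff)
  from image_compactin[OF C(1) this] have "compactin TR ((\<lambda>y. (y, y)) ` C)" .
  moreover have "\<forall>\<alpha>. diag h \<alpha> \<noteq> 0 \<longrightarrow> \<alpha> \<in> (\<lambda>y. (y, y)) ` C" using C(2) by (auto simp: diag_def)
  ultimately show ?thesis using cont unfolding Cc_iff by blast
qed

lemma diag_mult_left:
  assumes h: "h \<in> bump_functions T" and f: "f \<in> Cc G"
  shows "diag h \<otimes>\<^bsub>A\<^esub> f = (\<lambda>\<alpha>. h (fst \<alpha>) * f \<alpha>)"
proof (rule ext, clarify)
  fix y w
  obtain C where C: "compactin Y C" "carried C (diag h)" "carried C f" using Cc_carried2[OF diag_Cc[OF h] f] .
  show "(diag h \<otimes>\<^bsub>A\<^esub> f) (y, w) = h (fst (y, w)) * f (y, w)"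
  proof (cases "(y, w) \<in> R")
    case R: True
    have "(diag h \<otimes>\<^bsub>A\<^esub> f) (y, w) = (\<Sum>z\<in>fibre_in C y. if y = z then h y * f (y, w) * \<omega> y y w else 0)"
      unfolding mult_A[OF C(1,2) R] by (intro sum.cong) auto
    also have "\<dots> = (if y \<in> fibre_in C y then h y * f (y, w) * \<omega> y y w else 0)"
      using finite_fibre_in[OF C(1)] by simp
    also have "\<dots> = h y * f (y, w)"
      using R C(3) by (auto simp: fibre_in_def carried_def R_iff)
    finally show ?thesis by simp
  next
    case False
    then show ?thesis using Cc_R[OF f, of y w] by (auto simp: mult_A_outside)
  qed
qed

lemma diag_mult_right:
  assumes h: "h \<in> bump_functions T" and f: "f \<in> Cc G"
  shows "f \<otimes>\<^bsub>A\<^esub> diag h = (\<lambda>\<alpha>. f \<alpha> * h (snd \<alpha>))"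
proof (rule ext, clarify)
  fix y w
  obtain C where C: "compactin Y C" "carried C f" "carried C (diag h)" using Cc_carried2[OF f diag_Cc[OF h]] .
  show "(f \<otimes>\<^bsub>A\<^esub> diag h) (y, w) = f (y, w) * h (snd (y, w))"
  proof (cases "(y, w) \<in> R")
    case R: True
    have "(f \<otimes>\<^bsub>A\<^esub> diag h) (y, w) = (\<Sum>z\<in>fibre_in C y. if z = w then f (y, w) * h w * \<omega> y w w else 0)"
      unfolding mult_A[OF C(1,2) R] by (intro sum.cong) auto
    also have "\<dots> = (if w \<in> fibre_in C y then f (y, w) * h w * \<omega> y w w else 0)"
      using finite_fibre_in[OF C(1)] by simp
    also have "\<dots> = f (y, w) * h w"
      using R C(2) by (auto simp: fibre_in_def carried_def)
    finally show ?thesis by simp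
  next
    case False
    then show ?thesis using Cc_R[OF f, of y w] by (auto simp: mult_A_outside)
  qed
qed

lemma diag_star: "h \<in> bump_functions T \<Longrightarrow> astar A (diag h) = diag (\<lambda>y. cnj (h y))"
proof (rule ext, clarify)
  fix y z assume h: "h \<in> bump_functions T"
  show "astar A (diag h) (y, z) = diag (\<lambda>y. cnj (h y)) (y, z)"
    using bump_functionsD(3)[OF h, of y] by (cases "y = z") (auto simp: star_A R_iff)
qed

lemma diag_mult:
  "h \<in> bump_functions T \<Longrightarrow> k \<in> bump_functions T \<Longrightarrow> diag h \<otimes>\<^bsub>A\<^esub> diag k = diag (\<lambda>y. h y * k y)"
  by (subst diag_mult_left[OF _ diag_Cc]) (auto simp: diag_def fun_eq_iff)

lemma Cc_diagonal: assumes f: "f \<in> Cc G" shows "(\<lambda>y. f (y, y)) \<in> bump_functions T"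
proof -
  obtain C where C: "compactin Y C" "carried C f" using Cc_carried[OF f] .
  have "continuous_map Y euclidean (\<lambda>y. f (y, y))"
    by (rule Cc_continuous_map[OF f]) (auto simp: R_iff)
  then show ?thesis
    using C compactin_subset_topspace[OF C(1)] by (auto simp: bump_functions_def carried_def intro!: exI[of _ C])
qed

lemma Cc_bounded: assumes f: "f \<in> Cc G" obtains M where "0 \<le> M" "\<forall>\<alpha>. cmod (f \<alpha>) \<le> M"
proof -
  obtain K where K: "compactin TR K" "\<forall>\<alpha>. f \<alpha> \<noteq> 0 \<longrightarrow> \<alpha> \<in> K" using f unfolding Cc_iff by blast
  have "compactin euclidean (f ` K)" by (rule image_compactin[OF K(1) Cc_continuous[OF f]])
  then have "bounded (f ` K)" by (simp add: compact_imp_bounded)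
  then obtain M where M: "\<forall>x\<in>f ` K. cmod x \<le> M" by (auto simp: bounded_iff)
  show thesis
  proof (rule that[of "max M 0"])
    show "\<forall>\<alpha>. cmod (f \<alpha>) \<le> max M 0"
    proof
      fix \<alpha>
      show "cmod (f \<alpha>) \<le> max M 0"
      proof (cases "f \<alpha> = 0")
        case False
        then have "cmod (f \<alpha>) \<le> M" using K(2) M by blast
        then show ?thesis by simp
      qed simp
    qed
  qed simp
qed

text \<open>The entry of \<open>g\<^sup>* g\<close> at \<open>(y, w)\<close> pairs the columns of \<open>g\<close> at \<open>y\<close> and \<open>w\<close>. Over each fibre only one column
  can be nonzero, the one at the point of the slice.\<close>

lemma star_mult_slice:
  assumes g: "g \<in> Cc G" and C: "compactin Y C" "carried C g"
    and V: "slice V" "\<And>y z. g (y, z) \<noteq> 0 \<Longrightarrow> z \<in> V"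
  shows "astar A g \<otimes>\<^bsub>A\<^esub> g = diag (\<lambda>y. of_real (\<Sum>z\<in>fibre_in C y. (cmod (g (z, y)))\<^sup>2))"
proof (rule ext, clarify)
  fix y w
  let ?r = "\<lambda>y. of_real (\<Sum>z\<in>fibre_in C y. (cmod (g (z, y)))\<^sup>2)"
  show "(astar A g \<otimes>\<^bsub>A\<^esub> g) (y, w) = diag ?r (y, w)"
  proof (cases "(y, w) \<in> R")
    case R: True
    have eq: "(astar A g \<otimes>\<^bsub>A\<^esub> g) (y, w) = (\<Sum>z\<in>fibre_in C y. cnj (g (z, y) * \<omega> y z y) * g (z, w) * \<omega> y z w)"
      unfolding mult_A[OF C(1) star_A_carried[OF C(2)] R]
      by (intro sum.cong) (auto simp: star_A fibre_in_R)
    show ?thesis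
    proof (cases "y = w")
      case True
      have "cnj (g (z, y) * \<omega> y z y) * g (z, y) * \<omega> y z y = of_real ((cmod (g (z, y)))\<^sup>2)" if "z \<in> fibre_in C y" for z
      proof -
        have "cnj (g (z, y) * \<omega> y z y) * g (z, y) * \<omega> y z y = (g (z, y) * cnj (g (z, y))) * (cnj (\<omega> y z y) * \<omega> y z y)"
          by (simp add: mult_ac)
        then show ?thesis using om_cnj'[OF fibre_in_R[OF that]] by (simp only: mult_1_right complex_norm_square)
      qed
      then show ?thesis using eq True by simp
    next
      case False
      have "g (z, y) = 0 \<or> g (z, w) = 0" for z
        using V(2)[of z y] V(2)[of z w] slice_eq[OF V(1) _ _ R] False by blast
      then have "(astar A g \<otimes>\<^bsub>A\<^esub> g) (y, w) = 0" unfolding eq by (intro sum.neutral) auto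
      then show ?thesis using False by simp
    qed
  next
    case False
    have "?r y = 0" if "y \<notin> T" using that by (simp add: fibre_in_def R_iff)
    then show ?thesis using False by (cases "y = w") (auto simp: mult_A_outside R_iff)
  qed
qed

end

locale fibre_rep = fibre_cocycle Y X \<psi> \<sigma> for Y :: "'y topology" and X :: "'x topology" and \<psi> \<sigma> +
  fixes H :: "'h hilbert" and L
  assumes rep: "star_rep (twisted_algebra (fibre_groupoid Y \<psi>) \<sigma>) H L"
begin

sublocale L: rep A H L
  using rep by (rule rep_intro[OF star_algebra_A])

lemmas Lc = L.L_closed[unfolded A_simps]

text \<open>A function \<open>h\<close> with values in \<open>[0, M]\<close> satisfies \<open>M h - h\<^sup>2 = k\<^sup>2\<close> with \<open>k\<close> real, which replaces the
  positivity of \<open>M - h\<close> in the absence of a unit.\<close>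

lemma L_diag_bound_real:
  assumes r: "(\<lambda>y. of_real (r y)) \<in> bump_functions T" and M: "\<And>y. 0 \<le> r y \<and> r y \<le> M" and x: "x \<in> carrier H"
  shows "hnorm H (L (diag (\<lambda>y. of_real (r y))) x) \<le> M * hnorm H x"
proof -
  let ?h = "\<lambda>y. complex_of_real (r y)"
  let ?k = "\<lambda>y. complex_of_real (sqrt (r y * (M - r y)))"
  have k: "?k \<in> bump_functions T"
    using bump_functions_lift[OF r, of "\<lambda>t. complex_of_real (sqrt (Re t * (M - Re t)))"]
    by (simp add: continuous_intros)
  have sq: "diag ?k \<otimes>\<^bsub>A\<^esub> diag ?k = (M \<odot>\<^bsub>A\<^esub> diag ?h) \<oplus>\<^bsub>A\<^esub> ((-1) \<odot>\<^bsub>A\<^esub> (diag ?h \<otimes>\<^bsub>A\<^esub> diag ?h))"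
    unfolding diag_mult[OF k k] diag_mult[OF r r]
  proof (rule ext, clarify)
    fix y z
    have "?k y * ?k y = of_real (r y * (M - r y))" using M[of y] by (simp flip: of_real_mult)
    then show "diag (\<lambda>y. ?k y * ?k y) (y, z) = (complex_of_real M \<odot>\<^bsub>A\<^esub> diag ?h \<oplus>\<^bsub>A\<^esub> (-1) \<odot>\<^bsub>A\<^esub> diag (\<lambda>y. ?h y * ?h y)) (y, z)"
      by (cases "y = z") (simp_all add: algebra_simps)
  qed
  note kC = diag_Cc[OF k] and hC = diag_Cc[OF r]
  have sa: "astar A (diag ?k) = diag ?k" "astar A (diag ?h) = diag ?h"
    using diag_star[OF k] diag_star[OF r] by simp_all
  have "0 \<le> (hnorm H (L (diag ?k) x))\<^sup>2" by simp
  also have "\<dots> = Re (hinner H (L (diag ?k \<otimes>\<^bsub>A\<^esub> diag ?k) x) x)"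
    using L.hnorm_L_power2[of "diag ?k" x] kC x sa by simp
  also have "\<dots> = M * Re (hinner H (L (diag ?h) x) x) - (hnorm H (L (diag ?h) x))\<^sup>2"
  proof -
    have "L (diag ?k \<otimes>\<^bsub>A\<^esub> diag ?k) x = (complex_of_real M \<odot>\<^bsub>H\<^esub> L (diag ?h) x) \<oplus>\<^bsub>H\<^esub> ((-1) \<odot>\<^bsub>H\<^esub> L (diag ?h \<otimes>\<^bsub>A\<^esub> diag ?h) x)"
      unfolding sq using hC x Cc_mult[OF hC hC] L.smult_closed'[of "diag ?h" "complex_of_real M"]
        L.smult_closed'[of "diag ?h \<otimes>\<^bsub>A\<^esub> diag ?h" "-1"]
      by (subst L.L_add) (simp_all add: L.L_smult del: A_simps(3,4))
    then show ?thesis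
      using L.hnorm_L_power2[of "diag ?h" x] hC x sa Cc_mult[OF hC hC] Lc
      by (simp add: L.H.inner_add_left L.H.inner_smult_left)
  qed
  finally have "(hnorm H (L (diag ?h) x))\<^sup>2 \<le> M * Re (hinner H (L (diag ?h) x) x)" by simp
  also have "\<dots> \<le> M * (hnorm H (L (diag ?h) x) * hnorm H x)"
    using M[of undefined] L.H.cauchy_schwarz[of "L (diag ?h) x" x] hC x Lc
      complex_Re_le_cmod[of "hinner H (L (diag ?h) x) x"] by (intro mult_left_mono) auto
  finally have "hnorm H (L (diag ?h) x) * hnorm H (L (diag ?h) x) \<le> (M * hnorm H x) * hnorm H (L (diag ?h) x)"
    by (simp add: power2_eq_square mult_ac)
  moreover have "0 \<le> hnorm H (L (diag ?h) x)" "0 \<le> M * hnorm H x" using hC x Lc M[of undefined] by auto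
  ultimately show ?thesis by (cases "hnorm H (L (diag ?h) x) = 0") simp_all
qed

lemma hnorm_L_by_diag:
  assumes f: "f \<in> Cc G" and r: "(\<lambda>y. of_real (r y)) \<in> bump_functions T"
    and eq: "astar A f \<otimes>\<^bsub>A\<^esub> f = diag (\<lambda>y. of_real (r y))" and M: "\<And>y. 0 \<le> r y \<and> r y \<le> M\<^sup>2" "0 \<le> M"
  shows "op_norm H (L f) \<le> M"
proof (rule L.H.op_norm_le[OF M(2)])
  fix x assume x: "x \<in> carrier H"
  have "(hnorm H (L f x))\<^sup>2 = Re (hinner H (L (diag (\<lambda>y. of_real (r y))) x) x)"
    using L.hnorm_L_power2[of f x] f x eq by simp
  also have "\<dots> \<le> hnorm H (L (diag (\<lambda>y. of_real (r y))) x) * hnorm H x"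
    using L.H.cauchy_schwarz[of "L (diag (\<lambda>y. of_real (r y))) x" x] diag_Cc[OF r] x Lc
      complex_Re_le_cmod[of "hinner H (L (diag (\<lambda>y. of_real (r y))) x) x"] by auto
  also have "\<dots> \<le> (M\<^sup>2 * hnorm H x) * hnorm H x"
    using L_diag_bound_real[OF r M(1) x] x by (intro mult_right_mono) auto
  also have "\<dots> = (M * hnorm H x)\<^sup>2" by (simp add: power2_eq_square)
  finally show "hnorm H (L f x) \<le> M * hnorm H x"
    by (rule power2_le_imp_le) (use M(2) x in simp)
qed

lemma L_diag_bound:
  assumes h: "h \<in> bump_functions T" and M: "\<And>y. cmod (h y) \<le> M"
  shows "op_norm H (L (diag h)) \<le> M"
proof (rule hnorm_L_by_diag[OF diag_Cc[OF h]])
  show "astar A (diag h) \<otimes>\<^bsub>A\<^esub> diag h = diag (\<lambda>y. of_real ((cmod (h y))\<^sup>2))"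
    unfolding diag_star[OF h] using diag_mult[of "\<lambda>y. cnj (h y)" h] h bump_functions_lift[OF h, of cnj]
    by (simp only: complex_norm_square mult.commute) (simp add: continuous_intros mult.commute)
  show "(\<lambda>y. complex_of_real ((cmod (h y))\<^sup>2)) \<in> bump_functions T"
    using bump_functions_lift[OF h, of "\<lambda>t. complex_of_real ((cmod t)\<^sup>2)"] by (simp add: continuous_intros)
  show "0 \<le> M" using M[of undefined] norm_ge_zero order_trans by blast
  show "0 \<le> (cmod (h y))\<^sup>2 \<and> (cmod (h y))\<^sup>2 \<le> M\<^sup>2" for y using power_mono[OF M[of y]] by simp
qed

lemma p_sum_le:
  assumes "finite F" "\<And>i. i \<in> F \<Longrightarrow> f i \<in> Cc G" "\<And>i. i \<in> F \<Longrightarrow> L.p (f i) \<le> B"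
  shows "L.p (\<lambda>\<alpha>. \<Sum>i\<in>F. f i \<alpha>) \<le> real (card F) * B"
  using assms
proof (induction F)
  case empty
  then show ?case using L.p_smult[of "\<lambda>_. 0" 0] Cc_zero by simp
next
  case (insert j F)
  have "L.p (f j \<oplus>\<^bsub>A\<^esub> (\<lambda>\<alpha>. \<Sum>i\<in>F. f i \<alpha>)) \<le> L.p (f j) + L.p (\<lambda>\<alpha>. \<Sum>i\<in>F. f i \<alpha>)"
    using insert.prems by (intro L.p_add) (auto intro: Cc_sum)
  then show ?case using insert by (force simp: distrib_right)
qed

end

context fibre_cocycle begin

lemma fibre_rep_intro: "star_rep A H L \<Longrightarrow> fibre_rep Y X \<psi> \<sigma> H L"
  by (simp add: fibre_rep_def fibre_rep_axioms_def fibre_cocycle_axioms)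

text \<open>Cutting a function into pieces supported over slices bounds it, in every representation, by its
  supremum, with a constant that depends only on a compact set carrying it.\<close>

lemma crude_bound:
  assumes C: "compactin Y C"
  shows "\<exists>K\<ge>0. \<forall>(H :: 'h hilbert) L. star_rep A H L \<longrightarrow>
    (\<forall>f\<in>Cc G. \<forall>M. carried C f \<longrightarrow> (\<forall>\<alpha>. cmod (f \<alpha>) \<le> M) \<longrightarrow> op_norm H (L f) \<le> K * M)"
proof -
  have "\<exists>U. openin Y U \<and> c \<in> U \<and> slice U" if "c \<in> C" for c
    using slice_exists[of c] slice_openin compactin_subset_topspace[OF C(1)] that by blast
  then obtain F and h :: "'y \<Rightarrow> 'y \<Rightarrow> complex" where F: "finite F"
    "\<forall>i\<in>F. \<exists>U. slice U \<and> openin Y U \<and> h i \<in> bump_functions U"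
    "\<forall>i y. cmod (h i y) \<le> 1" "\<forall>c\<in>C. (\<Sum>i\<in>F. h i c) = 1" "F \<subseteq> C"
    by (rule partition_of_unity[OF C(1)])
  obtain U where U: "\<And>i. i \<in> F \<Longrightarrow> slice (U i)" "\<And>i. i \<in> F \<Longrightarrow> h i \<in> bump_functions (U i)" using F(2) by metis
  obtain N where N: "\<And>y. finite (fibre_in C y)" "\<And>y. card (fibre_in C y) \<le> N" using fibre_in_bounded[OF C] by metis
  show ?thesis
  proof (intro exI[of _ "real (card F) * sqrt (real N)"] conjI allI impI ballI)
    fix H :: "'h hilbert" and L f M
    assume L: "star_rep A H L" and f: "f \<in> Cc G" and Cf: "carried C f" and M: "\<forall>\<alpha>. cmod (f \<alpha>) \<le> M"
    interpret fibre_rep Y X \<psi> \<sigma> H L by (rule fibre_rep_intro[OF L])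
    have M0: "0 \<le> M" using M norm_ge_zero order_trans by blast
    let ?f = "\<lambda>i \<alpha>. f \<alpha> * h i (snd \<alpha>)"
    have fi: "?f i \<in> Cc G" if i: "i \<in> F" for i
    proof -
      have "continuous_map TR euclidean (\<lambda>\<alpha>. h i (snd \<alpha>))"
        using continuous_map_compose[OF continuous_snd bump_functionsD(1)[OF U(2)[OF i]]] by (simp add: o_def)
      then show ?thesis by (intro Cc_supported[OF f] continuous_map_complex_mult Cc_continuous[OF f]) auto
    qed
    have "L.p (?f i) \<le> sqrt (real N) * M" if i: "i \<in> F" for i
    proof -
      have Ci: "carried C (?f i)" using Cf by (auto simp: carried_def)
      have Vi: "z \<in> U i" if "?f i (y, z) \<noteq> 0" for y z using that bump_functionsD(2)[OF U(2)[OF i]] by simp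
      have eq: "astar A (?f i) \<otimes>\<^bsub>A\<^esub> ?f i = diag (\<lambda>y. of_real (\<Sum>z\<in>fibre_in C y. (cmod (?f i (z, y)))\<^sup>2))"
        by (rule star_mult_slice[OF fi[OF i] C Ci U(1)[OF i]]) (use Vi in blast)
      have "astar A (?f i) \<otimes>\<^bsub>A\<^esub> ?f i \<in> Cc G" using fi[OF i] by (intro Cc_mult Cc_star)
      from Cc_diagonal[OF this] have b: "(\<lambda>y. complex_of_real (\<Sum>z\<in>fibre_in C y. (cmod (?f i (z, y)))\<^sup>2)) \<in> bump_functions T"
        unfolding eq diag_simps .
      show ?thesis
      proof (rule hnorm_L_by_diag[OF fi[OF i] b eq])
        fix y
        have "cmod (?f i (z, y)) \<le> M" for z
          using M F(3) mult_mono[of "cmod (f (z, y))" M "cmod (h i y)" 1] M0 by (simp add: norm_mult)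
        then have "(\<Sum>z\<in>fibre_in C y. (cmod (?f i (z, y)))\<^sup>2) \<le> (\<Sum>z\<in>fibre_in C y. M\<^sup>2)"
          by (intro sum_mono power_mono) auto
        also have "\<dots> \<le> real N * M\<^sup>2" using N(2)[of y] by (simp add: mult_right_mono)
        finally show "0 \<le> (\<Sum>z\<in>fibre_in C y. (cmod (?f i (z, y)))\<^sup>2) \<and>
            (\<Sum>z\<in>fibre_in C y. (cmod (?f i (z, y)))\<^sup>2) \<le> (sqrt (real N) * M)\<^sup>2"
          by (auto simp: power_mult_distrib intro: sum_nonneg)
      qed (use M0 in simp)
    qed
    then have "L.p (\<lambda>\<alpha>. \<Sum>i\<in>F. ?f i \<alpha>) \<le> real (card F) * (sqrt (real N) * M)"
      by (intro p_sum_le F(1) fi)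
    moreover have "(\<lambda>\<alpha>. \<Sum>i\<in>F. ?f i \<alpha>) = f"
    proof (rule ext, clarify)
      fix y z
      show "(\<Sum>i\<in>F. ?f i (y, z)) = f (y, z)"
      proof (cases "f (y, z) = 0")
        case False
        then have "z \<in> C" using Cf by (auto simp: carried_def)
        then show ?thesis using F(4) by (simp flip: sum_distrib_left)
      qed simp
    qed
    ultimately show "op_norm H (L f) \<le> real (card F) * sqrt (real N) * M" by (simp add: mult.assoc)
  qed simp
qed

end

section \<open>The induced representations\<close>

context fibre_cocycle begin

abbreviation "Hu u \<equiv> ell2 (source_fibre G u)"

lemma source_fibre_iff: "(y, z) \<in> source_fibre G u \<longleftrightarrow> (y, z) \<in> R \<and> z = u"
  by (simp add: source_fibre_def)

lemma Hu_outside: "\<xi> \<in> carrier (Hu u) \<Longrightarrow> \<not> ((y, z) \<in> R \<and> z = u) \<Longrightarrow> \<xi> (y, z) = 0"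
  using ell2_outside[of \<xi> "source_fibre G u" "(y, z)"] by (simp add: source_fibre_iff)

lemma hilbert_Hu: "hilbert (Hu u)"
  using hilbert_ell2 by (simp add: hilbert_def)

text \<open>Vectors of the induced representation are functions on the relation as well, so that the identities
  of the algebra also describe its action.\<close>

lemma Ind_eq_mult: assumes \<xi>: "\<xi> \<in> carrier (Hu u)" shows "Ind G \<sigma> u f \<xi> = f \<otimes>\<^bsub>A\<^esub> \<xi>"
proof (rule ext, clarify)
  fix y w
  show "Ind G \<sigma> u f \<xi> (y, w) = (f \<otimes>\<^bsub>A\<^esub> \<xi>) (y, w)"
  proof (cases "(y, w) \<in> R \<and> w = u")
    case True
    then show ?thesis using \<xi> by (simp add: Ind_def source_fibre_iff twisted_algebra_def)
  next
    case False
    have "(f \<otimes>\<^bsub>A\<^esub> \<xi>) (y, w) = 0"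
    proof (cases "(y, w) \<in> R")
      case True
      then have "\<xi> (z, w) = 0" for z using Hu_outside[OF \<xi>] False by blast
      then show ?thesis using True by (simp add: twisted_algebra_def)
    qed (simp add: mult_A_outside)
    then show ?thesis using \<xi> False by (auto simp: Ind_def source_fibre_iff)
  qed
qed

lemma Ind_apply:
  assumes "\<xi> \<in> carrier (Hu u)" "compactin Y C" "carried C f" "(y, u) \<in> R"
  shows "Ind G \<sigma> u f \<xi> (y, u) = (\<Sum>z\<in>fibre_in C u. f (y, z) * \<xi> (z, u) * \<omega> y z u)"
  unfolding Ind_eq_mult[OF assms(1)] mult_A[OF assms(2-4)] fibre_in_eq[OF assms(4)] ..

lemma Ind_support:
  assumes \<xi>: "\<xi> \<in> carrier (Hu u)" and C: "compactin Y C" "carried C f"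
    and nz: "Ind G \<sigma> u f \<xi> \<alpha> \<noteq> 0"
  shows "\<alpha> \<in> (\<lambda>y. (y, u)) ` fibre_in C u"
proof -
  obtain y w where \<alpha>: "\<alpha> = (y, w)" by (cases \<alpha>)
  have R: "(y, w) \<in> R" "w = u"
    using nz \<xi> unfolding \<alpha> by (auto simp: Ind_def source_fibre_iff split: if_splits)
  have "\<exists>z\<in>fibre_in C u. f (y, z) * \<xi> (z, u) * \<omega> y z u \<noteq> 0"
    using nz Ind_apply[OF \<xi> C, of y] R unfolding \<alpha> by (metis (no_types, lifting) sum.neutral)
  then have "y \<in> C" using C(2) by (auto simp: carried_def)
  then show ?thesis using R R_sym unfolding \<alpha> by (auto simp: fibre_in_def)
qed

lemma sum_column: "(\<Sum>\<alpha>\<in>(\<lambda>y. (y, u)) ` F. g \<alpha>) = (\<Sum>y\<in>F. g (y, u))"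
  by (subst sum.reindex) (auto simp: inj_on_def)

lemma column_subset: "(\<lambda>y. (y, u)) ` fibre_in C u \<subseteq> source_fibre G u"
  by (auto simp: source_fibre_iff dest: fibre_in_R)

lemma finite_column: "compactin Y C \<Longrightarrow> finite ((\<lambda>y. (y, u)) ` fibre_in C u)"
  using finite_fibre_in by simp

lemma Ind_closed:
  assumes \<xi>: "\<xi> \<in> carrier (Hu u)" and f: "f \<in> Cc G"
  shows "Ind G \<sigma> u f \<xi> \<in> carrier (Hu u)"
proof -
  obtain C where C: "compactin Y C" "carried C f" using Cc_carried[OF f] .
  show ?thesis
    by (rule ell2_finite_support(1)[OF finite_column[OF C(1)] column_subset])
      (use Ind_support[OF \<xi> C] in blast)
qed

lemma Ind_inner:
  assumes \<xi>: "\<xi> \<in> carrier (Hu u)" and C: "compactin Y C" "carried C f"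
  shows "hinner (Hu u) (Ind G \<sigma> u f \<xi>) \<eta> = (\<Sum>y\<in>fibre_in C u. Ind G \<sigma> u f \<xi> (y, u) * cnj (\<eta> (y, u)))"
    "hinner (Hu u) \<eta> (Ind G \<sigma> u f \<xi>) = (\<Sum>y\<in>fibre_in C u. \<eta> (y, u) * cnj (Ind G \<sigma> u f \<xi> (y, u)))"
proof -
  have z: "Ind G \<sigma> u f \<xi> \<alpha> = 0" if "\<alpha> \<notin> (\<lambda>y. (y, u)) ` fibre_in C u" for \<alpha>
    using Ind_support[OF \<xi> C] that by blast
  note F = ell2_finite_support(2,3)[OF finite_column[OF C(1)] column_subset]
  show "hinner (Hu u) (Ind G \<sigma> u f \<xi>) \<eta> = (\<Sum>y\<in>fibre_in C u. Ind G \<sigma> u f \<xi> (y, u) * cnj (\<eta> (y, u)))"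
    by (subst F(1)) (use z sum_column in auto)
  show "hinner (Hu u) \<eta> (Ind G \<sigma> u f \<xi>) = (\<Sum>y\<in>fibre_in C u. \<eta> (y, u) * cnj (Ind G \<sigma> u f \<xi> (y, u)))"
    by (subst F(2)) (use z sum_column in auto)
qed

lemma star_rep_Ind: "star_rep A (Hu u) (Ind G \<sigma> u)"
  unfolding star_rep_def
proof (intro conjI ballI allI)
  interpret H: hilbert "Hu u" by (rule hilbert_Hu)
  show "hilbert_space (Hu u)" by (rule hilbert_ell2)
  fix f assume "f \<in> carrier A"
  then have f: "f \<in> Cc G" by simp
  obtain C where C: "compactin Y C" "carried C f" using Cc_carried[OF f] .
  let ?F = "fibre_in C u"
  note fin = finite_fibre_in[OF C(1), of u]
  show "Ind G \<sigma> u f \<in> bounded_ops (Hu u)"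
  proof (rule H.bounded_opsI)
    show "Ind G \<sigma> u f \<in> extensional (carrier (Hu u))" by (simp add: Ind_def)
    fix \<xi> assume \<xi>: "\<xi> \<in> carrier (Hu u)"
    show "Ind G \<sigma> u f \<xi> \<in> carrier (Hu u)" by (rule Ind_closed[OF \<xi> f])
    have c: "(\<lambda>\<alpha>. c * \<xi> \<alpha>) \<in> carrier (Hu u)" for c by (rule ell2_smult[OF \<xi>])
    show "Ind G \<sigma> u f (c \<odot>\<^bsub>Hu u\<^esub> \<xi>) = c \<odot>\<^bsub>Hu u\<^esub> Ind G \<sigma> u f \<xi>" for c
    proof (rule ext, clarify)
      fix y w
      show "Ind G \<sigma> u f (c \<odot>\<^bsub>Hu u\<^esub> \<xi>) (y, w) = (c \<odot>\<^bsub>Hu u\<^esub> Ind G \<sigma> u f \<xi>) (y, w)"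
        by (cases "(y, w) \<in> R")
          (simp_all add: Ind_eq_mult[OF c] Ind_eq_mult[OF \<xi>] mult_A[OF C] mult_A_outside sum_distrib_left mult_ac)
    qed
    show "Ind G \<sigma> u f (\<xi> \<oplus>\<^bsub>Hu u\<^esub> \<eta>) = Ind G \<sigma> u f \<xi> \<oplus>\<^bsub>Hu u\<^esub> Ind G \<sigma> u f \<eta>"
      if \<eta>: "\<eta> \<in> carrier (Hu u)" for \<eta>
    proof (rule ext, clarify)
      fix y w
      show "Ind G \<sigma> u f (\<xi> \<oplus>\<^bsub>Hu u\<^esub> \<eta>) (y, w) = (Ind G \<sigma> u f \<xi> \<oplus>\<^bsub>Hu u\<^esub> Ind G \<sigma> u f \<eta>) (y, w)"
        by (cases "(y, w) \<in> R")
          (simp_all add: Ind_eq_mult[OF ell2_add[OF \<xi> \<eta>]] Ind_eq_mult[OF \<xi>] Ind_eq_mult[OF \<eta>] mult_A[OF C]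
            mult_A_outside sum.distrib distrib_left distrib_right)
    qed
    \<comment> \<open>over the orbit of \<open>u\<close> the operator is a finite matrix, and its entries bound it\<close>
    define M where "M = (\<Sum>y\<in>?F. \<Sum>z\<in>?F. cmod (f (y, z)))"
    have M0: "0 \<le> M" unfolding M_def by (intro sum_nonneg) auto
    have entry: "cmod (Ind G \<sigma> u f \<xi> (y, u)) \<le> M * hnorm (Hu u) \<xi>" if y: "y \<in> ?F" for y
    proof -
      have "cmod (Ind G \<sigma> u f \<xi> (y, u)) \<le> (\<Sum>z\<in>?F. cmod (f (y, z) * \<xi> (z, u) * \<omega> y z u))"
        unfolding Ind_apply[OF \<xi> C fibre_in_R(2)[OF y]] by (rule norm_sum)
      also have "\<dots> \<le> (\<Sum>z\<in>?F. cmod (f (y, z)) * hnorm (Hu u) \<xi>)"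
      proof (rule sum_mono)
        fix z assume z: "z \<in> ?F"
        have "cmod (\<omega> y z u) = 1"
          using fibre_in_R[OF y] fibre_in_R[OF z] by (intro om_norm) (auto intro: R_trans)
        then show "cmod (f (y, z) * \<xi> (z, u) * \<omega> y z u) \<le> cmod (f (y, z)) * hnorm (Hu u) \<xi>"
          using ell2_coordinate_le[OF \<xi>] by (simp add: norm_mult mult_left_mono)
      qed
      also have "\<dots> = (\<Sum>z\<in>?F. cmod (f (y, z))) * hnorm (Hu u) \<xi>" by (simp add: sum_distrib_right)
      also have "\<dots> \<le> M * hnorm (Hu u) \<xi>"
        unfolding M_def using fin y \<xi>
        by (intro mult_right_mono member_le_sum) (auto intro: sum_nonneg)
      finally show ?thesis .
    qed
    have "(hnorm (Hu u) (Ind G \<sigma> u f \<xi>))\<^sup>2 = Re (\<Sum>y\<in>?F. of_real ((cmod (Ind G \<sigma> u f \<xi> (y, u)))\<^sup>2))"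
      unfolding H.hnorm_power2[OF Ind_closed[OF \<xi> f]] Ind_inner(1)[OF \<xi> C] by (simp only: complex_norm_square)
    also have "\<dots> = (\<Sum>y\<in>?F. (cmod (Ind G \<sigma> u f \<xi> (y, u)))\<^sup>2)"
      by (simp only: of_real_sum[symmetric] Re_complex_of_real)
    also have "\<dots> \<le> (\<Sum>y\<in>?F. (M * hnorm (Hu u) \<xi>)\<^sup>2)" using entry by (intro sum_mono power_mono) auto
    also have "\<dots> = (sqrt (real (card ?F)) * (M * hnorm (Hu u) \<xi>))\<^sup>2" by (simp add: power_mult_distrib)
    finally show "hnorm (Hu u) (Ind G \<sigma> u f \<xi>) \<le> sqrt (real (card ?F)) * M * hnorm (Hu u) \<xi>"
      unfolding mult.assoc by (rule power2_le_imp_le) (use M0 H.hnorm_ge0[OF \<xi>] in simp)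
  qed
  fix \<xi> assume \<xi>: "\<xi> \<in> carrier (Hu u)"
  show "Ind G \<sigma> u (c \<odot>\<^bsub>A\<^esub> f) \<xi> = c \<odot>\<^bsub>Hu u\<^esub> Ind G \<sigma> u f \<xi>" for c
  proof (rule ext, clarify)
    fix y w
    have cC: "carried C (\<lambda>\<alpha>. c * f \<alpha>)" using C(2) by (auto simp: carried_def)
    show "Ind G \<sigma> u (c \<odot>\<^bsub>A\<^esub> f) \<xi> (y, w) = (c \<odot>\<^bsub>Hu u\<^esub> Ind G \<sigma> u f \<xi>) (y, w)"
      by (cases "(y, w) \<in> R")
        (simp_all add: Ind_eq_mult[OF \<xi>] mult_A[OF C] mult_A[OF C(1) cC] mult_A_outside sum_distrib_left mult_ac)
  qed
  show "hinner (Hu u) (Ind G \<sigma> u f \<xi>) \<eta> = hinner (Hu u) \<xi> (Ind G \<sigma> u (astar A f) \<eta>)" if \<eta>: "\<eta> \<in> carrier (Hu u)" for \<eta>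
  proof -
    have Cs: "carried C (astar A f)" by (rule star_A_carried[OF C(2)])
    have "hinner (Hu u) (Ind G \<sigma> u f \<xi>) \<eta> = (\<Sum>y\<in>?F. Ind G \<sigma> u f \<xi> (y, u) * cnj (\<eta> (y, u)))"
      by (rule Ind_inner(1)[OF \<xi> C])
    also have "\<dots> = (\<Sum>y\<in>?F. \<Sum>z\<in>?F. f (y, z) * \<xi> (z, u) * \<omega> y z u * cnj (\<eta> (y, u)))"
      by (intro sum.cong refl) (simp add: Ind_apply[OF \<xi> C] fibre_in_R sum_distrib_right)
    also have "\<dots> = (\<Sum>y\<in>?F. \<Sum>z\<in>?F. \<xi> (z, u) * cnj (astar A f (z, y) * \<eta> (y, u) * \<omega> z y u))"
    proof (intro sum.cong refl)
      fix y z assume y: "y \<in> ?F" and z: "z \<in> ?F"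
      have R: "(z, y) \<in> R" "(y, u) \<in> R" using fibre_in_R[OF y] fibre_in_R[OF z] by (auto intro: R_trans)
      have "f (y, z) * \<xi> (z, u) * \<omega> y z u * cnj (\<eta> (y, u)) =
          \<xi> (z, u) * (f (y, z) * (\<omega> z y z * cnj (\<omega> z y u))) * cnj (\<eta> (y, u))"
        unfolding om_adjoint[OF R] by (simp only: mult_ac)
      also have "\<dots> = \<xi> (z, u) * cnj (astar A f (z, y) * \<eta> (y, u) * \<omega> z y u)"
        using R by (simp add: star_A)
      finally show "f (y, z) * \<xi> (z, u) * \<omega> y z u * cnj (\<eta> (y, u)) = \<xi> (z, u) * cnj (astar A f (z, y) * \<eta> (y, u) * \<omega> z y u)" .
    qed
    also have "\<dots> = (\<Sum>z\<in>?F. \<Sum>y\<in>?F. \<xi> (z, u) * cnj (astar A f (z, y) * \<eta> (y, u) * \<omega> z y u))" by (rule sum.swap)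
    also have "\<dots> = (\<Sum>z\<in>?F. \<xi> (z, u) * cnj (Ind G \<sigma> u (astar A f) \<eta> (z, u)))"
      by (intro sum.cong refl) (simp add: Ind_apply[OF \<eta> C(1) Cs] fibre_in_R sum_distrib_left)
    also have "\<dots> = hinner (Hu u) \<xi> (Ind G \<sigma> u (astar A f) \<eta>)"
      by (rule Ind_inner(2)[OF \<eta> C(1) Cs, symmetric])
    finally show ?thesis .
  qed
  fix g assume "g \<in> carrier A"
  then have g: "g \<in> Cc G" by simp
  obtain D where D: "compactin Y D" "carried D f" "carried D g" using Cc_carried2[OF f g] .
  show "Ind G \<sigma> u (f \<otimes>\<^bsub>A\<^esub> g) \<xi> = Ind G \<sigma> u f (Ind G \<sigma> u g \<xi>)"
    unfolding Ind_eq_mult[OF \<xi>] Ind_eq_mult[OF Ind_closed[OF \<xi> g, unfolded Ind_eq_mult[OF \<xi>]]]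
    by (rule mult_A_assoc[OF D])
  show "Ind G \<sigma> u (f \<oplus>\<^bsub>A\<^esub> g) \<xi> = Ind G \<sigma> u f \<xi> \<oplus>\<^bsub>Hu u\<^esub> Ind G \<sigma> u g \<xi>"
  proof (rule ext, clarify)
    fix y w
    have aC: "carried D (\<lambda>\<alpha>. f \<alpha> + g \<alpha>)" using D(2,3) by (auto simp: carried_def) (metis add_0)+
    show "Ind G \<sigma> u (f \<oplus>\<^bsub>A\<^esub> g) \<xi> (y, w) = (Ind G \<sigma> u f \<xi> \<oplus>\<^bsub>Hu u\<^esub> Ind G \<sigma> u g \<xi>) (y, w)"
      by (cases "(y, w) \<in> R")
        (simp_all add: Ind_eq_mult[OF \<xi>] mult_A[OF D(1,2)] mult_A[OF D(1,3)] mult_A[OF D(1) aC] mult_A_outside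
          sum.distrib distrib_right)
  qed
qed

lemma Ind_unit_vector:
  assumes f: "f \<in> Cc G" and R: "(y, u) \<in> R" "(z, u) \<in> R"
  shows "Ind G \<sigma> u f (unit_vector (z, u)) (y, u) = f (y, z) * \<omega> y z u"
proof -
  obtain C where C: "compactin Y C" "carried C f" using Cc_carried[OF f] .
  have e: "unit_vector (z, u) \<in> carrier (Hu u)" using R by (intro unit_vector_ell2(1)) (simp add: source_fibre_iff)
  have "Ind G \<sigma> u f (unit_vector (z, u)) (y, u) = (\<Sum>v\<in>fibre_in C u. if v = z then f (y, z) * \<omega> y z u else 0)"
    unfolding Ind_apply[OF e C R(1)] by (intro sum.cong) (auto simp: unit_vector_def)
  also have "\<dots> = (if z \<in> fibre_in C u then f (y, z) * \<omega> y z u else 0)"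
    using finite_fibre_in[OF C(1)] by simp
  also have "\<dots> = f (y, z) * \<omega> y z u"
    using C(2) R by (auto simp: fibre_in_def carried_def dest: R_sym)
  finally show ?thesis .
qed

lemma entry_le_Ind_norm:
  assumes f: "f \<in> Cc G" and R: "(y, u) \<in> R" "(z, u) \<in> R"
  shows "cmod (f (y, z)) \<le> op_norm (Hu u) (Ind G \<sigma> u f)"
proof -
  interpret rep A "Hu u" "Ind G \<sigma> u" by (rule rep_intro[OF star_algebra_A star_rep_Ind])
  have e: "unit_vector (z, u) \<in> carrier (Hu u)" "hnorm (Hu u) (unit_vector (z, u)) = 1"
    using R by (auto intro!: unit_vector_ell2 simp: source_fibre_iff)
  have "cmod (\<omega> y z u) = 1" using R by (intro om_norm) (auto intro: R_trans R_sym)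
  then have "cmod (f (y, z)) = cmod (Ind G \<sigma> u f (unit_vector (z, u)) (y, u))"
    unfolding Ind_unit_vector[OF f R] by (simp add: norm_mult)
  also have "\<dots> \<le> hnorm (Hu u) (Ind G \<sigma> u f (unit_vector (z, u)))"
    using ell2_coordinate_le[OF Ind_closed[OF e(1) f]] .
  also have "\<dots> \<le> op_norm (Hu u) (Ind G \<sigma> u f)" using hnorm_L[of f "unit_vector (z, u)"] e f by simp
  finally show ?thesis .
qed

end

section \<open>Full and reduced norms coincide\<close>

context fibre_cocycle begin

subsection \<open>The induced representations are irreducible\<close>

lemma Ind_diag:
  assumes \<xi>: "\<xi> \<in> carrier (Hu u)" and h: "h \<in> bump_functions T"
  shows "Ind G \<sigma> u (diag h) \<xi> = (\<lambda>\<alpha>. h (fst \<alpha>) * \<xi> \<alpha>)"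
proof (rule ext, clarify)
  fix y w
  obtain C where C: "compactin Y C" "carried C (diag h)" using Cc_carried[OF diag_Cc[OF h]] .
  show "Ind G \<sigma> u (diag h) \<xi> (y, w) = h (fst (y, w)) * \<xi> (y, w)"
  proof (cases "(y, w) \<in> R")
    case R: True
    have "(diag h \<otimes>\<^bsub>A\<^esub> \<xi>) (y, w) = (\<Sum>z\<in>fibre_in C y. if y = z then h y * \<xi> (y, w) * \<omega> y y w else 0)"
      unfolding mult_A[OF C R] by (intro sum.cong) auto
    also have "\<dots> = (if y \<in> fibre_in C y then h y * \<xi> (y, w) * \<omega> y y w else 0)"
      using finite_fibre_in[OF C(1)] by simp
    also have "\<dots> = h y * \<xi> (y, w)"
      using R C(2) by (auto simp: fibre_in_def carried_def R_iff dest!: spec[of _ y])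
    finally show ?thesis unfolding Ind_eq_mult[OF \<xi>] by simp
  next
    case False
    then show ?thesis using Hu_outside[OF \<xi>, of y w] by (simp add: Ind_eq_mult[OF \<xi>] mult_A_outside)
  qed
qed

text \<open>A function concentrated near one arrow. As the relation need not be closed in \<open>Y \<times> Y\<close>, a product
  of bump functions need not have compact support; the graph of a section over a compact set does.\<close>

lemma bump_at_arrow:
  assumes R: "(w, z) \<in> R" and U: "slice U" "z \<in> U" and W: "openin Y W" "w \<in> W"
  obtains f where "f \<in> Cc G" "f (w, z) = 1" "\<forall>y v. f (y, v) \<noteq> 0 \<longrightarrow> y \<in> W \<and> v \<in> U"
proof -
  have "openin Y (W \<inter> saturation U)" using W openin_saturation[OF slice_openin[OF U(1)]] by blast
  moreover have "w \<in> W \<inter> saturation U" using W U R by (auto simp: saturation_def)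
  ultimately obtain g V where g: "openin Y V" "w \<in> V" "V \<subseteq> W \<inter> saturation U" "\<forall>v\<in>V. g v = 1"
    "\<forall>z. 0 \<le> g z \<and> g z \<le> (1::real)" "(\<lambda>z. of_real (g z)) \<in> bump_functions (W \<inter> saturation U)"
    "continuous_map Y euclideanreal g"
    by (rule bump_at_point)
  define h where "h z = complex_of_real (g z)" for z
  have hb: "h \<in> bump_functions (W \<inter> saturation U)" using g(6) by (simp add: h_def[abs_def])
  then obtain C where C: "compactin Y C" "C \<subseteq> W \<inter> saturation U" "\<forall>y. h y \<noteq> 0 \<longrightarrow> y \<in> C"
    by (auto simp: bump_functions_def)
  let ?t = "section_map U"
  let ?Z = "subtopology Y (saturation U)"
  have top: "topspace ?Z = saturation U"
    using openin_subset[OF openin_saturation[OF slice_openin[OF U(1)]]] by auto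
  have "continuous_map ?Z TR (\<lambda>y. (y, ?t y))"
    by (intro continuous_map_into_TR continuous_section_map[OF U(1)] continuous_map_from_subtopology)
      (use section_map[OF U(1)] in \<open>auto simp: top\<close>)
  moreover have "compactin ?Z C" using C by (auto simp: compactin_subtopology)
  ultimately have K: "compactin TR ((\<lambda>y. (y, ?t y)) ` C)" (is "compactin TR ?K") using image_compactin by blast
  then have Kcl: "closedin TR ?K" by (rule compactin_imp_closedin[OF Hausdorff_TR])
  define f where "f \<alpha> = (if \<alpha> \<in> R \<and> snd \<alpha> \<in> U then h (fst \<alpha>) else 0)" for \<alpha>
  have supp: "\<alpha> \<in> ?K" if nz: "f \<alpha> \<noteq> 0" for \<alpha>
  proof -
    have a: "\<alpha> \<in> R" "snd \<alpha> \<in> U" "h (fst \<alpha>) \<noteq> 0" using nz by (auto simp: f_def split: if_splits)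
    then have "?t (fst \<alpha>) = snd \<alpha>" by (intro section_map_eq[OF U(1)]) auto
    then have "\<alpha> = (fst \<alpha>, ?t (fst \<alpha>))" by simp
    then show ?thesis using a(3) C(3) by blast
  qed
  have "continuous_map TR euclidean f"
  proof (rule pasting_lemma[where I = UNIV and T = "\<lambda>b. if b then {\<alpha> \<in> R. snd \<alpha> \<in> U} else R - ?K"
        and f = "\<lambda>b. if b then h \<circ> fst else (\<lambda>_. 0)"])
    have "openin TR {\<alpha> \<in> R. snd \<alpha> \<in> U}"
      using openin_continuous_map_preimage[OF continuous_snd slice_openin[OF U(1)]] unfolding topspace_TR .
    moreover have "openin TR (R - ?K)" using Kcl unfolding closedin_def topspace_TR by blast
    ultimately show "openin TR (if b then {\<alpha> \<in> R. snd \<alpha> \<in> U} else R - ?K)" for b by simp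
    have "continuous_map TR euclidean (h \<circ> fst)"
      by (rule continuous_map_compose[OF continuous_fst bump_functionsD(1)[OF hb]])
    then show "continuous_map (subtopology TR (if b then {\<alpha> \<in> R. snd \<alpha> \<in> U} else R - ?K)) euclidean (if b then h \<circ> fst else (\<lambda>_. 0))" for b
      by (cases b) (auto intro: continuous_map_from_subtopology)
    show "\<exists>b. b \<in> UNIV \<and> \<alpha> \<in> (if b then {\<alpha> \<in> R. snd \<alpha> \<in> U} else R - ?K) \<and> f \<alpha> = (if b then h \<circ> fst else (\<lambda>_. 0)) \<alpha>"
      if "\<alpha> \<in> topspace TR" for \<alpha>
    proof (cases "snd \<alpha> \<in> U")
      case True
      then show ?thesis using that unfolding topspace_TR by (intro exI[of _ True]) (simp add: f_def)
    next
      case False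
      then have "\<alpha> \<notin> ?K" using section_map[OF U(1)] C(2) by auto
      then show ?thesis using False that unfolding topspace_TR by (intro exI[of _ False]) (simp add: f_def)
    qed
    show "(if b then h \<circ> fst else (\<lambda>_. 0)) \<alpha> = (if c then h \<circ> fst else (\<lambda>_. 0)) \<alpha>"
      if "\<alpha> \<in> topspace TR \<inter> (if b then {\<alpha> \<in> R. snd \<alpha> \<in> U} else R - ?K) \<inter> (if c then {\<alpha> \<in> R. snd \<alpha> \<in> U} else R - ?K)" for b c \<alpha>
      using that supp[of \<alpha>] by (cases b; cases c) (auto simp: f_def)
  qed
  then have "f \<in> Cc G" unfolding Cc_iff using K supp by blast
  moreover have "f (w, z) = 1" using R U g by (simp add: f_def h_def)
  moreover have "\<forall>y v. f (y, v) \<noteq> 0 \<longrightarrow> y \<in> W \<and> v \<in> U"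
    using C by (auto simp: f_def split: if_splits)
  ultimately show thesis by (rule that)
qed

text \<open>A bump function over a slice cuts a nonzero vector of an invariant subspace down to a multiple of a basis
  vector, and functions concentrated near one arrow move that basis vector to all the others.\<close>

lemma irreducible_Ind: assumes u: "u \<in> T" shows "irreducible_rep A (Hu u) (Ind G \<sigma> u)"
  unfolding irreducible_rep_def
proof (intro conjI allI impI star_rep_Ind)
  interpret H: hilbert "Hu u" by (rule hilbert_Hu)
  obtain U where U: "slice U" "u \<in> U" using slice_exists[OF u] by blast
  obtain f where f: "f \<in> Cc G" "f (u, u) = 1" "\<forall>y v. f (y, v) \<noteq> 0 \<longrightarrow> y \<in> U \<and> v \<in> U"
    using bump_at_arrow[OF R_refl[OF u] U slice_openin[OF U(1)] U(2)] .
  have e: "unit_vector (u, u) \<in> carrier (Hu u)" using u by (intro unit_vector_ell2) (simp add: source_fibre_iff R_refl)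
  have "Ind G \<sigma> u f (unit_vector (u, u)) (u, u) = 1"
    using Ind_unit_vector[OF f(1) R_refl[OF u] R_refl[OF u]] f(2) R_refl[OF u] by simp
  then have "Ind G \<sigma> u f (unit_vector (u, u)) \<noteq> \<zero>\<^bsub>Hu u\<^esub>" by auto
  then show "\<exists>a\<in>carrier A. \<exists>x\<in>carrier (Hu u). Ind G \<sigma> u a x \<noteq> \<zero>\<^bsub>Hu u\<^esub>" using f e by auto
  fix S assume S: "closed_subspace (Hu u) (hnorm (Hu u)) S" and inv: "\<forall>a\<in>carrier A. \<forall>x\<in>S. Ind G \<sigma> u a x \<in> S"
  note S' = H.closed_subspaceD[OF S]
  show "S = {\<zero>\<^bsub>Hu u\<^esub>} \<or> S = carrier (Hu u)"
  proof (cases "S = {\<zero>\<^bsub>Hu u\<^esub>}")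
    case False
    then obtain \<xi> where \<xi>: "\<xi> \<in> S" "\<xi> \<noteq> (\<lambda>_. 0)" using S'(2) by auto
    have \<xi>c: "\<xi> \<in> carrier (Hu u)" using \<xi> S'(1) by blast
    from \<xi>(2) obtain z w where nz: "\<xi> (z, w) \<noteq> 0" by (auto simp: fun_eq_iff)
    then have "(z, w) \<in> R \<and> w = u" using Hu_outside[OF \<xi>c, of z w] by blast
    then have zR: "(z, u) \<in> R" "w = u" by auto
    then have nz: "\<xi> (z, u) \<noteq> 0" using nz by simp
    obtain V where V: "slice V" "z \<in> V" using slice_exists[of z] zR by (auto simp: R_iff)
    obtain h W where h: "openin Y W" "z \<in> W" "W \<subseteq> V" "\<forall>v\<in>W. h v = 1" "\<forall>z. 0 \<le> h z \<and> h z \<le> (1::real)"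
      "(\<lambda>z. of_real (h z)) \<in> bump_functions V" "continuous_map Y euclideanreal h"
      by (rule bump_at_point[OF slice_openin[OF V(1)] V(2)])
    let ?h = "\<lambda>z. complex_of_real (h z)"
    have hT: "?h \<in> bump_functions T" by (rule bump_functions_T[OF h(6)])
    have "Ind G \<sigma> u (diag ?h) \<xi> = (\<lambda>\<alpha>. \<xi> (z, u) * unit_vector (z, u) \<alpha>)"
      unfolding Ind_diag[OF \<xi>c hT]
    proof (rule ext, clarify)
      fix y v
      show "?h (fst (y, v)) * \<xi> (y, v) = \<xi> (z, u) * unit_vector (z, u) (y, v)"
      proof (cases "(y, v) = (z, u)")
        case True
        then show ?thesis using h by (simp add: unit_vector_def)
      next
        case False
        have "?h y = 0 \<or> \<xi> (y, v) = 0"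
        proof (rule ccontr)
          assume "\<not> ?thesis"
          then have "y \<in> V" "(y, u) \<in> R" "v = u"
            using bump_functionsD(2)[OF h(6), of y] Hu_outside[OF \<xi>c, of y v] by auto
          then show False using slice_eq[OF V(1) \<open>y \<in> V\<close> V(2)] zR(1) False by (auto intro: R_trans R_sym)
        qed
        then show ?thesis using False by (auto simp: unit_vector_def)
      qed
    qed
    moreover have "Ind G \<sigma> u (diag ?h) \<xi> \<in> S" using inv \<xi>(1) diag_Cc[OF hT] by simp
    ultimately have "(\<lambda>\<alpha>. \<xi> (z, u) * unit_vector (z, u) \<alpha>) \<in> S" by simp
    from S'(4)[OF this, of "inverse (\<xi> (z, u))"] have ez: "unit_vector (z, u) \<in> S"
      using nz by (simp add: mult.assoc[symmetric])
    have ezc: "unit_vector (z, u) \<in> carrier (Hu u)" using ez S'(1) by blast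
    have "unit_vector \<alpha> \<in> S" if "\<alpha> \<in> source_fibre G u" for \<alpha>
    proof -
      obtain y where \<alpha>: "\<alpha> = (y, u)" "(y, u) \<in> R" using \<open>\<alpha> \<in> source_fibre G u\<close> by (cases \<alpha>) (auto simp: source_fibre_iff)
      have yz: "(y, z) \<in> R" using \<alpha>(2) zR(1) by (auto intro: R_trans R_sym)
      obtain W where W: "slice W" "y \<in> W" using slice_exists[of y] \<alpha> by (auto simp: R_iff)
      obtain f where f: "f \<in> Cc G" "f (y, z) = 1" "\<forall>x v. f (x, v) \<noteq> 0 \<longrightarrow> x \<in> W \<and> v \<in> V"
        using bump_at_arrow[OF yz V slice_openin[OF W(1)] W(2)] .
      have "Ind G \<sigma> u f (unit_vector (z, u)) = (\<lambda>\<beta>. \<omega> y z u * unit_vector (y, u) \<beta>)"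
      proof (rule ext, clarify)
        fix x v
        show "Ind G \<sigma> u f (unit_vector (z, u)) (x, v) = \<omega> y z u * unit_vector (y, u) (x, v)"
        proof (cases "(x, u) \<in> R \<and> v = u")
          case True
          have "f (x, z) = 0" if "x \<noteq> y"
          proof (rule ccontr)
            assume "f (x, z) \<noteq> 0"
            then have "x \<in> W" using f(3) by blast
            moreover have "(x, y) \<in> R" using True \<alpha>(2) by (auto intro: R_trans R_sym)
            ultimately show False using slice_eq[OF W(1) _ W(2)] that by blast
          qed
          then show ?thesis using True Ind_unit_vector[OF f(1) _ zR(1), of x] f(2) by (auto simp: unit_vector_def)
        next
          case False
          then show ?thesis using Hu_outside[OF Ind_closed[OF ezc f(1)], of x v] \<alpha>(2) by (auto simp: unit_vector_def)
        qed
      qed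
      moreover have "Ind G \<sigma> u f (unit_vector (z, u)) \<in> S" using inv ez f(1) by simp
      ultimately have "(\<lambda>\<beta>. \<omega> y z u * unit_vector (y, u) \<beta>) \<in> S" by simp
      moreover have "\<omega> y z u \<noteq> 0" using om_norm[OF yz zR(1)] by auto
      ultimately show ?thesis using S'(4)[of "\<lambda>\<beta>. \<omega> y z u * unit_vector (y, u) \<beta>" "inverse (\<omega> y z u)"] \<alpha>
        by (simp add: mult.assoc[symmetric])
    qed
    then show ?thesis using ell2_closed_subspace_unit_vectors[OF S] by blast
  qed simp
qed

subsection \<open>The reduced norm dominates every representation\<close>

abbreviation "rn f \<equiv> reduced_norm G \<sigma> f"

lemma units_G: "units G = T"
proof -
  have "snd ` R = T" by (auto simp: R_iff intro!: image_eqI[of _ snd "(y, y)" for y])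
  then show ?thesis by (simp add: units_def)
qed

text \<open>The crude bound is uniform in the representation.\<close>

lemma reduced_norm_bdd:
  assumes f: "f \<in> Cc G"
  shows "bdd_above (insert 0 {op_norm (Hu u) (Ind G \<sigma> u f) | u. u \<in> units G})"
proof -
  obtain C where C: "compactin Y C" "carried C f" using Cc_carried[OF f] .
  obtain M where M: "0 \<le> M" "\<forall>\<alpha>. cmod (f \<alpha>) \<le> M" using Cc_bounded[OF f] .
  obtain K where K: "K \<ge> 0" "\<forall>(H :: ('y \<times> 'y \<Rightarrow> complex) hilbert) L. star_rep A H L \<longrightarrow>
    (\<forall>f\<in>Cc G. \<forall>M. carried C f \<longrightarrow> (\<forall>\<alpha>. cmod (f \<alpha>) \<le> M) \<longrightarrow> op_norm H (L f) \<le> K * M)"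
    using crude_bound[OF C(1)] by blast
  have "op_norm (Hu u) (Ind G \<sigma> u f) \<le> K * M" for u using K(2) star_rep_Ind f C(2) M(2) by blast
  then show ?thesis using K(1) M(1) by (intro bdd_aboveI[of _ "K * M"]) auto
qed

lemma Ind_le_reduced: "f \<in> Cc G \<Longrightarrow> u \<in> T \<Longrightarrow> op_norm (Hu u) (Ind G \<sigma> u f) \<le> rn f"
  unfolding reduced_norm_def by (rule cSup_upper[OF _ reduced_norm_bdd]) (auto simp: units_G)

lemma reduced_ge0: "f \<in> Cc G \<Longrightarrow> 0 \<le> rn f"
  unfolding reduced_norm_def by (rule cSup_upper[OF _ reduced_norm_bdd]) auto

lemma reduced_le: "0 \<le> B \<Longrightarrow> (\<And>u. u \<in> T \<Longrightarrow> op_norm (Hu u) (Ind G \<sigma> u f) \<le> B) \<Longrightarrow> rn f \<le> B"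
  unfolding reduced_norm_def by (rule cSup_least) (auto simp: units_G)

lemma entry_le_reduced: assumes f: "f \<in> Cc G" shows "cmod (f \<alpha>) \<le> rn f"
proof (cases "f \<alpha> = 0")
  case False
  obtain y z where \<alpha>: "\<alpha> = (y, z)" by (cases \<alpha>)
  then have R: "(y, z) \<in> R" using Cc_R[OF f] False by blast
  then have z: "z \<in> T" by (auto simp: R_iff)
  show ?thesis unfolding \<alpha> using entry_le_Ind_norm[OF f R R_refl[OF z]] Ind_le_reduced[OF f z] by simp
qed (simp add: reduced_ge0 f)

lemma reduced_star_mult_le: assumes f: "f \<in> Cc G" shows "rn (astar A f \<otimes>\<^bsub>A\<^esub> f) \<le> (rn f)\<^sup>2"
proof (rule reduced_le)
  fix u assume u: "u \<in> T"
  interpret rep A "Hu u" "Ind G \<sigma> u" by (rule rep_intro[OF star_algebra_A star_rep_Ind])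
  show "op_norm (Hu u) (Ind G \<sigma> u (astar A f \<otimes>\<^bsub>A\<^esub> f)) \<le> (rn f)\<^sup>2"
    using p_star_mult[of f] p_ge0[of f] f Ind_le_reduced[OF f u] by (simp add: power_mono)
qed simp

text \<open>The powers of \<open>f\<^sup>* f\<close> are all carried by one compact set. On functions carried by it, any
  representation is bounded by a multiple of the supremum norm and hence of the reduced norm, and the
  \<open>C\<^sup>*\<close>-identity removes the multiple.\<close>

theorem star_rep_le_reduced:
  assumes L: "star_rep A (H :: 'h hilbert) L" and f: "f \<in> Cc G"
  shows "op_norm H (L f) \<le> rn f"
proof -
  interpret rep A H L by (rule rep_intro[OF star_algebra_A L])
  obtain C where C: "compactin Y C" "carried C f" using Cc_carried[OF f] .
  obtain K where K: "K \<ge> 0" "\<forall>(H :: 'h hilbert) L. star_rep A H L \<longrightarrow>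
    (\<forall>f\<in>Cc G. \<forall>M. carried C f \<longrightarrow> (\<forall>\<alpha>. cmod (f \<alpha>) \<le> M) \<longrightarrow> op_norm H (L f) \<le> K * M)"
    using crude_bound[OF C(1)] by blast
  define a where "a = rec_nat f (\<lambda>_ g. astar A g \<otimes>\<^bsub>A\<^esub> g)"
  have a: "a 0 = f" "a (Suc k) = astar A (a k) \<otimes>\<^bsub>A\<^esub> a k" for k by (simp_all add: a_def)
  have ac: "a k \<in> Cc G \<and> carried C (a k)" for k
    by (induction k) (simp_all add: a f C Cc_mult Cc_star mult_A_carried star_A_carried)
  have pa: "p (a k) = p f ^ (2 ^ k)" for k
  proof (induction k)
    case (Suc k)
    have "p (a (Suc k)) = (p (a k))\<^sup>2" unfolding a(2) by (rule p_star_mult) (simp add: ac)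
    then show ?case by (simp add: Suc power_mult[symmetric] mult.commute)
  qed (simp add: a)
  have ra: "rn (a k) \<le> rn f ^ (2 ^ k)" for k
  proof (induction k)
    case (Suc k)
    have "rn (a (Suc k)) \<le> (rn (a k))\<^sup>2" unfolding a(2) by (rule reduced_star_mult_le) (simp add: ac)
    also have "\<dots> \<le> (rn f ^ (2 ^ k))\<^sup>2" using Suc ac reduced_ge0 by (intro power_mono) auto
    finally show ?case by (simp add: power_mult[symmetric] mult.commute)
  qed (simp add: a)
  have bound: "p f ^ (2 ^ k) \<le> K * rn f ^ (2 ^ k)" for k
  proof -
    have "p (a k) \<le> K * rn (a k)" using K(2) L ac[of k] entry_le_reduced by blast
    also have "\<dots> \<le> K * rn f ^ (2 ^ k)" using ra K(1) by (intro mult_left_mono)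
    finally show ?thesis by (simp add: pa)
  qed
  show ?thesis
  proof (rule ccontr)
    assume "\<not> p f \<le> rn f"
    then have lt: "rn f < p f" by simp
    have r0: "rn f > 0"
    proof (rule ccontr)
      assume "\<not> rn f > 0"
      then have "rn f = 0" using reduced_ge0[OF f] by simp
      then show False using bound[of 0] lt by simp
    qed
    define q where "q = p f / rn f"
    have q: "q > 1" using lt r0 by (simp add: q_def)
    obtain n where n: "K < q ^ n" using real_arch_pow[OF q] by blast
    have "q ^ n \<le> q ^ (2 ^ n)" using q by (intro power_increasing) (auto simp: less_imp_le)
    also have "\<dots> \<le> K" using bound[of n] r0 by (simp add: q_def power_divide divide_le_eq)
    finally show False using n by simp
  qed
qed

subsection \<open>Continuity for the inductive limit topology\<close>

lemma topspace_indlim: "topspace (indlim_topology G) = Cc G"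
proof -
  have "indlim_nhd G (Cc G)"
    unfolding indlim_nhd_def by (auto intro!: Cc_add Cc_smult exI[of _ 1])
  then have "openin (indlim_topology G) (Cc G)"
    unfolding openin_indlim_topology by (auto intro!: exI[of _ "Cc G"] Cc_add)
  moreover have "U \<subseteq> Cc G" if "openin (indlim_topology G) U" for U
    using that by (simp add: openin_indlim_topology)
  ultimately show ?thesis by (metis openin_subset openin_topspace subset_antisym)
qed

lemma star_rep_continuous:
  assumes L: "star_rep A (H :: 'h hilbert) L"
  shows "continuous_map (indlim_topology G) (weak_operator_topology H) L"
  unfolding weak_operator_topology_def continuous_on_generated_topo_iff topspace_indlim
proof (intro conjI allI impI)
  interpret rep A H L by (rule rep_intro[OF star_algebra_A L])
  note Lb = L_bounded[unfolded A_simps]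
  fix V assume "V \<in> {{T \<in> bounded_ops H. hinner H (T x) y \<in> U} | x y U. x \<in> carrier H \<and> y \<in> carrier H \<and> open U}"
  then obtain x y U where V: "V = {T \<in> bounded_ops H. hinner H (T x) y \<in> U}"
    and xy [simp]: "x \<in> carrier H" "y \<in> carrier H" and U: "open U" by blast
  have V': "L -` V \<inter> Cc G = {f \<in> Cc G. hinner H (L f x) y \<in> U}" using Lb by (auto simp: V)
  show "openin (indlim_topology G) (L -` V \<inter> Cc G)"
    unfolding V' openin_indlim_topology
  proof (intro conjI ballI)
    fix f assume f: "f \<in> {f \<in> Cc G. hinner H (L f x) y \<in> U}"
    then obtain e where e: "e > 0" "\<And>c. cmod (c - hinner H (L f x) y) < e \<Longrightarrow> c \<in> U"
      using U unfolding open_dist by (auto simp: dist_norm)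
    let ?W = "{w \<in> Cc G. cmod (hinner H (L w x) y) < e}"
    have add: "hinner H (L (\<lambda>\<alpha>. f \<alpha> + w \<alpha>) x) y = hinner H (L f x) y + hinner H (L w x) y"
      if "f \<in> Cc G" "w \<in> Cc G" for f w
      using L_add[of f w x] that by (simp add: H.inner_add_left)
    have sm: "hinner H (L (\<lambda>\<alpha>. c * w \<alpha>) x) y = c * hinner H (L w x) y" if "w \<in> Cc G" for w c
      using L_smult[of w x c] that by (simp add: H.inner_smult_left)
    have "indlim_nhd G ?W"
      unfolding indlim_nhd_def
    proof (intro conjI ballI allI impI)
      fix v w c d assume v: "v \<in> ?W" and w: "w \<in> ?W" and cd: "cmod c + cmod d \<le> 1"
      let ?v = "hinner H (L v x) y" and ?w = "hinner H (L w x) y"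
      have "cmod (c * ?v + d * ?w) \<le> cmod c * cmod ?v + cmod d * cmod ?w"
        by (metis norm_mult norm_triangle_ineq)
      also have "\<dots> \<le> cmod c * max (cmod ?v) (cmod ?w) + cmod d * max (cmod ?v) (cmod ?w)"
        by (intro add_mono mult_left_mono) auto
      also have "\<dots> = (cmod c + cmod d) * max (cmod ?v) (cmod ?w)" by (simp add: distrib_right)
      also have "\<dots> \<le> 1 * max (cmod ?v) (cmod ?w)" using cd by (intro mult_right_mono) (auto simp: le_max_iff_disj)
      also have "\<dots> < e" using v w by simp
      finally show "(\<lambda>\<alpha>. c * v \<alpha> + d * w \<alpha>) \<in> ?W"
        using v w by (simp add: add sm Cc_add Cc_smult)
    next
      fix K assume "compactin (gtop G) K"
      then have K: "compactin TR K" by simp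
      let ?C = "fst ` K \<union> snd ` K"
      have C: "compactin Y ?C"
        using K by (intro compactin_Un image_compactin[OF _ continuous_fst] image_compactin[OF _ continuous_snd])
      obtain B where B: "B \<ge> 0" "\<forall>(H :: 'h hilbert) L. star_rep A H L \<longrightarrow>
          (\<forall>f\<in>Cc G. \<forall>M. carried ?C f \<longrightarrow> (\<forall>\<alpha>. cmod (f \<alpha>) \<le> M) \<longrightarrow> op_norm H (L f) \<le> B * M)"
        using crude_bound[OF C] by blast
      define s where "s = B * hnorm H x * hnorm H y + 1"
      have s: "s > 0" "B * hnorm H x * hnorm H y < s" using B(1) by (auto simp: s_def intro: add_nonneg_pos)
      show "\<exists>d>0. \<forall>w\<in>Cc G. (\<forall>\<alpha>. w \<alpha> \<noteq> 0 \<longrightarrow> \<alpha> \<in> K) \<and> (\<forall>\<alpha>. cmod (w \<alpha>) < d) \<longrightarrow> w \<in> ?W"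
      proof (intro exI[of _ "e / s"] conjI ballI impI)
        show "e / s > 0" using e s by simp
        fix w assume w: "w \<in> Cc G" and wK: "(\<forall>\<alpha>. w \<alpha> \<noteq> 0 \<longrightarrow> \<alpha> \<in> K) \<and> (\<forall>\<alpha>. cmod (w \<alpha>) < e / s)"
        have "carried ?C w" using wK by (force simp: carried_def)
        moreover have "\<forall>\<alpha>. cmod (w \<alpha>) \<le> e / s" using wK by (simp add: less_imp_le)
        ultimately have op: "op_norm H (L w) \<le> B * (e / s)" using B(2) L w by blast
        have "cmod (hinner H (L w x) y) \<le> hnorm H (L w x) * hnorm H y" using w by (intro H.cauchy_schwarz) auto
        also have "\<dots> \<le> (B * (e / s) * hnorm H x) * hnorm H y"
          using hnorm_L[of w x] mult_right_mono[OF op, of "hnorm H x"] w by (intro mult_right_mono) auto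
        also have "\<dots> = (B * hnorm H x * hnorm H y) * (e / s)" by simp
        also have "\<dots> < s * (e / s)" using s e by (intro mult_strict_right_mono) auto
        also have "\<dots> = e" using s by simp
        finally show "w \<in> ?W" using w by simp
      qed
    qed auto
    moreover have "\<forall>w\<in>?W. (\<lambda>\<alpha>. f \<alpha> + w \<alpha>) \<in> {f \<in> Cc G. hinner H (L f x) y \<in> U}"
      using f e(2) by (auto simp: add Cc_add)
    ultimately show "\<exists>W. indlim_nhd G W \<and> (\<forall>w\<in>W. (\<lambda>\<alpha>. f \<alpha> + w \<alpha>) \<in> {f \<in> Cc G. hinner H (L f x) y \<in> U})" by blast
  qed auto
next
  interpret rep A H L by (rule rep_intro[OF star_algebra_A L])
  have "L f \<in> {T \<in> bounded_ops H. hinner H (T \<zero>\<^bsub>H\<^esub>) \<zero>\<^bsub>H\<^esub> \<in> UNIV}" if "f \<in> Cc G" for f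
    using L_bounded[of f] that by simp
  then show "L ` Cc G \<subseteq> \<Union> {{T \<in> bounded_ops H. hinner H (T x) y \<in> U} | x y U. x \<in> carrier H \<and> y \<in> carrier H \<and> open U}"
    using H.M.zero_closed open_UNIV by blast
qed

end

subsection \<open>A universe of the size of the continuum\<close>

text \<open>A complex function on a countable set is coded by countably many sets of natural numbers, one for each
  real and imaginary part, and hence by a single such set.\<close>

lemma functions_on_countable_inject_reals:
  assumes "countable I"
  shows "\<exists>j :: ('g \<Rightarrow> complex) \<Rightarrow> real. inj_on j {\<xi>. \<forall>\<alpha>. \<alpha> \<notin> I \<longrightarrow> \<xi> \<alpha> = 0}"
proof -
  obtain k :: "real \<Rightarrow> nat set" where k: "inj k"
    using nat_sets_eqpoll_reals eqpoll_imp_lepoll eqpoll_sym unfolding lepoll_def by blast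
  obtain l :: "nat set \<Rightarrow> real" where l: "inj l"
    using nat_sets_eqpoll_reals eqpoll_imp_lepoll unfolding lepoll_def by blast
  define c where "c \<xi> = {to_nat (to_nat_on I \<alpha>, b, n) | \<alpha> b n. \<alpha> \<in> I \<and> n \<in> k (if b then Re (\<xi> \<alpha>) else Im (\<xi> \<alpha>))}"
    for \<xi> :: "'g \<Rightarrow> complex"
  have mem: "to_nat (to_nat_on I \<alpha>, b, n) \<in> c \<xi> \<longleftrightarrow> n \<in> k (if b then Re (\<xi> \<alpha>) else Im (\<xi> \<alpha>))"
    (is "_ \<longleftrightarrow> n \<in> ?K \<xi> \<alpha> b") if \<alpha>: "\<alpha> \<in> I" for \<alpha> b n \<xi>
  proof
    assume "to_nat (to_nat_on I \<alpha>, b, n) \<in> c \<xi>"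
    then obtain \<alpha>' b' n' where eq: "to_nat (to_nat_on I \<alpha>, b, n) = to_nat (to_nat_on I \<alpha>', b', n')"
      and \<alpha>': "\<alpha>' \<in> I" and k': "n' \<in> ?K \<xi> \<alpha>' b'" unfolding c_def by blast
    from eq have "to_nat_on I \<alpha> = to_nat_on I \<alpha>'" and bn: "b' = b" "n' = n" by simp_all
    then have a: "\<alpha>' = \<alpha>" using \<alpha>' \<alpha> assms by simp
    show "n \<in> ?K \<xi> \<alpha> b" using k' unfolding bn a .
  next
    assume "n \<in> ?K \<xi> \<alpha> b"
    then show "to_nat (to_nat_on I \<alpha>, b, n) \<in> c \<xi>"
      unfolding c_def using \<alpha> by (intro CollectI exI[of _ \<alpha>] exI[of _ b] exI[of _ n]) simp
  qed
  have "inj_on (\<lambda>\<xi>. l (c \<xi>)) {\<xi>. \<forall>\<alpha>. \<alpha> \<notin> I \<longrightarrow> \<xi> \<alpha> = 0}"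
  proof (rule inj_onI)
    fix \<xi> \<eta> :: "'g \<Rightarrow> complex"
    assume x: "\<xi> \<in> {\<xi>. \<forall>\<alpha>. \<alpha> \<notin> I \<longrightarrow> \<xi> \<alpha> = 0}" and y: "\<eta> \<in> {\<xi>. \<forall>\<alpha>. \<alpha> \<notin> I \<longrightarrow> \<xi> \<alpha> = 0}"
      and "l (c \<xi>) = l (c \<eta>)"
    then have eq: "c \<xi> = c \<eta>" using l by (simp add: inj_eq)
    show "\<xi> = \<eta>"
    proof
      fix \<alpha>
      show "\<xi> \<alpha> = \<eta> \<alpha>"
      proof (cases "\<alpha> \<in> I")
        case True
        have "k (if b then Re (\<xi> \<alpha>) else Im (\<xi> \<alpha>)) = k (if b then Re (\<eta> \<alpha>) else Im (\<eta> \<alpha>))" for b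
          using mem[OF True, of b _ \<xi>] mem[OF True, of b _ \<eta>] eq by blast
        from this[of True] this[of False] show ?thesis using k by (simp add: inj_eq complex_eq_iff)
      qed (use x y in simp)
    qed
  qed
  then show ?thesis by blast
qed

context fibre_cocycle begin

text \<open>Assign to each point of a fibre a slice from a countable basis that contains it: different points of the
  fibre get different slices.\<close>

lemma countable_source_fibre: "countable (source_fibre G u)"
proof -
  obtain \<B> where B: "countable \<B>" "\<And>V. V \<in> \<B> \<Longrightarrow> openin Y V"
    "\<And>U x. openin Y U \<Longrightarrow> x \<in> U \<Longrightarrow> \<exists>V\<in>\<B>. x \<in> V \<and> V \<subseteq> U"
    using second_countable unfolding second_countable_def by metis
  have "\<exists>V\<in>\<B>. y \<in> V \<and> slice V" if y: "y \<in> T" for y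
  proof -
    obtain U where U: "slice U" "y \<in> U" using slice_exists[OF y] by blast
    obtain V where V: "V \<in> \<B>" "y \<in> V" "V \<subseteq> U" using B(3)[OF slice_openin[OF U(1)] U(2)] by blast
    then show ?thesis using slice_Int[OF U(1) B(2)[OF V(1)]] by (auto simp: inf.absorb1)
  qed
  then obtain V where V: "\<And>y. y \<in> T \<Longrightarrow> V y \<in> \<B> \<and> y \<in> V y \<and> slice (V y)" by metis
  have "inj_on (\<lambda>\<alpha>. V (fst \<alpha>)) (source_fibre G u)"
  proof (rule inj_onI, clarify)
    fix y v z w assume a: "(y, v) \<in> source_fibre G u" "(z, w) \<in> source_fibre G u" and eq: "V (fst (y, v)) = V (fst (z, w))"
    then have R: "(y, u) \<in> R" "(z, u) \<in> R" "v = u" "w = u" by (auto simp: source_fibre_iff)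
    then have T: "y \<in> T" "z \<in> T" by (auto simp: R_iff)
    have "y = z" using slice_eq[of "V y" y z] V[OF T(1)] V[OF T(2)] eq R by (auto intro: R_trans R_sym)
    then show "y = z \<and> v = w" using R by simp
  qed
  moreover have "(\<lambda>\<alpha>. V (fst \<alpha>)) ` source_fibre G u \<subseteq> \<B>"
    using V by (auto simp: source_fibre_iff R_iff)
  ultimately show ?thesis using B(1) by (metis countable_image_inj_on countable_subset)
qed

lemma Hu_injects:
  assumes universe: "\<exists>j :: real \<Rightarrow> 'h. inj j"
  obtains j :: "('y \<times> 'y \<Rightarrow> complex) \<Rightarrow> 'h" where "inj_on j (carrier (Hu u))"
proof -
  obtain i :: "('y \<times> 'y \<Rightarrow> complex) \<Rightarrow> real" where i: "inj_on i {\<xi>. \<forall>\<alpha>. \<alpha> \<notin> source_fibre G u \<longrightarrow> \<xi> \<alpha> = 0}"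
    using functions_on_countable_inject_reals[OF countable_source_fibre] by blast
  obtain k :: "real \<Rightarrow> 'h" where k: "inj k" using universe by blast
  have "inj_on i (carrier (Hu u))" by (rule inj_on_subset[OF i]) (auto simp: carrier_ell2)
  then have "inj_on (k \<circ> i) (carrier (Hu u))" by (rule comp_inj_on) (rule inj_on_subset[OF k subset_UNIV])
  then show thesis by (rule that)
qed

text \<open>If \<open>Y\<close> is empty, the representation on the zero space keeps the supremum in the full norm from ranging
  over the empty set.\<close>

lemma zero_space_nondegenerate:
  assumes "star_rep A H L" "carrier H = {\<zero>\<^bsub>H\<^esub>}"
  shows "nondegenerate A H L"
proof -
  interpret rep A H L by (rule rep_intro[OF star_algebra_A assms(1)])
  have "S = carrier H" if "closed_subspace H (hnorm H) S" for S
    using H.closed_subspaceD(1,2)[OF that] unfolding assms(2) by blast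
  moreover have "{L a x | a x. a \<in> carrier A \<and> x \<in> carrier H} \<subseteq> carrier H" by auto
  ultimately have "{S. closed_subspace H (hnorm H) S \<and> {L a x | a x. a \<in> carrier A \<and> x \<in> carrier H} \<subseteq> S} = {carrier H}"
    using H.closed_subspace_carrier by blast
  then show ?thesis by (simp add: nondegenerate_def closed_span_def)
qed

theorem full_eq_reduced:
  assumes universe: "\<exists>j :: real \<Rightarrow> 'h. inj j" and f: "f \<in> Cc G"
  shows "full_norm TYPE('h) G \<sigma> f = rn f"
proof -
  define S where "S = {op_norm H (L f) | (H :: 'h hilbert) L. star_rep A H L \<and> nondegenerate A H L \<and>
     continuous_map (indlim_topology G) (weak_operator_topology H) L}"
  have upper: "s \<le> rn f" if "s \<in> S" for s using that star_rep_le_reduced f by (auto simp: S_def)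
  have mem: "op_norm (Hu u) (Ind G \<sigma> u f) \<in> S" if u: "u \<in> T \<or> T = {}" for u
  proof -
    obtain j :: "('y \<times> 'y \<Rightarrow> complex) \<Rightarrow> 'h" where j: "inj_on j (carrier (Hu u))" by (rule Hu_injects[OF universe])
    let ?H = "transport_hilbert j (Hu u)" and ?L = "transport_rep j (Hu u) (Ind G \<sigma> u)"
    note t = star_rep_transport[OF star_algebra_A star_rep_Ind j]
    have "nondegenerate A ?H ?L"
    proof (cases "u \<in> T")
      case True
      interpret rep A ?H ?L by (rule rep_intro[OF star_algebra_A t(1)])
      show ?thesis
        by (rule irreducible_nondegenerate[OF irreducible_rep_unitarily_equivalent[OF irreducible_Ind[OF True] t(1,2)]])
    next
      case False
      then have "(y, z) \<notin> source_fibre G u" for y z by (auto simp: source_fibre_iff R_iff)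
      then have "source_fibre G u = {}" by (metis ex_in_conv surj_pair)
      then have "carrier (Hu u) = {\<lambda>_. 0}" by (auto simp: carrier_ell2)
      then have "carrier ?H = {\<zero>\<^bsub>?H\<^esub>}" by (simp add: transport_hilbert_def Let_def)
      then show ?thesis by (rule zero_space_nondegenerate[OF t(1)])
    qed
    then show ?thesis unfolding S_def using t(1) t(3)[of f] star_rep_continuous[OF t(1)] f
      by (intro CollectI exI[of _ ?H] exI[of _ ?L]) simp
  qed
  have bdd: "bdd_above S" using upper by (intro bdd_aboveI)
  have ge0: "0 \<le> op_norm (Hu u) (Ind G \<sigma> u f)" for u
  proof -
    interpret rep A "Hu u" "Ind G \<sigma> u" by (rule rep_intro[OF star_algebra_A star_rep_Ind])
    show ?thesis using p_ge0[of f] f by simp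
  qed
  obtain u0 where u0: "u0 \<in> T \<or> T = {}" by blast
  have "Sup S = rn f"
  proof (rule antisym)
    show "Sup S \<le> rn f" using mem[OF u0] upper by (intro cSup_least) auto
    show "rn f \<le> Sup S"
    proof (rule reduced_le)
      show "0 \<le> Sup S" using ge0[of u0] cSup_upper[OF mem[OF u0] bdd] by linarith
      show "op_norm (Hu u) (Ind G \<sigma> u f) \<le> Sup S" if "u \<in> T" for u using that by (intro cSup_upper bdd mem) simp
    qed
  qed
  then show ?thesis by (simp add: full_norm_def S_def)
qed

end

section \<open>Irreducible representations of the convolution algebra\<close>

locale irreducible_fibre_rep = fibre_rep Y X \<psi> \<sigma> H L
  for Y :: "'y topology" and X :: "'x topology" and \<psi> \<sigma> and H :: "'h hilbert" and L +
  assumes irreducible: "irreducible_rep A H L"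
begin

definition vanishes :: "('y \<times> 'y \<Rightarrow> complex) \<Rightarrow> bool" where
  "vanishes f \<longleftrightarrow> (\<forall>x\<in>carrier H. L f x = \<zero>\<^bsub>H\<^esub>)"

lemma vanishes_p: assumes f: "f \<in> Cc G" shows "vanishes f \<longleftrightarrow> L.p f \<le> 0"
proof
  assume "vanishes f"
  then show "L.p f \<le> 0" by (intro L.H.op_norm_le) (auto simp: vanishes_def)
next
  assume p: "L.p f \<le> 0"
  have "L f x = \<zero>\<^bsub>H\<^esub>" if x: "x \<in> carrier H" for x
  proof -
    have "hnorm H (L f x) \<le> L.p f * hnorm H x" using L.hnorm_L[of f x] f x by simp
    also have "\<dots> \<le> 0" using p x by (simp add: mult_nonpos_nonneg)
    finally show ?thesis using L.H.hnorm_ge0[OF Lc[OF f x]] L.H.hnorm_zero_imp[OF Lc[OF f x]] by simp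
  qed
  then show "vanishes f" by (simp add: vanishes_def)
qed

text \<open>Over a slice the corner \<open>h f k\<close> of the algebra is diagonal. Two functions with disjoint supports
  therefore annihilate each other across the whole algebra, and irreducibility kills one of them.\<close>

lemma prime:
  assumes h: "h \<in> bump_functions T" and k: "k \<in> bump_functions T" and U: "slice U"
    and hU: "\<And>y. h y \<noteq> 0 \<Longrightarrow> y \<in> U" and kU: "\<And>y. k y \<noteq> 0 \<Longrightarrow> y \<in> U" and disj: "\<And>y. h y * k y = 0"
    and nk: "\<not> vanishes (diag k)"
  shows "vanishes (diag h)"
proof -
  note hC = diag_Cc[OF h] and kC = diag_Cc[OF k]
  obtain x where x: "x \<in> carrier H" "L (diag k) x \<noteq> \<zero>\<^bsub>H\<^esub>" using nk by (auto simp: vanishes_def)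
  let ?x = "L (diag k) x"
  have x': "?x \<in> carrier H" using Lc[OF kC x(1)] .
  let ?S = "{y \<in> carrier H. L (diag h) y \<in> {\<zero>\<^bsub>H\<^esub>}}"
  have S: "closed_subspace H (hnorm H) ?S"
    using hC by (intro L.H.kernel_closed_subspace L.L_bounded L.H.closed_subspace_zero_H) simp
  have "L (diag h) (L f ?x) = \<zero>\<^bsub>H\<^esub>" if f: "f \<in> Cc G" for f
  proof -
    have "(\<lambda>\<alpha>. h (fst \<alpha>) * (f \<alpha> * k (snd \<alpha>))) = (\<lambda>_. 0)"
    proof
      fix \<alpha> :: "'y \<times> 'y"
      have "h y * (f (y, z) * k z) = 0" for y z
      proof (rule ccontr)
        assume nz: "h y * (f (y, z) * k z) \<noteq> 0"
        then have "y \<in> U" "z \<in> U" "(y, z) \<in> R" using hU kU Cc_R[OF f] by auto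
        then have "y = z" by (rule slice_eq[OF U])
        then show False using nz disj[of y] by auto
      qed
      from this[of "fst \<alpha>" "snd \<alpha>"] show "h (fst \<alpha>) * (f \<alpha> * k (snd \<alpha>)) = 0" by simp
    qed
    then have "diag h \<otimes>\<^bsub>A\<^esub> (f \<otimes>\<^bsub>A\<^esub> diag k) = (\<lambda>_. 0)"
      unfolding diag_mult_left[OF h Cc_mult[OF f kC]] unfolding diag_mult_right[OF k f] .
    then have "L (diag h \<otimes>\<^bsub>A\<^esub> (f \<otimes>\<^bsub>A\<^esub> diag k)) x = \<zero>\<^bsub>H\<^esub>" using L.L_zero[OF x(1)] by simp
    then show ?thesis using hC kC f x(1) Cc_mult[OF f kC] by (simp add: L.L_mult)
  qed
  then have "L.orbit_space ?x \<subseteq> ?S" using x' by auto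
  then have "L.H.limit_points (L.orbit_space ?x) \<subseteq> ?S" by (rule L.H.limit_points_subset[OF S])
  then have "carrier H \<subseteq> ?S" unfolding L.irreducible_cyclic[OF irreducible x' x(2)] .
  then show ?thesis by (auto simp: vanishes_def)
qed

text \<open>Otherwise a partition of unity writes every function as a sum of products with functions that \<open>L\<close>
  annihilates.\<close>

lemma support_point: "\<exists>y\<in>T. \<forall>V. openin Y V \<longrightarrow> y \<in> V \<longrightarrow> (\<exists>h\<in>bump_functions V. \<not> vanishes (diag h))"
proof (rule ccontr)
  assume none: "\<not> ?thesis"
  have "L f x = \<zero>\<^bsub>H\<^esub>" if f: "f \<in> Cc G" and x: "x \<in> carrier H" for f x
  proof -
    obtain C where C: "compactin Y C" "carried C f" using Cc_carried[OF f] .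
    have "\<exists>V. openin Y V \<and> c \<in> V \<and> (\<forall>h\<in>bump_functions V. vanishes (diag h))" if c: "c \<in> C" for c
    proof -
      have "c \<in> T" using compactin_subset_topspace[OF C(1)] c by blast
      then have "\<not> (\<forall>V. openin Y V \<longrightarrow> c \<in> V \<longrightarrow> (\<exists>h\<in>bump_functions V. \<not> vanishes (diag h)))" using none unfolding bex_simps(8)[symmetric] by blast
      then show ?thesis by simp
    qed
    then obtain F and h :: "'y \<Rightarrow> 'y \<Rightarrow> complex" where F: "finite F"
      "\<forall>i\<in>F. \<exists>U. (\<forall>h\<in>bump_functions U. vanishes (diag h)) \<and> openin Y U \<and> h i \<in> bump_functions U"
      "\<forall>i y. cmod (h i y) \<le> 1" "\<forall>c\<in>C. (\<Sum>i\<in>F. h i c) = 1" "F \<subseteq> C"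
      by (rule partition_of_unity[OF C(1)])
    have hT: "h i \<in> bump_functions T" and van: "vanishes (diag (h i))" if "i \<in> F" for i
      using F(2) that bump_functions_T by blast+
    have "L.p (diag (h i) \<otimes>\<^bsub>A\<^esub> f) \<le> 0" if i: "i \<in> F" for i
    proof -
      have "L (diag (h i) \<otimes>\<^bsub>A\<^esub> f) x = \<zero>\<^bsub>H\<^esub>" if x: "x \<in> carrier H" for x
        using van[OF i] diag_Cc[OF hT[OF i]] f x Lc[OF f x] by (simp add: L.L_mult vanishes_def)
      then show ?thesis
        using vanishes_p[OF Cc_mult[OF diag_Cc[OF hT[OF i]] f]] by (simp add: vanishes_def)
    qed
    then have "L.p (\<lambda>\<alpha>. \<Sum>i\<in>F. (diag (h i) \<otimes>\<^bsub>A\<^esub> f) \<alpha>) \<le> real (card F) * 0"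
      using hT diag_Cc f by (intro p_sum_le F(1) Cc_mult) auto
    moreover have "(\<lambda>\<alpha>. \<Sum>i\<in>F. (diag (h i) \<otimes>\<^bsub>A\<^esub> f) \<alpha>) = f"
    proof (rule ext, clarify)
      fix y z
      have "(\<Sum>i\<in>F. (diag (h i) \<otimes>\<^bsub>A\<^esub> f) (y, z)) = (\<Sum>i\<in>F. h i y) * f (y, z)"
        by (simp add: diag_mult_left[OF hT f] sum_distrib_right)
      then show "(\<Sum>i\<in>F. (diag (h i) \<otimes>\<^bsub>A\<^esub> f) (y, z)) = f (y, z)"
        using F(4) C(2) by (cases "f (y, z) = 0") (auto simp: carried_def)
    qed
    ultimately have "vanishes f" using vanishes_p[OF f] by simp
    then show ?thesis using x by (simp add: vanishes_def)
  qed
  then show False using irreducible unfolding irreducible_rep_def by auto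
qed

text \<open>A function that vanishes at a point of the support is uniformly close to functions that vanish
  near it, and a function supported still nearer that \<open>L\<close> does not annihilate shows that it annihilates those.\<close>

lemma vanishes_at_support_point:
  assumes y: "y \<in> T" and supp: "\<And>V. openin Y V \<Longrightarrow> y \<in> V \<Longrightarrow> \<exists>h\<in>bump_functions V. \<not> vanishes (diag h)"
    and U: "slice U" "y \<in> U" and h: "h \<in> bump_functions U" and h0: "h y = 0"
  shows "vanishes (diag h)"
proof -
  have hT: "h \<in> bump_functions T" by (rule bump_functions_T[OF h])
  have "L.p (diag h) \<le> e" if e: "e > 0" for e
  proof -
    \<comment> \<open>the retraction of the plane onto the disc of radius \<open>e\<close>\<close>
    define E where "E t = t * of_real (e / max e (cmod t))" for t :: complex
    have Ec: "continuous_on UNIV E" unfolding E_def using e by (intro continuous_intros) (auto simp: max_def)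
    have E_le: "cmod (E t) \<le> e" for t
      using e by (auto simp: E_def norm_mult norm_divide max_def field_simps)
    have E_small: "E t = t" if "cmod t \<le> e" for t using e that by (simp add: E_def max_def)
    let ?k = "\<lambda>z. E (h z)" and ?l = "\<lambda>z. h z - E (h z)"
    have k: "?k \<in> bump_functions U" by (rule bump_functions_lift[OF h Ec]) (simp add: E_def)
    have l: "?l \<in> bump_functions U"
      by (rule bump_functions_lift[OF h continuous_on_diff[OF continuous_on_id Ec]]) (simp add: E_def)
    note kT = bump_functions_T[OF k] and lT = bump_functions_T[OF l]
    let ?V = "{z \<in> T. h z \<in> ball 0 e} \<inter> U"
    have "openin Y {z \<in> T. h z \<in> ball 0 e}"
      by (rule openin_continuous_map_preimage[OF bump_functionsD(1)[OF h]]) simp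
    then have "openin Y ?V" using slice_openin[OF U(1)] by blast
    moreover have "y \<in> ?V" using y U(2) h0 e by simp
    ultimately obtain g where g: "g \<in> bump_functions ?V" "\<not> vanishes (diag g)" using supp by blast
    have "vanishes (diag ?l)"
    proof (rule prime[OF lT bump_functions_T[OF g(1)] U(1) _ _ _ g(2)])
      show "z \<in> U" if nz: "?l z \<noteq> 0" for z by (rule bump_functionsD(2)[OF l nz])
      show "z \<in> U" if nz: "g z \<noteq> 0" for z using bump_functionsD(2)[OF g(1) nz] by simp
      show "?l z * g z = 0" for z
        using bump_functionsD(2)[OF g(1), of z] E_small[of "h z"] by (cases "g z = 0") auto
    qed
    then have "L.p (diag ?l) \<le> 0" using vanishes_p[OF diag_Cc[OF lT]] by simp
    moreover have "L.p (diag ?k) \<le> e" by (rule L_diag_bound[OF kT]) (rule E_le)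
    moreover have "diag h = diag ?l \<oplus>\<^bsub>A\<^esub> diag ?k" by (auto simp: diag_def fun_eq_iff)
    then have "L.p (diag h) \<le> L.p (diag ?l) + L.p (diag ?k)"
      using L.p_add[of "diag ?l" "diag ?k"] diag_Cc[OF lT] diag_Cc[OF kT] by simp
    ultimately show ?thesis by linarith
  qed
  then have "L.p (diag h) \<le> 0" by (rule field_le_epsilon[of _ 0, simplified])
  then show ?thesis using vanishes_p[OF diag_Cc[OF hT]] by simp
qed

text \<open>At a point \<open>y\<close> of the support, \<open>L k = k(y) L h\<close> for all \<open>k\<close> supported in a slice around \<open>y\<close> and a fixed \<open>h\<close>
  with \<open>h(y) = 1\<close>. Since \<open>h f h\<close> is such a \<open>k\<close>, the vectors \<open>v\<close> in the range of \<open>L h\<close> have the vector state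
  \<open>f \<mapsto> f(y, y) \<parallel>v\<parallel>\<^sup>2\<close>. So does the basis vector of the induced representation at \<open>(y, y)\<close>, scaled to the
  length of \<open>v\<close>.\<close>

theorem equivalent_to_Ind: "\<exists>y\<in>T. unitarily_equivalent A (Hu y, Ind G \<sigma> y) (H, L)"
proof -
  obtain y where y: "y \<in> T" and supp: "\<And>V. openin Y V \<Longrightarrow> y \<in> V \<Longrightarrow> \<exists>h\<in>bump_functions V. \<not> vanishes (diag h)"
    using support_point by blast
  obtain U where U: "slice U" "y \<in> U" using slice_exists[OF y] by blast
  obtain r V where r: "openin Y V" "y \<in> V" "V \<subseteq> U" "\<forall>v\<in>V. r v = 1" "\<forall>z. 0 \<le> r z \<and> r z \<le> (1::real)"
    "(\<lambda>z. of_real (r z)) \<in> bump_functions U" "continuous_map Y euclideanreal r"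
    by (rule bump_at_point[OF slice_openin[OF U(1)] U(2)])
  define h where "h z = complex_of_real (r z)" for z
  have h: "h \<in> bump_functions U" "h y = 1" using r by (simp_all add: h_def[abs_def])
  note hT = bump_functions_T[OF h(1)]
  note hC = diag_Cc[OF hT]
  have h_star: "astar A (diag h) = diag h" unfolding diag_star[OF hT] by (simp add: h_def[abs_def])
  have scalar: "L (diag k) x = k y \<odot>\<^bsub>H\<^esub> L (diag h) x" if k: "k \<in> bump_functions U" and x: "x \<in> carrier H" for k x
  proof -
    let ?k = "\<lambda>z. k z + (- k y) * h z"
    have ch: "(\<lambda>z. (- k y) * h z) \<in> bump_functions U"
      by (rule bump_functions_lift[OF h(1)]) (auto intro: continuous_intros)
    have k': "?k \<in> bump_functions U" by (rule bump_functions_add[OF k ch])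
    note kT = diag_Cc[OF bump_functions_T[OF k]] and kT' = diag_Cc[OF bump_functions_T[OF k']]
    have "vanishes (diag ?k)" using h(2) by (intro vanishes_at_support_point[OF y supp U k']) simp_all
    then have "L (diag ?k) x = \<zero>\<^bsub>H\<^esub>" using x by (simp add: vanishes_def)
    moreover have "diag k = diag ?k \<oplus>\<^bsub>A\<^esub> (k y \<odot>\<^bsub>A\<^esub> diag h)" by (auto simp: diag_def fun_eq_iff)
    then have "L (diag k) x = L (diag ?k) x \<oplus>\<^bsub>H\<^esub> L (k y \<odot>\<^bsub>A\<^esub> diag h) x"
      using L.L_add[of "diag ?k" "k y \<odot>\<^bsub>A\<^esub> diag h" x] kT' hC Cc_smult[OF hC] x by simp
    moreover have "L (k y \<odot>\<^bsub>A\<^esub> diag h) x = k y \<odot>\<^bsub>H\<^esub> L (diag h) x" using L.L_smult[of "diag h" x "k y"] hC x by simp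
    ultimately show ?thesis using Lc[OF hC x] by simp
  qed
  obtain k where k: "k \<in> bump_functions U" "\<not> vanishes (diag k)" using supp[OF slice_openin[OF U(1)] U(2)] by blast
  then obtain x where x: "x \<in> carrier H" "L (diag k) x \<noteq> \<zero>\<^bsub>H\<^esub>" by (auto simp: vanishes_def)
  define v where "v = L (diag h) x"
  have v: "v \<in> carrier H" unfolding v_def using hC x by (intro Lc)
  have v0: "v \<noteq> \<zero>\<^bsub>H\<^esub>" using x scalar[OF k(1) x(1)] by (auto simp: v_def)
  have "L (diag h) v = L (diag h \<otimes>\<^bsub>A\<^esub> diag h) x" using hC x by (simp add: v_def L.L_mult)
  also have "\<dots> = v"
    unfolding diag_mult[OF hT hT] v_def
    using scalar[OF bump_functions_mult[OF h(1) bump_functionsD(1)[OF h(1)]] x(1)] h(2) Lc[OF hC x(1)] by simp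
  finally have hv: "L (diag h) v = v" .
  have state: "hinner H (L f v) v = f (y, y) * hinner H v v" if f: "f \<in> Cc G" for f
  proof -
    note fh = Cc_mult[OF f hC]
    have corner: "diag h \<otimes>\<^bsub>A\<^esub> (f \<otimes>\<^bsub>A\<^esub> diag h) = diag (\<lambda>z. h z * (f (z, z) * h z))"
      unfolding diag_mult_left[OF hT fh] unfolding diag_mult_right[OF hT f]
    proof
      fix \<alpha> :: "'y \<times> 'y"
      have "h z * (f (z, w) * h w) = 0" if ne: "z \<noteq> w" for z w
      proof (rule ccontr)
        assume "h z * (f (z, w) * h w) \<noteq> 0"
        then have "z \<in> U" "w \<in> U" "(z, w) \<in> R" using bump_functionsD(2)[OF h(1)] Cc_R[OF f] by auto
        then show False using slice_eq[OF U(1)] ne by blast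
      qed
      then show "h (fst \<alpha>) * (f \<alpha> * h (snd \<alpha>)) = diag (\<lambda>z. h z * (f (z, z) * h z)) \<alpha>"
        by (cases \<alpha>; cases "fst \<alpha> = snd \<alpha>") simp_all
    qed
    have b: "(\<lambda>z. h z * (f (z, z) * h z)) \<in> bump_functions U"
      by (intro bump_functions_mult[OF h(1)] continuous_map_complex_mult bump_functionsD(1)[OF h(1)]
          bump_functionsD(1)[OF Cc_diagonal[OF f]])
    have "hinner H (L f v) v = hinner H (L f (L (diag h) v)) (L (diag h) v)" by (simp add: hv)
    also have "\<dots> = hinner H (L (diag h) (L f (L (diag h) v))) v"
      using L.L_adj[of "diag h" "L f (L (diag h) v)" v] hC f v h_star Lc by simp
    also have "\<dots> = hinner H (L (diag h \<otimes>\<^bsub>A\<^esub> (f \<otimes>\<^bsub>A\<^esub> diag h)) v) v"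
      using hC f v fh by (simp add: L.L_mult)
    also have "\<dots> = hinner H (f (y, y) \<odot>\<^bsub>H\<^esub> v) v"
      unfolding corner using scalar[OF b v] h(2) hv by simp
    finally show ?thesis using v by (simp add: L.H.inner_smult_left)
  qed
  let ?d = "unit_vector (y, y)"
  have yy: "(y, y) \<in> source_fibre G y" using R_refl[OF y] by (simp add: source_fibre_iff)
  note d = unit_vector_ell2[OF yy]
  interpret I: rep A "Hu y" "Ind G \<sigma> y" by (rule rep_intro[OF star_algebra_A star_rep_Ind])
  let ?c = "complex_of_real (hnorm H v)"
  let ?e = "?c \<odot>\<^bsub>Hu y\<^esub> ?d"
  have e: "?e \<in> carrier (Hu y)" by (rule I.H.smult_closed'[OF d(1)])
  have "hnorm H v \<noteq> 0" using v0 L.H.hnorm_zero_imp[OF v] by blast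
  then have e0: "?e \<noteq> \<zero>\<^bsub>Hu y\<^esub>"
    by (auto simp: fun_eq_iff unit_vector_def intro!: exI[of _ y])
  have "hinner (Hu y) (Ind G \<sigma> y f ?e) ?e = hinner H (L f v) v" if f: "f \<in> Cc G" for f
  proof -
    have fd: "Ind G \<sigma> y f ?d \<in> carrier (Hu y)" by (rule Ind_closed[OF d(1) f])
    have "Ind G \<sigma> y f ?e = ?c \<odot>\<^bsub>Hu y\<^esub> Ind G \<sigma> y f ?d" using I.L_lin(2)[of f ?d ?c] f d(1) by simp
    then have "hinner (Hu y) (Ind G \<sigma> y f ?e) ?e = ?c * (cnj ?c * hinner (Hu y) (Ind G \<sigma> y f ?d) ?d)"
      using I.H.inner_smult_left[OF fd e] I.H.inner_smult_right[OF fd d(1)] by (simp del: ell2_simps)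
    also have "hinner (Hu y) (Ind G \<sigma> y f ?d) ?d = f (y, y)"
      unfolding d(2) using Ind_unit_vector[OF f R_refl[OF y] R_refl[OF y]] R_refl[OF y] by simp
    also have "?c * (cnj ?c * f (y, y)) = f (y, y) * hinner H v v"
      using L.H.inner_self[OF v] by (simp add: power2_eq_square)
    finally show ?thesis using state[OF f] by simp
  qed
  then have "unitarily_equivalent A (Hu y, Ind G \<sigma> y) (H, L)"
    using irreducible_same_state_equivalent[OF star_algebra_A irreducible_Ind[OF y] irreducible e e0 v v0] by simp
  then show ?thesis using y by blast
qed

end

section \<open>The completion and the extended induced representations\<close>

lemma extend_simps [simp]:
  "carrier (star_algebra.extend A F) = carrier A" "mult (star_algebra.extend A F) = mult A"
  "ring.zero (star_algebra.extend A F) = ring.zero A" "add (star_algebra.extend A F) = add A"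
  "smult (star_algebra.extend A F) = smult A" "astar (star_algebra.extend A F) = astar A"
  by (simp_all add: star_algebra.defs)

lemma anorm_extend [simp]: "anorm (star_algebra.extend A (normed_star_algebra.fields N)) = N"
  by (simp add: star_algebra.defs normed_star_algebra.defs)

lemma is_star_algebra_extend:
  assumes "is_star_algebra A" shows "is_star_algebra (star_algebra.extend A F)"
proof -
  interpret star_alg A using assms by unfold_locales
  have "module complex_ring (star_algebra.extend A F)"
    by (rule complex_moduleI) (simp_all add: a_ac smult_add_left smult_simps)
  then show ?thesis using assms unfolding is_star_algebra_def by simp
qed

lemma star_rep_extend_iff: "star_rep (star_algebra.extend A F) H L \<longleftrightarrow> star_rep A H L"
  by (simp add: star_rep_def)

lemma irreducible_rep_extend_iff: "irreducible_rep (star_algebra.extend A F) H L \<longleftrightarrow> irreducible_rep A H L"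
  by (simp add: irreducible_rep_def star_rep_extend_iff)

lemma unitarily_equivalent_extend_iff:
  "unitarily_equivalent (star_algebra.extend A F) \<pi> \<rho> \<longleftrightarrow> unitarily_equivalent A \<pi> \<rho>"
  by (simp add: unitarily_equivalent_def)

lemma unitarily_equivalent_cong:
  assumes e: "unitarily_equivalent A (H, L) (K, M)"
    and L: "\<And>a x. a \<in> carrier A \<Longrightarrow> x \<in> carrier H \<Longrightarrow> L' a x = L a x"
    and M: "\<And>a x. a \<in> carrier A \<Longrightarrow> x \<in> carrier K \<Longrightarrow> M' a x = M a x"
  shows "unitarily_equivalent A (H, L') (K, M')"
proof -
  obtain U where U: "linear_on H K U" "bij_betw U (carrier H) (carrier K)"
    "\<forall>x\<in>carrier H. \<forall>y\<in>carrier H. hinner K (U x) (U y) = hinner H x y"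
    "\<forall>a\<in>carrier A. \<forall>x\<in>carrier H. U (L a x) = M a (U x)"
    using e unfolding unitarily_equivalent_def by blast
  have "\<forall>a\<in>carrier A. \<forall>x\<in>carrier H. U (L' a x) = M' a (U x)"
    using U(4) L M bij_betwE[OF U(2)] by simp
  then show ?thesis unfolding unitarily_equivalent_def using U(1-3) by blast
qed

context fibre_cocycle begin

lemma reduced_smult_le: assumes f: "f \<in> Cc G" shows "rn (\<lambda>\<alpha>. c * f \<alpha>) \<le> cmod c * rn f"
proof (rule reduced_le)
  fix u assume u: "u \<in> T"
  interpret rep A "Hu u" "Ind G \<sigma> u" by (rule rep_intro[OF star_algebra_A star_rep_Ind])
  show "op_norm (Hu u) (Ind G \<sigma> u (\<lambda>\<alpha>. c * f \<alpha>)) \<le> cmod c * rn f"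
    using p_smult[of f c] f Ind_le_reduced[OF f u] by (simp add: mult_left_mono)
qed (simp add: reduced_ge0 f)

lemma reduced_smult: assumes f: "f \<in> Cc G" shows "rn (\<lambda>\<alpha>. c * f \<alpha>) = cmod c * rn f"
proof (cases "c = 0")
  case True
  have "rn (\<lambda>\<alpha>. c * f \<alpha>) \<le> 0" using reduced_smult_le[OF f, of c] True by simp
  then show ?thesis using reduced_ge0[OF Cc_smult[OF f, of c]] True by simp
next
  case False
  then have "rn f \<le> cmod (inverse c) * rn (\<lambda>\<alpha>. c * f \<alpha>)"
    using reduced_smult_le[OF Cc_smult[OF f, of c], of "inverse c"] by (simp add: mult.assoc[symmetric])
  then have "cmod c * rn f \<le> rn (\<lambda>\<alpha>. c * f \<alpha>)"
    using False by (simp add: norm_inverse norm_divide field_simps)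
  then show ?thesis using reduced_smult_le[OF f, of c] by simp
qed

lemma reduced_add: assumes f: "f \<in> Cc G" and g: "g \<in> Cc G" shows "rn (\<lambda>\<alpha>. f \<alpha> + g \<alpha>) \<le> rn f + rn g"
proof (rule reduced_le)
  fix u assume u: "u \<in> T"
  interpret rep A "Hu u" "Ind G \<sigma> u" by (rule rep_intro[OF star_algebra_A star_rep_Ind])
  show "op_norm (Hu u) (Ind G \<sigma> u (\<lambda>\<alpha>. f \<alpha> + g \<alpha>)) \<le> rn f + rn g"
    using p_add[of f g] f g Ind_le_reduced[OF f u] Ind_le_reduced[OF g u] by simp
qed (simp add: reduced_ge0 f g)

lemma reduced_mult: assumes f: "f \<in> Cc G" and g: "g \<in> Cc G" shows "rn (f \<otimes>\<^bsub>A\<^esub> g) \<le> rn f * rn g"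
proof (rule reduced_le)
  fix u assume u: "u \<in> T"
  interpret rep A "Hu u" "Ind G \<sigma> u" by (rule rep_intro[OF star_algebra_A star_rep_Ind])
  have "op_norm (Hu u) (Ind G \<sigma> u (f \<otimes>\<^bsub>A\<^esub> g)) \<le> op_norm (Hu u) (Ind G \<sigma> u f) * op_norm (Hu u) (Ind G \<sigma> u g)"
    using p_mult[of f g] f g by simp
  also have "\<dots> \<le> rn f * rn g"
    using Ind_le_reduced[OF f u] Ind_le_reduced[OF g u] p_ge0[of g] reduced_ge0[OF f] g by (intro mult_mono) simp_all
  finally show "op_norm (Hu u) (Ind G \<sigma> u (f \<otimes>\<^bsub>A\<^esub> g)) \<le> rn f * rn g" .
qed (simp add: reduced_ge0 f g)

lemma reduced_star_mult: assumes f: "f \<in> Cc G" shows "rn (astar A f \<otimes>\<^bsub>A\<^esub> f) = (rn f)\<^sup>2"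
proof (rule antisym[OF reduced_star_mult_le[OF f]])
  let ?g = "astar A f \<otimes>\<^bsub>A\<^esub> f"
  have g: "?g \<in> Cc G" by (intro Cc_mult Cc_star f)
  have "rn f \<le> sqrt (rn ?g)"
  proof (rule reduced_le)
    fix u assume u: "u \<in> T"
    interpret rep A "Hu u" "Ind G \<sigma> u" by (rule rep_intro[OF star_algebra_A star_rep_Ind])
    show "op_norm (Hu u) (Ind G \<sigma> u f) \<le> sqrt (rn ?g)"
      using p_star_mult[of f] f Ind_le_reduced[OF g u] by (intro real_le_rsqrt) simp
  qed (simp add: reduced_ge0 g)
  then have "(rn f)\<^sup>2 \<le> (sqrt (rn ?g))\<^sup>2" using reduced_ge0[OF f] by (rule power_mono)
  then show "(rn f)\<^sup>2 \<le> rn ?g" using reduced_ge0[OF g] by simp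
qed

end

text \<open>Prescribing the norm on \<open>C\<^sub>c(G)\<close> and leaving its values at other functions open covers the full and the
  reduced norm alike.\<close>

locale fibre_cstar = fibre_cocycle Y X \<psi> \<sigma>
  for Y :: "'y topology" and X :: "'x topology" and \<psi> \<sigma> +
  fixes N
  assumes N: "f \<in> Cc (fibre_groupoid Y \<psi>) \<Longrightarrow> N f = reduced_norm (fibre_groupoid Y \<psi>) \<sigma> f"
begin

abbreviation "NA \<equiv> star_algebra.extend A (normed_star_algebra.fields N)"

lemma cstar_seminormed_NA: "cstar_seminormed_alg NA"
  by unfold_locales
    (simp_all add: is_star_algebra_extend star_algebra_A N Cc_add Cc_smult Cc_mult Cc_star
      reduced_ge0 reduced_smult reduced_add reduced_mult reduced_star_mult)

sublocale S: cstar_seminormed_alg NA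
  by (rule cstar_seminormed_NA)

lemma contractive_rep_NA:
  assumes L: "star_rep A H L" shows "contractive_rep NA H L"
proof -
  interpret rep NA H L
    by (rule rep_intro[OF S.is_star_algebra]) (simp add: star_rep_extend_iff L)
  show ?thesis by unfold_locales (simp add: N star_rep_le_reduced[OF L])
qed

abbreviation "E u \<equiv> extend_rep (Hu u) (Ind G \<sigma> u)"

lemma star_rep_E: "star_rep S.C (Hu u) (E u)"
  by (rule contractive_rep.star_rep_extend[OF contractive_rep_NA[OF star_rep_Ind]])

lemma E_embed: "f \<in> Cc G \<Longrightarrow> \<xi> \<in> carrier (Hu u) \<Longrightarrow> E u (S.embed f) \<xi> = Ind G \<sigma> u f \<xi>"
  by (rule contractive_rep.extend_rep_embed[OF contractive_rep_NA[OF star_rep_Ind]]) simp_all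

lemma irreducible_E: "u \<in> T \<Longrightarrow> irreducible_rep S.C (Hu u) (E u)"
  by (rule contractive_rep.irreducible_extend[OF contractive_rep_NA[OF star_rep_Ind]])
    (simp add: irreducible_rep_extend_iff irreducible_Ind)

theorem irreducible_equivalent_E:
  assumes M: "irreducible_rep S.C H M"
  shows "\<exists>y\<in>T. unitarily_equivalent S.C (Hu y, E y) (H, M)"
proof -
  let ?L = "\<lambda>f. M (S.embed f)"
  have irr: "irreducible_rep A H ?L"
    using S.irreducible_restrict[OF M] by (simp add: irreducible_rep_extend_iff)
  interpret irreducible_fibre_rep Y X \<psi> \<sigma> H ?L
    by unfold_locales (rule irreducible_rep_star_rep[OF irr], rule irr)
  obtain y where y: "y \<in> T" "unitarily_equivalent A (Hu y, Ind G \<sigma> y) (H, ?L)"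
    using equivalent_to_Ind by blast
  have "unitarily_equivalent A (Hu y, \<lambda>f. E y (S.embed f)) (H, ?L)"
    by (rule unitarily_equivalent_cong[OF y(2)]) (simp_all add: E_embed)
  then have "unitarily_equivalent S.C (Hu y, E y) (H, M)"
    by (intro S.unitarily_equivalent_completion star_rep_E irreducible_rep_star_rep[OF M])
      (simp add: unitarily_equivalent_extend_iff)
  then show ?thesis using y(1) by blast
qed

text \<open>On an orbit all the induced representations share the vector state \<open>f \<mapsto> f(y, y)\<close>.\<close>

lemma E_equivalent:
  assumes R: "(y, z) \<in> R"
  shows "unitarily_equivalent S.C (Hu y, E y) (Hu z, E z)"
proof -
  have T: "y \<in> T" "z \<in> T" using R by (auto simp: R_iff)
  note yy = R_refl[OF T(1)]
  have src: "(y, y) \<in> source_fibre G y" "(y, z) \<in> source_fibre G z" using R yy by (simp_all add: source_fibre_iff)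
  have nz: "unit_vector \<alpha> \<noteq> (\<lambda>_. 0)" for \<alpha> :: "'y \<times> 'y"
    using unit_vector_def[of \<alpha> \<alpha>] by auto
  have "unitarily_equivalent A (Hu y, Ind G \<sigma> y) (Hu z, Ind G \<sigma> z)"
  proof (rule irreducible_same_state_equivalent[OF star_algebra_A irreducible_Ind[OF T(1)] irreducible_Ind[OF T(2)]])
    show "unit_vector (y, y) \<in> carrier (Hu y)" "unit_vector (y, z) \<in> carrier (Hu z)"
      by (rule unit_vector_ell2(1)[OF src(1)], rule unit_vector_ell2(1)[OF src(2)])
    show "unit_vector (y, y) \<noteq> \<zero>\<^bsub>Hu y\<^esub>" "unit_vector (y, z) \<noteq> \<zero>\<^bsub>Hu z\<^esub>" using nz by simp_all
    fix f assume "f \<in> carrier A"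
    then have f: "f \<in> Cc G" by simp
    show "hinner (Hu y) (Ind G \<sigma> y f (unit_vector (y, y))) (unit_vector (y, y)) =
        hinner (Hu z) (Ind G \<sigma> z f (unit_vector (y, z))) (unit_vector (y, z))"
      unfolding unit_vector_ell2(2)[OF src(1)] unit_vector_ell2(2)[OF src(2)]
        Ind_unit_vector[OF f yy yy] Ind_unit_vector[OF f R R] using yy R by simp
  qed
  then have "unitarily_equivalent A (Hu y, \<lambda>f. E y (S.embed f)) (Hu z, \<lambda>f. E z (S.embed f))"
    by (rule unitarily_equivalent_cong) (simp_all add: E_embed)
  then show ?thesis
    by (intro S.unitarily_equivalent_completion star_rep_E) (simp add: unitarily_equivalent_extend_iff)
qed

definition nonvanishing :: "(nat \<Rightarrow> 'y \<times> 'y \<Rightarrow> complex) set \<Rightarrow> 'y set" where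
  "nonvanishing F = {y \<in> T. \<exists>\<xi>\<in>carrier (Hu y). E y F \<xi> \<noteq> \<zero>\<^bsub>Hu y\<^esub>}"

lemma nonvanishing_saturated:
  assumes "F \<in> carrier S.C" "y \<in> nonvanishing F" "(y, z) \<in> R"
  shows "z \<in> nonvanishing F"
  using unitarily_equivalent_nonzero[OF star_rep_E star_rep_E E_equivalent[OF assms(3)] assms(1)] assms(2,3)
  unfolding nonvanishing_def by (auto simp: R_iff)

lemma nonvanishing_diag:
  assumes h: "h \<in> bump_functions T"
  shows "y \<in> nonvanishing (S.embed (diag h)) \<longleftrightarrow> (\<exists>w. (y, w) \<in> R \<and> h w \<noteq> 0)"
proof
  assume "y \<in> nonvanishing (S.embed (diag h))"
  then obtain \<xi> where \<xi>: "\<xi> \<in> carrier (Hu y)" "(\<lambda>\<alpha>. h (fst \<alpha>) * \<xi> \<alpha>) \<noteq> (\<lambda>_. 0)"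
    unfolding nonvanishing_def using E_embed[OF diag_Cc[OF h]] Ind_diag[OF _ h] by auto
  then obtain w v where "h w \<noteq> 0" "\<xi> (w, v) \<noteq> 0" by (auto simp: fun_eq_iff)
  then show "\<exists>w. (y, w) \<in> R \<and> h w \<noteq> 0" using Hu_outside[OF \<xi>(1), of w v] R_sym by blast
next
  assume "\<exists>w. (y, w) \<in> R \<and> h w \<noteq> 0"
  then obtain w where w: "(y, w) \<in> R" "h w \<noteq> 0" by blast
  then have y: "y \<in> T" and src: "(w, y) \<in> source_fibre G y" using R_sym by (auto simp: source_fibre_iff R_iff)
  note e = unit_vector_ell2(1)[OF src]
  have "E y (S.embed (diag h)) (unit_vector (w, y)) (w, y) \<noteq> 0"
    using w(2) by (simp add: E_embed[OF diag_Cc[OF h] e] Ind_diag[OF e h] unit_vector_def)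
  then show "y \<in> nonvanishing (S.embed (diag h))"
    unfolding nonvanishing_def using y e by (auto intro!: bexI[of _ "unit_vector (w, y)"])
qed

text \<open>A point of a slice is the only one of its orbit there, and points are closed. So a bump function
  tells \<open>y\<close> from another orbit, although orbits need not have disjoint neighbourhoods.\<close>

lemma E_inequivalent:
  assumes y: "y \<in> T" and z: "z \<in> T" and nR: "(y, z) \<notin> R"
  shows "\<not> unitarily_equivalent S.C (Hu y, E y) (Hu z, E z)"
proof
  assume e: "unitarily_equivalent S.C (Hu y, E y) (Hu z, E z)"
  obtain U where U: "slice U" "y \<in> U" using slice_exists[OF y] by blast
  let ?P = "{u \<in> U. (u, z) \<in> R}"
  have "u = v" if "u \<in> ?P" "v \<in> ?P" for u v
    using that slice_eq[OF U(1), of u v] by (auto intro: R_trans R_sym)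
  then have "?P = {} \<or> (\<exists>u. ?P = {u})" by blast
  then have "finite ?P" by (elim disjE exE) (simp_all only: finite.emptyI finite.insertI)
  then have "closedin Y ?P"
    using Hausdorff slice_subset_T[OF U(1)] by (intro closedin_Hausdorff_finite) auto
  then have W: "openin Y (U - ?P)" "y \<in> U - ?P" using slice_openin[OF U(1)] U(2) nR by (auto intro: openin_diff)
  obtain h V where h: "openin Y V" "y \<in> V" "V \<subseteq> U - ?P" "\<forall>v\<in>V. h v = 1" "\<forall>z. 0 \<le> h z \<and> h z \<le> (1::real)"
    "(\<lambda>z. of_real (h z)) \<in> bump_functions (U - ?P)" "continuous_map Y euclideanreal h"
    by (rule bump_at_point[OF W])
  let ?h = "\<lambda>z. complex_of_real (h z)"
  note hT = bump_functions_T[OF h(6)]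
  have "y \<in> nonvanishing (S.embed (diag ?h))"
    unfolding nonvanishing_diag[OF hT] using R_refl[OF y] h(2,4) by (intro exI[of _ y]) simp
  then have "z \<in> nonvanishing (S.embed (diag ?h))"
    using unitarily_equivalent_nonzero[OF star_rep_E star_rep_E e, of "S.embed (diag ?h)"] diag_Cc[OF hT] z
    unfolding nonvanishing_def by simp
  then obtain w where w: "(z, w) \<in> R" "?h w \<noteq> 0" unfolding nonvanishing_diag[OF hT] by blast
  have "w \<in> U - ?P" by (rule bump_functionsD(2)[OF h(6) w(2)])
  then show False using R_sym[OF w(1)] by blast
qed

text \<open>A matrix entry of an element of the completion is a uniform limit of entries of functions. The
  error does not exceed the distance in the norm.\<close>

lemma entry_close:
  assumes F: "F \<in> carrier S.C" and f: "f \<in> Cc G" and close: "anorm S.C (F \<ominus>\<^bsub>S.C\<^esub> S.embed f) < c"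
    and R: "(v, u) \<in> R" "(w, u) \<in> R"
  shows "\<bar>cmod (E u F (unit_vector (w, u)) (v, u)) - cmod (f (v, w))\<bar> < c"
proof -
  interpret rep S.C "Hu u" "E u" by (rule S.rep_completion[OF star_rep_E])
  have src: "(w, u) \<in> source_fibre G u" using R by (simp add: source_fibre_iff)
  let ?e = "unit_vector (w, u)" and ?D = "F \<ominus>\<^bsub>S.C\<^esub> S.embed f"
  note e = unit_vector_ell2(1,3)[OF src]
  have fC: "S.embed f \<in> carrier S.C" using f by simp
  have D: "?D \<in> carrier S.C" using F fC by simp
  have "E u ?D ?e = E u F ?e \<ominus>\<^bsub>Hu u\<^esub> E u (S.embed f) ?e" by (rule L_minus[OF F fC e(1)])
  also have "\<dots> = (\<lambda>\<alpha>. E u F ?e \<alpha> - E u (S.embed f) ?e \<alpha>)"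
    using L_closed[OF F e(1)] L_closed[OF fC e(1)] by (rule ell2_minus)
  finally have eq: "E u ?D ?e (v, u) = E u F ?e (v, u) - f (v, w) * \<omega> v w u"
    by (simp add: E_embed[OF f e(1)] Ind_unit_vector[OF f R])
  have "cmod (E u ?D ?e (v, u)) \<le> hnorm (Hu u) (E u ?D ?e)" by (rule ell2_coordinate_le[OF L_closed[OF D e(1)]])
  also have "\<dots> \<le> op_norm (Hu u) (E u ?D) * hnorm (Hu u) ?e" by (rule hnorm_L[OF D e(1)])
  also have "\<dots> \<le> anorm S.C ?D" using S.star_rep_completion_contractive[OF star_rep_E D] e(2) by simp
  finally have "cmod (E u F ?e (v, u) - f (v, w) * \<omega> v w u) < c" using close eq by simp
  moreover have "cmod (f (v, w) * \<omega> v w u) = cmod (f (v, w))"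
    using om_norm[OF R_trans[OF R(1) R_sym[OF R(2)]] R(2)] by (simp add: norm_mult)
  ultimately show ?thesis using norm_triangle_ineq3[of "E u F ?e (v, u)" "f (v, w) * \<omega> v w u"] by simp
qed

text \<open>A continuous function that approximates a nonzero entry up to half its modulus stays large on nearby arrows
  and keeps the entries of \<open>F\<close> there from vanishing.\<close>

lemma openin_nonvanishing:
  assumes F: "F \<in> carrier S.C"
  shows "openin Y (nonvanishing F)"
proof (subst openin_subopen, intro ballI)
  fix y assume "y \<in> nonvanishing F"
  then obtain \<xi> where y: "y \<in> T" and \<xi>: "\<xi> \<in> carrier (Hu y)" "E y F \<xi> \<noteq> \<zero>\<^bsub>Hu y\<^esub>" by (auto simp: nonvanishing_def)
  interpret rep S.C "Hu y" "E y" by (rule S.rep_completion[OF star_rep_E])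
  have "\<exists>\<beta>\<in>source_fibre G y. E y F (unit_vector \<beta>) \<noteq> \<zero>\<^bsub>Hu y\<^esub>"
  proof (rule ccontr)
    assume none: "\<not> ?thesis"
    have "{\<eta> \<in> carrier (Hu y). E y F \<eta> \<in> {\<zero>\<^bsub>Hu y\<^esub>}} = carrier (Hu y)"
      by (rule ell2_closed_subspace_unit_vectors[OF H.kernel_closed_subspace[OF L_bounded[OF F] H.closed_subspace_zero_H]])
        (use none in \<open>auto intro: unit_vector_ell2(1)\<close>)
    then show False using \<xi> by blast
  qed
  then obtain \<beta> where \<beta>: "\<beta> \<in> source_fibre G y" "E y F (unit_vector \<beta>) \<noteq> \<zero>\<^bsub>Hu y\<^esub>" by blast
  obtain w where w: "\<beta> = (w, y)" "(w, y) \<in> R" using \<beta>(1) by (cases \<beta>) (auto simp: source_fibre_iff)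
  have "E y F (unit_vector (w, y)) \<noteq> (\<lambda>_. 0)" using \<beta>(2) w(1) by simp
  then obtain v v' where v': "E y F (unit_vector (w, y)) (v, v') \<noteq> 0" by (auto simp: fun_eq_iff)
  have "E y F (unit_vector (w, y)) \<in> carrier (Hu y)"
    using \<beta>(1) w(1) by (intro L_closed F unit_vector_ell2(1)) simp
  from Hu_outside[OF this, of v v'] have v: "(v, y) \<in> R" "v' = y" using v' by auto
  define c where "c = cmod (E y F (unit_vector (w, y)) (v, y)) / 2"
  have c: "c > 0" using v' v by (simp add: c_def)
  obtain f where f: "f \<in> Cc G" "anorm S.C (F \<ominus>\<^bsub>S.C\<^esub> S.embed f) < c" using S.embed_dense[OF F c] by auto
  have fc: "cmod (f (v, w)) > c" using entry_close[OF F f v(1) w(2)] c_def by linarith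
  obtain U where U: "slice U" "w \<in> U" using slice_exists[of w] w(2) by (auto simp: R_iff)
  have vw: "(v, w) \<in> R" using v(1) w(2) by (auto intro: R_trans R_sym)
  let ?TU = "subtopology Y (saturation U)"
  have top: "topspace ?TU = saturation U" using openin_subset[OF openin_saturation[OF slice_openin[OF U(1)]]] by auto
  have "continuous_map ?TU euclidean (\<lambda>p. f (p, section_map U p))"
    by (rule Cc_continuous_map[OF f(1)])
      (auto simp: top section_map[OF U(1)] continuous_section_map[OF U(1)] intro: continuous_map_from_subtopology)
  from openin_continuous_map_preimage[OF this, of "{t. c < cmod t}"]
  have "openin ?TU {p \<in> saturation U. f (p, section_map U p) \<in> {t. c < cmod t}}"
    unfolding top by (simp add: open_Collect_less continuous_intros)
  then have V: "openin Y {p \<in> saturation U. c < cmod (f (p, section_map U p))}" (is "openin Y ?V")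
    using openin_trans_full[OF _ openin_saturation[OF slice_openin[OF U(1)]]] by simp
  have "v \<in> ?V" using fc vw U section_map_eq[OF U vw] by (auto simp: saturation_def)
  then have "y \<in> saturation ?V" using R_sym[OF v(1)] unfolding saturation_def by blast
  moreover have "saturation ?V \<subseteq> nonvanishing F"
  proof
    fix x assume "x \<in> saturation ?V"
    then obtain p where p: "p \<in> ?V" "(x, p) \<in> R" unfolding saturation_def by blast
    define q where "q = section_map U p"
    have pq: "(p, q) \<in> R" using section_map[OF U(1), of p] p(1) by (simp add: q_def)
    then have q: "q \<in> T" by (auto simp: R_iff)
    have "E q F (unit_vector (q, q)) (p, q) \<noteq> 0"
      using entry_close[OF F f pq R_refl[OF q]] p(1) by (auto simp: q_def[symmetric])
    moreover have "unit_vector (q, q) \<in> carrier (Hu q)" using R_refl[OF q] by (intro unit_vector_ell2(1)) (simp add: source_fibre_iff)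
    ultimately have "q \<in> nonvanishing F" unfolding nonvanishing_def using q by force
    then show "x \<in> nonvanishing F"
      by (rule nonvanishing_saturated[OF F]) (use p(2) pq in \<open>blast intro: R_trans R_sym\<close>)
  qed
  ultimately show "\<exists>V. openin Y V \<and> y \<in> V \<and> V \<subseteq> nonvanishing F" using openin_saturation[OF V] by blast
qed

end

section \<open>The spectrum\<close>

locale fibre_spectrum = fibre_cstar Y X \<psi> \<sigma> N
  for Y :: "'y topology" and X :: "'x topology" and \<psi> \<sigma> N +
  fixes univ :: "'h itself"
  assumes universe: "\<exists>j :: real \<Rightarrow> 'h. inj j"
begin

definition ind_class :: "'y \<Rightarrow> ((nat \<Rightarrow> 'y \<times> 'y \<Rightarrow> complex) set, 'h) rep_class" where
  "ind_class y = rep_class S.C (Hu y, E y)"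

abbreviation spec :: "((nat \<Rightarrow> 'y \<times> 'y \<Rightarrow> complex) set, 'h) rep_class set" where
  "spec \<equiv> spectrum S.C"

abbreviation spec_top :: "((nat \<Rightarrow> 'y \<times> 'y \<Rightarrow> complex) set, 'h) rep_class topology" where
  "spec_top \<equiv> spectrum_topology S.C"

lemma mem_ind_class: "(H, M) \<in> ind_class y \<longleftrightarrow> irreducible_rep S.C H M \<and> unitarily_equivalent S.C (Hu y, E y) (H, M)"
  by (simp add: ind_class_def rep_class_def)

lemma ind_class_nonempty:
  assumes y: "y \<in> T" obtains H M where "(H, M) \<in> ind_class y"
proof -
  obtain j :: "('y \<times> 'y \<Rightarrow> complex) \<Rightarrow> 'h" where j: "inj_on j (carrier (Hu y))" by (rule Hu_injects[OF universe])
  note t = star_rep_transport[OF S.star_alg_completion star_rep_E j]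
  have "irreducible_rep S.C (transport_hilbert j (Hu y)) (transport_rep j (Hu y) (E y))"
    by (rule irreducible_rep_unitarily_equivalent[OF irreducible_E[OF y] t(1,2)])
  then show thesis using t(2) by (intro that) (simp add: mem_ind_class)
qed

lemma ind_class_eq:
  assumes e: "(H, M) \<in> ind_class y" shows "ind_class y = rep_class S.C (H, M)"
  using e[unfolded mem_ind_class] unfolding ind_class_def
  by (intro rep_class_eqI star_rep_E irreducible_rep_star_rep) auto

lemma spec_eq: "spec = ind_class ` T"
proof (intro equalityI subsetI)
  fix c assume "c \<in> spec"
  then obtain H :: "'h hilbert" and M where c: "c = rep_class S.C (H, M)" and irr: "irreducible_rep S.C H M"
    by (auto simp: spectrum_def)
  obtain y where "y \<in> T" "unitarily_equivalent S.C (Hu y, E y) (H, M)"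
    using irreducible_equivalent_E[OF irr] by blast
  then show "c \<in> ind_class ` T"
    using ind_class_eq[of H M y] irr unfolding c by (simp add: mem_ind_class image_iff) blast
next
  fix c assume "c \<in> ind_class ` T"
  then obtain y where y: "y \<in> T" "c = ind_class y" by blast
  obtain H M where HM: "(H, M) \<in> ind_class y" by (rule ind_class_nonempty[OF y(1)])
  show "c \<in> spec" unfolding y(2) ind_class_eq[OF HM] spectrum_def using HM[unfolded mem_ind_class] by blast
qed

lemma ind_class_eq_iff:
  assumes y: "y \<in> T" and z: "z \<in> T" shows "ind_class y = ind_class z \<longleftrightarrow> (y, z) \<in> R"
proof
  assume "(y, z) \<in> R"
  then show "ind_class y = ind_class z"
    unfolding ind_class_def by (intro rep_class_eqI star_rep_E E_equivalent)
next
  assume eq: "ind_class y = ind_class z"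
  obtain H M where HM: "(H, M) \<in> ind_class y" by (rule ind_class_nonempty[OF y])
  then have M: "star_rep S.C H M" by (simp add: mem_ind_class irreducible_rep_star_rep)
  have e: "unitarily_equivalent S.C (Hu y, E y) (H, M)" "unitarily_equivalent S.C (Hu z, E z) (H, M)"
    using HM HM[unfolded eq] by (simp_all add: mem_ind_class)
  have "unitarily_equivalent S.C (Hu y, E y) (Hu z, E z)"
    by (rule unitarily_equivalent_trans[OF star_rep_hilbert[OF star_rep_E] star_rep_hilbert[OF M]
        star_rep_hilbert[OF star_rep_E] e(1) unitarily_equivalent_sym[OF star_rep_E M e(2)]])
  then show "(y, z) \<in> R" using E_inequivalent[OF y z] by blast
qed

text \<open>The generating open set of the spectrum that belongs to the ideal \<open>J\<close>.\<close>

definition hull_complement :: "(nat \<Rightarrow> 'y \<times> 'y \<Rightarrow> complex) set set \<Rightarrow>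
    ((nat \<Rightarrow> 'y \<times> 'y \<Rightarrow> complex) set, 'h) rep_class set" where
  "hull_complement J = {c \<in> spec. \<exists>(H, L)\<in>c. \<exists>a\<in>J. \<exists>x\<in>carrier H. L a x \<noteq> \<zero>\<^bsub>H\<^esub>}"

lemma ind_class_nonzero:
  assumes HM: "(H, M) \<in> ind_class y" and y: "y \<in> T" and F: "F \<in> carrier S.C"
  shows "(\<exists>x\<in>carrier H. M F x \<noteq> \<zero>\<^bsub>H\<^esub>) \<longleftrightarrow> y \<in> nonvanishing F"
proof -
  have M: "star_rep S.C H M" and e: "unitarily_equivalent S.C (Hu y, E y) (H, M)"
    using HM[unfolded mem_ind_class] by (auto dest: irreducible_rep_star_rep)
  show ?thesis using unitarily_equivalent_nonzero[OF star_rep_E M e F] y unfolding nonvanishing_def by blast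
qed

lemma ind_class_hull_complement:
  assumes y: "y \<in> T" and J: "J \<subseteq> carrier S.C"
  shows "ind_class y \<in> hull_complement J \<longleftrightarrow> (\<exists>F\<in>J. y \<in> nonvanishing F)"
proof
  assume "ind_class y \<in> hull_complement J"
  then obtain H L a where HL: "(H, L) \<in> ind_class y" and a: "a \<in> J" "\<exists>x\<in>carrier H. L a x \<noteq> \<zero>\<^bsub>H\<^esub>"
    unfolding hull_complement_def by blast
  then show "\<exists>F\<in>J. y \<in> nonvanishing F" using ind_class_nonzero[OF HL y, of a] J by blast
next
  assume "\<exists>F\<in>J. y \<in> nonvanishing F"
  then obtain F where F: "F \<in> J" "y \<in> nonvanishing F" by blast
  obtain H M where HM: "(H, M) \<in> ind_class y" by (rule ind_class_nonempty[OF y])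
  have "\<exists>x\<in>carrier H. M F x \<noteq> \<zero>\<^bsub>H\<^esub>" using ind_class_nonzero[OF HM y, of F] F J by blast
  then have "\<exists>(H, L)\<in>ind_class y. \<exists>a\<in>J. \<exists>x\<in>carrier H. L a x \<noteq> \<zero>\<^bsub>H\<^esub>"
    using HM F(1) by (intro bexI[of _ "(H, M)"]) auto
  moreover have "ind_class y \<in> spec" using y by (simp add: spec_eq)
  ultimately show "ind_class y \<in> hull_complement J" by (simp add: hull_complement_def)
qed

lemma spec_top_eq: "spec_top = topology_generated_by {hull_complement J | J. closed_ideal S.C J}"
  by (simp add: spectrum_topology_def hull_complement_def)

lemma closed_ideal_subset: "closed_ideal S.C J \<Longrightarrow> J \<subseteq> carrier S.C"
  unfolding closed_ideal_def
  by (simp add: closed_subspace_def submodule_def subgroup_def)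

text \<open>The ideal of an invariant open set consists of the elements that every representation induced
  from a point outside annihilates.\<close>

lemma openin_ind_class_image:
  assumes V: "openin Y V" and sat: "\<And>y z. y \<in> V \<Longrightarrow> (y, z) \<in> R \<Longrightarrow> z \<in> V"
  shows "openin spec_top (ind_class ` V)"
proof -
  interpret Cp: cstar_seminormed_alg S.C by (rule S.cstar_seminormed_completion)
  note VT = openin_subset[OF V]
  define J where "J = {F \<in> carrier S.C. \<forall>z\<in>T - V. \<forall>\<xi>\<in>carrier (Hu z). E z F \<xi> = \<zero>\<^bsub>Hu z\<^esub>}"
  have J: "closed_ideal S.C J"
    unfolding closed_ideal_def
  proof (intro conjI ballI)
    show "closed_subspace S.C (anorm S.C) J"
    proof (rule Cp.closed_subspaceI)
      show "J \<subseteq> carrier S.C" by (auto simp: J_def)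
      show "\<zero>\<^bsub>S.C\<^esub> \<in> J" using rep.L_zero[OF S.rep_completion[OF star_rep_E]] by (simp add: J_def)
      show "F \<oplus>\<^bsub>S.C\<^esub> F' \<in> J" if "F \<in> J" "F' \<in> J" for F F'
        using that rep.L_add[OF S.rep_completion[OF star_rep_E]] by (simp add: J_def)
      show "c \<odot>\<^bsub>S.C\<^esub> F \<in> J" if "F \<in> J" for c F
        using that rep.L_smult[OF S.rep_completion[OF star_rep_E]] by (simp add: J_def)
      fix u F assume u: "\<And>n. u n \<in> J" and F: "F \<in> carrier S.C" and lim: "converges_in S.C (anorm S.C) u F"
      have uC: "u n \<in> carrier S.C" for n using u[of n] by (simp add: J_def)
      have "E z F \<xi> = \<zero>\<^bsub>Hu z\<^esub>" if z: "z \<in> T - V" and \<xi>: "\<xi> \<in> carrier (Hu z)" for z \<xi>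
      proof -
        interpret rep S.C "Hu z" "E z" by (rule S.rep_completion[OF star_rep_E])
        have "E z (u n) \<xi> = \<zero>\<^bsub>Hu z\<^esub>" for n using u[of n] z \<xi> unfolding J_def by blast
        then have "converges_in (Hu z) (hnorm (Hu z)) (\<lambda>_. \<zero>\<^bsub>Hu z\<^esub>) (E z F \<xi>)"
          using S.star_rep_completion_converges[OF star_rep_E uC F lim \<xi>] by simp
        then show ?thesis
          using H.converges_in_unique[of "\<lambda>_. \<zero>\<^bsub>Hu z\<^esub>" "E z F \<xi>" "\<zero>\<^bsub>Hu z\<^esub>"] H.converges_in_const[OF H.zero_closed]
            L_closed[OF F \<xi>] H.zero_closed by blast
      qed
      then show "F \<in> J" using F by (simp add: J_def)
    qed
    fix F F' assume F: "F \<in> carrier S.C" and F': "F' \<in> J"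
    then have F'C: "F' \<in> carrier S.C" by (simp add: J_def)
    have "E z (F \<otimes>\<^bsub>S.C\<^esub> F') \<xi> = \<zero>\<^bsub>Hu z\<^esub> \<and> E z (F' \<otimes>\<^bsub>S.C\<^esub> F) \<xi> = \<zero>\<^bsub>Hu z\<^esub>"
      if z: "z \<in> T - V" and \<xi>: "\<xi> \<in> carrier (Hu z)" for z \<xi>
    proof -
      interpret rep S.C "Hu z" "E z" by (rule S.rep_completion[OF star_rep_E])
      have "E z F' \<eta> = \<zero>\<^bsub>Hu z\<^esub>" if "\<eta> \<in> carrier (Hu z)" for \<eta> using F' z that unfolding J_def by blast
      then show ?thesis
        using L_mult[OF F F'C \<xi>] L_mult[OF F'C F \<xi>] L_closed[OF F \<xi>] \<xi> H.bounded_ops_zero[OF L_bounded[OF F]] by metis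
    qed
    then show "F \<otimes>\<^bsub>S.C\<^esub> F' \<in> J" "F' \<otimes>\<^bsub>S.C\<^esub> F \<in> J" using F F'C by (simp_all add: J_def)
  qed
  have nv: "y \<in> V \<longleftrightarrow> (\<exists>F\<in>J. y \<in> nonvanishing F)" if y: "y \<in> T" for y
  proof
    assume yV: "y \<in> V"
    obtain h W where h: "openin Y W" "y \<in> W" "W \<subseteq> V" "\<forall>v\<in>W. h v = 1" "\<forall>z. 0 \<le> h z \<and> h z \<le> (1::real)"
      "(\<lambda>z. of_real (h z)) \<in> bump_functions V" "continuous_map Y euclideanreal h"
      by (rule bump_at_point[OF V yV])
    let ?h = "\<lambda>z. complex_of_real (h z)"
    let ?F = "S.embed (diag ?h)"
    note hT = bump_functions_T[OF h(6)]
    have hV: "w \<in> V" if nz: "?h w \<noteq> 0" for w by (rule bump_functionsD(2)[OF h(6) nz])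
    have F: "?F \<in> carrier S.C" using diag_Cc[OF hT] by simp
    have "z \<notin> nonvanishing ?F" if z: "z \<in> T - V" for z
      unfolding nonvanishing_diag[OF hT] using hV sat R_sym z by blast
    then have "?F \<in> J" using F unfolding J_def nonvanishing_def by blast
    moreover have "y \<in> nonvanishing ?F"
      unfolding nonvanishing_diag[OF hT] using R_refl[OF y] h(2,4) by (intro exI[of _ y]) simp
    ultimately show "\<exists>F\<in>J. y \<in> nonvanishing F" by blast
  next
    assume "\<exists>F\<in>J. y \<in> nonvanishing F"
    then show "y \<in> V" using y unfolding J_def nonvanishing_def by blast
  qed
  have JC: "J \<subseteq> carrier S.C" by (auto simp: J_def)
  have "ind_class ` V = hull_complement J"
  proof (intro equalityI subsetI)
    fix c assume "c \<in> ind_class ` V"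
    then show "c \<in> hull_complement J" using VT nv ind_class_hull_complement[OF _ JC] by blast
  next
    fix c assume c: "c \<in> hull_complement J"
    then have "c \<in> ind_class ` T" by (simp add: hull_complement_def spec_eq)
    then show "c \<in> ind_class ` V" using c nv ind_class_hull_complement[OF _ JC] by blast
  qed
  then show ?thesis unfolding spec_top_eq using J by (intro topology_generated_by_Basis) blast
qed

lemma topspace_spec_top: "topspace spec_top = spec"
proof (intro equalityI subsetI)
  fix c assume "c \<in> topspace spec_top"
  then show "c \<in> spec" unfolding spec_top_eq topology_generated_by_topspace hull_complement_def by blast
next
  fix c assume "c \<in> spec"
  moreover have "openin spec_top (ind_class ` T)"
    by (rule openin_ind_class_image[OF openin_topspace]) (simp add: R_iff)
  ultimately show "c \<in> topspace spec_top" using openin_subset unfolding spec_eq by blast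
qed

definition orbit_class :: "'y set \<Rightarrow> ((nat \<Rightarrow> 'y \<times> 'y \<Rightarrow> complex) set, 'h) rep_class" where
  "orbit_class c = ind_class (SOME y. y \<in> c)"

lemma orbit_class: assumes y: "y \<in> T" shows "orbit_class (R `` {y}) = ind_class y"
proof -
  have "(SOME z. z \<in> R `` {y}) \<in> R `` {y}" by (rule someI[of _ y]) (simp add: R_refl[OF y])
  then have "(y, SOME z. z \<in> R `` {y}) \<in> R" by simp
  then show ?thesis unfolding orbit_class_def using ind_class_eq_iff[OF y] by (metis R_iff)
qed

lemma orbit_eq: "(y, z) \<in> R \<Longrightarrow> R `` {y} = R `` {z}"
  by (auto intro: R_trans R_sym)

text \<open>Images of invariant open sets are generating open sets of the spectrum, and the preimage of the generating
  set of an ideal is the union of the open sets on which its elements do not vanish.\<close>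

theorem homeomorphic_orbit_class: "homeomorphic_map (quotient_topology Y R) spec_top orbit_class"
proof (rule bijective_open_imp_homeomorphic_map)
  let ?Q = "quotient_topology Y R"
  have orb: "R `` {y} \<in> T // R" if "y \<in> T" for y using that by (auto simp: quotient_def)
  have "{y \<in> T. R `` {y} \<in> T // R} = T" using orb by blast
  then have "openin ?Q (T // R)" unfolding openin_quotient_topology by simp
  moreover have "topspace ?Q \<subseteq> T // R" using openin_topspace[of ?Q] unfolding openin_quotient_topology by blast
  ultimately have top: "topspace ?Q = T // R" using openin_subset by blast
  have orbits: "\<exists>y\<in>T. c = R `` {y}" if "c \<in> T // R" for c using that by (auto simp: quotient_def)
  show img: "orbit_class ` topspace ?Q = topspace spec_top"
    unfolding top topspace_spec_top spec_eq
  proof (intro equalityI subsetI)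
    fix c assume "c \<in> orbit_class ` (T // R)"
    then show "c \<in> ind_class ` T" using orbits orbit_class by blast
  next
    fix c assume "c \<in> ind_class ` T"
    then obtain y where "y \<in> T" "c = ind_class y" by blast
    then show "c \<in> orbit_class ` (T // R)" using orb orbit_class by (metis imageI)
  qed
  show "inj_on orbit_class (topspace ?Q)"
    unfolding top
  proof (rule inj_onI)
    fix c d assume "c \<in> T // R" "d \<in> T // R" "orbit_class c = orbit_class d"
    moreover then obtain y z where "y \<in> T" "z \<in> T" "c = R `` {y}" "d = R `` {z}" using orbits by meson
    ultimately show "c = d" using orbit_class ind_class_eq_iff orbit_eq by metis
  qed
  show "open_map ?Q spec_top orbit_class"
    unfolding open_map_def
  proof (intro allI impI)
    fix U assume "openin ?Q U"
    then have U: "U \<subseteq> T // R" "openin Y {y \<in> T. R `` {y} \<in> U}" by (simp_all add: openin_quotient_topology)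
    let ?V = "{y \<in> T. R `` {y} \<in> U}"
    have "orbit_class ` U = ind_class ` ?V"
    proof (intro equalityI subsetI)
      fix c assume "c \<in> orbit_class ` U"
      then obtain d where d: "d \<in> U" "c = orbit_class d" by blast
      then obtain y where "y \<in> T" "d = R `` {y}" using orbits U(1) by blast
      then show "c \<in> ind_class ` ?V" using d orbit_class by (intro image_eqI[of _ _ y]) simp_all
    next
      fix c assume "c \<in> ind_class ` ?V"
      then obtain y where "y \<in> T" "R `` {y} \<in> U" "c = ind_class y" by blast
      then show "c \<in> orbit_class ` U" using orbit_class by (intro image_eqI[of _ _ "R `` {y}"]) simp_all
    qed
    moreover have "openin spec_top (ind_class ` ?V)"
    proof (rule openin_ind_class_image[OF U(2)])
      fix y z assume "y \<in> ?V" and yz: "(y, z) \<in> R"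
      then show "z \<in> ?V" using orbit_eq[OF yz] by (simp add: R_iff)
    qed
    ultimately show "openin spec_top (orbit_class ` U)" by simp
  qed
  show "continuous_map ?Q spec_top orbit_class"
    unfolding spec_top_eq continuous_on_generated_topo_iff
  proof (intro conjI allI impI)
    show "orbit_class ` topspace ?Q \<subseteq> \<Union> {hull_complement J | J. closed_ideal S.C J}"
      using img unfolding spec_top_eq topology_generated_by_topspace by (rule equalityD1)
    fix O' assume "O' \<in> {hull_complement J | J. closed_ideal S.C J}"
    then obtain J where O': "O' = hull_complement J" and "closed_ideal S.C J" by blast
    then have JC: "J \<subseteq> carrier S.C" by (intro closed_ideal_subset)
    have "{y \<in> T. R `` {y} \<in> orbit_class -` O' \<inter> T // R} = (\<Union>F\<in>J. nonvanishing F)"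
    proof (intro equalityI subsetI)
      fix y assume "y \<in> {y \<in> T. R `` {y} \<in> orbit_class -` O' \<inter> T // R}"
      then have y: "y \<in> T" "orbit_class (R `` {y}) \<in> hull_complement J" by (simp_all add: O')
      then have "ind_class y \<in> hull_complement J" using orbit_class[OF y(1)] by simp
      then show "y \<in> (\<Union>F\<in>J. nonvanishing F)" using ind_class_hull_complement[OF y(1) JC] by blast
    next
      fix y assume y: "y \<in> (\<Union>F\<in>J. nonvanishing F)"
      then have yT: "y \<in> T" by (auto simp: nonvanishing_def)
      then have "ind_class y \<in> hull_complement J" using y ind_class_hull_complement[OF _ JC] by blast
      then show "y \<in> {y \<in> T. R `` {y} \<in> orbit_class -` O' \<inter> T // R}" using yT orb by (simp add: orbit_class O')
    qed
    moreover have "openin Y (\<Union>F\<in>J. nonvanishing F)" using JC openin_nonvanishing by blast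
    ultimately show "openin ?Q (orbit_class -` O' \<inter> topspace ?Q)"
      unfolding openin_quotient_topology top by simp
  qed
qed

text \<open>The bump function multiplies the basis vectors of \<open>Ind\<^sub>v\<close> by its values along the orbit of \<open>v\<close>, and \<open>v\<close> is
  the only point of its orbit in the slice.\<close>

lemma rank_one_diag:
  assumes U: "slice U" and h: "h \<in> bump_functions U" and v: "v \<in> U" "h v = 1"
  shows "rank_one_projection (Hu v) (E v (S.embed (diag h)))"
proof -
  interpret rep S.C "Hu v" "E v" by (rule S.rep_completion[OF star_rep_E])
  note hT = bump_functions_T[OF h]
  note hC = diag_Cc[OF hT]
  let ?a = "S.embed (diag h)" and ?e = "unit_vector (v, v)"
  have a: "?a \<in> carrier S.C" using hC by simp
  have src: "(v, v) \<in> source_fibre G v" using R_refl[OF slice_subset_T[OF U v(1)]] by (simp add: source_fibre_iff)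
  note e = unit_vector_ell2[OF src]
  have P: "E v ?a \<xi> = \<xi> (v, v) \<odot>\<^bsub>Hu v\<^esub> ?e" if \<xi>: "\<xi> \<in> carrier (Hu v)" for \<xi>
  proof -
    have "h w * \<xi> (w, z) = \<xi> (v, v) * ?e (w, z)" for w z
    proof (cases "(w, z) = (v, v)")
      case False
      have "h w * \<xi> (w, z) = 0"
      proof (rule ccontr)
        assume "h w * \<xi> (w, z) \<noteq> 0"
        then have "w \<in> U" "(w, z) \<in> R" "z = v" using bump_functionsD(2)[OF h] Hu_outside[OF \<xi>, of w z] by auto
        then show False using slice_eq[OF U, of w v] v(1) False by blast
      qed
      then show ?thesis using False by (auto simp: unit_vector_def)
    qed (simp add: unit_vector_def v)
    then have "(\<lambda>\<alpha>. h (fst \<alpha>) * \<xi> \<alpha>) = (\<lambda>\<alpha>. \<xi> (v, v) * ?e \<alpha>)" by (auto simp: fun_eq_iff)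
    then show ?thesis by (simp add: E_embed[OF hC \<xi>] Ind_diag[OF \<xi> hT])
  qed
  have "?e (v, v) = 1" by (simp add: unit_vector_def)
  then have Pe: "E v ?a ?e = ?e" using P[OF e(1)] by simp
  have "hinner (Hu v) (\<xi> (v, v) \<odot>\<^bsub>Hu v\<^esub> ?e) \<eta> = \<xi> (v, v) * cnj (\<eta> (v, v))" if "\<eta> \<in> carrier (Hu v)" for \<xi> \<eta>
    using H.inner_smult_left[OF e(1) \<open>\<eta> \<in> carrier (Hu v)\<close>] H.inner_commute[OF \<open>\<eta> \<in> carrier (Hu v)\<close> e(1)] e(2)[of \<eta>] by metis
  moreover have "hinner (Hu v) \<xi> (\<eta> (v, v) \<odot>\<^bsub>Hu v\<^esub> ?e) = \<xi> (v, v) * cnj (\<eta> (v, v))" if "\<xi> \<in> carrier (Hu v)" for \<xi> \<eta>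
    using H.inner_smult_right[OF \<open>\<xi> \<in> carrier (Hu v)\<close> e(1)] e(2)[of \<xi>] by (metis mult.commute)
  ultimately have self: "\<forall>\<xi>\<in>carrier (Hu v). \<forall>\<eta>\<in>carrier (Hu v). hinner (Hu v) (E v ?a \<xi>) \<eta> = hinner (Hu v) \<xi> (E v ?a \<eta>)"
    using P by metis
  have idem: "\<forall>\<xi>\<in>carrier (Hu v). E v ?a (E v ?a \<xi>) = E v ?a \<xi>"
    using H.bounded_opsD(3)[OF L_bounded[OF a] e(1)] P Pe by metis
  have range: "E v ?a ` carrier (Hu v) = {c \<odot>\<^bsub>Hu v\<^esub> ?e | c. True}"
  proof (intro equalityI subsetI)
    fix \<xi> assume "\<xi> \<in> E v ?a ` carrier (Hu v)"
    then show "\<xi> \<in> {c \<odot>\<^bsub>Hu v\<^esub> ?e | c. True}" using P by blast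
  next
    fix \<xi> assume "\<xi> \<in> {c \<odot>\<^bsub>Hu v\<^esub> ?e | c. True}"
    then obtain c where "\<xi> = c \<odot>\<^bsub>Hu v\<^esub> ?e" by blast
    then have "\<xi> = E v ?a (c \<odot>\<^bsub>Hu v\<^esub> ?e)" using H.bounded_opsD(3)[OF L_bounded[OF a] e(1)] Pe by metis
    then show "\<xi> \<in> E v ?a ` carrier (Hu v)" using H.smult_closed'[OF e(1)] by blast
  qed
  have "?e \<noteq> \<zero>\<^bsub>Hu v\<^esub>" using unit_vector_def[of "(v, v)" "(v, v)"] by auto
  then show ?thesis
    unfolding rank_one_projection_def using L_bounded[OF a] self idem range e(1) by blast
qed

text \<open>The bump function over a slice around \<open>y\<close> is the square of a real function, and it is \<open>1\<close> on a neighbourhood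
  \<open>V\<close> of \<open>y\<close>. The classes of the orbits through \<open>V\<close> form the required neighbourhood in the spectrum.\<close>

theorem fell: "fell_algebra univ S.C"
  unfolding fell_algebra_def
proof (intro conjI ballI S.cstar_algebra_completion)
  fix c assume "c \<in> spec"
  then obtain y where y: "y \<in> T" "c = ind_class y" unfolding spec_eq by blast
  obtain U where U: "slice U" "y \<in> U" using slice_exists[OF y(1)] by blast
  obtain h V where h: "openin Y V" "y \<in> V" "V \<subseteq> U" "\<forall>v\<in>V. h v = 1" "\<forall>z. 0 \<le> h z \<and> h z \<le> (1::real)"
    "(\<lambda>z. of_real (h z)) \<in> bump_functions U" "continuous_map Y euclideanreal h"
    by (rule bump_at_point[OF slice_openin[OF U(1)] U(2)])
  define k where "k z = complex_of_real (sqrt (h z))" for z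
  let ?h = "\<lambda>z. complex_of_real (h z)"
  let ?a = "S.embed (diag ?h)"
  have "continuous_on UNIV (\<lambda>t. complex_of_real (sqrt (Re t)))" by (intro continuous_intros)
  from bump_functions_lift[OF h(6) this] have k: "k \<in> bump_functions U" by (simp add: k_def[abs_def])
  note hC = diag_Cc[OF bump_functions_T[OF h(6)]] and kT = bump_functions_T[OF k]
  note kC = diag_Cc[OF kT]
  have "astar A (diag k) = diag k" unfolding diag_star[OF kT] by (simp add: k_def[abs_def])
  moreover have "k z * k z = ?h z" for z using h(5) by (simp add: k_def flip: of_real_mult)
  ultimately have "astar A (diag k) \<otimes>\<^bsub>A\<^esub> diag k = diag ?h" by (simp add: diag_mult[OF kT kT])
  then have "?a = astar S.C (S.embed (diag k)) \<otimes>\<^bsub>S.C\<^esub> S.embed (diag k)"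
    using S.embed_ops(2)[of "astar A (diag k)" "diag k"] S.embed_ops(4)[of "diag k" "diag k"] kC Cc_star[OF kC] by simp
  then have pos: "positive_element S.C ?a"
    unfolding positive_element_def using kC by (intro bexI[of _ "S.embed (diag k)"]) simp_all
  let ?U = "ind_class ` saturation V"
  have VT: "V \<subseteq> T" by (rule openin_subset[OF h(1)])
  have "openin spec_top ?U"
    by (rule openin_ind_class_image[OF openin_saturation[OF h(1)]])
      (auto simp: saturation_def intro: R_trans R_sym)
  moreover have "c \<in> ?U" using y R_refl[OF y(1)] h(2) unfolding saturation_def by blast
  moreover have "?U \<subseteq> spec" unfolding spec_eq saturation_def by (auto simp: R_iff)
  moreover have "\<forall>d\<in>?U. \<forall>(H, L)\<in>d. rank_one_projection H (L ?a)"
  proof (intro ballI, clarify)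
    fix z H L assume z: "z \<in> saturation V" and HL: "(H, L) \<in> ind_class z"
    then obtain v where v: "v \<in> V" "(z, v) \<in> R" unfolding saturation_def by blast
    have "ind_class z = ind_class v" using v(2) by (subst ind_class_eq_iff) (auto simp: R_iff)
    then have "irreducible_rep S.C H L" "unitarily_equivalent S.C (Hu v, E v) (H, L)"
      using HL by (simp_all add: mem_ind_class)
    moreover have "rank_one_projection (Hu v) (E v ?a)"
      using v(1) h(3,4) by (intro rank_one_diag[OF U(1) h(6)]) auto
    ultimately show "rank_one_projection H (L ?a)"
      using hC by (intro unitarily_equivalent_rank_one_projection[OF star_rep_E irreducible_rep_star_rep]) simp_all
  qed
  ultimately have "\<exists>U V. openin spec_top V \<and> c \<in> V \<and> V \<subseteq> U \<and> U \<subseteq> spec \<and> (\<forall>d\<in>U. \<forall>(H, L)\<in>d. rank_one_projection H (L ?a))"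
    by blast
  then show "\<exists>a\<in>carrier S.C. positive_element S.C a \<and>
      (\<exists>U V. openin spec_top V \<and> c \<in> V \<and> V \<subseteq> U \<and> U \<subseteq> spec \<and> (\<forall>d\<in>U. \<forall>(H, L)\<in>d. rank_one_projection H (L a)))"
    using pos hC by (intro bexI[of _ ?a]) simp_all
qed

end

theorem corollary5p4:
  fixes Y :: "'y topology" and X :: "'x topology" and \<psi> :: "'y \<Rightarrow> 'x"
    and \<sigma> :: "('y \<times> 'y) \<times> ('y \<times> 'y) \<Rightarrow> complex"
  assumes "second_countable Y" and "locally_compact_space Y" and "Hausdorff_space Y"
    and "local_homeomorphism Y X \<psi>" and "\<psi> ` topspace Y = topspace X"
    and "normalised_cocycle (fibre_groupoid Y \<psi>) \<sigma>"
    and universe: "\<exists>j :: real \<Rightarrow> 'h. inj j"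
  shows "fell_algebra TYPE('h) (full_twisted_algebra TYPE('h) (fibre_groupoid Y \<psi>) \<sigma>) \<and>
     (\<exists>\<Phi>. homeomorphic_map (quotient_topology Y (fibre_relation Y \<psi>))
          (spectrum_topology (full_twisted_algebra TYPE('h) (fibre_groupoid Y \<psi>) \<sigma>)
             :: ((nat \<Rightarrow> 'y \<times> 'y \<Rightarrow> complex) set, 'h) rep_class topology) \<Phi> \<and>
        (\<forall>y\<in>topspace Y. \<Phi> (fibre_relation Y \<psi> `` {y}) =
           rep_class (full_twisted_algebra TYPE('h) (fibre_groupoid Y \<psi>) \<sigma>)
             (Ind_rep (fibre_groupoid Y \<psi>) \<sigma> y))) \<and>
     (\<forall>f\<in>Cc (fibre_groupoid Y \<psi>).
        full_norm TYPE('h) (fibre_groupoid Y \<psi>) \<sigma> f = reduced_norm (fibre_groupoid Y \<psi>) \<sigma> f)"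
proof -
  interpret fibre_cocycle Y X \<psi> \<sigma>
    using assms(1-4,6) by unfold_locales
  have norms: "\<forall>f\<in>Cc G. full_norm TYPE('h) G \<sigma> f = rn f"
    using full_eq_reduced[OF universe] by blast
  interpret fibre_spectrum Y X \<psi> \<sigma> "full_norm TYPE('h) G \<sigma>" "TYPE('h)"
    using norms universe by unfold_locales blast+
  have "\<forall>y\<in>T. orbit_class (R `` {y}) = rep_class S.C (Ind_rep G \<sigma> y)"
    by (simp add: orbit_class ind_class_def Ind_rep_def)
  then show ?thesis
    unfolding full_twisted_algebra_def using fell homeomorphic_orbit_class norms by blast
qed

end
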